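(* Let $\Omega\subseteq\mathbb{R}^N$ ($N>2$) be a bounded domain with $\mathcal{C}^2$-boundary, let $p:\overline{\Omega}\to\mathbb{R}$ be continuous with $1<p^-\leqslant p(x)\leqslant p^+<N<\infty$ and $p^+\leqslant \hat p^*$, and let $\lambda\in\mathbb{R}$. Suppose that $j:\Omega\times\mathbb{R}\to\mathbb{R}$ satisfies hypotheses $H(j)$ and $H(j)_1$ (as listed in the context), and that $$\lambda<\widetilde p\,\lambda_*,\qquad \widetilde p:=\min\Big\{\frac{(p^--1)p^+}{(p^+-1)p^-},\ \frac{p^-}{p^+}\Big\}.$$ Then the problem $$-\Delta_{p(x)}u-\lambda|u(x)|^{p(x)-2}u(x)\in\partial j(x,u(x))\ \text{ a.e. on }\Omega,\qquad u=0\ \text{ on }\partial\Omega,$$ has a nontrivial solution $u\in W_0^{1,p(x)}(\Omega)$.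
   Context: Notation: $p^-:=\inf_{x\in\Omega}p(x)$, $p^+:=\sup_{x\in\Omega}p(x)$, $\hat p^*:=\frac{Np^-}{N-p^-}$. $\Delta_{p(x)}u:=\operatorname{div}(|\nabla u(x)|^{p(x)-2}\nabla u(x))$. Spaces: $L^{p(x)}(\Omega)$ is the space of (classes of) measurable $u:\Omega\to\mathbb{R}$ with $\int_\Omega|u(x)|^{p(x)}dx<\infty$, with norm $\|u\|_{p(x)}=\inf\{\kappa>0:\int_\Omega|u(x)/\kappa|^{p(x)}dx\leqslant1\}$. $W^{1,p(x)}(\Omega)=\{u\in L^{p(x)}(\Omega):|\nabla u|\in L^{p(x)}(\Omega)\}$ with norm $\|u\|=\|u\|_{p(x)}+\|\nabla u\|_{p(x)}$, and $W_0^{1,p(x)}(\Omega)$ is the closure of $C_0^\infty(\Omega)$ in $W^{1,p(x)}(\Omega)$. $$\lambda_*=\inf_{u\in W_0^{1,p(x)}(\Omega)\setminus\{0\}}\frac{\int_\Omega|\nabla u(x)|^{p(x)}dx}{\int_\Omega|u(x)|^{p(x)}dx}$$ (it may happen that $\lambda_*=0$). Clarke subdifferential: for a locally Lipschitz $f:X\to\mathbb{R}$ on a Banach space $X$, $f^0(x;h)=\limsup_{y\to x,\,s\downarrow0}\frac{f(y+sh)-f(y)}{s}$ and $\partial f(x)=\{x^*\in X^*:\langle x^*,h\rangle\leqslant f^0(x;h)\ \forall h\in X\}$. $\partial j(x,t)$ is taken with respect to the variable $t$. Solution: a function $u\in W_0^{1,p(x)}(\Omega)$ for which there is a measurable $v^*:\Omega\to\mathbb{R}$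 with $v^*(x)\in\partial j(x,u(x))$ for a.a. $x\in\Omega$ and $\int_\Omega|\nabla u|^{p(x)-2}(\nabla u,\nabla v)_{\mathbb{R}^N}dx=\int_\Omega\lambda|u|^{p(x)-2}uv\,dx+\int_\Omega v^*v\,dx$ for all $v\in C_0^\infty(\Omega)$. Nontrivial means $u\neq0$. Hypotheses $H(j)$: $j(x,0)=0$ for a.a. $x\in\Omega$ and (i) for all $t\in\mathbb{R}$, $x\mapsto j(x,t)$ is measurable on $\Omega$; (ii) for a.a. $x\in\Omega$, $t\mapsto j(x,t)$ is locally Lipschitz on $\mathbb{R}$; (iii) for a.a. $x\in\Omega$, all $t\in\mathbb{R}$ and all $v\in\partial j(x,t)$, $|v|\leqslant a(x)+c_1|t|^{r(x)-1}$, with $a\in L^\infty_+(\Omega)$ (nonnegative, essentially bounded), $c_1>0$ and $r\in\mathcal{C}(\overline\Omega)$ such that $p^+\leqslant r^+:=\max_{x}r(x)<\hat p^*$; (iv) there exists $\mu>0$ such that $\limsup_{|t|\to0}\frac{j(x,t)}{|t|^{p(x)}}\leqslant-\mu$ uniformly for a.a. $x\in\Omega$. Hypotheses $H(j)_1$: (v) there exists $c>0$ such that $\limsup_{|t|\to\infty}\frac{v^*t-j(x,t)}{|t|^{p(x)}}\leqslant-c$ uniformly for a.a. $x\in\Omega$ and all $v^*\in\partial j(x,t)$ (i.e. for every $\varepsilon>0$ there is $L>0$ such that for a.a. $x$, all $|t|\geqslant L$ and all $v^*\in\partial j(x,t)$ the quotient is $\leqslant-c+\varepsilon$); (vi) there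 exists $\overline u\in W_0^{1,p(x)}(\Omega)\setminus\{0\}$ such that $\frac1{p^-}\int_\Omega|\nabla\overline u(x)|^{p(x)}dx+\frac{\lambda_-}{p^-}\int_\Omega|\overline u(x)|^{p(x)}dx\leqslant\int_\Omega j(x,\overline u(x))dx$, where $\lambda_-:=\max\{0,-\lambda\}$. *)

theory Defs
  imports "HOL-Analysis.Analysis"
begin

text \<open>
  Functions on \<open>\<Omega>\<close> (or on its closure) are total functions on the ambient space of which only
  the values on \<open>\<Omega>\<close> (or on its closure) matter. Elements of Lebesgue and Sobolev spaces are
  represented by functions rather than by classes, so \<open>u = 0\<close> becomes \<open>u = 0\<close> almost everywhere
  in \<open>\<Omega>\<close>.
\<close>

subsection \<open>Smooth functions and domains of class \<open>C\<^sup>k\<close>\<close>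

text \<open>\<open>S\<close> is meant to be open: \<open>f\<close> is \<open>C\<^bsup>k+1\<^esup>\<close> iff it is differentiable and all its directional
  derivatives are \<open>C\<^sup>k\<close>.\<close>

primrec Ck_on :: "nat \<Rightarrow> 'a::real_normed_vector set \<Rightarrow> ('a \<Rightarrow> real) \<Rightarrow> bool" where
  "Ck_on 0 S f \<longleftrightarrow> continuous_on S f"
| "Ck_on (Suc k) S f \<longleftrightarrow>
     (\<forall>x\<in>S. f differentiable (at x)) \<and>
     (\<forall>v. Ck_on k S (\<lambda>x. frechet_derivative f (at x) v))"

definition test_functions :: "'a::euclidean_space set \<Rightarrow> ('a \<Rightarrow> real) set" where
  "test_functions \<Omega> =
     {\<phi>. (\<forall>k. Ck_on k UNIV \<phi>) \<and> compact (closure {x. \<phi> x \<noteq> 0}) \<and> closure {x. \<phi> x \<noteq> 0} \<subseteq> \<Omega>}"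

text \<open>Near every boundary point, \<open>\<Omega>\<close> is the part lying above the graph of a \<open>C\<^sup>k\<close> function in some
  orthonormal coordinate system. The unit vector \<open>e\<close> is the last coordinate axis, and
  \<open>x - (x \<bullet> e) *\<^sub>R e\<close> stands for the remaining \<open>N - 1\<close> coordinates. Only the values of \<open>\<gamma>\<close> on the
  hyperplane orthogonal to \<open>e\<close> are used; a \<open>C\<^sup>k\<close> function on that hyperplane extends to the
  whole space by composing with the orthogonal projection.\<close>

definition Ck_boundary :: "nat \<Rightarrow> 'a::euclidean_space set \<Rightarrow> bool" where
  "Ck_boundary k \<Omega> \<longleftrightarrow>
     (\<forall>x0\<in>frontier \<Omega>. \<exists>\<rho>>0. \<exists>e \<gamma>. norm e = 1 \<and> Ck_on k UNIV \<gamma> \<and>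
        \<Omega> \<inter> ball x0 \<rho> = {x \<in> ball x0 \<rho>. \<gamma> (x - (x \<bullet> e) *\<^sub>R e) < x \<bullet> e})"

definition bounded_Ck_domain :: "nat \<Rightarrow> 'a::euclidean_space set \<Rightarrow> bool" where
  "bounded_Ck_domain k \<Omega> \<longleftrightarrow>
     open \<Omega> \<and> connected \<Omega> \<and> \<Omega> \<noteq> {} \<and> bounded \<Omega> \<and> Ck_boundary k \<Omega>"

subsection \<open>Exponents\<close>

definition pminus :: "'a set \<Rightarrow> ('a \<Rightarrow> real) \<Rightarrow> real" where
  "pminus \<Omega> p = (INF x\<in>\<Omega>. p x)"

definition pplus :: "'a set \<Rightarrow> ('a \<Rightarrow> real) \<Rightarrow> real" where
  "pplus \<Omega> p = (SUP x\<in>\<Omega>. p x)"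

definition crit_exponent :: "'a::euclidean_space set \<Rightarrow> ('a \<Rightarrow> real) \<Rightarrow> real" where
  "crit_exponent \<Omega> p = real DIM('a) * pminus \<Omega> p / (real DIM('a) - pminus \<Omega> p)"

definition ptilde :: "'a set \<Rightarrow> ('a \<Rightarrow> real) \<Rightarrow> real" where
  "ptilde \<Omega> p =
     min (((pminus \<Omega> p - 1) * pplus \<Omega> p) / ((pplus \<Omega> p - 1) * pminus \<Omega> p))
         (pminus \<Omega> p / pplus \<Omega> p)"

subsection \<open>Variable exponent Lebesgue and Sobolev spaces\<close>

definition modular :: "'a::euclidean_space set \<Rightarrow> ('a \<Rightarrow> real) \<Rightarrow> ('a \<Rightarrow> real) \<Rightarrow> real" where
  "modular \<Omega> p u = (LINT x|lebesgue_on \<Omega>. \<bar>u x\<bar> powr p x)"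

definition Lpx :: "'a::euclidean_space set \<Rightarrow> ('a \<Rightarrow> real) \<Rightarrow> ('a \<Rightarrow> real) set" where
  "Lpx \<Omega> p = {u \<in> borel_measurable (lebesgue_on \<Omega>).
                integrable (lebesgue_on \<Omega>) (\<lambda>x. \<bar>u x\<bar> powr p x)}"

definition Lpx_norm :: "'a::euclidean_space set \<Rightarrow> ('a \<Rightarrow> real) \<Rightarrow> ('a \<Rightarrow> real) \<Rightarrow> real" where
  "Lpx_norm \<Omega> p u = Inf {\<kappa>. \<kappa> > 0 \<and> modular \<Omega> p (\<lambda>x. u x / \<kappa>) \<le> 1}"

definition locally_integrable_on ::
  "('a::euclidean_space \<Rightarrow> 'b::{banach, second_countable_topology}) \<Rightarrow> 'a set \<Rightarrow> bool" where
  "locally_integrable_on f \<Omega> \<longleftrightarrow> (\<forall>K. compact K \<and> K \<subseteq> \<Omega> \<longrightarrow> set_integrable lebesgue K f)"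

definition is_weak_gradient ::
  "'a::euclidean_space set \<Rightarrow> ('a \<Rightarrow> real) \<Rightarrow> ('a \<Rightarrow> 'a) \<Rightarrow> bool" where
  "is_weak_gradient \<Omega> u g \<longleftrightarrow>
     locally_integrable_on u \<Omega> \<and> locally_integrable_on g \<Omega> \<and>
     (\<forall>\<phi>\<in>test_functions \<Omega>. \<forall>b\<in>Basis.
        (LINT x|lebesgue_on \<Omega>. u x * frechet_derivative \<phi> (at x) b) =
        - (LINT x|lebesgue_on \<Omega>. (g x \<bullet> b) * \<phi> x))"

text \<open>Weak gradients on an open set are unique up to null sets, so every use of the chosen
  representative below is independent of the choice.\<close>

definition weak_grad :: "'a::euclidean_space set \<Rightarrow> ('a \<Rightarrow> real) \<Rightarrow> 'a \<Rightarrow> 'a" where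
  "weak_grad \<Omega> u = (SOME g. is_weak_gradient \<Omega> u g)"

definition W1px :: "'a::euclidean_space set \<Rightarrow> ('a \<Rightarrow> real) \<Rightarrow> ('a \<Rightarrow> real) set" where
  "W1px \<Omega> p = {u \<in> Lpx \<Omega> p. (\<exists>g. is_weak_gradient \<Omega> u g) \<and>
                            (\<lambda>x. norm (weak_grad \<Omega> u x)) \<in> Lpx \<Omega> p}"

definition W1px_norm :: "'a::euclidean_space set \<Rightarrow> ('a \<Rightarrow> real) \<Rightarrow> ('a \<Rightarrow> real) \<Rightarrow> real" where
  "W1px_norm \<Omega> p u = Lpx_norm \<Omega> p u + Lpx_norm \<Omega> p (\<lambda>x. norm (weak_grad \<Omega> u x))"

definition W01px :: "'a::euclidean_space set \<Rightarrow> ('a \<Rightarrow> real) \<Rightarrow> ('a \<Rightarrow> real) set" where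
  "W01px \<Omega> p = {u \<in> W1px \<Omega> p.
     \<forall>\<epsilon>>0. \<exists>\<phi>\<in>test_functions \<Omega>. W1px_norm \<Omega> p (\<lambda>x. u x - \<phi> x) < \<epsilon>}"

definition nontrivial_on :: "'a::euclidean_space set \<Rightarrow> ('a \<Rightarrow> real) \<Rightarrow> bool" where
  "nontrivial_on \<Omega> u \<longleftrightarrow> \<not> (AE x in lebesgue_on \<Omega>. u x = 0)"

definition lambda_star :: "'a::euclidean_space set \<Rightarrow> ('a \<Rightarrow> real) \<Rightarrow> real" where
  "lambda_star \<Omega> p =
     (INF u\<in>{u \<in> W01px \<Omega> p. nontrivial_on \<Omega> u}.
        modular \<Omega> p (\<lambda>x. norm (weak_grad \<Omega> u x)) / modular \<Omega> p u)"

subsection \<open>Clarke subdifferential\<close>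

definition locally_lipschitz :: "(real \<Rightarrow> real) \<Rightarrow> bool" where
  "locally_lipschitz f \<longleftrightarrow> (\<forall>t. \<exists>\<delta>>0. \<exists>L. L-lipschitz_on (ball t \<delta>) f)"

text \<open>The base point \<open>y\<close> ranges over full neighbourhoods of \<open>t\<close>, including \<open>t\<close> itself.\<close>

definition clarke_deriv :: "(real \<Rightarrow> real) \<Rightarrow> real \<Rightarrow> real \<Rightarrow> ereal" where
  "clarke_deriv f t h =
     Limsup (nhds t \<times>\<^sub>F at_right 0) (\<lambda>(y, s). ereal ((f (y + s * h) - f y) / s))"

text \<open>The dual space of the real line is identified with the real line.\<close>

definition clarke_subdiff :: "(real \<Rightarrow> real) \<Rightarrow> real \<Rightarrow> real set" where
  "clarke_subdiff f t = {v. \<forall>h. ereal (v * h) \<le> clarke_deriv f t h}"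

subsection \<open>Hypotheses on the potential\<close>

text \<open>The power \<open>\<bar>t\<bar>\<^sup>e\<close> for \<open>e \<ge> 0\<close> with the convention that the zeroth power of zero is one;
  \<open>0 powr 0\<close> is zero.\<close>

definition abs_pow :: "real \<Rightarrow> real \<Rightarrow> real" where
  "abs_pow t e = (if e = 0 then 1 else \<bar>t\<bar> powr e)"

text \<open>The condition \<open>1 \<le> r x\<close> says that \<open>\<bar>t\<bar>\<^bsup>r x - 1\<^esup>\<close> makes sense for every real \<open>t\<close>, in particular
  for \<open>t = 0\<close>.\<close>

definition growth_condition ::
  "'a::euclidean_space set \<Rightarrow> ('a \<Rightarrow> real) \<Rightarrow> ('a \<Rightarrow> real \<Rightarrow> real) \<Rightarrow> bool" where
  "growth_condition \<Omega> p j \<longleftrightarrow>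
     (\<exists>a c\<^sub>1 r.
        a \<in> borel_measurable (lebesgue_on \<Omega>) \<and>
        (AE x in lebesgue_on \<Omega>. 0 \<le> a x) \<and> (\<exists>M. AE x in lebesgue_on \<Omega>. a x \<le> M) \<and>
        c\<^sub>1 > 0 \<and>
        continuous_on (closure \<Omega>) r \<and> (\<forall>x\<in>closure \<Omega>. 1 \<le> r x) \<and>
        pplus \<Omega> p \<le> (SUP x\<in>closure \<Omega>. r x) \<and> (SUP x\<in>closure \<Omega>. r x) < crit_exponent \<Omega> p \<and>
        (AE x in lebesgue_on \<Omega>. \<forall>t. \<forall>v\<in>clarke_subdiff (j x) t.
           \<bar>v\<bar> \<le> a x + c\<^sub>1 * abs_pow t (r x - 1)))"

definition hyp_H ::
  "'a::euclidean_space set \<Rightarrow> ('a \<Rightarrow> real) \<Rightarrow> ('a \<Rightarrow> real \<Rightarrow> real) \<Rightarrow> bool" where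
  "hyp_H \<Omega> p j \<longleftrightarrow>
     (AE x in lebesgue_on \<Omega>. j x 0 = 0) \<and>
     (\<forall>t. (\<lambda>x. j x t) \<in> borel_measurable (lebesgue_on \<Omega>)) \<and>
     (AE x in lebesgue_on \<Omega>. locally_lipschitz (j x)) \<and>
     growth_condition \<Omega> p j \<and>
     (\<exists>\<mu>>0. \<forall>\<epsilon>>0. \<exists>\<delta>>0. AE x in lebesgue_on \<Omega>. \<forall>t.
        0 < \<bar>t\<bar> \<and> \<bar>t\<bar> < \<delta> \<longrightarrow> j x t / \<bar>t\<bar> powr p x \<le> - \<mu> + \<epsilon>)"

definition hyp_H1 ::
  "'a::euclidean_space set \<Rightarrow> ('a \<Rightarrow> real) \<Rightarrow> real \<Rightarrow> ('a \<Rightarrow> real \<Rightarrow> real) \<Rightarrow> bool" where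
  "hyp_H1 \<Omega> p lam j \<longleftrightarrow>
     (\<exists>c>0. \<forall>\<epsilon>>0. \<exists>L>0. AE x in lebesgue_on \<Omega>. \<forall>t. \<forall>v\<in>clarke_subdiff (j x) t.
        L \<le> \<bar>t\<bar> \<longrightarrow> (v * t - j x t) / \<bar>t\<bar> powr p x \<le> - c + \<epsilon>) \<and>
     (\<exists>w\<in>W01px \<Omega> p. nontrivial_on \<Omega> w \<and>
        1 / pminus \<Omega> p * modular \<Omega> p (\<lambda>x. norm (weak_grad \<Omega> w x))
          + max 0 (- lam) / pminus \<Omega> p * modular \<Omega> p w
        \<le> (LINT x|lebesgue_on \<Omega>. j x (w x)))"

subsection \<open>Solutions\<close>

text \<open>Integrability of \<open>v\<^sup>* v\<close> is spelled out because the integral of a non-integrable function is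
  zero by convention. The other two integrands are integrable for every \<open>u\<close> in
  \<open>W\<^sub>0\<^bsup>1,p(x)\<^esup>(\<Omega>)\<close>. Where \<open>\<nabla>u\<close> or \<open>u\<close> vanishes, they vanish as well, whatever the sign of
  \<open>p x - 2\<close>.\<close>

definition is_solution ::
  "'a::euclidean_space set \<Rightarrow> ('a \<Rightarrow> real) \<Rightarrow> real \<Rightarrow> ('a \<Rightarrow> real \<Rightarrow> real) \<Rightarrow> ('a \<Rightarrow> real) \<Rightarrow> bool"
  where
  "is_solution \<Omega> p lam j u \<longleftrightarrow>
     u \<in> W01px \<Omega> p \<and>
     (\<exists>vs \<in> borel_measurable (lebesgue_on \<Omega>).
        (AE x in lebesgue_on \<Omega>. vs x \<in> clarke_subdiff (j x) (u x)) \<and>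
        (\<forall>v\<in>test_functions \<Omega>.
           integrable (lebesgue_on \<Omega>) (\<lambda>x. vs x * v x) \<and>
           (LINT x|lebesgue_on \<Omega>.
              norm (weak_grad \<Omega> u x) powr (p x - 2) * (weak_grad \<Omega> u x \<bullet> weak_grad \<Omega> v x)) =
           (LINT x|lebesgue_on \<Omega>. lam * \<bar>u x\<bar> powr (p x - 2) * u x * v x)
           + (LINT x|lebesgue_on \<Omega>. vs x * v x)))"

end

theory Submission
  imports Defs "HOL-Complex_Analysis.Great_Picard"
begin

text \<open>
  By (v), \<open>j(x,t)/\<bar>t\<bar>\<close> plus a multiple of \<open>\<bar>t\<bar>\<^bsup>p(x)-1\<^esup>\<close> is nonincreasing for large \<open>\<bar>t\<bar>\<close>, so \<open>j\<close> is
  bounded above. With \<open>\<lambda> < p\<^sup>- \<lambda>\<^sub>*/p\<^sup>+\<close> the energy functional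
  \<open>\<integral>\<bar>\<nabla>u\<bar>\<^bsup>p\<^esup>/p - \<lambda>\<integral>\<bar>u\<bar>\<^bsup>p\<^esup>/p - \<integral>j(x,u)\<close> is therefore coercive, and it attains its minimum
  on \<open>W\<^sub>0\<^bsup>1,p(x)\<^esup>(\<Omega>)\<close> by the direct method. By (vi) its value at some \<open>w \<noteq> 0\<close> is at most zero, the value at the
  origin, so that some minimiser is nontrivial: if the minimum is attained at the origin, then \<open>w\<close> is
  itself a minimiser.

  Let \<open>ell\<close> be the derivative of the smooth part of the functional at a minimiser \<open>u\<close>. Minimality
  bounds \<open>ell \<phi>\<close> by integrals of difference quotients of \<open>j(x,\<cdot>)\<close>. Hence \<open>ell\<close> is represented by a
  function \<open>v*\<close>, and the fundamental lemma places \<open>v*(x)\<close> between the infimum and the supremum of the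
  difference quotients of \<open>j(x,\<cdot>)\<close> near \<open>u(x)\<close>, which is membership in the Clarke subdifferential.
\<close>

section \<open>Clarke subdifferentials on the real line\<close>

text \<open>Exponents that vary with x destroy homogeneity and make Luxemburg norms clumsy, so
  convergence is measured by modulars, with constants that depend only on p^- and p^+. Since
  \<Omega> is bounded, gradients lie in L^(p^-), and a Sobolev inequality with the constant exponent
  p^- is enough; hence the critical exponent is formed from p^-. The factor p^-/p^+ in the bound on
  \<lambda> is the price of the weights 1/p(x), which lie between 1/p^+ and 1/p^-. Two abstract
  tools are replaced by minimisation. Weak lower semicontinuity gives way to Rellich compactness in
  L^1 together with uniform convexity, which makes near-minimisers converge strongly. Riesz
  representation gives way to minimising a quadratic functional over test functions in a weighted
  L^2 space, the weight being a local Lipschitz constant of j(x,.) near u(x). The potential is never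
  differentiated along u: minimality is compared with envelopes of difference quotients over
  rational increments, whose countability also settles measurability.\<close>

lemma locally_lipschitz_imp_continuous_on:
  assumes "locally_lipschitz f"
  shows "continuous_on A f"
proof -
  have "isCont f t" for t
  proof -
    obtain d L where "d > 0" "L-lipschitz_on (ball t d) f"
      using assms unfolding locally_lipschitz_def by blast
    then have "continuous_on (ball t d) f"
      by (auto intro: lipschitz_on_continuous_on)
    then show ?thesis
      using \<open>d > 0\<close> by (simp add: continuous_on_eq_continuous_at)
  qed
  then show ?thesis
    by (simp add: continuous_at_imp_continuous_on)
qed

lemma le_Limsup_frequently:
  fixes X :: "'a \<Rightarrow> ereal"
  assumes "\<And>y. y < C \<Longrightarrow> \<exists>\<^sub>F x in F. y < X x"
  shows "C \<le> Limsup F X"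
proof (rule ccontr)
  assume "\<not> C \<le> Limsup F X"
  then have "Limsup F X < C"
    by simp
  then obtain y where "Limsup F X < y" "y < C"
    using dense by meson
  then have "\<exists>\<^sub>F x in F. y < X x \<and> X x < y"
    by (intro frequently_eventually_frequently assms Limsup_lessD)
  then obtain x where "y < X x" "X x < y"
    using frequently_ex by blast
  then show False
    by (meson less_asym)
qed

text \<open>At a local minimum of \<open>f - \<psi>\<close> the difference quotients of
  \<open>f\<close> with base point \<open>c\<close> dominate those of \<open>\<psi>\<close>. At a
  local maximum they do so when \<open>c\<close> is the end point, that is, with base points
  \<open>c - s * h\<close>; these are admissible because the Clarke derivative lets the base point
  move.\<close>

lemma clarke_subdiff_local_extremum:
  fixes f \<psi> :: "real \<Rightarrow> real"
  assumes der: "(\<psi> has_real_derivative d) (at c)"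
    and ext: "(\<forall>\<^sub>F t in nhds c. f t - \<psi> t \<le> f c - \<psi> c) \<or> (\<forall>\<^sub>F t in nhds c. f c - \<psi> c \<le> f t - \<psi> t)"
  shows "d \<in> clarke_subdiff f c"
proof -
  have "ereal (d * h) \<le> clarke_deriv f c h" for h
    unfolding clarke_deriv_def
  proof (rule le_Limsup_frequently)
    fix y assume "y < ereal (d * h)"
    then obtain y' where y': "y < ereal y'" "y' < d * h"
      using ereal_dense2 by (metis ereal_less_eq(3) less_ereal.simps(1))
    have lim: "((\<lambda>s. (\<psi> (c + s * k) - \<psi> c) / s) \<longlongrightarrow> d * k) (at_right 0)" for k
    proof -
      have "((\<lambda>s. \<psi> (c + s * k)) has_real_derivative (d * k)) (at 0)"
        by (rule DERIV_chain2[of \<psi>]) (auto intro!: derivative_eq_intros simp: der)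
      then show ?thesis
        by (auto simp: DERIV_def intro: filterlim_mono[OF _ order_refl at_le])
    qed
    have mv: "((\<lambda>s. c + s * k) \<longlongrightarrow> c) (at_right 0)" for k
      by (auto intro!: tendsto_eq_intros)
    have ev1: "\<forall>\<^sub>F s in at_right 0. y' < (\<psi> (c + s * h) - \<psi> c) / s"
      using lim[of h] y'(2) by (simp add: order_tendsto_iff)
    have ev2: "\<forall>\<^sub>F s in at_right 0. (\<psi> (c + s * (-h)) - \<psi> c) / s < - y'"
      using lim[of "-h"] y'(2) by (simp add: order_tendsto_iff)
    have pos: "\<forall>\<^sub>F s::real in at_right 0. 0 < s"
      by (simp add: eventually_at_right_less)
    show "\<exists>\<^sub>F x in nhds c \<times>\<^sub>F at_right 0. y < (case x of (ya, s) \<Rightarrow> ereal ((f (ya + s * h) - f ya) / s))"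
      unfolding frequently_def
    proof
      assume "\<forall>\<^sub>F x in nhds c \<times>\<^sub>F at_right 0. \<not> y < (case x of (ya, s) \<Rightarrow> ereal ((f (ya + s * h) - f ya) / s))"
      then obtain P Q where P: "eventually P (nhds c)" and Q: "eventually Q (at_right 0)"
        and PQ: "\<And>ya s. P ya \<Longrightarrow> Q s \<Longrightarrow> \<not> y < ereal ((f (ya + s * h) - f ya) / s)"
        unfolding eventually_prod_filter by auto
      have Pc: "P c"
        using P eventually_nhds_x_imp_x by blast
      have "\<forall>\<^sub>F s::real in at_right 0. \<not> 0 < s"
        using ext
      proof
        assume "\<forall>\<^sub>F t in nhds c. f c - \<psi> c \<le> f t - \<psi> t"
        then have "\<forall>\<^sub>F s in at_right 0. f c - \<psi> c \<le> f (c + s * h) - \<psi> (c + s * h)"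
          using mv by (rule eventually_compose_filterlim)
        with Q ev1 pos show ?thesis
        proof eventually_elim
          case (elim s)
          then have "(\<psi> (c + s * h) - \<psi> c) / s \<le> (f (c + s * h) - f c) / s"
            by (intro divide_right_mono) auto
          with elim have "y' < (f (c + s * h) - f c) / s"
            by linarith
          then have "y < ereal ((f (c + s * h) - f c) / s)"
            using y'(1) by (meson ereal_less_eq(3) less_le_trans less_imp_le)
          then show ?case
            using PQ[OF Pc elim(1)] by simp
        qed
      next
        assume "\<forall>\<^sub>F t in nhds c. f t - \<psi> t \<le> f c - \<psi> c"
        then have "\<forall>\<^sub>F s in at_right 0. f (c + s * (-h)) - \<psi> (c + s * (-h)) \<le> f c - \<psi> c"
          using mv by (rule eventually_compose_filterlim)
        \<comment> \<open>The base point is now \<open>c - s * h\<close>, so it has to be checked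
          that it enters the given neighbourhood as \<open>s\<close> tends to zero.\<close>
        moreover have "\<forall>\<^sub>F s in at_right 0. P (c + s * (-h))"
          using P mv by (rule eventually_compose_filterlim)
        ultimately show ?thesis
          using Q ev2 pos
        proof eventually_elim
          case (elim s)
          then have "(\<psi> c - \<psi> (c + s * (-h))) / s \<le> (f c - f (c + s * (-h))) / s"
            by (intro divide_right_mono) auto
          moreover have "y' < (\<psi> c - \<psi> (c + s * (-h))) / s"
            using elim by (simp add: field_simps)
          ultimately have "y' < (f c - f (c + s * (-h))) / s"
            by linarith
          then have "y < ereal ((f ((c + s * (-h)) + s * h) - f (c + s * (-h))) / s)"
            using y'(1) by (simp, meson ereal_less_eq(3) less_le_trans less_imp_le)
          then show ?case
            using PQ[OF elim(2,3)] by simp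
        qed
      qed
      with pos have "\<forall>\<^sub>F s::real in at_right 0. False"
        by eventually_elim simp
      then show False
        by simp
    qed
  qed
  then show ?thesis
    by (simp add: clarke_subdiff_def)
qed

text \<open>Rolle's argument without a derivative: a maximum or a minimum lies in the interior
  unless both are attained at the end points only, and then the equal end values force
  \<open>K\<close> to be constant, so that the midpoint serves.\<close>

lemma interior_extremum:
  fixes K :: "real \<Rightarrow> real"
  assumes "a < b" "continuous_on {a..b} K" "K a = K b"
  obtains c where "a < c" "c < b"
    "(\<forall>\<^sub>F t in nhds c. K t \<le> K c) \<or> (\<forall>\<^sub>F t in nhds c. K c \<le> K t)"
proof -
  have ne: "{a..b} \<noteq> {}" "compact {a..b}"
    using assms by auto
  obtain M where M: "M \<in> {a..b}" "\<And>t. t \<in> {a..b} \<Longrightarrow> K t \<le> K M"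
    using continuous_attains_sup[OF ne(2,1) assms(2)] by blast
  obtain m where m: "m \<in> {a..b}" "\<And>t. t \<in> {a..b} \<Longrightarrow> K m \<le> K t"
    using continuous_attains_inf[OF ne(2,1) assms(2)] by blast
  have ev: "\<forall>\<^sub>F t in nhds c. t \<in> {a..b}" if "a < c" "c < b" for c
    using that eventually_nhds_in_open[of "{a<..<b}" c] by (auto elim: eventually_mono)
  consider "a < M" "M < b" | "a < m" "m < b" | "M \<in> {a, b}" "m \<in> {a, b}"
    using M(1) m(1) by fastforce
  then show ?thesis
  proof cases
    case 1
    show ?thesis
      by (rule that[OF 1]) (rule disjI1, use ev[OF 1] M in \<open>auto elim: eventually_mono\<close>)
  next
    case 2
    show ?thesis
      by (rule that[OF 2]) (rule disjI2, use ev[OF 2] m in \<open>auto elim: eventually_mono\<close>)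
  next
    case 3
    then have "K t = K a" if "t \<in> {a..b}" for t
      using M(2)[OF that] m(2)[OF that] assms(3) by auto
    then have Ka: "K t = K a" if "t \<in> {a..b}" for t
      using that by blast
    have mid: "a < (a + b) / 2" "(a + b) / 2 < b"
      using assms(1) by auto
    then have "K ((a + b) / 2) = K a"
      by (intro Ka) auto
    then have "K t \<le> K ((a + b) / 2)" if "t \<in> {a..b}" for t
      using Ka[OF that] by linarith
    then have "\<forall>\<^sub>F t in nhds ((a + b) / 2). K t \<le> K ((a + b) / 2)"
      by (rule eventually_mono[OF ev[OF mid]])
    then show ?thesis
      using that[OF mid] by blast
  qed
qed

text \<open>Lebourg's mean value theorem on the line. Subtracting the secant produces equal end
  values, and at the interior extremum the secant slope is a subgradient. Conditions on subgradients
  become conditions on increments in this way.\<close>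

lemma clarke_mean_value:
  fixes f :: "real \<Rightarrow> real"
  assumes "a < b" "continuous_on {a..b} f"
  obtains c v where "a < c" "c < b" "v \<in> clarke_subdiff f c" "f b - f a = v * (b - a)"
proof -
  define k where "k = (f b - f a) / (b - a)"
  have k: "f b - f a = k * (b - a)"
    using assms by (simp add: k_def)
  have "continuous_on {a..b} (\<lambda>t. f t - k * t)"
    using assms by (intro continuous_intros)
  moreover have "f a - k * a = f b - k * b"
    using k by (simp add: algebra_simps)
  ultimately obtain c where c: "a < c" "c < b"
    "(\<forall>\<^sub>F t in nhds c. f t - k * t \<le> f c - k * c) \<or> (\<forall>\<^sub>F t in nhds c. f c - k * c \<le> f t - k * t)"
    using interior_extremum[OF assms(1)] by blast
  have "((\<lambda>t. k * t) has_real_derivative k) (at c)"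
    by (auto intro!: derivative_eq_intros)
  then have "k \<in> clarke_subdiff f c"
    using c(3) by (rule clarke_subdiff_local_extremum)
  then show ?thesis
    using that c k by blast
qed

text \<open>The mean value theorem writes the increment as a subgradient times the length of the
  segment. The growth bound on the subgradients of j thereby becomes a Lipschitz estimate with an
  explicit constant.\<close>

lemma clarke_bound_imp_lipschitz:
  fixes f :: "real \<Rightarrow> real"
  assumes "continuous_on UNIV f"
    and "\<And>t v. \<lbrakk>min a b \<le> t; t \<le> max a b; v \<in> clarke_subdiff f t\<rbrakk> \<Longrightarrow> \<bar>v\<bar> \<le> K"
  shows "\<bar>f b - f a\<bar> \<le> K * \<bar>b - a\<bar>"
proof -
  have *: "\<bar>f y - f x\<bar> \<le> K * \<bar>y - x\<bar>"
    if xy: "x < y" "\<And>t v. \<lbrakk>x \<le> t; t \<le> y; v \<in> clarke_subdiff f t\<rbrakk> \<Longrightarrow> \<bar>v\<bar> \<le> K" for x y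
  proof -
    obtain c v where "x < c" "c < y" "v \<in> clarke_subdiff f c" "f y - f x = v * (y - x)"
      using clarke_mean_value[OF xy(1) continuous_on_subset[OF assms(1) subset_UNIV]] by blast
    then show ?thesis
      using xy(2)[of c v] \<open>x < y\<close> by (simp add: abs_mult mult_right_mono)
  qed
  consider "a < b" | "a = b" | "b < a" by linarith
  then show ?thesis
  proof cases
    case 1 then show ?thesis using *[OF 1] assms(2) by auto
  next
    case 3 then show ?thesis using *[OF 3] assms(2) by (simp add: abs_minus_commute)
  qed auto
qed

text \<open>Multiplication by \<open>\<sigma>\<close> is an involution, so a function touching the
  reflected \<open>f\<close> gives one touching \<open>f\<close>. Both half-lines can then be
  treated as the positive one.\<close>

lemma clarke_subdiff_local_extremum_reflect:
  fixes f \<psi> :: "real \<Rightarrow> real"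
  assumes \<sigma>: "\<sigma> = 1 \<or> \<sigma> = -1"
    and der: "(\<psi> has_real_derivative d) (at c)"
    and ext: "(\<forall>\<^sub>F t in nhds c. f (\<sigma> * t) - \<psi> t \<le> f (\<sigma> * c) - \<psi> c) \<or>
              (\<forall>\<^sub>F t in nhds c. f (\<sigma> * c) - \<psi> c \<le> f (\<sigma> * t) - \<psi> t)"
  shows "\<sigma> * d \<in> clarke_subdiff f (\<sigma> * c)"
proof (rule clarke_subdiff_local_extremum)
  have [simp]: "\<sigma> * (\<sigma> * t) = t" for t
    using \<sigma> by auto
  show "((\<lambda>t. \<psi> (\<sigma> * t)) has_real_derivative \<sigma> * d) (at (\<sigma> * c))"
  proof -
    have "((\<lambda>t. \<sigma> * t) has_real_derivative \<sigma>) (at (\<sigma> * c))"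
      by (auto intro!: derivative_eq_intros)
    moreover have "(\<psi> has_real_derivative d) (at (\<sigma> * (\<sigma> * c)))"
      using der by simp
    ultimately have "((\<lambda>t. \<psi> (\<sigma> * t)) has_real_derivative d * \<sigma>) (at (\<sigma> * c))"
      by (rule DERIV_chain2[rotated])
    then show ?thesis
      by (simp add: mult.commute)
  qed
  have lim: "((\<lambda>t. \<sigma> * t) \<longlongrightarrow> c) (nhds (\<sigma> * c))"
    using tendsto_mult[OF tendsto_const filterlim_ident, of \<sigma> "\<sigma> * c"] by simp
  show "(\<forall>\<^sub>F t in nhds (\<sigma> * c). f t - \<psi> (\<sigma> * t) \<le> f (\<sigma> * c) - \<psi> (\<sigma> * (\<sigma> * c))) \<or>
        (\<forall>\<^sub>F t in nhds (\<sigma> * c). f (\<sigma> * c) - \<psi> (\<sigma> * (\<sigma> * c)) \<le> f t - \<psi> (\<sigma> * t))"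
    using ext eventually_compose_filterlim[OF _ lim] by fastforce
qed

text \<open>The condition on the subgradients says that \<open>f(\<sigma>t)/t\<close> has slope at most \<open>-c t\<^bsup>p-2\<^esup>\<close>.\<close>

lemma clarke_superlinear_decay:
  fixes f :: "real \<Rightarrow> real"
  assumes \<sigma>: "\<sigma> = 1 \<or> \<sigma> = -1" and cont: "continuous_on UNIV f" and "0 < L" "L \<le> t"
    and "1 < p" "0 < \<kappa>" "\<kappa> * (p - 1) \<le> c"
    and sub: "\<And>s v. \<lbrakk>L \<le> s; v \<in> clarke_subdiff f (\<sigma> * s)\<rbrakk> \<Longrightarrow> v * (\<sigma> * s) - f (\<sigma> * s) \<le> - c * s powr p"
  shows "f (\<sigma> * t) / t + \<kappa> * t powr (p - 1) \<le> f (\<sigma> * L) / L + \<kappa> * L powr (p - 1)"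
proof (rule ccontr)
  define K where "K s = f (\<sigma> * s) / s + \<kappa> * s powr (p - 1)" for s
  assume "\<not> ?thesis"
  then have gt: "K L < K t"
    by (simp add: K_def)
  then have "L < t"
    using \<open>L \<le> t\<close> by (cases "L = t") auto
  \<comment> \<open>If the claim fails, \<open>K\<close> has a positive secant slope
    \<open>\<tau>\<close>. An interior extremum of \<open>K s - \<tau> * s\<close> is a point where
    the subgradient condition will be violated.\<close>
  define \<tau> where "\<tau> = (K t - K L) / (t - L)"
  have \<tau>: "\<tau> > 0" "K t - K L = \<tau> * (t - L)"
    using gt \<open>L < t\<close> by (auto simp: \<tau>_def)
  have "continuous_on {L..t} (\<lambda>s. f (\<sigma> * s))"
    by (intro continuous_on_compose2[OF cont] continuous_intros) auto
  then have "continuous_on {L..t} K"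
    unfolding K_def using \<open>0 < L\<close> by (intro continuous_intros) auto
  then have "continuous_on {L..t} (\<lambda>s. K s - \<tau> * s)"
    by (intro continuous_intros)
  moreover have "K L - \<tau> * L = K t - \<tau> * t"
    using \<tau>(2) by (simp add: algebra_simps)
  ultimately obtain x where x: "L < x" "x < t"
    and ext: "(\<forall>\<^sub>F s in nhds x. K s - \<tau> * s \<le> K x - \<tau> * x) \<or> (\<forall>\<^sub>F s in nhds x. K x - \<tau> * x \<le> K s - \<tau> * s)"
    using interior_extremum[OF \<open>L < t\<close>] by blast
  have "x > 0" using x \<open>0 < L\<close> by simp
  \<comment> \<open>Solving \<open>K s - \<tau> * s = K x - \<tau> * x\<close> for the value of
    \<open>f\<close> gives \<open>\<psi>\<close>. The difference of \<open>f\<close> and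
    \<open>\<psi>\<close> carries the positive factor \<open>s\<close>, so it inherits the extremum
    at \<open>x\<close>.\<close>
  define \<psi> where "\<psi> s = s * (K x - \<tau> * x + \<tau> * s - \<kappa> * s powr (p - 1))" for s
  have f_eq: "f (\<sigma> * s) - \<psi> s = s * ((K s - \<tau> * s) - (K x - \<tau> * x))" if "s > 0" for s
    using that by (simp add: K_def \<psi>_def field_simps)
  have pos: "\<forall>\<^sub>F s in nhds x. s > 0"
    using \<open>x > 0\<close> eventually_nhds_in_open[of "{0<..}" x] by auto
  have fx: "f (\<sigma> * x) - \<psi> x = 0"
    using f_eq[OF \<open>x > 0\<close>] by simp
  have ext': "(\<forall>\<^sub>F s in nhds x. f (\<sigma> * s) - \<psi> s \<le> f (\<sigma> * x) - \<psi> x) \<or>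
              (\<forall>\<^sub>F s in nhds x. f (\<sigma> * x) - \<psi> x \<le> f (\<sigma> * s) - \<psi> s)"
    using ext
  proof
    assume "\<forall>\<^sub>F s in nhds x. K s - \<tau> * s \<le> K x - \<tau> * x"
    then have "\<forall>\<^sub>F s in nhds x. f (\<sigma> * s) - \<psi> s \<le> f (\<sigma> * x) - \<psi> x"
      using pos by eventually_elim (simp add: fx f_eq mult_le_0_iff)
    then show ?thesis ..
  next
    assume "\<forall>\<^sub>F s in nhds x. K x - \<tau> * x \<le> K s - \<tau> * s"
    then have "\<forall>\<^sub>F s in nhds x. f (\<sigma> * x) - \<psi> x \<le> f (\<sigma> * s) - \<psi> s"
      using pos by eventually_elim (simp add: fx f_eq)
    then show ?thesis ..
  qed
  define d where "d = (K x - \<kappa> * x powr (p - 1)) + x * (\<tau> - \<kappa> * ((p - 1) * x powr (p - 2)))"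
  have "(\<psi> has_real_derivative d) (at x)"
    unfolding \<psi>_def d_def using \<open>x > 0\<close>
    by (auto intro!: derivative_eq_intros simp: algebra_simps)
  \<comment> \<open>Inserting the subgradient \<open>\<sigma> * d\<close> bounds
    \<open>x * x * \<tau>\<close> by a multiple of \<open>\<kappa> * (p - 1) - c\<close>, which is
    at most zero.\<close>
  from clarke_subdiff_local_extremum_reflect[OF \<sigma> this ext']
  have "\<sigma> * d * (\<sigma> * x) - f (\<sigma> * x) \<le> - c * x powr p"
    using sub[of x "\<sigma> * d"] x by simp
  moreover have "\<sigma> * d * (\<sigma> * x) = d * x"
    using \<sigma> by auto
  moreover have "x powr (p - 1) = x powr (p - 2) * x" "x powr p = x powr (p - 1) * x"
    using \<open>x > 0\<close> by (simp_all add: powr_diff power2_eq_square)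
  then have "d * x - f (\<sigma> * x) = x * x * \<tau> - \<kappa> * (p - 1) * x powr p"
    using \<open>x > 0\<close> by (simp add: d_def K_def field_simps)
  ultimately have "x * x * \<tau> - \<kappa> * (p - 1) * x powr p \<le> - c * x powr p"
    by metis
  then have "x * x * \<tau> \<le> (\<kappa> * (p - 1) - c) * x powr p"
    by (simp add: algebra_simps)
  also have "\<dots> \<le> 0"
    using assms(7) by (simp add: mult_nonpos_nonneg)
  finally show False
    using \<open>x > 0\<close> \<open>\<tau> > 0\<close> by (simp add: mult_le_0_iff)
qed

text \<open>Up to scaling there are only two directions on the line. For \<open>h > 0\<close> the
  large quotients are used with step \<open>s / h\<close>; for \<open>h < 0\<close> the small
  quotients are read backwards, from \<open>y + s\<close> to \<open>y\<close>, which again relies on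
  moving base points.\<close>

lemma clarke_subdiff_between:
  fixes f :: "real \<Rightarrow> real"
  assumes up: "\<And>\<delta>. \<delta> > 0 \<Longrightarrow> \<exists>y s. \<bar>y - t\<bar> < \<delta> \<and> 0 < s \<and> s < \<delta> \<and> v - \<delta> \<le> (f (y + s) - f y) / s"
    and lo: "\<And>\<delta>. \<delta> > 0 \<Longrightarrow> \<exists>y s. \<bar>y - t\<bar> < \<delta> \<and> 0 < s \<and> s < \<delta> \<and> (f (y + s) - f y) / s \<le> v + \<delta>"
  shows "v \<in> clarke_subdiff f t"
proof -
  have "ereal (v * h) \<le> clarke_deriv f t h" for h
    unfolding clarke_deriv_def
  proof (rule le_Limsup_frequently)
    fix w assume "w < ereal (v * h)"
    then obtain y' where y': "w < ereal y'" "y' < v * h"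
      using ereal_dense2 by (metis less_ereal.simps(1))
    show "\<exists>\<^sub>F x in nhds t \<times>\<^sub>F at_right 0. w < (case x of (y, s) \<Rightarrow> ereal ((f (y + s * h) - f y) / s))"
      unfolding frequently_def
    proof
      assume "\<forall>\<^sub>F x in nhds t \<times>\<^sub>F at_right 0. \<not> w < (case x of (y, s) \<Rightarrow> ereal ((f (y + s * h) - f y) / s))"
      then obtain P Q where P: "eventually P (nhds t)" and Q: "eventually Q (at_right 0)"
        and PQ: "\<And>y s. P y \<Longrightarrow> Q s \<Longrightarrow> \<not> w < ereal ((f (y + s * h) - f y) / s)"
        unfolding eventually_prod_filter by auto
      obtain d1 where d1: "d1 > 0" "\<And>y. \<bar>y - t\<bar> < d1 \<Longrightarrow> P y"
        using P unfolding eventually_nhds_metric dist_real_def by blast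
      obtain d2 where d2: "d2 > 0" "\<And>s. 0 < s \<Longrightarrow> s < d2 \<Longrightarrow> Q s"
        using Q unfolding eventually_at_right_field by blast
      have le: "(f (y + s * h) - f y) / s \<le> y'" if "\<bar>y - t\<bar> < d1" "0 < s" "s < d2" for y s
      proof -
        have "\<not> w < ereal ((f (y + s * h) - f y) / s)"
          using PQ d1 d2 that by blast
        then show ?thesis
          using y'(1) by (metis ereal_less_eq(3) less_le_trans linorder_linear)
      qed
      consider "h = 0" | "h > 0" | "h < 0" by linarith
      then show False
      proof cases
        case 1
        then show False
          using le[of t "d2/2"] d1 d2 y'(2) by simp
      next
        case 2
        define \<delta> where "\<delta> = min (min d1 (d2 * h)) ((v * h - y') / (2 * h))"
        have "\<delta> > 0"
          using d1 d2 2 y'(2) by (simp add: \<delta>_def)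
        then obtain y s where ys: "\<bar>y - t\<bar> < \<delta>" "0 < s" "s < \<delta>" "v - \<delta> \<le> (f (y + s) - f y) / s"
          using up by blast
        have "s / h < d2"
          using ys(3) 2 by (simp add: \<delta>_def field_simps)
        then have "(f (y + (s / h) * h) - f y) / (s / h) \<le> y'"
          using le[of y "s / h"] ys 2 by (simp add: \<delta>_def)
        then have "((f (y + s) - f y) / s) * h \<le> y'"
          using 2 by simp
        moreover have "(v - \<delta>) * h \<le> ((f (y + s) - f y) / s) * h"
          using ys(4) 2 by (intro mult_right_mono) auto
        moreover have "\<delta> * h \<le> (v * h - y') / 2"
        proof -
          have "\<delta> * h \<le> (v * h - y') / (2 * h) * h"
            using 2 by (intro mult_right_mono) (auto simp: \<delta>_def)
          then show ?thesis using 2 by simp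
        qed
        ultimately show False
          using y'(2) by (simp add: left_diff_distrib)
      next
        case 3
        define k where "k = - h"
        have "k > 0" using 3 k_def by simp
        \<comment> \<open>Half of \<open>d1\<close> leaves room for the shifted base point
          \<open>y + s\<close>; the last entry keeps the loss \<open>\<delta> * k\<close> below half
          of the gap \<open>v * h - y'\<close>.\<close>
        define \<delta> where "\<delta> = min (min (d1 / 2) (d2 * k)) ((v * h - y') / (2 * k))"
        have "\<delta> > 0"
          using d1 d2 \<open>k > 0\<close> y'(2) by (simp add: \<delta>_def)
        then obtain y s where ys: "\<bar>y - t\<bar> < \<delta>" "0 < s" "s < \<delta>" "(f (y + s) - f y) / s \<le> v + \<delta>"
          using lo by blast
        have 1: "\<bar>(y + s) - t\<bar> < d1"
          using ys unfolding \<delta>_def by linarith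
        have "s / k < d2"
          using ys(3) \<open>k > 0\<close> by (simp add: \<delta>_def field_simps)
        then have "(f ((y + s) + (s / k) * h) - f (y + s)) / (s / k) \<le> y'"
          using le[of "y + s" "s / k"] 1 ys \<open>k > 0\<close> by simp
        then have "(f y - f (y + s)) / s * k \<le> y'"
          using \<open>k > 0\<close> by (simp add: k_def)
        then have "- y' \<le> ((f (y + s) - f y) / s) * k"
          by (simp add: field_simps diff_divide_distrib)
        moreover have "((f (y + s) - f y) / s) * k \<le> (v + \<delta>) * k"
          using ys(4) \<open>k > 0\<close> by (intro mult_right_mono) auto
        moreover have "\<delta> * k \<le> (v * h - y') / 2"
        proof -
          have "\<delta> * k \<le> (v * h - y') / (2 * k) * k"
            using \<open>k > 0\<close> by (intro mult_right_mono) (auto simp: \<delta>_def)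
          then show ?thesis using \<open>k > 0\<close> by simp
        qed
        ultimately show False
          using y'(2) by (simp add: distrib_right k_def)
      qed
    qed
  qed
  then show ?thesis
    by (simp add: clarke_subdiff_def)
qed

section \<open>Test functions\<close>

lemma Ck_on_has_derivative:
  "Ck_on (Suc k) UNIV f \<Longrightarrow> (f has_derivative frechet_derivative f (at x)) (at x)"
  by (simp add: frechet_derivative_works)

lemma Ck_on_Suc_imp: "Ck_on (Suc k) UNIV f \<Longrightarrow> Ck_on k UNIV f"
proof (induction k arbitrary: f)
  case 0
  then show ?case
    by (auto simp: continuous_on_eq_continuous_within differentiable_imp_continuous_within)
next
  case (Suc k)
  have "Ck_on k UNIV (\<lambda>x. frechet_derivative f (at x) v)" for v
    using Suc.prems by (intro Suc.IH) simp
  then show ?case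
    using Suc.prems by simp
qed

lemma Ck_on_const: "Ck_on k UNIV (\<lambda>x. c)"
  by (induction k arbitrary: c) auto

lemma Ck_on_add:
  "\<lbrakk>Ck_on k UNIV f; Ck_on k UNIV g\<rbrakk> \<Longrightarrow> Ck_on k UNIV (\<lambda>x. f x + g x)"
proof (induction k arbitrary: f g)
  case 0
  then show ?case by (auto intro: continuous_on_add)
next
  case (Suc k)
  have "frechet_derivative (\<lambda>x. f x + g x) (at x) =
      (\<lambda>v. frechet_derivative f (at x) v + frechet_derivative g (at x) v)" for x
    by (rule frechet_derivative_at[symmetric])
      (intro has_derivative_add Ck_on_has_derivative[OF Suc.prems(1)] Ck_on_has_derivative[OF Suc.prems(2)])
  then show ?case
    using Suc by (auto intro: differentiable_add)
qed

lemma Ck_on_mult: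
  "\<lbrakk>Ck_on k UNIV f; Ck_on k UNIV g\<rbrakk> \<Longrightarrow> Ck_on k UNIV (\<lambda>x. f x * g x)"
proof (induction k arbitrary: f g)
  case 0
  then show ?case by (auto intro: continuous_on_mult)
next
  case (Suc k)
  have "frechet_derivative (\<lambda>x. f x * g x) (at x) =
      (\<lambda>v. f x * frechet_derivative g (at x) v + frechet_derivative f (at x) v * g x)" for x
    by (rule frechet_derivative_at[symmetric])
      (intro has_derivative_mult Ck_on_has_derivative[OF Suc.prems(1)] Ck_on_has_derivative[OF Suc.prems(2)])
  moreover have "Ck_on k UNIV (\<lambda>x. f x * frechet_derivative g (at x) v + frechet_derivative f (at x) v * g x)" for v
    using Suc.prems Ck_on_Suc_imp[OF Suc.prems(1)] Ck_on_Suc_imp[OF Suc.prems(2)]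
    by (intro Ck_on_add Suc.IH) simp_all
  ultimately show ?case
    using Suc.prems by (auto intro: differentiable_mult)
qed

lemma Ck_on_prod:
  "\<lbrakk>finite I; \<And>i. i \<in> I \<Longrightarrow> Ck_on k UNIV (f i)\<rbrakk> \<Longrightarrow> Ck_on k UNIV (\<lambda>x. \<Prod>i\<in>I. f i x)"
  by (induction I rule: finite_induct) (auto intro: Ck_on_const Ck_on_mult)

text \<open>\<open>flat n t = t\<^sup>-\<^sup>n e\<^bsup>-1/t\<^esup>\<close> on the positive axis: this family is closed under differentiation.\<close>

definition flat :: "nat \<Rightarrow> real \<Rightarrow> real" where
  "flat n t = (if t > 0 then (1 / t) ^ n * exp (- (1 / t)) else 0)"

lemma flat_tendsto_0: "(flat n \<longlongrightarrow> 0) (at_right 0)"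
proof -
  have "((\<lambda>s. s ^ n / exp s) \<longlongrightarrow> (0::real)) at_top"
    by (rule tendsto_power_div_exp_0)
  then have "((\<lambda>t. (1 / t) ^ n / exp (1 / t)) \<longlongrightarrow> (0::real)) (at_right 0)"
    by (rule filterlim_compose) (simp add: filterlim_inverse_at_top_right flip: inverse_eq_divide)
  then show ?thesis
    by (rule Lim_transform_eventually)
      (auto simp: flat_def exp_minus divide_inverse eventually_at_right_field intro!: exI[of _ 1])
qed

lemma flat_has_derivative:
  "(flat n has_real_derivative flat (n + 2) t - real n * flat (n + 1) t) (at t)"
proof -
  consider "t > 0" | "t < 0" | "t = 0" by linarith
  then show ?thesis
  proof cases
    case 1
    have d1: "((\<lambda>t. 1 / t) has_real_derivative - ((1 / t)\<^sup>2)) (at t)"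
      using 1 by (auto intro!: derivative_eq_intros simp: power2_eq_square)
    have "((\<lambda>t. (1 / t) ^ n) has_real_derivative - (real n * (1 / t) ^ (n + 1))) (at t)"
      by (rule DERIV_power[OF d1, THEN DERIV_cong]) (cases n, simp_all add: power2_eq_square)
    moreover have "((\<lambda>t. exp (- (1 / t))) has_real_derivative exp (- (1 / t)) * (1 / t)\<^sup>2) (at t)"
      using DERIV_fun_exp[OF DERIV_minus[OF d1]] by simp
    ultimately have "((\<lambda>t. (1 / t) ^ n * exp (- (1 / t))) has_real_derivative
        - (real n * (1 / t) ^ (n + 1)) * exp (- (1 / t)) + exp (- (1 / t)) * (1 / t)\<^sup>2 * (1 / t) ^ n) (at t)"
      by (rule DERIV_mult)
    moreover have "- (real n * (1 / t) ^ (n + 1)) * exp (- (1 / t)) + exp (- (1 / t)) * (1 / t)\<^sup>2 * (1 / t) ^ n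
        = flat (n + 2) t - real n * flat (n + 1) t"
      using 1 by (simp add: flat_def power_add power2_eq_square mult.commute mult.left_commute)
    ultimately have "((\<lambda>t. (1 / t) ^ n * exp (- (1 / t))) has_real_derivative flat (n + 2) t - real n * flat (n + 1) t) (at t)"
      by simp
    moreover have "\<forall>\<^sub>F s in nhds t. (1 / s) ^ n * exp (- (1 / s)) = flat n s"
      using eventually_nhds_in_open[of "{0<..}" t] 1 by (auto simp: flat_def elim!: eventually_mono)
    ultimately show ?thesis
      by (rule DERIV_cong_ev[OF refl _ refl, THEN iffD1, rotated])
  next
    case 2
    have "((\<lambda>t. 0) has_real_derivative flat (n + 2) t - real n * flat (n + 1) t) (at t)"
      using 2 by (simp add: flat_def)
    moreover have "\<forall>\<^sub>F s in nhds t. 0 = flat n s"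
      using eventually_nhds_in_open[of "{..<0}" t] 2 by (auto simp: flat_def elim!: eventually_mono)
    ultimately show ?thesis
      by (rule DERIV_cong_ev[OF refl _ refl, THEN iffD1, rotated])
  next
    case 3
    \<comment> \<open>For \<open>h > 0\<close> the quotient \<open>flat n h / h\<close> is
      \<open>flat (Suc n) h\<close>, whose limit is already known.\<close>
    have "((\<lambda>h. (flat n (0 + h) - flat n 0) / h) \<longlongrightarrow> 0) (at_right 0)"
      by (rule Lim_transform_eventually[OF flat_tendsto_0[of "Suc n"]])
        (auto simp: flat_def eventually_at_right_field intro!: exI[of _ 1])
    moreover have "((\<lambda>h. (flat n (0 + h) - flat n 0) / h) \<longlongrightarrow> 0) (at_left 0)"
      by (rule Lim_transform_eventually[OF tendsto_const])
        (auto simp: flat_def eventually_at_left_field intro!: exI[of _ "-1"])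
    ultimately have "((\<lambda>h. (flat n (0 + h) - flat n 0) / h) \<longlongrightarrow> 0) (at 0)"
      by (simp add: filterlim_split_at)
    then show ?thesis
      using 3 by (simp add: DERIV_def flat_def)
  qed
qed

text \<open>The induction on \<open>k\<close> keeps \<open>n\<close> arbitrary, since each
  differentiation raises it.\<close>

lemma Ck_on_flat_affine: "Ck_on k UNIV (\<lambda>x. flat n (c * (x \<bullet> i) + d))"
proof (induction k arbitrary: n)
  have der: "((\<lambda>x. flat n (c * (x \<bullet> i) + d)) has_derivative
      (\<lambda>v. (c * (v \<bullet> i)) * (flat (n + 2) (c * (x \<bullet> i) + d) - real n * flat (n + 1) (c * (x \<bullet> i) + d)))) (at x)"
    for n x
    by (rule has_derivative_compose[OF _ flat_has_derivative[unfolded has_field_derivative_def], THEN has_derivative_eq_rhs])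
      (auto intro!: derivative_eq_intros simp: algebra_simps)
  {
    case 0
    show ?case
      using der by (auto simp: continuous_on_eq_continuous_within intro: has_derivative_continuous)
  next
    case (Suc k)
    have "Ck_on k UNIV (\<lambda>x. (c * (v \<bullet> i)) * (flat (n + 2) (c * (x \<bullet> i) + d) + (- real n) * flat (n + 1) (c * (x \<bullet> i) + d)))" for v
      by (intro Ck_on_mult Ck_on_add Ck_on_const Suc.IH)
    then show ?case
      using der[of n] frechet_derivative_at[OF der[of n], symmetric]
      by (auto simp: differentiable_def)
  }
qed

text \<open>Each coordinate contributes two factors exp(-1/(n s)), where s is the distance to one of
  the two faces (for n = 0 the product is zero). They vanish to infinite order at the faces, so
  every product is smooth with support in the closed box, and they tend to 1 inside as
  \<open>n\<close> grows.\<close>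

lemma test_functions_approx_box:
  fixes a b :: "'a::euclidean_space"
  assumes "cbox a b \<subseteq> \<Omega>"
  obtains \<phi> where "\<And>n. \<phi> n \<in> test_functions \<Omega>" "\<And>n x. 0 \<le> \<phi> n x" "\<And>n x. \<phi> n x \<le> 1"
    "\<And>n x. x \<notin> box a b \<Longrightarrow> \<phi> n x = 0" "\<And>x. x \<in> box a b \<Longrightarrow> (\<lambda>n. \<phi> n x) \<longlonglongrightarrow> 1"
proof
  let ?\<phi> = "\<lambda>(n::nat) x. \<Prod>i\<in>Basis. flat 0 (real n * (x \<bullet> i) + (- real n * (a \<bullet> i))) * flat 0 (- real n * (x \<bullet> i) + real n * (b \<bullet> i))"
  have f01: "0 \<le> flat 0 t" "flat 0 t \<le> 1" for t
    by (auto simp: flat_def)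
  show "0 \<le> ?\<phi> n x" "?\<phi> n x \<le> 1" for n x
    using f01 by (auto intro!: prod_nonneg prod_le_1 mult_nonneg_nonneg mult_le_one)
  show zero: "?\<phi> n x = 0" if xb: "x \<notin> box a b" for n x
  proof -
    obtain i where i: "i \<in> Basis" "x \<bullet> i \<le> a \<bullet> i \<or> b \<bullet> i \<le> x \<bullet> i"
      using xb unfolding mem_box by (meson not_less)
    have "flat 0 (real n * (x \<bullet> i) + (- real n * (a \<bullet> i))) * flat 0 (- real n * (x \<bullet> i) + real n * (b \<bullet> i)) = 0"
      using i(2) mult_left_mono[of "x \<bullet> i" "a \<bullet> i" "real n"] mult_left_mono[of "b \<bullet> i" "x \<bullet> i" "real n"]
      by (auto simp: flat_def)
    then show ?thesis
      using i(1) by (intro prod_zero) auto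
  qed
  show "(\<lambda>n. ?\<phi> n x) \<longlonglongrightarrow> 1" if "x \<in> box a b" for x
  proof -
    have lim: "(\<lambda>n. flat 0 (real n * s)) \<longlonglongrightarrow> 1" if "s > 0" for s :: real
    proof -
      have "(\<lambda>n. exp (- (inverse s * inverse (real n)))) \<longlonglongrightarrow> exp (- (inverse s * 0))"
        by (intro tendsto_intros lim_inverse_n)
      then have "(\<lambda>n. exp (- (inverse s * inverse (real n)))) \<longlonglongrightarrow> 1"
        by simp
      then show ?thesis
        by (rule Lim_transform_eventually)
          (use that in \<open>auto simp: flat_def field_simps intro!: eventually_sequentiallyI[of 1]\<close>)
    qed
    have "(\<lambda>n. \<Prod>i\<in>Basis. flat 0 (real n * (x \<bullet> i - a \<bullet> i)) * flat 0 (real n * (b \<bullet> i - x \<bullet> i))) \<longlonglongrightarrow> (\<Prod>i\<in>(Basis::'a set). 1 * 1)"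
      using that by (intro tendsto_prod tendsto_mult lim) (auto simp: mem_box)
    then show ?thesis
      by (simp add: algebra_simps)
  qed
  show "?\<phi> n \<in> test_functions \<Omega>" for n
  proof -
    have sub: "{x. ?\<phi> n x \<noteq> 0} \<subseteq> cbox a b"
      using zero box_subset_cbox by blast
    then have "closure {x. ?\<phi> n x \<noteq> 0} \<subseteq> cbox a b"
      by (intro closure_minimal) auto
    moreover have "bounded {x. ?\<phi> n x \<noteq> 0}"
      using sub bounded_cbox bounded_subset by blast
    moreover have "Ck_on k UNIV (?\<phi> n)" for k
      by (intro Ck_on_prod Ck_on_mult Ck_on_flat_affine) simp
    ultimately show ?thesis
      unfolding test_functions_def compact_closure[symmetric] using assms by blast
  qed
qed

section \<open>Gradients, supports and bounds of test functions\<close>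

definition grad :: "('a::euclidean_space \<Rightarrow> real) \<Rightarrow> 'a \<Rightarrow> 'a" where
  "grad \<phi> x = (\<Sum>b\<in>Basis. frechet_derivative \<phi> (at x) b *\<^sub>R b)"

lemma has_derivative_grad:
  assumes "f differentiable (at x)"
  shows "(f has_derivative (\<lambda>h. grad f x \<bullet> h)) (at x)"
proof -
  have d: "(f has_derivative frechet_derivative f (at x)) (at x)"
    using assms by (simp add: frechet_derivative_works)
  then interpret bounded_linear "frechet_derivative f (at x)"
    by (rule has_derivative_bounded_linear)
  have "frechet_derivative f (at x) h = grad f x \<bullet> h" for h
  proof -
    have "frechet_derivative f (at x) h = frechet_derivative f (at x) (\<Sum>b\<in>Basis. (h \<bullet> b) *\<^sub>R b)"
      by (simp add: euclidean_representation)
    also have "\<dots> = grad f x \<bullet> h"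
      unfolding grad_def inner_sum_left inner_scaleR_left
      by (simp add: sum scale inner_commute mult.commute)
    finally show ?thesis .
  qed
  then have "frechet_derivative f (at x) = (\<lambda>h. grad f x \<bullet> h)"
    by auto
  then show ?thesis
    using d by simp
qed

lemma grad_eqI:
  assumes "(f has_derivative (\<lambda>h. g \<bullet> h)) (at x)"
  shows "grad f x = g"
proof -
  have "frechet_derivative f (at x) = (\<lambda>h. g \<bullet> h)"
    using frechet_derivative_at[OF assms] by simp
  then show ?thesis
    by (simp add: grad_def euclidean_representation)
qed

lemma test_function_differentiable:
  "\<phi> \<in> test_functions \<Omega> \<Longrightarrow> \<phi> differentiable (at x)"
proof -
  assume "\<phi> \<in> test_functions \<Omega>"
  then have "Ck_on (Suc 0) UNIV \<phi>"
    by (auto simp: test_functions_def simp del: Ck_on.simps)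
  then show ?thesis by simp
qed

lemma test_function_derivative_eq:
  "\<phi> \<in> test_functions \<Omega> \<Longrightarrow> frechet_derivative \<phi> (at x) h = grad \<phi> x \<bullet> h"
  by (rule fun_cong[OF frechet_derivative_at[OF has_derivative_grad[OF test_function_differentiable], symmetric]])

lemma test_function_continuous:
  assumes "\<phi> \<in> test_functions \<Omega>"
  shows "continuous_on A \<phi>" "continuous_on A (grad \<phi>)"
proof -
  have C: "Ck_on 0 UNIV \<phi>" "Ck_on (Suc 0) UNIV \<phi>"
    using assms by (auto simp: test_functions_def simp del: Ck_on.simps)
  then show "continuous_on A \<phi>"
    by (auto intro: continuous_on_subset)
  have "continuous_on UNIV (\<lambda>x. frechet_derivative \<phi> (at x) b)" for b
    using C(2) by simp
  then have "continuous_on UNIV (grad \<phi>)"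
    unfolding grad_def by (intro continuous_intros)
  then show "continuous_on A (grad \<phi>)"
    by (rule continuous_on_subset) simp
qed

lemma test_function_measurable[measurable_dest]:
  assumes "\<phi> \<in> test_functions \<Omega>"
  shows "\<phi> \<in> borel_measurable borel" "grad \<phi> \<in> borel_measurable borel"
  using test_function_continuous[OF assms] by (auto intro: borel_measurable_continuous_onI)

lemma test_function_support:
  assumes "\<phi> \<in> test_functions \<Omega>"
  obtains K where "compact K" "K \<subseteq> \<Omega>" "\<And>x. x \<notin> K \<Longrightarrow> \<phi> x = 0" "\<And>x. x \<notin> K \<Longrightarrow> grad \<phi> x = 0"
proof
  let ?K = "closure {x. \<phi> x \<noteq> 0}"
  show "compact ?K" "?K \<subseteq> \<Omega>"
    using assms by (auto simp: test_functions_def)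
  show z: "\<phi> x = 0" if "x \<notin> ?K" for x
    using that closure_subset[of "{x. \<phi> x \<noteq> 0}"] by blast
  show "grad \<phi> x = 0" if "x \<notin> ?K" for x
  proof (rule grad_eqI)
    have "\<forall>\<^sub>F y in nhds x. y \<in> - ?K"
      using that by (intro eventually_nhds_in_open) auto
    then have "\<forall>\<^sub>F y in nhds x. 0 = \<phi> y"
      by (rule eventually_mono) (metis z ComplD)
    then have "\<forall>\<^sub>F y in at x. 0 = \<phi> y"
      by (simp add: eventually_nhds_conv_at)
    moreover have "((\<lambda>y. 0) has_derivative (\<lambda>h. (0::'a) \<bullet> h)) (at x)"
      by simp
    ultimately show "(\<phi> has_derivative (\<lambda>h. (0::'a) \<bullet> h)) (at x)"
      using has_derivative_transform_eventually[of "\<lambda>y. 0" _ x UNIV \<phi>] z[OF that] by simp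
  qed
qed

lemma test_function_zero_outside:
  assumes "\<phi> \<in> test_functions \<Omega>" "x \<notin> \<Omega>"
  shows "\<phi> x = 0" "grad \<phi> x = 0"
  using test_function_support[OF assms(1)] assms(2) by (metis subsetD)+

lemma test_function_bounded:
  assumes "\<phi> \<in> test_functions \<Omega>"
  obtains B where "B > 0" "\<And>x. \<bar>\<phi> x\<bar> \<le> B" "\<And>x. norm (grad \<phi> x) \<le> B"
proof -
  obtain K where K: "compact K" "\<And>x. x \<notin> K \<Longrightarrow> \<phi> x = 0" "\<And>x. x \<notin> K \<Longrightarrow> grad \<phi> x = 0"
    using test_function_support[OF assms] by metis
  have "bounded (\<phi> ` K)" "bounded (grad \<phi> ` K)"
    using K test_function_continuous[OF assms]
    by (auto intro!: compact_imp_bounded compact_continuous_image)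
  then obtain B1 B2 where B: "B1 > 0" "\<And>x. x \<in> K \<Longrightarrow> \<bar>\<phi> x\<bar> \<le> B1" "B2 > 0" "\<And>x. x \<in> K \<Longrightarrow> norm (grad \<phi> x) \<le> B2"
    by (auto simp: bounded_pos)
  have "\<bar>\<phi> x\<bar> \<le> max B1 B2 \<and> norm (grad \<phi> x) \<le> max B1 B2" for x
    using B K by (cases "x \<in> K") (auto simp: le_max_iff_disj)
  then show ?thesis
    using that[of "max B1 B2"] B by auto
qed

lemma test_function_add:
  assumes "\<phi> \<in> test_functions \<Omega>" "\<psi> \<in> test_functions \<Omega>"
  shows "(\<lambda>x. \<phi> x + c * \<psi> x) \<in> test_functions \<Omega>"
    and "grad (\<lambda>x. \<phi> x + c * \<psi> x) x = grad \<phi> x + c *\<^sub>R grad \<psi> x"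
proof -
  let ?S = "\<lambda>f. closure {x. f x \<noteq> (0::real)}"
  have "?S (\<lambda>x. \<phi> x + c * \<psi> x) \<subseteq> closure ({x. \<phi> x \<noteq> 0} \<union> {x. \<psi> x \<noteq> 0})"
    by (intro closure_mono) auto
  then have sub: "?S (\<lambda>x. \<phi> x + c * \<psi> x) \<subseteq> ?S \<phi> \<union> ?S \<psi>"
    by (simp add: closure_Un)
  have "compact (?S \<phi> \<union> ?S \<psi>)"
    using assms by (auto simp: test_functions_def)
  then have "compact (?S (\<lambda>x. \<phi> x + c * \<psi> x))"
    using bounded_subset[OF compact_imp_bounded sub] bounded_subset[OF _ closure_subset]
    by (simp add: compact_closure)
  with sub show "(\<lambda>x. \<phi> x + c * \<psi> x) \<in> test_functions \<Omega>"
    using assms by (auto simp: test_functions_def intro!: Ck_on_add Ck_on_mult Ck_on_const)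
  show "grad (\<lambda>x. \<phi> x + c * \<psi> x) x = grad \<phi> x + c *\<^sub>R grad \<psi> x"
    by (rule grad_eqI)
      (auto intro!: derivative_eq_intros has_derivative_grad test_function_differentiable assms
        simp: inner_add_left)
qed

lemma test_function_zero: "(\<lambda>x. 0) \<in> test_functions \<Omega>"
  by (simp add: test_functions_def Ck_on_const)

lemma test_function_scale:
  assumes "\<psi> \<in> test_functions \<Omega>"
  shows "(\<lambda>x. c * \<psi> x) \<in> test_functions \<Omega>" "grad (\<lambda>x. c * \<psi> x) x = c *\<^sub>R grad \<psi> x"
  using test_function_add[OF test_function_zero assms, of c] grad_eqI[of "\<lambda>x. 0" 0]
  by auto

section \<open>Integration over the domain and over the whole space\<close>

text \<open>Functions that vanish off \<Omega> may be integrated over the whole space, where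
  translations and dilations are available.\<close>

lemma integral_lebesgue_on_eq_lborel:
  fixes f :: "'a::euclidean_space \<Rightarrow> 'b::{banach, second_countable_topology}"
  assumes "\<Omega> \<in> sets lebesgue" "f \<in> borel_measurable borel" "\<And>x. x \<notin> \<Omega> \<Longrightarrow> f x = 0"
  shows "(LINT x|lebesgue_on \<Omega>. f x) = (LINT x|lborel. f x)"
    and "integrable (lebesgue_on \<Omega>) f \<longleftrightarrow> integrable lborel f"
proof -
  have "(\<lambda>x. indicator \<Omega> x *\<^sub>R f x) = f"
    using assms(3) by (auto simp: indicator_def)
  then show "(LINT x|lebesgue_on \<Omega>. f x) = (LINT x|lborel. f x)"
    and "integrable (lebesgue_on \<Omega>) f \<longleftrightarrow> integrable lborel f"
    using assms by (simp_all add: integral_restrict_space integrable_restrict_space integral_completion integrable_completion)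
qed

lemma nn_integral_lebesgue_on_eq_lborel:
  fixes f :: "'a::euclidean_space \<Rightarrow> ennreal"
  assumes "\<Omega> \<in> sets lebesgue" "\<And>x. x \<notin> \<Omega> \<Longrightarrow> f x = 0"
  shows "(\<integral>\<^sup>+x. f x \<partial>lebesgue_on \<Omega>) = (\<integral>\<^sup>+x. f x \<partial>lborel)"
proof -
  have "(\<lambda>x. f x * indicator \<Omega> x) = f"
    using assms(2) by (auto simp: indicator_def)
  then show ?thesis
    using assms by (simp add: nn_integral_restrict_space nn_integral_completion)
qed

lemma borel_measurable_lebesgue_on:
  "f \<in> borel_measurable borel \<Longrightarrow> f \<in> borel_measurable (lebesgue_on \<Omega>)"
  by (simp add: measurable_completion measurable_restrict_space1)

lemma nn_integral_lborel_shift: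
  fixes f :: "'a::euclidean_space \<Rightarrow> ennreal"
  assumes "f \<in> borel_measurable borel"
  shows "(\<integral>\<^sup>+x. f (c + x) \<partial>lborel) = (\<integral>\<^sup>+x. f x \<partial>lborel)"
proof -
  have "(\<integral>\<^sup>+x. f x \<partial>lborel) = (\<integral>\<^sup>+x. f x \<partial>distr lborel borel ((+) c))"
    by (simp add: lborel_distr_plus)
  also have "\<dots> = (\<integral>\<^sup>+x. f (c + x) \<partial>lborel)"
    using assms by (subst nn_integral_distr) auto
  finally show ?thesis by simp
qed

lemma integral_lborel_shift:
  fixes f :: "'a::euclidean_space \<Rightarrow> real"
  assumes "integrable lborel f"
  shows "integrable lborel (\<lambda>x. f (c + x))" "(LINT x|lborel. f (c + x)) = (LINT x|lborel. f x)"
proof -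
  have m: "f \<in> borel_measurable borel" "(+) c \<in> lborel \<rightarrow>\<^sub>M borel"
    using assms by auto
  have "integrable (distr lborel borel ((+) c)) f" "(LINT x|distr lborel borel ((+) c). f x) = (LINT x|lborel. f x)"
    using assms by (simp_all add: lborel_distr_plus)
  then show "integrable lborel (\<lambda>x. f (c + x))" "(LINT x|lborel. f (c + x)) = (LINT x|lborel. f x)"
    using m by (simp_all add: integrable_distr_eq integral_distr)
qed

lemma integrable_bounded_support:
  fixes f :: "'a::euclidean_space \<Rightarrow> 'b::{banach, second_countable_topology}"
  assumes "f \<in> borel_measurable borel" "bounded K" "\<And>x. x \<notin> K \<Longrightarrow> f x = 0" "\<And>x. norm (f x) \<le> B"
  shows "integrable lborel f"
proof -
  obtain a where a: "K \<subseteq> cbox (-a) a"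
    using bounded_subset_cbox_symmetric[OF assms(2)] by blast
  have "integrable lborel (\<lambda>x. indicator (cbox (-a) a) x *\<^sub>R B)"
    by (rule integrable_indicator) (use emeasure_bounded_finite[OF bounded_cbox] in auto)
  then show ?thesis
  proof (rule Bochner_Integration.integrable_bound)
    show "AE x in lborel. norm (f x) \<le> norm (indicator (cbox (- a) a) x *\<^sub>R B)"
    proof (rule AE_I2)
      fix x show "norm (f x) \<le> norm (indicator (cbox (- a) a) x *\<^sub>R B)"
        using assms(3)[of x] assms(4)[of x] a by (auto simp: indicator_def)
    qed
  qed (use assms in simp)
qed

text \<open>By translation invariance the difference quotients in direction \<open>b\<close> have integral zero.\<close>

lemma integral_directional_derivative_eq_0:
  fixes f :: "'a::euclidean_space \<Rightarrow> real" and G :: "'a \<Rightarrow> 'a"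
  assumes der: "\<And>x. (f has_derivative (\<lambda>h. G x \<bullet> h)) (at x)"
    and K: "compact K" "\<And>x. x \<notin> K \<Longrightarrow> f x = 0" and B: "\<And>x. norm (G x) \<le> B"
  shows "(LINT x|lborel. G x \<bullet> b) = 0"
proof -
  have cont: "continuous_on A f" for A
    using der by (meson continuous_at_imp_continuous_on has_derivative_continuous)
  have fm[measurable]: "f \<in> borel_measurable borel"
    by (rule borel_measurable_continuous_onI[OF cont])
  have "bounded (f ` K)"
    by (intro compact_imp_bounded compact_continuous_image cont K)
  then obtain M where M: "M > 0" "\<And>x. x \<in> K \<Longrightarrow> \<bar>f x\<bar> \<le> M"
    by (auto simp: bounded_pos)
  have Mx: "norm (f x) \<le> M" for x
    using M K(2)[of x] by (cases "x \<in> K") auto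
  have int: "integrable lborel f"
    by (rule integrable_bounded_support[OF fm compact_imp_bounded[OF K(1)] K(2) Mx])
  define t where "t n = 1 / real (Suc n)" for n
  have t: "t n > 0" "t n \<le> 1" for n
    by (auto simp: t_def)
  have t0: "t \<longlonglongrightarrow> 0"
    unfolding t_def using LIMSEQ_Suc[OF lim_1_over_n] by simp
  define q where "q n x = (f (t n *\<^sub>R b + x) - f x) / t n" for n x
  have zero: "(LINT x|lborel. q n x) = 0" for n
    unfolding q_def using integral_lborel_shift[OF int, of "t n *\<^sub>R b"] int by simp
  \<comment> \<open>The gradient bound makes \<open>f\<close> globally Lipschitz, so that the
    quotients are bounded by \<open>B * norm b\<close>; steps of length at most one keep their
    supports in a common ball. Together this gives an integrable majorant.\<close>
  have lip: "\<bar>f x - f y\<bar> \<le> B * norm (x - y)" for x y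
  proof -
    have "onorm (\<lambda>h. G x \<bullet> h) \<le> B" for x
      using B[of x] by (intro onorm_le) (smt (verit) Cauchy_Schwarz_ineq2 mult_right_mono norm_ge_zero real_norm_def)
    then have "norm (f x - f y) \<le> B * norm (x - y)"
      by (intro differentiable_bound[of UNIV f "\<lambda>x h. G x \<bullet> h"]) (auto intro: der)
    then show ?thesis by simp
  qed
  obtain R where R: "R > 0" "\<And>x. x \<in> K \<Longrightarrow> norm x \<le> R"
    using compact_imp_bounded[OF K(1)] by (auto simp: bounded_pos)
  have supp: "q n x = 0" if "x \<notin> cball 0 (R + norm b)" for n x
  proof -
    have nx: "R + norm b < norm x"
      using that by simp
    then have "x \<notin> K"
      using R(2)[of x] by (smt (verit) norm_ge_zero)
    moreover have "norm (t n *\<^sub>R b) \<le> norm b"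
      using t[of n] mult_right_mono[of "t n" 1 "norm b"] by simp
    then have "norm (t n *\<^sub>R b + x) > R"
      using nx norm_triangle_ineq2[of x "- (t n *\<^sub>R b)"] by (simp add: add.commute)
    then have "t n *\<^sub>R b + x \<notin> K"
      using R(2) by fastforce
    ultimately show ?thesis
      by (simp add: q_def K)
  qed
  have qB: "\<bar>q n x\<bar> \<le> B * norm b" for n x
  proof -
    have "\<bar>f (t n *\<^sub>R b + x) - f x\<bar> \<le> B * norm (t n *\<^sub>R b)"
      using lip[of "t n *\<^sub>R b + x" x] by simp
    then show ?thesis
      using t[of n] by (simp add: q_def field_simps)
  qed
  have qlim: "(\<lambda>n. q n x) \<longlonglongrightarrow> G x \<bullet> b" for x
  proof -
    have "((\<lambda>s. f (s *\<^sub>R b + x)) has_derivative (\<lambda>s. G x \<bullet> (s *\<^sub>R b))) (at 0)"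
      by (rule has_derivative_compose[where g = f and g' = "\<lambda>h. G x \<bullet> h"])
        (auto intro!: derivative_eq_intros der)
    then have "((\<lambda>s. f (s *\<^sub>R b + x)) has_real_derivative (G x \<bullet> b)) (at 0)"
      by (simp add: has_field_derivative_def mult_commute_abs)
    then have "((\<lambda>h. (f (h *\<^sub>R b + x) - f x) / h) \<longlongrightarrow> G x \<bullet> b) (at 0)"
      by (simp add: DERIV_def)
    moreover have "filterlim t (at 0) sequentially"
      using t0 t(1) by (auto simp: filterlim_at intro!: always_eventually) (metis less_irrefl)
    ultimately show ?thesis
      unfolding q_def by (rule filterlim_compose)
  qed
  have "(\<lambda>n. LINT x|lborel. q n x) \<longlonglongrightarrow> (LINT x|lborel. G x \<bullet> b)"
  proof (rule integral_dominated_convergence[where w = "\<lambda>x. indicator (cball 0 (R + norm b)) x *\<^sub>R (B * norm b)"])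
    show "integrable lborel (\<lambda>x::'a. indicator (cball 0 (R + norm b)) x *\<^sub>R (B * norm b))"
      by (rule integrable_indicator) (use emeasure_bounded_finite[OF bounded_cball] in auto)
    show "AE x in lborel. norm (q n x) \<le> indicator (cball 0 (R + norm b)) x *\<^sub>R (B * norm b)" for n
      using supp qB by (auto simp: indicator_def)
    show qm: "q n \<in> borel_measurable lborel" for n
      unfolding q_def by measurable
    show "(\<lambda>x. G x \<bullet> b) \<in> borel_measurable lborel"
      using qm qlim by (rule borel_measurable_LIMSEQ_real[rotated])
    show "AE x in lborel. (\<lambda>n. q n x) \<longlonglongrightarrow> G x \<bullet> b"
      using qlim by simp
  qed
  then show ?thesis
    using zero LIMSEQ_unique[OF _ tendsto_const] by fastforce
qed

section \<open>The fundamental lemma of the calculus of variations\<close>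

lemma integrable_test_mult:
  fixes f :: "'a::euclidean_space \<Rightarrow> real"
  assumes \<Omega>: "\<Omega> \<in> sets lebesgue" and f: "locally_integrable_on f \<Omega>" and "compact K" "K \<subseteq> \<Omega>"
    and m: "m \<in> borel_measurable borel" "\<And>x. x \<notin> K \<Longrightarrow> m x = 0" "\<And>x. \<bar>m x\<bar> \<le> B"
  shows "integrable (lebesgue_on \<Omega>) (\<lambda>x. f x * m x)"
proof -
  have int: "integrable lebesgue (\<lambda>x. indicator K x *\<^sub>R f x)"
    using f assms(3,4) by (auto simp: locally_integrable_on_def set_integrable_def)
  have "integrable lebesgue (\<lambda>x. (indicator K x *\<^sub>R f x) * m x)"
  proof (rule Bochner_Integration.integrable_bound[OF integrable_mult_right[OF int, of B]])
    show "(\<lambda>x. (indicator K x *\<^sub>R f x) * m x) \<in> borel_measurable lebesgue"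
      using borel_measurable_integrable[OF int] m(1) by (intro borel_measurable_times) (auto intro: measurable_completion)
    show "AE x in lebesgue. norm ((indicator K x *\<^sub>R f x) * m x) \<le> norm (B * (indicator K x *\<^sub>R f x))"
    proof (rule AE_I2)
      fix x
      have "\<bar>m x\<bar> \<le> \<bar>B\<bar>" using m(3)[of x] by linarith
      then show "norm ((indicator K x *\<^sub>R f x) * m x) \<le> norm (B * (indicator K x *\<^sub>R f x))"
        by (simp add: abs_mult mult.commute mult_right_mono)
    qed
  qed
  moreover have "(\<lambda>x. (indicator K x *\<^sub>R f x) * m x) = (\<lambda>x. indicator \<Omega> x *\<^sub>R (f x * m x))"
    using m(2) assms(4) by (auto simp: indicator_def fun_eq_iff)
  ultimately show ?thesis
    using \<Omega> by (simp add: integrable_restrict_space)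
qed

lemma integrable_test_function_mult:
  assumes "\<Omega> \<in> sets lebesgue" "locally_integrable_on f \<Omega>" "\<phi> \<in> test_functions \<Omega>"
  shows "integrable (lebesgue_on \<Omega>) (\<lambda>x. f x * \<phi> x)"
proof -
  obtain K where "compact K" "K \<subseteq> \<Omega>" "\<And>x. x \<notin> K \<Longrightarrow> \<phi> x = 0"
    using test_function_support[OF assms(3)] by metis
  moreover obtain B where "\<And>x. \<bar>\<phi> x\<bar> \<le> B"
    using test_function_bounded[OF assms(3)] by metis
  ultimately show ?thesis
    using integrable_test_mult[OF assms(1,2)] test_function_measurable[OF assms(3)] by metis
qed

text \<open>Test functions approximate indicators of boxes, and the averages over small cubes determine
  the function by Lebesgue's differentiation theorem.\<close>

lemma AE_nonneg_if_test_integrals_nonneg: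
  fixes f :: "'a::euclidean_space \<Rightarrow> real"
  assumes \<Omega>: "open \<Omega>" and f: "locally_integrable_on f \<Omega>"
    and nonneg: "\<And>\<phi>. \<lbrakk>\<phi> \<in> test_functions \<Omega>; \<And>x. 0 \<le> \<phi> x\<rbrakk> \<Longrightarrow> 0 \<le> (LINT x|lebesgue_on \<Omega>. f x * \<phi> x)"
  shows "AE x in lebesgue_on \<Omega>. 0 \<le> f x"
proof -
  have \<Omega>m: "\<Omega> \<in> sets lebesgue"
    using \<Omega> by (simp add: borel_open)
  \<comment> \<open>Dominated convergence along test functions that tend to the indicator of the
    open box; passing to the closed box does not change the integral.\<close>
  have box: "0 \<le> integral (cbox a b) f" if ab: "cbox a b \<subseteq> \<Omega>" for a b
  proof -
    obtain \<phi> where \<phi>: "\<And>n. \<phi> n \<in> test_functions \<Omega>" "\<And>n x. 0 \<le> \<phi> n x" "\<And>n x. \<phi> n x \<le> 1"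
      "\<And>n x. x \<notin> box a b \<Longrightarrow> \<phi> n x = 0" "\<And>x. x \<in> box a b \<Longrightarrow> (\<lambda>n. \<phi> n x) \<longlonglongrightarrow> 1"
      using test_functions_approx_box[OF ab] by blast
    have si: "set_integrable lebesgue (cbox a b) f"
      using f ab by (simp add: locally_integrable_on_def)
    then have int: "integrable lebesgue (\<lambda>x. indicator (cbox a b) x *\<^sub>R f x)"
      by (simp add: set_integrable_def)
    have si': "set_integrable lebesgue (box a b) f"
      by (rule set_integrable_subset[OF si]) (auto simp: box_subset_cbox)
    have eq: "(LINT x|lebesgue_on \<Omega>. f x * \<phi> n x) = (LINT x|lebesgue. (indicator (cbox a b) x *\<^sub>R f x) * \<phi> n x)" for n
    proof -
      have "(\<lambda>x. (indicator (cbox a b) x *\<^sub>R f x) * \<phi> n x) = (\<lambda>x. indicator \<Omega> x *\<^sub>R (f x * \<phi> n x))"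
        using \<phi>(4)[of _ n] ab box_subset_cbox[of a b] by (auto simp: indicator_def fun_eq_iff)
      then show ?thesis
        using \<Omega>m by (simp add: integral_restrict_space)
    qed
    have mphi: "\<phi> n \<in> borel_measurable lebesgue" for n
      using test_function_measurable(1)[OF \<phi>(1)] by (intro measurable_completion) simp
    have "(\<lambda>n. LINT x|lebesgue. (indicator (cbox a b) x *\<^sub>R f x) * \<phi> n x) \<longlonglongrightarrow> (LINT x|lebesgue. indicator (box a b) x *\<^sub>R f x)"
    proof (rule integral_dominated_convergence[where w = "\<lambda>x. norm (indicator (cbox a b) x *\<^sub>R f x)"])
      show "(\<lambda>x. indicator (box a b) x *\<^sub>R f x) \<in> borel_measurable lebesgue"
        using si' by (auto simp: set_integrable_def)
      show "(\<lambda>x. (indicator (cbox a b) x *\<^sub>R f x) * \<phi> n x) \<in> borel_measurable lebesgue" for n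
        using int mphi by (intro borel_measurable_times) auto
      show "AE x in lebesgue. (\<lambda>n. (indicator (cbox a b) x *\<^sub>R f x) * \<phi> n x) \<longlonglongrightarrow> indicator (box a b) x *\<^sub>R f x"
      proof (rule AE_I2)
        fix x
        show "(\<lambda>n. (indicator (cbox a b) x *\<^sub>R f x) * \<phi> n x) \<longlonglongrightarrow> indicator (box a b) x *\<^sub>R f x"
        proof (cases "x \<in> box a b")
          case True
          then show ?thesis
            using tendsto_mult[OF tendsto_const \<phi>(5)[OF True], of "f x"] box_subset_cbox[of a b]
            by (auto simp: indicator_def)
        next
          case False
          then show ?thesis using \<phi>(4)[OF False] by simp
        qed
      qed
      show "AE x in lebesgue. norm ((indicator (cbox a b) x *\<^sub>R f x) * \<phi> n x) \<le> norm (indicator (cbox a b) x *\<^sub>R f x)" for n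
        using \<phi>(2,3) by (auto simp: abs_mult mult_left_le)
    qed (use int in auto)
    moreover have "\<forall>\<^sub>F n in sequentially. 0 \<le> (LINT x|lebesgue. (indicator (cbox a b) x *\<^sub>R f x) * \<phi> n x)"
      unfolding eq[symmetric] by (intro always_eventually allI nonneg \<phi>)
    ultimately have "0 \<le> (LINT x|lebesgue. indicator (box a b) x *\<^sub>R f x)"
      by (rule tendsto_lowerbound) simp
    also have "\<dots> = integral (box a b) f"
      using set_lebesgue_integral_eq_integral(2)[OF si'] by (simp add: set_lebesgue_integral_def)
    also have "\<dots> = integral (cbox a b) f"
      by (rule integral_open_interval)
    finally show ?thesis .
  qed
  have cb: "AE x in lebesgue. x \<in> cbox a b \<longrightarrow> 0 \<le> f x" if ab: "cbox a b \<subseteq> \<Omega>" for a b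
  proof -
    \<comment> \<open>The differentiation theorem asks for integrability on every box, whereas
      \<open>f\<close> is only known to be integrable on compact subsets of \<Omega>; hence the
      truncation.\<close>
    let ?g = "\<lambda>x. if x \<in> cbox a b then f x else 0"
    have "f integrable_on cbox a b"
      using f ab by (intro set_lebesgue_integral_eq_integral(1)) (simp add: locally_integrable_on_def)
    then have "?g integrable_on UNIV"
      by (simp add: integrable_restrict_UNIV)
    then have "?g integrable_on cbox c d" for c d
      using integrable_on_subcbox by blast
    then obtain N where N: "negligible N"
      "\<And>x e. \<lbrakk>x \<notin> N; 0 < e\<rbrakk> \<Longrightarrow> \<exists>d>0. \<forall>h. 0 < h \<and> h < d \<longrightarrow>
         norm (integral (cbox x (x + h *\<^sub>R One)) ?g /\<^sub>R h ^ DIM('a) - ?g x) < e"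
      using integrable_ccontinuous_explicit by blast
    have "0 \<le> f x" if x: "x \<in> box a b" "x \<notin> N" for x
    proof (rule ccontr)
      assume neg: "\<not> 0 \<le> f x"
      then obtain d where d: "d > 0" "\<And>h. \<lbrakk>0 < h; h < d\<rbrakk> \<Longrightarrow>
         norm (integral (cbox x (x + h *\<^sub>R One)) ?g /\<^sub>R h ^ DIM('a) - ?g x) < - f x"
        using N(2)[OF x(2), of "- f x"] by auto
      obtain e where e: "e > 0" "ball x e \<subseteq> box a b"
        using x(1) open_box openE by blast
      \<comment> \<open>The cube has \<open>x\<close> as a corner and side \<open>h\<close>. The
        distance of its points from \<open>x\<close> is at most the dimension times
        \<open>h\<close>, hence at most \<open>e / 2\<close>, so the cube stays inside the
        box.\<close>
      define h where "h = min (d / 2) (e / (2 * real DIM('a)))"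
      have h: "0 < h" "h < d"
        using d(1) e(1) by (auto simp: h_def)
      have sub: "cbox x (x + h *\<^sub>R One) \<subseteq> ball x e"
      proof
        fix y assume y: "y \<in> cbox x (x + h *\<^sub>R One)"
        have "norm (y - x) \<le> (\<Sum>i\<in>Basis. \<bar>(y - x) \<bullet> i\<bar>)"
          by (rule norm_le_l1)
        also have "\<dots> \<le> (\<Sum>i\<in>(Basis::'a set). h)"
        proof (rule sum_mono)
          fix i :: 'a assume "i \<in> Basis"
          then have "x \<bullet> i \<le> y \<bullet> i" "y \<bullet> i \<le> x \<bullet> i + h"
            using y by (auto simp: mem_box inner_add_left)
          then show "\<bar>(y - x) \<bullet> i\<bar> \<le> h"
            by (simp add: inner_diff_left)
        qed
        also have "\<dots> = real DIM('a) * h"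
          by simp
        also have "\<dots> \<le> real DIM('a) * (e / (2 * real DIM('a)))"
          by (intro mult_left_mono) (auto simp: h_def)
        also have "\<dots> < e"
          using e(1) by simp
        finally show "y \<in> ball x e"
          by (simp add: dist_norm norm_minus_commute)
      qed
      then have sub2: "cbox x (x + h *\<^sub>R One) \<subseteq> cbox a b"
        using e(2) box_subset_cbox by blast
      have "integral (cbox x (x + h *\<^sub>R One)) ?g = integral (cbox x (x + h *\<^sub>R One)) f"
        using sub2 by (intro integral_cong) auto
      also have "\<dots> \<ge> 0"
        using sub2 ab by (intro box) auto
      finally have "0 \<le> integral (cbox x (x + h *\<^sub>R One)) ?g /\<^sub>R h ^ DIM('a)"
        using h(1) by simp
      moreover have "norm (integral (cbox x (x + h *\<^sub>R One)) ?g /\<^sub>R h ^ DIM('a) - f x) < - f x"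
        using d(2)[OF h] x(1) box_subset_cbox[of a b] by auto
      ultimately show False
        by simp
    qed
    then have sub: "{x. \<not> (x \<in> cbox a b \<longrightarrow> 0 \<le> f x)} \<subseteq> N \<union> (cbox a b - box a b)"
      by auto
    moreover have "negligible (N \<union> (cbox a b - box a b))"
      using N(1) negligible_frontier_interval by (simp add: negligible_Un_eq)
    ultimately show ?thesis
      by (intro AE_I'[of "N \<union> (cbox a b - box a b)"]) (auto simp: negligible_iff_null_sets)
  qed
  \<comment> \<open>Countably many closed boxes exhaust \<Omega>, so the exceptional null sets can
    be united.\<close>
  obtain \<D> where \<D>: "countable \<D>" "\<D> \<subseteq> Pow \<Omega>" "\<And>X. X \<in> \<D> \<Longrightarrow> \<exists>a b. X = cbox a b" "\<Union>\<D> = \<Omega>"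
    using open_countable_Union_open_cbox[OF \<Omega>] by metis
  have "AE x in lebesgue. \<forall>X\<in>\<D>. x \<in> X \<longrightarrow> 0 \<le> f x"
    using \<D> cb by (subst AE_ball_countable) (auto, metis Pow_iff subsetD)
  then have "AE x in lebesgue. x \<in> \<Omega> \<longrightarrow> 0 \<le> f x"
    by (rule AE_mp) (use \<D>(4) in auto)
  then show ?thesis
    using \<Omega>m by (simp add: AE_restrict_space_iff)
qed


section \<open>Weak gradients\<close>

text \<open>Integrability on each compact box of a countable cover contains measurability there, and
  the pieces are glued. Weak gradients are only required to be locally integrable, while
  measurability on all of \<Omega> is wanted for the chosen one.\<close>

lemma locally_integrable_imp_measurable:
  fixes f :: "'a::euclidean_space \<Rightarrow> 'b::{banach, second_countable_topology}"
  assumes \<Omega>: "open \<Omega>" and f: "locally_integrable_on f \<Omega>"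
  shows "f \<in> borel_measurable (lebesgue_on \<Omega>)"
proof -
  obtain \<D> where \<D>: "countable \<D>" "\<D> \<subseteq> Pow \<Omega>" "\<And>X. X \<in> \<D> \<Longrightarrow> \<exists>a b. X = cbox a b" "\<Union>\<D> = \<Omega>"
    using open_countable_Union_open_cbox[OF \<Omega>] by metis
  have \<Omega>m: "\<Omega> \<in> sets lebesgue"
    using \<Omega> by (simp add: borel_open)
  show ?thesis
  proof (rule measurable_piecewise_restrict[of \<D>])
    fix X assume "X \<in> \<D>"
    then have X: "X \<subseteq> \<Omega>" "compact X"
      using \<D> by (auto, metis compact_cbox)
    then have Xm: "X \<in> sets lebesgue"
      by (simp add: borel_compact)
    then show "X \<inter> space (lebesgue_on \<Omega>) \<in> sets (lebesgue_on \<Omega>)"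
      using X \<Omega>m by (auto simp: sets_restrict_space intro!: image_eqI[of _ _ X])
    have "integrable (lebesgue_on X) f"
      using f X Xm integrable_restrict_space[of X lebesgue f]
      by (simp add: locally_integrable_on_def set_integrable_def)
    then have "f \<in> borel_measurable (lebesgue_on X)"
      by (rule borel_measurable_integrable)
    moreover have "restrict_space (lebesgue_on \<Omega>) X = lebesgue_on X"
      using X \<Omega>m Xm by (subst restrict_restrict_space) (auto simp: Int_absorb1)
    ultimately show "f \<in> borel_measurable (restrict_space (lebesgue_on \<Omega>) X)"
      by simp
  qed (use \<D> in auto)
qed

lemma continuous_imp_locally_integrable:
  fixes f :: "'a::euclidean_space \<Rightarrow> 'b::{banach, second_countable_topology}"
  assumes "continuous_on UNIV f"
  shows "locally_integrable_on f \<Omega>"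
  unfolding locally_integrable_on_def set_integrable_def
proof (intro allI impI)
  fix K assume "compact K \<and> K \<subseteq> \<Omega>"
  then have "integrable lborel (\<lambda>x. indicator K x *\<^sub>R f x)"
    using assms by (auto intro!: borel_integrable_compact intro: continuous_on_subset)
  then show "integrable lebesgue (\<lambda>x. indicator K x *\<^sub>R f x)"
    by (simp add: integrable_completion)
qed

text \<open>Integration by parts: the product \<open>\<phi> * \<psi>\<close> has compact support, so
  its directional derivative integrates to zero, and the product rule splits that integral.\<close>

lemma grad_is_weak_gradient:
  assumes \<Omega>: "open \<Omega>" and \<phi>: "\<phi> \<in> test_functions \<Omega>"
  shows "is_weak_gradient \<Omega> \<phi> (grad \<phi>)"
  unfolding is_weak_gradient_def
proof (intro conjI ballI)
  have \<Omega>m: "\<Omega> \<in> sets lebesgue"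
    using \<Omega> by (simp add: borel_open)
  show "locally_integrable_on \<phi> \<Omega>" "locally_integrable_on (grad \<phi>) \<Omega>"
    using test_function_continuous[OF \<phi>] by (auto intro: continuous_imp_locally_integrable)
  fix \<psi> b assume \<psi>: "\<psi> \<in> test_functions \<Omega>" and b: "b \<in> (Basis :: 'a set)"
  note [measurable] = test_function_measurable[OF \<phi>] test_function_measurable[OF \<psi>]
  obtain K where K: "compact K" "\<And>x. x \<notin> K \<Longrightarrow> \<phi> x = 0" "\<And>x. x \<notin> K \<Longrightarrow> grad \<phi> x = 0"
    using test_function_support[OF \<phi>] by metis
  obtain B where B: "\<And>x. \<bar>\<phi> x\<bar> \<le> B" "\<And>x. norm (grad \<phi> x) \<le> B"
    using test_function_bounded[OF \<phi>] by metis
  obtain C where C: "C > 0" "\<And>x. \<bar>\<psi> x\<bar> \<le> C" "\<And>x. norm (grad \<psi> x) \<le> C"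
    using test_function_bounded[OF \<psi>] by metis
  have bound1: "norm (\<phi> x *\<^sub>R grad \<psi> x) \<le> B * C" and bound2: "norm (\<psi> x *\<^sub>R grad \<phi> x) \<le> B * C" for x
    using mult_mono[OF B(1)[of x] C(3)[of x]] mult_mono[OF C(2)[of x] B(2)[of x]] B(1)[of x] C(1)
    by (auto simp: mult.commute[of C])
  define G where "G x = \<phi> x *\<^sub>R grad \<psi> x + \<psi> x *\<^sub>R grad \<phi> x" for x
  have "(LINT x|lborel. G x \<bullet> b) = 0"
  proof (rule integral_directional_derivative_eq_0)
    show "((\<lambda>x. \<phi> x * \<psi> x) has_derivative (\<lambda>h. G x \<bullet> h)) (at x)" for x
      by (rule has_derivative_eq_rhs[OF has_derivative_mult[OF
              has_derivative_grad[OF test_function_differentiable[OF \<phi>]]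
              has_derivative_grad[OF test_function_differentiable[OF \<psi>]]]])
        (simp add: G_def inner_add_left mult.commute)
    show "norm (G x) \<le> B * C + B * C" for x
      unfolding G_def by (intro norm_triangle_mono bound1 bound2)
  qed (use K in auto)
  moreover have i1: "integrable lborel (\<lambda>x. \<phi> x *\<^sub>R grad \<psi> x)"
    by (rule integrable_bounded_support[OF _ compact_imp_bounded[OF K(1)] _ bound1]) (use K in auto)
  moreover have i2: "integrable lborel (\<lambda>x. \<psi> x *\<^sub>R grad \<phi> x)"
    by (rule integrable_bounded_support[OF _ compact_imp_bounded[OF K(1)] _ bound2]) (use K in auto)
  ultimately have "(LINT x|lborel. \<phi> x * (grad \<psi> x \<bullet> b)) + (LINT x|lborel. (grad \<phi> x \<bullet> b) * \<psi> x) = 0"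
    using Bochner_Integration.integral_add[OF integrable_inner_left[OF i1, of b] integrable_inner_left[OF i2, of b]]
    by (simp add: G_def inner_add_left mult.commute)
  then show "(LINT x|lebesgue_on \<Omega>. \<phi> x * frechet_derivative \<psi> (at x) b) = - (LINT x|lebesgue_on \<Omega>. (grad \<phi> x \<bullet> b) * \<psi> x)"
    using test_function_zero_outside[OF \<phi>]
    by (simp add: test_function_derivative_eq[OF \<psi>] integral_lebesgue_on_eq_lborel[OF \<Omega>m])
qed

lemma locally_integrable_inner_diff:
  fixes f g :: "'a::euclidean_space \<Rightarrow> 'b::euclidean_space"
  assumes "locally_integrable_on f \<Omega>" "locally_integrable_on g \<Omega>"
  shows "locally_integrable_on (\<lambda>x. (f x - g x) \<bullet> b) \<Omega>"
  unfolding locally_integrable_on_def set_integrable_def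
proof (intro allI impI)
  fix K assume "compact K \<and> K \<subseteq> \<Omega>"
  then have "integrable lebesgue (\<lambda>x. indicator K x *\<^sub>R f x)" "integrable lebesgue (\<lambda>x. indicator K x *\<^sub>R g x)"
    using assms by (auto simp: locally_integrable_on_def set_integrable_def)
  then have "integrable lebesgue (\<lambda>x. (indicator K x *\<^sub>R f x - indicator K x *\<^sub>R g x) \<bullet> b)"
    by (intro integrable_inner_left Bochner_Integration.integrable_diff)
  then show "integrable lebesgue (\<lambda>x. indicator K x *\<^sub>R ((f x - g x) \<bullet> b))"
    by (simp add: inner_diff_left right_diff_distrib)
qed

text \<open>The fundamental lemma is applied to the components of \<open>g - h\<close> and of
  \<open>h - g\<close>. Thanks to this the choice made in \<open>weak_grad\<close> can be replaced,
  almost everywhere, by whichever weak gradient is at hand.\<close>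

lemma weak_gradient_unique:
  assumes \<Omega>: "open \<Omega>" and g: "is_weak_gradient \<Omega> u g" and h: "is_weak_gradient \<Omega> u h"
  shows "AE x in lebesgue_on \<Omega>. g x = h x"
proof -
  have \<Omega>m: "\<Omega> \<in> sets lebesgue"
    using \<Omega> by (simp add: borel_open)
  have le: "AE x in lebesgue_on \<Omega>. 0 \<le> (g x - h x) \<bullet> b"
    if b: "b \<in> Basis" and g: "is_weak_gradient \<Omega> u g" and h: "is_weak_gradient \<Omega> u h" for b g h
  proof (rule AE_nonneg_if_test_integrals_nonneg[OF \<Omega>])
    have L: "locally_integrable_on g \<Omega>" "locally_integrable_on h \<Omega>"
      using g h by (auto simp: is_weak_gradient_def)
    then show "locally_integrable_on (\<lambda>x. (g x - h x) \<bullet> b) \<Omega>"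
      by (rule locally_integrable_inner_diff)
    fix \<phi> assume \<phi>: "\<phi> \<in> test_functions \<Omega>"
    have "locally_integrable_on (\<lambda>x. 0::'a) \<Omega>"
      by (rule continuous_imp_locally_integrable) simp
    then have "locally_integrable_on (\<lambda>x. (g x - 0) \<bullet> b) \<Omega>" "locally_integrable_on (\<lambda>x. (h x - 0) \<bullet> b) \<Omega>"
      by (rule locally_integrable_inner_diff[OF L(1)], rule locally_integrable_inner_diff[OF L(2)])
    then have "integrable (lebesgue_on \<Omega>) (\<lambda>x. (g x \<bullet> b) * \<phi> x)" "integrable (lebesgue_on \<Omega>) (\<lambda>x. (h x \<bullet> b) * \<phi> x)"
      using integrable_test_function_mult[OF \<Omega>m _ \<phi>] by fastforce+
    then have "(LINT x|lebesgue_on \<Omega>. ((g x - h x) \<bullet> b) * \<phi> x) =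
        (LINT x|lebesgue_on \<Omega>. (g x \<bullet> b) * \<phi> x) - (LINT x|lebesgue_on \<Omega>. (h x \<bullet> b) * \<phi> x)"
      by (simp add: inner_diff_left left_diff_distrib)
    also have "\<dots> = 0"
      using g h \<phi> b unfolding is_weak_gradient_def by (metis (no_types, lifting) add.inverse_inverse diff_self)
    finally show "0 \<le> (LINT x|lebesgue_on \<Omega>. ((g x - h x) \<bullet> b) * \<phi> x)"
      by simp
  qed
  have "AE x in lebesgue_on \<Omega>. \<forall>b\<in>Basis. 0 \<le> (g x - h x) \<bullet> b \<and> 0 \<le> (h x - g x) \<bullet> b"
    using le[OF _ g h] le[OF _ h g] by (subst AE_ball_countable) (auto intro: countable_finite)
  then show ?thesis
    by (rule AE_mp) (auto intro!: AE_I2 euclidean_eqI[of "g _"] simp: inner_diff_left)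
qed

section \<open>Sobolev and Rellich for test functions\<close>

text \<open>For \<open>a > 1\<close> and \<open>c > 0\<close> this is Young's inequality for
  \<open>y / c\<close> and 1, multiplied by \<open>c powr a\<close>. The base point zero is included
  because the mean of a nonnegative function, which is inserted for \<open>c\<close>, may
  vanish.\<close>

lemma powr_tangent_le:
  fixes y c a :: real
  assumes "1 \<le> a" "0 \<le> y" "0 \<le> c"
  shows "c powr a + a * c powr (a - 1) * (y - c) \<le> y powr a"
proof (cases "a = 1 \<or> c = 0")
  case True
  then show ?thesis
    using assms by (cases "c = 0") auto
next
  case False
  then have a: "a > 1" and c: "c > 0"
    using assms by auto
  have "(y / c) * 1 \<le> (y / c) powr a / a + 1 powr (a / (a - 1)) / (a / (a - 1))"
    by (rule Youngs_inequality) (use a c assms in \<open>auto simp: field_simps\<close>)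
  then have "y / c \<le> ((y / c) powr a + (a - 1)) / a"
    by (simp add: add_divide_distrib)
  then have "a * (y / c) \<le> (y / c) powr a + (a - 1)"
    using a by (simp only: pos_le_divide_eq mult.commute)
  then have "c powr a * (1 + a * (y / c - 1)) \<le> c powr a * (y / c) powr a"
    by (intro mult_left_mono) (auto simp: algebra_simps)
  also have "c powr a * (y / c) powr a = y powr a"
    using assms c by (simp flip: powr_mult)
  also have "c powr a * (1 + a * (y / c - 1)) = c powr a + a * c powr (a - 1) * (y - c)"
    using c by (simp add: powr_diff field_simps)
  finally show ?thesis .
qed

text \<open>Jensen's inequality: the tangent at the mean \<open>c\<close> is integrated, and its
  linear term has integral zero because the total mass is one.\<close>

lemma (in finite_measure) integral_powr_le:
  fixes f :: "'a \<Rightarrow> real"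
  assumes "measure M (space M) = 1" "f \<in> borel_measurable M" "AE x in M. 0 \<le> f x \<and> f x \<le> B" "1 \<le> a"
  shows "(\<integral>x. f x \<partial>M) powr a \<le> (\<integral>x. f x powr a \<partial>M)"
proof -
  have i1: "integrable M f"
    using assms by (intro integrable_const_bound[where B = B]) auto
  have i2: "integrable M (\<lambda>x. f x powr a)"
    using assms by (intro integrable_const_bound[where B = "B powr a"]) (auto intro!: powr_mono2)
  define c where "c = (\<integral>x. f x \<partial>M)"
  have "c \<ge> 0"
    using assms unfolding c_def by (intro integral_nonneg_AE) auto
  have "c powr a = (\<integral>x. c powr a + a * c powr (a - 1) * (f x - c) \<partial>M)"
    using i1 by (simp add: c_def assms(1))
  also have "\<dots> \<le> (\<integral>x. f x powr a \<partial>M)"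
    using i1 i2 assms \<open>c \<ge> 0\<close> by (intro integral_mono_AE) (auto intro!: powr_tangent_le)
  finally show ?thesis
    by (simp add: c_def)
qed

lemma nn_integral_lborel_affine:
  fixes f :: "'a::euclidean_space \<Rightarrow> ennreal"
  assumes [measurable]: "f \<in> borel_measurable borel" and "c > 0"
  shows "(\<integral>\<^sup>+z. f (x + c *\<^sub>R z) \<partial>lborel) = ennreal (1 / c ^ DIM('a)) * (\<integral>\<^sup>+z. f z \<partial>lborel)"
proof -
  have "(\<integral>\<^sup>+z. f z \<partial>lborel) = (\<integral>\<^sup>+z. f z \<partial>density (distr lborel borel (\<lambda>z. x + c *\<^sub>R z)) (\<lambda>_. ennreal (\<bar>c\<bar> ^ DIM('a))))"
    using assms by (subst lborel_affine[of c x]) auto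
  also have "\<dots> = ennreal (c ^ DIM('a)) * (\<integral>\<^sup>+z. f (x + c *\<^sub>R z) \<partial>lborel)"
    using assms by (simp add: nn_integral_density nn_integral_distr nn_integral_cmult)
  finally show ?thesis
    using \<open>c > 0\<close> by (simp add: mult.assoc[symmetric] flip: ennreal_mult)
qed

text \<open>The fundamental theorem of calculus along the curve
  \<open>x + s ^ m *\<^sub>R z\<close>, which starts at \<open>x\<close> because
  \<open>m \<ge> 1\<close>. The exponent reparametrises the segment: \<open>m = 1\<close> serves
  translation estimates, large \<open>m\<close> the Sobolev inequality.\<close>

lemma test_function_path:
  fixes \<phi> :: "'a::euclidean_space \<Rightarrow> real"
  assumes \<phi>: "\<phi> \<in> test_functions \<Omega>" and m: "m \<ge> 1"
  shows "\<bar>\<phi> (x + z) - \<phi> x\<bar> \<le> integral {0..1} (\<lambda>s. real m * s ^ (m - 1) * norm z * norm (grad \<phi> (x + s ^ m *\<^sub>R z)))"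
    and "(\<lambda>s. real m * s ^ (m - 1) * norm z * norm (grad \<phi> (x + s ^ m *\<^sub>R z))) integrable_on {0..1}"
proof -
  have cont: "continuous_on UNIV (grad \<phi>)"
    using test_function_continuous(2)[OF \<phi>] .
  show int: "(\<lambda>s. real m * s ^ (m - 1) * norm z * norm (grad \<phi> (x + s ^ m *\<^sub>R z))) integrable_on {0..1}"
    by (intro integrable_continuous_real continuous_intros continuous_on_compose2[OF cont]) auto
  have der: "((\<lambda>s. \<phi> (x + s ^ m *\<^sub>R z)) has_vector_derivative (real m * s ^ (m - 1)) * (grad \<phi> (x + s ^ m *\<^sub>R z) \<bullet> z)) (at s within {0..1})" for s
  proof -
    have "((\<lambda>s. x + s ^ m *\<^sub>R z) has_derivative (\<lambda>h. (h * (real m * s ^ (m - 1))) *\<^sub>R z)) (at s)"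
    proof -
      have "((\<lambda>s. s ^ m) has_derivative (\<lambda>h. h * (real m * s ^ (m - 1)))) (at s)"
        using DERIV_pow[of m s UNIV] by (simp add: has_field_derivative_def mult_commute_abs)
      from has_derivative_add[OF has_derivative_const has_derivative_scaleR_left[OF this, of z], of x]
      show ?thesis by simp
    qed
    then have "((\<lambda>s. \<phi> (x + s ^ m *\<^sub>R z)) has_derivative (\<lambda>h. grad \<phi> (x + s ^ m *\<^sub>R z) \<bullet> ((h * (real m * s ^ (m - 1))) *\<^sub>R z))) (at s)"
      by (rule has_derivative_compose) (rule has_derivative_grad[OF test_function_differentiable[OF \<phi>]])
    then have "((\<lambda>s. \<phi> (x + s ^ m *\<^sub>R z)) has_derivative (\<lambda>h. h *\<^sub>R (real m * s ^ (m - 1) * (grad \<phi> (x + s ^ m *\<^sub>R z) \<bullet> z)))) (at s)"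
      by (simp add: mult.assoc)
    then show ?thesis
      unfolding has_vector_derivative_def by (rule has_derivative_at_withinI)
  qed
  have hi: "((\<lambda>s. (real m * s ^ (m - 1)) * (grad \<phi> (x + s ^ m *\<^sub>R z) \<bullet> z)) has_integral (\<phi> (x + z) - \<phi> x)) {0..1}"
    using fundamental_theorem_of_calculus[OF _ der] m by (simp add: power_0_left)
  have "norm (integral {0..1} (\<lambda>s. (real m * s ^ (m - 1)) * (grad \<phi> (x + s ^ m *\<^sub>R z) \<bullet> z))) \<le>
      integral {0..1} (\<lambda>s. real m * s ^ (m - 1) * norm z * norm (grad \<phi> (x + s ^ m *\<^sub>R z)))"
  proof (rule integral_norm_bound_integral[OF _ int])
    show "(\<lambda>s. (real m * s ^ (m - 1)) * (grad \<phi> (x + s ^ m *\<^sub>R z) \<bullet> z)) integrable_on {0..1}"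
      using hi by blast
    fix s :: real assume "s \<in> {0..1}"
    then have s: "0 \<le> real m * s ^ (m - 1)" by simp
    have "\<bar>grad \<phi> (x + s ^ m *\<^sub>R z) \<bullet> z\<bar> \<le> norm z * norm (grad \<phi> (x + s ^ m *\<^sub>R z))"
      by (metis Cauchy_Schwarz_ineq2 mult.commute)
    from mult_left_mono[OF this s]
    show "norm ((real m * s ^ (m - 1)) * (grad \<phi> (x + s ^ m *\<^sub>R z) \<bullet> z)) \<le> real m * s ^ (m - 1) * norm z * norm (grad \<phi> (x + s ^ m *\<^sub>R z))"
      unfolding real_norm_def abs_mult[of "real m * s ^ (m - 1)"] abs_of_nonneg[OF s] by (simp add: mult.assoc)
  qed
  then show "\<bar>\<phi> (x + z) - \<phi> x\<bar> \<le> integral {0..1} (\<lambda>s. real m * s ^ (m - 1) * norm z * norm (grad \<phi> (x + s ^ m *\<^sub>R z)))"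
    using hi by (simp add: integral_unique)
qed

text \<open>For sets of Lebesgue measure one this is a probability measure, so that averages over
  the unit interval and over unit cubes become integrals to which Jensen and Fubini apply.\<close>

definition unif :: "'a::euclidean_space set \<Rightarrow> 'a measure" where
  "unif S = density lborel (indicator S)"

lemma sets_unif[measurable_cong, simp]: "sets (unif S) = sets borel"
  and space_unif[simp]: "space (unif S) = UNIV"
  by (simp_all add: unif_def)

lemma finite_measure_unif:
  assumes "S \<in> sets borel" "emeasure lborel S = 1"
  shows "finite_measure (unif S)" "emeasure (unif S) UNIV = 1" "measure (unif S) UNIV = 1"
proof -
  show "emeasure (unif S) UNIV = 1"
    using assms by (simp add: unif_def emeasure_density)
  then show "finite_measure (unif S)" "measure (unif S) UNIV = 1"
    by (auto intro!: finite_measureI simp: measure_def)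
qed

lemma nn_integral_unif:
  assumes "S \<in> sets borel" "f \<in> borel_measurable borel"
  shows "(\<integral>\<^sup>+x. f x \<partial>unif S) = (\<integral>\<^sup>+x. f x * indicator S x \<partial>lborel)"
  using assms by (simp add: unif_def nn_integral_density mult.commute)

lemma AE_unif:
  assumes "S \<in> sets borel"
  shows "AE x in unif S. x \<in> S"
  unfolding unif_def by (subst AE_density) (use assms in \<open>auto simp: indicator_def\<close>)

lemma emeasure_unit_cube: "emeasure lborel (cbox a (a + One) :: 'a::euclidean_space set) = 1"
  by (subst emeasure_lborel_cbox) (simp_all add: inner_add_left)

lemma integral_unif_interval:
  fixes f :: "real \<Rightarrow> real"
  assumes "f integrable_on {0..1}" "f \<in> borel_measurable borel" "\<And>s. s \<in> {0..1} \<Longrightarrow> 0 \<le> f s"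
  shows "ennreal (integral {0..1} f) = (\<integral>\<^sup>+s. ennreal (f s) \<partial>unif {0..1})"
proof -
  have "(f has_integral integral {0..1} f) {0..1}"
    using assms(1) by (rule integrable_integral)
  then have "((\<lambda>x. if x \<in> {0..1} then f x else 0) has_integral integral {0..1} f) UNIV"
    by (simp only: has_integral_restrict_UNIV)
  moreover have "(\<lambda>x. if x \<in> {0..1} then f x else 0) = (\<lambda>x. indicator {0..1} x * f x)"
    by (auto simp: indicator_def)
  moreover have "(\<lambda>x. indicator {0..1} x * f x) \<in> borel_measurable borel"
    using assms(2) by measurable
  ultimately have "(\<integral>\<^sup>+x. ennreal (indicator {0..1} x * f x) \<partial>lborel) = ennreal (integral {0..1} f)"
    using assms(3) by (intro nn_integral_has_integral_lborel) (auto simp: indicator_def)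
  moreover have "(\<lambda>x. ennreal (indicator {0..1} x * f x)) = (\<lambda>x. ennreal (f x) * indicator {0..1} x)"
    by (auto simp: indicator_def)
  ultimately show ?thesis
    using assms(2) by (simp add: nn_integral_unif)
qed

lemma test_function_path_nn:
  fixes \<phi> :: "'a::euclidean_space \<Rightarrow> real"
  assumes \<phi>: "\<phi> \<in> test_functions \<Omega>" and m: "m \<ge> 1"
  shows "ennreal \<bar>\<phi> (x + z) - \<phi> x\<bar> \<le> (\<integral>\<^sup>+s. ennreal (real m * s ^ (m - 1) * norm z * norm (grad \<phi> (x + s ^ m *\<^sub>R z))) \<partial>unif {0..1})"
proof -
  note [measurable] = test_function_measurable[OF \<phi>]
  have "(\<lambda>s. real m * s ^ (m - 1) * norm z * norm (grad \<phi> (x + s ^ m *\<^sub>R z))) \<in> borel_measurable borel"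
    by measurable
  from integral_unif_interval[OF test_function_path(2)[OF \<phi> m] this]
  have "(\<integral>\<^sup>+s. ennreal (real m * s ^ (m - 1) * norm z * norm (grad \<phi> (x + s ^ m *\<^sub>R z))) \<partial>unif {0..1})
      = ennreal (integral {0..1} (\<lambda>s. real m * s ^ (m - 1) * norm z * norm (grad \<phi> (x + s ^ m *\<^sub>R z))))"
    by simp
  then show ?thesis
    using ennreal_leI[OF test_function_path(1)[OF \<phi> m, of x z]] by simp
qed

text \<open>The estimate along the segment is integrated in \<open>x\<close>; after the exchange of
  integrals, translation invariance makes the inner integral independent of \<open>s\<close>. This
  is the equicontinuity in L^1 behind Rellich's theorem.\<close>

lemma test_function_shift_L1:
  fixes \<phi> :: "'a::euclidean_space \<Rightarrow> real"
  assumes \<phi>: "\<phi> \<in> test_functions \<Omega>"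
  shows "(\<integral>\<^sup>+x. ennreal \<bar>\<phi> (x + z) - \<phi> x\<bar> \<partial>lborel) \<le> ennreal (norm z) * (\<integral>\<^sup>+x. ennreal (norm (grad \<phi> x)) \<partial>lborel)"
proof -
  note [measurable] = test_function_measurable[OF \<phi>]
  interpret U: finite_measure "unif {0..1::real}"
    by (rule finite_measure_unif) auto
  interpret P: pair_sigma_finite "unif {0..1::real}" "lborel :: 'a measure" ..
  have "(\<integral>\<^sup>+x. ennreal \<bar>\<phi> (x + z) - \<phi> x\<bar> \<partial>lborel) \<le>
      (\<integral>\<^sup>+x. (\<integral>\<^sup>+s. ennreal (norm z * norm (grad \<phi> (x + s *\<^sub>R z))) \<partial>unif {0..1}) \<partial>lborel)"
    using test_function_path_nn[OF \<phi>, of 1] by (intro nn_integral_mono) simp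
  also have "\<dots> = (\<integral>\<^sup>+s. (\<integral>\<^sup>+x. ennreal (norm z * norm (grad \<phi> (x + s *\<^sub>R z))) \<partial>lborel) \<partial>unif {0..1::real})"
    by (subst P.Fubini') auto
  also have "\<dots> = (\<integral>\<^sup>+s. ennreal (norm z) * (\<integral>\<^sup>+x. ennreal (norm (grad \<phi> x)) \<partial>lborel) \<partial>unif {0..1::real})"
  proof (rule nn_integral_cong)
    fix s
    have "(\<integral>\<^sup>+x. ennreal (norm z * norm (grad \<phi> (s *\<^sub>R z + x))) \<partial>lborel) = (\<integral>\<^sup>+x. ennreal (norm z * norm (grad \<phi> x)) \<partial>lborel)"
      by (rule nn_integral_lborel_shift) measurable
    then show "(\<integral>\<^sup>+x. ennreal (norm z * norm (grad \<phi> (x + s *\<^sub>R z))) \<partial>lborel) = ennreal (norm z) * (\<integral>\<^sup>+x. ennreal (norm (grad \<phi> x)) \<partial>lborel)"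
      by (simp add: add.commute ennreal_mult nn_integral_cmult)
  qed
  also have "\<dots> = ennreal (norm z) * (\<integral>\<^sup>+x. ennreal (norm (grad \<phi> x)) \<partial>lborel)"
    using finite_measure_unif(2)[of "{0..1::real}"] by simp
  finally show ?thesis .
qed

lemma test_function_grad_powr_integrable:
  assumes \<phi>: "\<phi> \<in> test_functions \<Omega>" and "P > 0"
  shows "integrable lborel (\<lambda>x. norm (grad \<phi> x) powr P)"
proof -
  note [measurable] = test_function_measurable[OF \<phi>]
  obtain K where "compact K" "\<And>x. x \<notin> K \<Longrightarrow> grad \<phi> x = 0"
    using test_function_support[OF \<phi>] by metis
  moreover obtain B where "\<And>x. norm (grad \<phi> x) \<le> B"
    using test_function_bounded[OF \<phi>] by metis
  then have "norm (norm (grad \<phi> x) powr P) \<le> B powr P" for x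
    using \<open>P > 0\<close> by (simp add: powr_mono2)
  ultimately show ?thesis
    by (intro integrable_bounded_support[of _ K]) (auto intro: compact_imp_bounded)
qed

text \<open>The function is recovered from its gradient along the curves \<open>s \<mapsto> x + s\<^sup>m z\<close>, averaged over
  a cube of endpoints \<open>x + z\<close> outside the domain. For \<open>m\<close> large the factor \<open>s\<^bsup>m-1\<^esup>\<close> compensates the
  singularity of the averages at \<open>s = 0\<close>; this is where the subcritical exponent enters.\<close>

lemma sobolev_test_functions:
  fixes \<Omega> :: "'a::euclidean_space set"
  assumes \<Omega>: "bounded \<Omega>" and P: "1 \<le> P" "P \<le> q" and sub: "q * (real DIM('a) - P) < real DIM('a) * P"
  obtains C where "C > 0"
    "\<And>\<phi>. \<phi> \<in> test_functions \<Omega> \<Longrightarrow> (\<integral>\<^sup>+x. ennreal (\<bar>\<phi> x\<bar> powr q) \<partial>lborel)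
       \<le> ennreal (C * (LINT x|lborel. norm (grad \<phi> x) powr P) powr (q / P))"
proof -
  define N where "N = real DIM('a)"
  \<comment> \<open>\<open>P * \<delta>\<close> equals \<open>N * P - q * (N - P)\<close>, so the
    subcriticality assumption is the positivity of \<open>\<delta>\<close>.\<close>
  define \<delta> where "\<delta> = q - N * (q / P - 1)"
  have "P * \<delta> = N * P - q * (N - P)"
    using P by (simp add: \<delta>_def field_simps)
  then have "P * \<delta> > 0"
    using sub by (simp add: N_def)
  then have \<delta>: "\<delta> > 0"
    using P by (simp add: zero_less_mult_iff)
  \<comment> \<open>The choice makes \<open>q \<le> m * \<delta>\<close>, so that the power of
    \<open>s\<close> left over after all estimates has the nonnegative exponent
    \<open>m * \<delta> - q\<close>.\<close>
  define m where "m = nat \<lceil>q / \<delta>\<rceil>"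
  have "q / \<delta> > 0"
    using \<delta> P by simp
  then have m: "m \<ge> 1" "q / \<delta> \<le> real m"
    unfolding m_def by linarith+
  then have m\<delta>: "q \<le> real m * \<delta>"
    using \<delta> by (simp add: field_simps)
  obtain R where R: "R > 0" "\<And>x. x \<in> \<Omega> \<Longrightarrow> norm x \<le> R"
    using \<Omega> by (auto simp: bounded_pos)
  \<comment> \<open>Two points of \<Omega> differ by at most \<open>2 * R\<close> in each
    coordinate, while every \<open>z\<close> in the cube has coordinates at least
    \<open>2 * R + 1\<close>. Hence \<open>x + z\<close> has left \<Omega> and \<open>\<phi>\<close>
    vanishes there.\<close>
  define a :: 'a where "a = (2 * R + 1) *\<^sub>R One"
  define Q where "Q = cbox a (a + One)"
  have outside: "x + z \<notin> \<Omega>" if "x \<in> \<Omega>" "z \<in> Q" for x z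
  proof
    assume "x + z \<in> \<Omega>"
    obtain i :: 'a where i: "i \<in> Basis"
      using nonempty_Basis by blast
    have "\<bar>x \<bullet> i\<bar> \<le> R" "\<bar>(x + z) \<bullet> i\<bar> \<le> R"
      using R(2)[OF that(1)] R(2)[OF \<open>x + z \<in> \<Omega>\<close>] Basis_le_norm[OF i] order_trans by blast+
    moreover have "z \<bullet> i \<ge> 2 * R + 1"
      using that(2) i by (simp add: Q_def mem_box a_def)
    ultimately show False
      using R(1) by (simp add: inner_add_left)
  qed
  obtain D where D: "D > 0" "\<And>z. z \<in> Q \<Longrightarrow> norm z \<le> D"
    using bounded_cbox[of a "a + One"] by (auto simp: bounded_pos Q_def)
  have Qb: "Q \<in> sets borel" "emeasure lborel Q = 1"
    by (simp_all add: Q_def emeasure_unit_cube)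
  define C where "C = (real m * D) powr q"
  have "C > 0"
    using m D by (simp add: C_def)
  interpret MQ: finite_measure "unif Q"
    by (rule finite_measure_unif[OF Qb])
  interpret M1: finite_measure "unif {0..1::real}"
    by (rule finite_measure_unif) auto
  interpret P1Q: pair_sigma_finite "unif {0..1::real}" "unif Q" ..
  interpret PL1: pair_sigma_finite "lborel :: 'a measure" "unif {0..1::real}" ..
  interpret PLQ: pair_sigma_finite "lborel :: 'a measure" "unif Q" ..
  have u1: "measure (unif {0..1::real}) UNIV = 1" "emeasure (unif {0..1::real}) UNIV = 1"
    by (rule finite_measure_unif; simp)+
  have ae1: "AE s in unif {0..1::real}. s \<in> {0..1}"
    by (rule AE_unif) simp
  note uQ = finite_measure_unif(2,3)[OF Qb]
  have "(\<integral>\<^sup>+x. ennreal (\<bar>\<phi> x\<bar> powr q) \<partial>lborel) \<le> ennreal (C * (LINT x|lborel. norm (grad \<phi> x) powr P) powr (q / P))"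
    if \<phi>: "\<phi> \<in> test_functions \<Omega>" for \<phi>
  proof -
    note [measurable] = test_function_measurable[OF \<phi>]
    obtain B where B: "B > 0" "\<And>x. norm (grad \<phi> x) \<le> B"
      using test_function_bounded[OF \<phi>] by metis
    define g where "g x = norm (grad \<phi> x)" for x
    have g: "0 \<le> g x" "g x \<le> B" for x
      using B by (auto simp: g_def)
    have gm[measurable]: "g \<in> borel_measurable borel"
      unfolding g_def by measurable
    define I where "I = (LINT x|lborel. g x powr P)"
    have gint: "integrable lborel (\<lambda>x. g x powr P)"
      unfolding g_def using test_function_grad_powr_integrable[OF \<phi>] P by simp
    have "I \<ge> 0"
      by (simp add: I_def)
    have Inn: "(\<integral>\<^sup>+x. ennreal (g x powr P) \<partial>lborel) = ennreal I"
      unfolding I_def by (rule nn_integral_eq_integral[OF gint]) simp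
    \<comment> \<open>\<open>A\<close> averages the length of the gradient over the cube of end
      points, and \<open>H\<close> averages its \<open>P\<close>-th power; Jensen's inequality
      compares the two.\<close>
    define A where "A s x = (\<integral>z. g (x + s ^ m *\<^sub>R z) \<partial>unif Q)" for s x
    define H where "H s x = (\<integral>z. g (x + s ^ m *\<^sub>R z) powr P \<partial>unif Q)" for s x
    have iA: "integrable (unif Q) (\<lambda>z. g (x + s ^ m *\<^sub>R z))" for s x
      using g by (intro MQ.integrable_const_bound[where B = B]) auto
    have iH: "integrable (unif Q) (\<lambda>z. g (x + s ^ m *\<^sub>R z) powr P)" for s x
      using g P by (intro MQ.integrable_const_bound[where B = "B powr P"]) (auto intro!: powr_mono2)
    have A: "0 \<le> A s x" "A s x \<le> B" for s x
    proof -
      show "0 \<le> A s x" unfolding A_def using g by simp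
      have "A s x \<le> (\<integral>z. B \<partial>unif Q)"
        unfolding A_def using g by (intro integral_mono iA) auto
      then show "A s x \<le> B" using uQ by simp
    qed
    have H: "0 \<le> H s x" "H s x \<le> B powr P" for s x
    proof -
      show "0 \<le> H s x" unfolding H_def by simp
      have "H s x \<le> (\<integral>z. B powr P \<partial>unif Q)"
        unfolding H_def using g P by (intro integral_mono iH) (auto intro!: powr_mono2)
      then show "H s x \<le> B powr P" using uQ by simp
    qed
    have AH: "A s x powr P \<le> H s x" for s x
      unfolding A_def H_def using g P uQ by (intro MQ.integral_powr_le[where B = B]) auto
    have Am[measurable]: "(\<lambda>s. A s x) \<in> borel_measurable borel" for x
      unfolding A_def by measurable
    have Hm[measurable]: "(\<lambda>s. H s x) \<in> borel_measurable borel" for x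
      unfolding H_def by measurable
    have Hnn: "ennreal (H s x) = (\<integral>\<^sup>+z. ennreal (g (x + s ^ m *\<^sub>R z) powr P) \<partial>unif Q)" for s x
      unfolding H_def by (rule nn_integral_eq_integral[symmetric, OF iH]) simp
    \<comment> \<open>Enlarging the cube to the whole space and substituting
      \<open>x + s ^ m *\<^sub>R z\<close> costs the Jacobian, a negative power of
      \<open>s\<close>.\<close>
    have HI: "H s x \<le> I / (s ^ m) ^ DIM('a)" if s: "s > 0" for s x
    proof -
      have "ennreal (H s x) = (\<integral>\<^sup>+z. ennreal (g (x + s ^ m *\<^sub>R z) powr P) * indicator Q z \<partial>lborel)"
        unfolding Hnn by (rule nn_integral_unif[OF Qb(1)]) measurable
      also have "\<dots> \<le> (\<integral>\<^sup>+z. ennreal (g (x + s ^ m *\<^sub>R z) powr P) \<partial>lborel)"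
        by (intro nn_integral_mono) (auto simp: indicator_def)
      also have "\<dots> = ennreal (1 / (s ^ m) ^ DIM('a)) * ennreal I"
        using s by (subst nn_integral_lborel_affine) (simp_all add: Inn)
      also have "\<dots> = ennreal (I / (s ^ m) ^ DIM('a))"
        using s \<open>I \<ge> 0\<close> by (simp flip: ennreal_mult)
      finally show ?thesis
        using s \<open>I \<ge> 0\<close> by simp
    qed
    have step1: "\<bar>\<phi> x\<bar> \<le> real m * D * (\<integral>s. s ^ (m - 1) * A s x \<partial>unif {0..1})" if x: "x \<in> \<Omega>" for x
    proof -
      have "ennreal \<bar>\<phi> x\<bar> = (\<integral>\<^sup>+z. ennreal \<bar>\<phi> x\<bar> \<partial>unif Q)"
        using uQ by simp
      also have "\<dots> \<le> (\<integral>\<^sup>+z. (\<integral>\<^sup>+s. ennreal (real m * D * s ^ (m - 1) * g (x + s ^ m *\<^sub>R z)) \<partial>unif {0..1}) \<partial>unif Q)"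
      proof (rule nn_integral_mono_AE, use AE_unif[OF Qb(1)] in eventually_elim)
        fix z assume z: "z \<in> Q"
        then have "\<phi> (x + z) = 0"
          using outside[OF x z] test_function_zero_outside[OF \<phi>] by blast
        then have "ennreal \<bar>\<phi> x\<bar> \<le> (\<integral>\<^sup>+s. ennreal (real m * s ^ (m - 1) * norm z * norm (grad \<phi> (x + s ^ m *\<^sub>R z))) \<partial>unif {0..1})"
          using test_function_path_nn[OF \<phi> m(1), of x z] by simp
        also have "\<dots> \<le> (\<integral>\<^sup>+s. ennreal (real m * D * s ^ (m - 1) * g (x + s ^ m *\<^sub>R z)) \<partial>unif {0..1})"
        proof (rule nn_integral_mono_AE, use ae1 in eventually_elim)
          fix s :: real assume "s \<in> {0..1}"
          then have "real m * s ^ (m - 1) * norm z * g (x + s ^ m *\<^sub>R z) \<le> real m * s ^ (m - 1) * D * g (x + s ^ m *\<^sub>R z)"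
            using D(2)[OF z] g by (intro mult_right_mono mult_left_mono) auto
          then show "ennreal (real m * s ^ (m - 1) * norm z * norm (grad \<phi> (x + s ^ m *\<^sub>R z))) \<le> ennreal (real m * D * s ^ (m - 1) * g (x + s ^ m *\<^sub>R z))"
            by (intro ennreal_leI) (simp add: g_def mult_ac)
        qed
        finally show "ennreal \<bar>\<phi> x\<bar> \<le> (\<integral>\<^sup>+s. ennreal (real m * D * s ^ (m - 1) * g (x + s ^ m *\<^sub>R z)) \<partial>unif {0..1})" .
      qed
      also have "\<dots> = (\<integral>\<^sup>+s. (\<integral>\<^sup>+z. ennreal (real m * D * s ^ (m - 1) * g (x + s ^ m *\<^sub>R z)) \<partial>unif Q) \<partial>unif {0..1})"
        by (subst P1Q.Fubini') measurable
      also have "\<dots> = (\<integral>\<^sup>+s. ennreal (real m * D * (s ^ (m - 1) * A s x)) \<partial>unif {0..1})"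
      proof (rule nn_integral_cong_AE, use ae1 in eventually_elim)
        fix s :: real assume s: "s \<in> {0..1}"
        have "(\<integral>\<^sup>+z. ennreal (real m * D * s ^ (m - 1) * g (x + s ^ m *\<^sub>R z)) \<partial>unif Q) = ennreal (\<integral>z. real m * D * s ^ (m - 1) * g (x + s ^ m *\<^sub>R z) \<partial>unif Q)"
          using s D g by (intro nn_integral_eq_integral integrable_mult_right iA) auto
        then show "(\<integral>\<^sup>+z. ennreal (real m * D * s ^ (m - 1) * g (x + s ^ m *\<^sub>R z)) \<partial>unif Q) = ennreal (real m * D * (s ^ (m - 1) * A s x))"
          by (simp add: A_def mult.assoc)
      qed
      also have "\<dots> = ennreal (\<integral>s. real m * D * (s ^ (m - 1) * A s x) \<partial>unif {0..1})"
      proof (rule nn_integral_eq_integral)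
        have "AE s in unif {0..1}. norm (real m * D * (s ^ (m - 1) * A s x)) \<le> real m * D * (1 * B)"
        proof (use ae1 in eventually_elim)
          fix s :: real assume s: "s \<in> {0..1}"
          then have "s ^ (m - 1) * A s x \<le> 1 * B"
            using A by (intro mult_mono power_le_one) auto
          then show "norm (real m * D * (s ^ (m - 1) * A s x)) \<le> real m * D * (1 * B)"
            using s A[of s x] D mult_left_mono[of "s ^ (m - 1) * A s x" "1 * B" "real m * D"] by (simp add: abs_mult)
        qed
        then show "integrable (unif {0..1}) (\<lambda>s. real m * D * (s ^ (m - 1) * A s x))"
          by (rule M1.integrable_const_bound) measurable
        show "AE s in unif {0..1}. 0 \<le> real m * D * (s ^ (m - 1) * A s x)"
          using ae1 by (rule AE_mp) (use D A in \<open>auto intro!: AE_I2\<close>)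
      qed
      also have "(\<integral>s. real m * D * (s ^ (m - 1) * A s x) \<partial>unif {0..1}) = real m * D * (\<integral>s. s ^ (m - 1) * A s x \<partial>unif {0..1})"
        by simp
      finally show ?thesis
      proof (subst (asm) ennreal_le_iff)
        have "0 \<le> (\<integral>s. s ^ (m - 1) * A s x \<partial>unif {0..1})"
          by (rule integral_nonneg_AE, rule AE_mp[OF ae1]) (use A in \<open>auto intro!: AE_I2\<close>)
        then show "0 \<le> real m * D * (\<integral>s. s ^ (m - 1) * A s x \<partial>unif {0..1})"
          using D by simp
      qed
    qed
    \<comment> \<open>Only the factor \<open>H powr (q / P - 1)\<close> is estimated by the singular
      bound. The remaining factor \<open>H\<close> is kept, because its integral over
      \<open>x\<close> is \<open>I\<close> for every \<open>s\<close>.\<close>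
    have kH: "(s ^ (m - 1) * A s x) powr q \<le> I powr (q / P - 1) * H s x" if s: "0 < s" "s \<le> 1" for s x
    proof -
      have qP: "q / P - 1 \<ge> 0" "q / P \<ge> 1"
        using P by (auto simp: field_simps)
      have "A s x powr q = (A s x powr P) powr (q / P)"
        using P by (simp add: powr_powr)
      also have "\<dots> \<le> H s x powr (q / P)"
        using AH qP by (intro powr_mono2) auto
      also have "\<dots> = H s x powr (q / P - 1) * H s x"
        using H(1)[of s x] by (cases "H s x = 0") (auto simp: powr_diff)
      also have "\<dots> \<le> (I / (s ^ m) ^ DIM('a)) powr (q / P - 1) * H s x"
        using H HI[OF s(1)] qP by (intro mult_right_mono powr_mono2) auto
      also have "(I / (s ^ m) ^ DIM('a)) = I * s powr (- (real m * N))"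
        using s by (simp add: N_def powr_minus powr_realpow[symmetric] power_mult[symmetric] divide_inverse powr_powr)
      also have "(I * s powr (- (real m * N))) powr (q / P - 1) = I powr (q / P - 1) * s powr (- (real m * N) * (q / P - 1))"
        using \<open>I \<ge> 0\<close> by (simp add: powr_mult powr_powr)
      finally have Aq: "A s x powr q \<le> I powr (q / P - 1) * s powr (- (real m * N) * (q / P - 1)) * H s x" .
      have "s ^ (m - 1) = s powr (real m - 1)"
        using s m by (simp add: powr_realpow[symmetric] of_nat_diff)
      then have "(s ^ (m - 1) * A s x) powr q = s powr ((real m - 1) * q) * A s x powr q"
        using A by (simp add: powr_mult powr_powr)
      also have "\<dots> \<le> s powr ((real m - 1) * q) * (I powr (q / P - 1) * s powr (- (real m * N) * (q / P - 1)) * H s x)"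
        using Aq by (intro mult_left_mono) auto
      also have "\<dots> = s powr ((real m - 1) * q + (- (real m * N) * (q / P - 1))) * (I powr (q / P - 1) * H s x)"
        by (simp only: powr_add mult_ac)
      also have "\<dots> \<le> 1 * (I powr (q / P - 1) * H s x)"
      proof (rule mult_right_mono)
        have "(real m - 1) * q + (- (real m * N) * (q / P - 1)) = real m * \<delta> - q"
          by (simp add: \<delta>_def algebra_simps)
        then show "s powr ((real m - 1) * q + (- (real m * N) * (q / P - 1))) \<le> 1"
          using m\<delta> s by (simp add: powr_le1)
      qed (use H in auto)
      finally show ?thesis by simp
    qed
    have iH1: "integrable (unif {0..1}) (\<lambda>s. H s x)" for x
      using H by (intro M1.integrable_const_bound[where B = "B powr P"]) auto
    have ev01: "AE s in unif {0..1::real}. 0 < s \<and> s \<le> 1"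
    proof -
      have "AE s in lborel. s \<in> {0..1::real} \<longrightarrow> 0 < s \<and> s \<le> 1"
        using AE_lborel_singleton[of "0::real"] by eventually_elim auto
      then show ?thesis
        unfolding unif_def by (subst AE_density) (auto simp: indicator_def elim!: eventually_mono)
    qed
    have step2: "\<bar>\<phi> x\<bar> powr q \<le> C * I powr (q / P - 1) * (\<integral>s. H s x \<partial>unif {0..1})" if x: "x \<in> \<Omega>" for x
    proof -
      have k0: "AE s in unif {0..1}. 0 \<le> s ^ (m - 1) * A s x \<and> s ^ (m - 1) * A s x \<le> B"
      proof (use ev01 in eventually_elim)
        fix s :: real assume s: "0 < s \<and> s \<le> 1"
        have "s ^ (m - 1) * A s x \<le> 1 * B"
          using A s by (intro mult_mono power_le_one) auto
        then show "0 \<le> s ^ (m - 1) * A s x \<and> s ^ (m - 1) * A s x \<le> B"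
          using s A by simp
      qed
      have nn: "0 \<le> (\<integral>s. s ^ (m - 1) * A s x \<partial>unif {0..1})"
        using k0 by (intro integral_nonneg_AE) auto
      have "\<bar>\<phi> x\<bar> powr q \<le> (real m * D * (\<integral>s. s ^ (m - 1) * A s x \<partial>unif {0..1})) powr q"
        using step1[OF x] P by (intro powr_mono2) auto
      also have "\<dots> = C * (\<integral>s. s ^ (m - 1) * A s x \<partial>unif {0..1}) powr q"
        using D nn by (simp add: C_def powr_mult)
      also have "\<dots> \<le> C * (\<integral>s. (s ^ (m - 1) * A s x) powr q \<partial>unif {0..1})"
        using P \<open>C > 0\<close> k0 u1 by (intro mult_left_mono M1.integral_powr_le[where B = B]) auto
      also have "\<dots> \<le> C * (\<integral>s. I powr (q / P - 1) * H s x \<partial>unif {0..1})"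
      proof (intro mult_left_mono integral_mono_AE)
        show "integrable (unif {0..1}) (\<lambda>s. (s ^ (m - 1) * A s x) powr q)"
        proof (rule M1.integrable_const_bound[where B = "B powr q"])
          show "AE s in unif {0..1}. norm ((s ^ (m - 1) * A s x) powr q) \<le> B powr q"
            by (rule AE_mp[OF k0]) (use P in \<open>auto intro!: AE_I2 powr_mono2\<close>)
        qed measurable
        show "AE s in unif {0..1}. (s ^ (m - 1) * A s x) powr q \<le> I powr (q / P - 1) * H s x"
        proof (use ev01 in eventually_elim)
          fix s :: real assume "0 < s \<and> s \<le> 1"
          then show "(s ^ (m - 1) * A s x) powr q \<le> I powr (q / P - 1) * H s x"
            using kH[of s x] by blast
        qed
      qed (use \<open>C > 0\<close> iH1 in auto)
      finally show ?thesis by simp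
    qed
    have "(\<integral>\<^sup>+x. ennreal (\<bar>\<phi> x\<bar> powr q) \<partial>lborel) \<le>
        (\<integral>\<^sup>+x. ennreal (C * I powr (q / P - 1)) * (\<integral>\<^sup>+s. (\<integral>\<^sup>+z. ennreal (g (x + s ^ m *\<^sub>R z) powr P) \<partial>unif Q) \<partial>unif {0..1}) \<partial>lborel)"
    proof (rule nn_integral_mono)
      fix x
      have e: "ennreal (\<integral>s. H s x \<partial>unif {0..1}) = (\<integral>\<^sup>+s. (\<integral>\<^sup>+z. ennreal (g (x + s ^ m *\<^sub>R z) powr P) \<partial>unif Q) \<partial>unif {0..1})"
        unfolding Hnn[symmetric] by (rule nn_integral_eq_integral[symmetric, OF iH1]) (use H in auto)
      show "ennreal (\<bar>\<phi> x\<bar> powr q) \<le> ennreal (C * I powr (q / P - 1)) * (\<integral>\<^sup>+s. (\<integral>\<^sup>+z. ennreal (g (x + s ^ m *\<^sub>R z) powr P) \<partial>unif Q) \<partial>unif {0..1})"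
      proof (cases "x \<in> \<Omega>")
        case True
        then show ?thesis
          unfolding e[symmetric] using step2[OF True] H(1) \<open>C > 0\<close>
          by (subst ennreal_mult[symmetric]) (auto intro!: ennreal_leI)
      next
        case False
        then show ?thesis
          using test_function_zero_outside[OF \<phi> False] by simp
      qed
    qed
    also have "\<dots> = ennreal (C * I powr (q / P - 1)) * (\<integral>\<^sup>+x. (\<integral>\<^sup>+s. (\<integral>\<^sup>+z. ennreal (g (x + s ^ m *\<^sub>R z) powr P) \<partial>unif Q) \<partial>unif {0..1}) \<partial>lborel)"
      by (rule nn_integral_cmult) measurable
    \<comment> \<open>Fubini: for fixed \<open>s\<close> and \<open>z\<close> the integrand in
      \<open>x\<close> is a translate with integral \<open>I\<close>, and the two averages have
      total mass one.\<close>
    also have "(\<integral>\<^sup>+x. (\<integral>\<^sup>+s. (\<integral>\<^sup>+z. ennreal (g (x + s ^ m *\<^sub>R z) powr P) \<partial>unif Q) \<partial>unif {0..1}) \<partial>lborel)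
        = (\<integral>\<^sup>+s. (\<integral>\<^sup>+x. (\<integral>\<^sup>+z. ennreal (g (x + s ^ m *\<^sub>R z) powr P) \<partial>unif Q) \<partial>lborel) \<partial>unif {0..1})"
      by (rule PL1.Fubini'[symmetric]) measurable
    also have "\<dots> = (\<integral>\<^sup>+s. (\<integral>\<^sup>+z. (\<integral>\<^sup>+x. ennreal (g (x + s ^ m *\<^sub>R z) powr P) \<partial>lborel) \<partial>unif Q) \<partial>unif {0..1})"
      by (intro nn_integral_cong PLQ.Fubini'[symmetric]) measurable
    also have "\<dots> = (\<integral>\<^sup>+s. (\<integral>\<^sup>+z. ennreal I \<partial>unif Q) \<partial>unif {0..1::real})"
    proof (intro nn_integral_cong)
      fix s :: real and z
      have "(\<integral>\<^sup>+x. ennreal (g (s ^ m *\<^sub>R z + x) powr P) \<partial>lborel) = (\<integral>\<^sup>+x. ennreal (g x powr P) \<partial>lborel)"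
        by (rule nn_integral_lborel_shift) measurable
      then show "(\<integral>\<^sup>+x. ennreal (g (x + s ^ m *\<^sub>R z) powr P) \<partial>lborel) = ennreal I"
        by (simp add: add.commute Inn)
    qed
    also have "\<dots> = ennreal I"
      using u1 uQ by simp
    also have "ennreal (C * I powr (q / P - 1)) * ennreal I = ennreal (C * (I powr (q / P - 1) * I))"
      using \<open>C > 0\<close> \<open>I \<ge> 0\<close> by (subst ennreal_mult[symmetric]) (auto simp: mult.assoc)
    also have "I powr (q / P - 1) * I = I powr (q / P)"
      using \<open>I \<ge> 0\<close> by (cases "I = 0") (auto simp: powr_diff)
    finally show ?thesis
      by (simp add: I_def g_def)
  qed
  then show thesis
    using that \<open>C > 0\<close> by blast
qed


text \<open>Averages over cubes of side \<open>\<tau> k\<close> are, for fixed \<open>k\<close>,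
  bounded and equi-Lipschitz in \<open>n\<close>, and their L^1 distance to \<open>\<phi> n\<close>
  is of order \<open>\<tau> k\<close> uniformly in \<open>n\<close>. A diagonal subsequence makes
  all of them converge pointwise, and dominated convergence on a common ball makes them converge in
  L^1.\<close>

lemma rellich_test_functions:
  fixes \<phi> :: "nat \<Rightarrow> 'a::euclidean_space \<Rightarrow> real"
  assumes \<Omega>: "bounded \<Omega>" and \<phi>: "\<And>n. \<phi> n \<in> test_functions \<Omega>"
    and K: "\<And>n. (LINT x|lborel. norm (grad (\<phi> n) x)) \<le> K"
  obtains r :: "nat \<Rightarrow> nat" where "strict_mono r"
    "\<And>e. e > 0 \<Longrightarrow> \<exists>M. \<forall>i\<ge>M. \<forall>j\<ge>M. (LINT x|lborel. \<bar>\<phi> (r i) x - \<phi> (r j) x\<bar>) < e"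
proof -
  note [measurable] = test_function_measurable[OF \<phi>]
  have "K \<ge> 0"
    using K[of 0] by (rule order_trans[rotated]) simp
  have Kn: "(\<integral>\<^sup>+x. ennreal (norm (grad (\<phi> n) x)) \<partial>lborel) \<le> ennreal K" for n
  proof -
    have "integrable lborel (\<lambda>x. norm (grad (\<phi> n) x))"
      using test_function_grad_powr_integrable[OF \<phi>, of 1] by simp
    then show ?thesis
      using K[of n] by (simp add: nn_integral_eq_integral ennreal_leI)
  qed
  define \<tau> where "\<tau> k = 1 / real (Suc k)" for k
  have \<tau>: "0 < \<tau> k" "\<tau> k \<le> 1" for k
    by (auto simp: \<tau>_def)
  have \<tau>0: "\<tau> \<longlonglongrightarrow> 0"
    unfolding \<tau>_def using LIMSEQ_Suc[OF lim_1_over_n] by simp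
  define Q :: "'a set" where "Q = cbox 0 (0 + One)"
  have Qb: "Q \<in> sets borel" "emeasure lborel Q = 1"
    unfolding Q_def by (simp, rule emeasure_unit_cube)
  obtain D where D: "D > 0" "\<And>z. z \<in> Q \<Longrightarrow> norm z \<le> D"
    using bounded_cbox[of "0::'a" "0 + One"] by (auto simp: bounded_pos Q_def)
  interpret MQ: finite_measure "unif Q"
    by (rule finite_measure_unif[OF Qb])
  interpret PLQ: pair_sigma_finite "lborel :: 'a measure" "unif Q" ..
  note uQ = finite_measure_unif(2,3)[OF Qb]
  obtain R where R: "R > 0" "\<And>x. x \<in> \<Omega> \<Longrightarrow> norm x \<le> R"
    using \<Omega> by (auto simp: bounded_pos)
  define A where "A k n x = (\<integral>z. \<phi> n (x + \<tau> k *\<^sub>R z) \<partial>unif Q)" for k n x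
  have iA: "integrable (unif Q) (\<lambda>z. \<phi> n (x + c *\<^sub>R z))" for n x c
  proof -
    obtain B where "\<And>x. \<bar>\<phi> n x\<bar> \<le> B"
      using test_function_bounded[OF \<phi>] by metis
    then show ?thesis
      by (intro MQ.integrable_const_bound[where B = B]) auto
  qed
  have Am[measurable]: "A k n \<in> borel_measurable borel" for k n
    unfolding A_def by measurable
  \<comment> \<open>Enlarging the cube to the whole space and rescaling leaves the L^1 translation
    estimate, with the Jacobian in the denominator.\<close>
  have lip: "\<bar>A k n x - A k n y\<bar> \<le> norm (x - y) * K / \<tau> k ^ DIM('a)" for k n x y
  proof -
    have "A k n x - A k n y = (\<integral>z. \<phi> n (x + \<tau> k *\<^sub>R z) - \<phi> n (y + \<tau> k *\<^sub>R z) \<partial>unif Q)"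
      unfolding A_def by (simp add: iA)
    then have "\<bar>A k n x - A k n y\<bar> \<le> (\<integral>z. \<bar>\<phi> n (x + \<tau> k *\<^sub>R z) - \<phi> n (y + \<tau> k *\<^sub>R z)\<bar> \<partial>unif Q)"
      by (simp add: integral_abs_bound)
    then have "ennreal \<bar>A k n x - A k n y\<bar> \<le> (\<integral>\<^sup>+z. ennreal \<bar>\<phi> n (x + \<tau> k *\<^sub>R z) - \<phi> n (y + \<tau> k *\<^sub>R z)\<bar> \<partial>unif Q)"
      by (subst nn_integral_eq_integral) (auto intro!: ennreal_leI iA)
    also have "\<dots> = (\<integral>\<^sup>+z. ennreal \<bar>\<phi> n (x + \<tau> k *\<^sub>R z) - \<phi> n (y + \<tau> k *\<^sub>R z)\<bar> * indicator Q z \<partial>lborel)"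
      by (rule nn_integral_unif[OF Qb(1)]) measurable
    also have "\<dots> \<le> (\<integral>\<^sup>+z. ennreal \<bar>\<phi> n ((y + \<tau> k *\<^sub>R z) + (x - y)) - \<phi> n (y + \<tau> k *\<^sub>R z)\<bar> \<partial>lborel)"
      by (intro nn_integral_mono) (auto simp: indicator_def algebra_simps)
    also have "\<dots> = ennreal (1 / \<tau> k ^ DIM('a)) * (\<integral>\<^sup>+w. ennreal \<bar>\<phi> n (w + (x - y)) - \<phi> n w\<bar> \<partial>lborel)"
      using \<tau> by (subst nn_integral_lborel_affine[where f = "\<lambda>w. ennreal \<bar>\<phi> n (w + (x - y)) - \<phi> n w\<bar>"]) simp_all
    also have "\<dots> \<le> ennreal (1 / \<tau> k ^ DIM('a)) * (ennreal (norm (x - y)) * ennreal K)"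
      by (intro mult_left_mono order_trans[OF test_function_shift_L1[OF \<phi>]] Kn) auto
    also have "\<dots> = ennreal (norm (x - y) * K / \<tau> k ^ DIM('a))"
      using \<tau>[of k] \<open>K \<ge> 0\<close> by (simp flip: ennreal_mult)
    finally show ?thesis
      using \<tau>[of k] \<open>K \<ge> 0\<close> by (subst (asm) ennreal_le_iff) auto
  qed
  have supp: "A k n x = 0" if "norm x > R + D" for k n x
  proof -
    have "A k n x = (\<integral>z. 0 \<partial>unif Q)"
      unfolding A_def
    proof (rule integral_cong_AE, measurable, use AE_unif[OF Qb(1)] in eventually_elim)
      fix z assume z: "z \<in> Q"
      have "norm (\<tau> k *\<^sub>R z) \<le> 1 * D"
        unfolding norm_scaleR using \<tau>[of k] D(2)[OF z] by (intro mult_mono) auto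
      then have "norm (x + \<tau> k *\<^sub>R z) > R"
        using that norm_triangle_ineq2[of x "- (\<tau> k *\<^sub>R z)"] by simp
      then show "\<phi> n (x + \<tau> k *\<^sub>R z) = 0"
        using R(2) test_function_zero_outside[OF \<phi>] by (metis not_less)
    qed
    then show ?thesis by simp
  qed
  \<comment> \<open>A point \<open>y\<close> of norm \<open>R + D + 1\<close> lies beyond the
    supports of all averages, so the Lipschitz estimate between \<open>x\<close> and
    \<open>y\<close> bounds the value at \<open>x\<close>; their distance is at most
    \<open>2 * (R + D + 1)\<close>.\<close>
  define L where "L = 2 * (R + D + 1) * K"
  have bnd: "\<bar>A k n x\<bar> \<le> L / \<tau> k ^ DIM('a)" for k n x
  proof (cases "norm x > R + D")
    case True
    then show ?thesis
      using supp[OF True] \<tau>[of k] \<open>K \<ge> 0\<close> R D by (simp add: L_def)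
  next
    case False
    obtain e :: 'a where e: "e \<in> Basis"
      using nonempty_Basis by blast
    define y where "y = (R + D + 1) *\<^sub>R e"
    have ny: "norm y = R + D + 1"
      using e R D by (simp add: y_def)
    then have "\<bar>A k n x\<bar> \<le> norm (x - y) * K / \<tau> k ^ DIM('a)"
      using lip[of k n x y] supp[of y k n] by simp
    also have "\<dots> \<le> (2 * (R + D + 1)) * K / \<tau> k ^ DIM('a)"
      using norm_triangle_ineq4[of x y] ny False \<tau>[of k] \<open>K \<ge> 0\<close> by (intro divide_right_mono mult_right_mono) auto
    finally show ?thesis by (simp add: L_def)
  qed
  obtain E :: "'a set" where E: "countable E" "\<And>X. open X \<Longrightarrow> X \<noteq> {} \<Longrightarrow> \<exists>d\<in>E. d \<in> X"
    using countable_dense_setE by metis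
  \<comment> \<open>The factor in front normalises the bound to \<open>L\<close> at every scale, so
    that a single extraction over pairs of a scale and a dense point handles all \<open>k\<close> at
    once.\<close>
  define F where "F n ky = \<tau> (fst ky) ^ DIM('a) * A (fst ky) n (snd ky)" for n and ky :: "nat \<times> 'a"
  have "countable ((UNIV :: nat set) \<times> E)"
    using E(1) by auto
  moreover have "norm (F n ky) \<le> L" for n ky
  proof -
    have "\<bar>\<tau> (fst ky) ^ DIM('a)\<bar> = \<tau> (fst ky) ^ DIM('a)"
      using \<tau>(1)[of "fst ky"] by simp
    then show ?thesis
      using bnd[of "fst ky" n "snd ky"] \<tau>(1)[of "fst ky"] by (simp add: F_def abs_mult field_simps)
  qed
  ultimately obtain r where r: "strict_mono (r :: nat \<Rightarrow> nat)"
    and conv: "\<And>x. x \<in> (UNIV :: nat set) \<times> E \<Longrightarrow> \<exists>l. (\<lambda>n. F (r n) x) \<longlonglongrightarrow> l"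
    using function_convergent_subsequence[of "(UNIV :: nat set) \<times> E" F L] by blast
  have convE: "convergent (\<lambda>n. A k (r n) y)" if "y \<in> E" for k y
  proof -
    obtain l where "(\<lambda>n. \<tau> k ^ DIM('a) * A k (r n) y) \<longlonglongrightarrow> l"
      using conv[of "(k, y)"] \<open>y \<in> E\<close> by (auto simp: F_def)
    from tendsto_divide[OF this tendsto_const, of "\<tau> k ^ DIM('a)"] show ?thesis
      using \<tau>[of k] by (auto simp: convergent_def)
  qed
  have convA: "convergent (\<lambda>n. A k (r n) x)" for k x
  proof (rule Cauchy_convergent, rule metric_CauchyI)
    fix e :: real assume "e > 0"
    \<comment> \<open>Within distance \<open>d\<close> the Lipschitz estimate allows a variation of
      at most \<open>e / 3\<close>; \<open>K + 1\<close> in the denominator covers the case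
      \<open>K = 0\<close>.\<close>
    define d where "d = e * \<tau> k ^ DIM('a) / (3 * (K + 1))"
    have d: "d > 0"
      using \<open>e > 0\<close> \<open>K \<ge> 0\<close> \<tau>[of k] by (simp add: d_def)
    then obtain y where y: "y \<in> E" "y \<in> ball x d"
      using E(2)[of "ball x d"] by auto
    have close: "\<bar>A k n x - A k n y\<bar> \<le> e / 3" for n
    proof -
      have "norm (x - y) * K / \<tau> k ^ DIM('a) \<le> d * (K + 1) / \<tau> k ^ DIM('a)"
        using y(2) \<open>K \<ge> 0\<close> \<tau>[of k] d by (intro divide_right_mono mult_mono) (auto simp: dist_norm)
      also have "\<dots> = e / 3"
      proof -
        have "e * T / (3 * J) * J / T = e / 3" if "J > 0" "T > 0" for J T :: real
          using that by simp
        then show ?thesis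
          unfolding d_def using \<open>K \<ge> 0\<close> \<tau>[of k] by (meson add_nonneg_pos zero_less_one zero_less_power)
      qed
      finally show ?thesis using lip order_trans by blast
    qed
    obtain M where M: "\<And>i j. i \<ge> M \<Longrightarrow> j \<ge> M \<Longrightarrow> dist (A k (r i) y) (A k (r j) y) < e / 3"
      using convergent_Cauchy[OF convE[OF y(1), of k]] \<open>e > 0\<close> unfolding Cauchy_def
      by (metis divide_pos_pos zero_less_numeral)
    have "dist (A k (r i) x) (A k (r j) x) < e" if "i \<ge> M" "j \<ge> M" for i j
      using M[OF that] close[of "r i"] close[of "r j"] unfolding dist_real_def by linarith
    then show "\<exists>M. \<forall>i\<ge>M. \<forall>j\<ge>M. dist (A k (r i) x) (A k (r j) x) < e"
      by blast
  qed
  define a where "a k x = lim (\<lambda>n. A k (r n) x)" for k x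
  have a: "(\<lambda>n. A k (r n) x) \<longlonglongrightarrow> a k x" for k x
    unfolding a_def using convA convergent_LIMSEQ_iff by blast
  have am[measurable]: "a k \<in> borel_measurable borel" for k
    by (rule borel_measurable_LIMSEQ_real[OF a Am])
  have abnd: "\<bar>a k x\<bar> \<le> L / \<tau> k ^ DIM('a)" for k x
    by (rule tendsto_upperbound[OF tendsto_rabs[OF a]]) (use bnd in auto)
  have asupp: "a k x = 0" if "norm x > R + D" for k x
    using a[of k x] supp[OF that] by (simp add: LIMSEQ_const_iff)
  have int\<phi>: "integrable lborel (\<phi> n)" for n
  proof -
    obtain B where "\<And>x. \<bar>\<phi> n x\<bar> \<le> B"
      using test_function_bounded[OF \<phi>] by metis
    then show ?thesis
      using \<Omega> test_function_zero_outside[OF \<phi>]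
      by (intro integrable_bounded_support[of _ \<Omega> B]) auto
  qed
  have intA: "integrable lborel (A k n)" and inta: "integrable lborel (a k)" for k n
    by (rule integrable_bounded_support[of _ "cball 0 (R + D)" "L / \<tau> k ^ DIM('a)"];
        use supp bnd asupp abnd in auto)+
  \<comment> \<open>The translation estimate is averaged over displacements of length at most
    \<open>\<tau> k * D\<close>.\<close>
  have app: "(LINT x|lborel. \<bar>\<phi> n x - A k n x\<bar>) \<le> \<tau> k * D * K" for k n
  proof -
    have "(\<integral>\<^sup>+x. ennreal \<bar>\<phi> n x - A k n x\<bar> \<partial>lborel) \<le> (\<integral>\<^sup>+x. (\<integral>\<^sup>+z. ennreal \<bar>\<phi> n (x + \<tau> k *\<^sub>R z) - \<phi> n x\<bar> \<partial>unif Q) \<partial>lborel)"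
    proof (rule nn_integral_mono)
      fix x
      have "A k n x - \<phi> n x = (\<integral>z. \<phi> n (x + \<tau> k *\<^sub>R z) - \<phi> n x \<partial>unif Q)"
        unfolding A_def using uQ by (simp add: iA)
      then have "\<bar>\<phi> n x - A k n x\<bar> \<le> (\<integral>z. \<bar>\<phi> n (x + \<tau> k *\<^sub>R z) - \<phi> n x\<bar> \<partial>unif Q)"
        by (simp add: abs_minus_commute[of "\<phi> n x"] integral_abs_bound)
      then show "ennreal \<bar>\<phi> n x - A k n x\<bar> \<le> (\<integral>\<^sup>+z. ennreal \<bar>\<phi> n (x + \<tau> k *\<^sub>R z) - \<phi> n x\<bar> \<partial>unif Q)"
        by (subst nn_integral_eq_integral) (auto intro!: ennreal_leI iA)
    qed
    also have "\<dots> = (\<integral>\<^sup>+z. (\<integral>\<^sup>+x. ennreal \<bar>\<phi> n (x + \<tau> k *\<^sub>R z) - \<phi> n x\<bar> \<partial>lborel) \<partial>unif Q)"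
      by (rule PLQ.Fubini'[symmetric]) measurable
    also have "\<dots> \<le> (\<integral>\<^sup>+z. ennreal (\<tau> k * D * K) \<partial>unif Q)"
    proof (rule nn_integral_mono_AE, use AE_unif[OF Qb(1)] in eventually_elim)
      fix z assume z: "z \<in> Q"
      have "(\<integral>\<^sup>+x. ennreal \<bar>\<phi> n (x + \<tau> k *\<^sub>R z) - \<phi> n x\<bar> \<partial>lborel) \<le> ennreal (norm (\<tau> k *\<^sub>R z)) * ennreal K"
        by (intro order_trans[OF test_function_shift_L1[OF \<phi>]] mult_left_mono Kn) auto
      also have "\<dots> = ennreal (\<tau> k * norm z * K)"
        using \<tau>[of k] \<open>K \<ge> 0\<close> by (simp add: ennreal_mult)
      also have "\<dots> \<le> ennreal (\<tau> k * D * K)"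
        using \<tau>[of k] \<open>K \<ge> 0\<close> D(2)[OF z] by (intro ennreal_leI mult_right_mono mult_left_mono) auto
      finally show "(\<integral>\<^sup>+x. ennreal \<bar>\<phi> n (x + \<tau> k *\<^sub>R z) - \<phi> n x\<bar> \<partial>lborel) \<le> ennreal (\<tau> k * D * K)" .
    qed
    also have "\<dots> = ennreal (\<tau> k * D * K)"
      using uQ by simp
    finally show ?thesis
      using \<tau>[of k] \<open>K \<ge> 0\<close> D int\<phi>[of n] intA[of k n]
      by (subst (asm) nn_integral_eq_integral) (auto simp: integral_nonneg_AE)
  qed
  have lim: "(\<lambda>n. LINT x|lborel. \<bar>A k (r n) x - a k x\<bar>) \<longlonglongrightarrow> 0" for k
  proof -
    have "(\<lambda>n. LINT x|lborel. \<bar>A k (r n) x - a k x\<bar>) \<longlonglongrightarrow> (LINT x|(lborel :: 'a measure). 0)"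
    proof (rule integral_dominated_convergence[where w = "\<lambda>x. indicator (cball 0 (R + D)) x *\<^sub>R (2 * (L / \<tau> k ^ DIM('a)))"])
      show "integrable lborel (\<lambda>x::'a. indicator (cball 0 (R + D)) x *\<^sub>R (2 * (L / \<tau> k ^ DIM('a))))"
        by (rule integrable_indicator) (use emeasure_bounded_finite[OF bounded_cball] in auto)
      show "AE x in lborel. norm \<bar>A k (r n) x - a k x\<bar> \<le> indicator (cball 0 (R + D)) x *\<^sub>R (2 * (L / \<tau> k ^ DIM('a)))" for n
      proof (rule AE_I2)
        fix x
        show "norm \<bar>A k (r n) x - a k x\<bar> \<le> indicator (cball 0 (R + D)) x *\<^sub>R (2 * (L / \<tau> k ^ DIM('a)))"
        proof (cases "norm x > R + D")
          case True
          then show ?thesis by (simp add: supp asupp)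
        next
          case False
          have "\<bar>A k (r n) x - a k x\<bar> \<le> 2 * (L / \<tau> k ^ DIM('a))"
            using bnd[of k "r n" x] abnd[of k x] by linarith
          then show ?thesis using False by simp
        qed
      qed
      show "AE x in lborel. (\<lambda>n. \<bar>A k (r n) x - a k x\<bar>) \<longlonglongrightarrow> 0"
        using tendsto_rabs_zero[OF LIM_zero[OF a]] by simp
    qed auto
    then show ?thesis by simp
  qed
  have "\<exists>M. \<forall>i\<ge>M. \<forall>j\<ge>M. (LINT x|lborel. \<bar>\<phi> (r i) x - \<phi> (r j) x\<bar>) < e" if "e > 0" for e
  proof -
    have "(\<lambda>k. \<tau> k * D * K) \<longlonglongrightarrow> 0 * D * K"
      by (intro tendsto_intros \<tau>0)
    then have "\<forall>\<^sub>F k in sequentially. \<tau> k * D * K < e / 4"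
      using \<open>e > 0\<close> by (intro order_tendstoD) auto
    then obtain k where k: "\<tau> k * D * K < e / 4"
      by (auto dest: eventually_happens)
    have "\<forall>\<^sub>F n in sequentially. (LINT x|lborel. \<bar>A k (r n) x - a k x\<bar>) < e / 4"
      using \<open>e > 0\<close> by (intro order_tendstoD(2)[OF lim]) auto
    then obtain M where M: "\<And>n. n \<ge> M \<Longrightarrow> (LINT x|lborel. \<bar>A k (r n) x - a k x\<bar>) < e / 4"
      by (auto simp: eventually_sequentially)
    have "(LINT x|lborel. \<bar>\<phi> (r i) x - \<phi> (r j) x\<bar>) < e" if ij: "i \<ge> M" "j \<ge> M" for i j
    proof -
      have "(LINT x|lborel. \<bar>\<phi> (r i) x - \<phi> (r j) x\<bar>) \<le>
          (LINT x|lborel. (\<bar>\<phi> (r i) x - A k (r i) x\<bar> + \<bar>A k (r i) x - a k x\<bar>) + (\<bar>\<phi> (r j) x - A k (r j) x\<bar> + \<bar>A k (r j) x - a k x\<bar>))"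
      proof (rule integral_mono)
        show "integrable lborel (\<lambda>x. \<bar>\<phi> (r i) x - \<phi> (r j) x\<bar>)"
          by (intro integrable_abs Bochner_Integration.integrable_diff int\<phi>)
        show "integrable lborel (\<lambda>x. (\<bar>\<phi> (r i) x - A k (r i) x\<bar> + \<bar>A k (r i) x - a k x\<bar>) + (\<bar>\<phi> (r j) x - A k (r j) x\<bar> + \<bar>A k (r j) x - a k x\<bar>))"
          by (intro integrable_abs Bochner_Integration.integrable_diff Bochner_Integration.integrable_add int\<phi> intA inta)
      qed linarith
      also have "\<dots> = (LINT x|lborel. \<bar>\<phi> (r i) x - A k (r i) x\<bar>) + (LINT x|lborel. \<bar>A k (r i) x - a k x\<bar>)
          + ((LINT x|lborel. \<bar>\<phi> (r j) x - A k (r j) x\<bar>) + (LINT x|lborel. \<bar>A k (r j) x - a k x\<bar>))"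
        using int\<phi> intA inta by simp
      also have "\<dots> < e"
        using app[of "r i" k] app[of "r j" k] M[OF ij(1)] M[OF ij(2)] k by linarith
      finally show ?thesis .
    qed
    then show ?thesis by blast
  qed
  then show thesis
    using that[OF r] by blast
qed

section \<open>Modulars with variable exponent\<close>

lemma ennreal_tendsto_0_iff:
  fixes f :: "'a \<Rightarrow> ennreal"
  shows "(f \<longlongrightarrow> 0) F \<longleftrightarrow> (\<forall>e>0. \<forall>\<^sub>F x in F. f x \<le> ennreal e)"
proof
  assume "(f \<longlongrightarrow> 0) F"
  then have "\<forall>\<^sub>F x in F. f x < ennreal e" if "e > 0" for e
    using that by (intro order_tendstoD) auto
  then show "\<forall>e>0. \<forall>\<^sub>F x in F. f x \<le> ennreal e"
    by (meson eventually_mono less_imp_le)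
next
  assume *: "\<forall>e>0. \<forall>\<^sub>F x in F. f x \<le> ennreal e"
  show "(f \<longlongrightarrow> 0) F"
  proof (rule order_tendstoI)
    fix a :: ennreal assume "0 < a"
    then obtain b where b: "0 < b" "b < a"
      using dense by blast
    then have "b < top"
      using less_le_trans top_greatest by blast
    then have "b = ennreal (enn2real b)" "enn2real b > 0"
      using b(1) by (simp_all add: enn2real_positive_iff)
    then have "\<forall>\<^sub>F x in F. f x \<le> b"
      using * by metis
    then show "\<forall>\<^sub>F x in F. f x < a"
      by (rule eventually_mono) (use b in auto)
  qed auto
qed

lemma nn_integral_fatou_AE:
  assumes [measurable]: "\<And>n. g n \<in> borel_measurable M" and lim: "AE x in M. (\<lambda>n. g n x) \<longlonglongrightarrow> h x"
    and bound: "\<forall>\<^sub>F n in sequentially. (\<integral>\<^sup>+x. g n x \<partial>M) \<le> C"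
  shows "(\<integral>\<^sup>+x. h x \<partial>M) \<le> (C :: ennreal)"
proof -
  have "(\<integral>\<^sup>+x. h x \<partial>M) = (\<integral>\<^sup>+x. liminf (\<lambda>n. g n x) \<partial>M)"
    by (rule nn_integral_cong_AE, rule AE_mp[OF lim]) (auto intro!: AE_I2 lim_imp_Liminf[symmetric])
  also have "\<dots> \<le> liminf (\<lambda>n. \<integral>\<^sup>+x. g n x \<partial>M)"
    by (rule nn_integral_liminf) simp
  also have "\<dots> \<le> limsup (\<lambda>n. \<integral>\<^sup>+x. g n x \<partial>M)"
    by (rule Liminf_le_Limsup) simp
  also have "\<dots> \<le> C"
    by (rule Limsup_bounded[OF bound])
  finally show ?thesis .
qed

text \<open>For \<open>t \<le> \<eta> \<le> 1\<close> the left side is at most \<open>t\<close>;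
  otherwise \<open>t / \<eta> > 1\<close>, and raising the exponent increases its power. The
  constants involve only \<open>\<eta>\<close> and the bound \<open>R\<close>, so the inequality can
  be used pointwise with exponents that vary with x.\<close>

lemma powr_le_interpolate:
  fixes t :: real
  assumes "0 \<le> t" "0 < \<eta>" "\<eta> \<le> 1" "1 \<le> s" "s \<le> r" "r \<le> R"
  shows "t powr s \<le> \<eta> + \<eta> powr (- R) * t powr r"
proof (cases "t \<le> \<eta>")
  case True
  have "t powr s \<le> t powr 1"
    using assms True by (intro powr_mono') auto
  also have "\<dots> \<le> \<eta> + \<eta> powr (- R) * t powr r"
    using True assms by (simp add: add_increasing2)
  finally show ?thesis .
next
  case False
  have "t powr s = \<eta> powr s * (t / \<eta>) powr s"
    using assms by (simp flip: powr_mult)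
  also have "\<dots> \<le> 1 * (t / \<eta>) powr r"
    using assms False by (intro mult_mono powr_le1 powr_mono) auto
  also have "\<dots> = \<eta> powr (- r) * t powr r"
    using assms by (simp add: powr_divide powr_minus field_simps)
  also have "\<dots> \<le> \<eta> powr (- R) * t powr r"
    using assms by (intro mult_right_mono powr_mono') auto
  finally show ?thesis
    using assms by simp
qed

lemma powr_add_le:
  fixes a b :: real
  assumes "0 \<le> a" "0 \<le> b" "0 \<le> r" "r \<le> R"
  shows "(a + b) powr r \<le> 2 powr R * (a powr r + b powr r)"
proof -
  have "(a + b) powr r \<le> (2 * max a b) powr r"
    using assms by (intro powr_mono2) auto
  also have "\<dots> = 2 powr r * max a b powr r"
    using assms by (simp add: powr_mult)
  also have "\<dots> \<le> 2 powr R * (a powr r + b powr r)"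
    using assms by (intro mult_mono powr_mono) (auto simp: max_def)
  finally show ?thesis .
qed

text \<open>Strictness comes from the mean value theorem and a strictly increasing derivative. The
  point \<open>y = 0\<close>, at the edge of the range where the derivative formula is used, is
  computed directly.\<close>

lemma powr_tangent_less:
  fixes y c a :: real
  assumes a: "1 < a" "0 \<le> y" "0 < c" "y \<noteq> c"
  shows "c powr a + a * c powr (a - 1) * (y - c) < y powr a"
proof (cases "y = 0")
  case True
  have "c powr (a - 1) * c = c powr a"
    using a by (simp add: powr_diff)
  then have "c powr a + a * c powr (a - 1) * (y - c) = c powr a * (1 - a)"
    using True by (simp add: algebra_simps)
  also have "\<dots> < 0"
    using a by (simp add: mult_pos_neg)
  finally show ?thesis
    using True by simp
next
  case False
  then have y: "y > 0" using a by simp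
  have der: "((\<lambda>y. y powr a) has_real_derivative a * z powr (a - 1)) (at z)" if "z > 0" for z
    using that by (auto intro!: derivative_eq_intros)
  consider "y < c" | "c < y" using a by linarith
  then show ?thesis
  proof cases
    case 1
    obtain z where z: "y < z" "z < c" "c powr a - y powr a = (c - y) * (a * z powr (a - 1))"
      using MVT2[OF 1, of "\<lambda>y. y powr a" "\<lambda>z. a * z powr (a - 1)"] der y by force
    have "z powr (a - 1) < c powr (a - 1)"
      using z y a by (intro powr_less_mono2) auto
    then have "(c - y) * (a * z powr (a - 1)) < (c - y) * (a * c powr (a - 1))"
      using 1 a by simp
    then show ?thesis
      using z(3) by (simp add: algebra_simps)
  next
    case 2
    obtain z where z: "c < z" "z < y" "y powr a - c powr a = (y - c) * (a * z powr (a - 1))"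
      using MVT2[OF 2, of "\<lambda>y. y powr a" "\<lambda>z. a * z powr (a - 1)"] der a by force
    have "c powr (a - 1) < z powr (a - 1)"
      using z a by (intro powr_less_mono2) auto
    then have "(y - c) * (a * c powr (a - 1)) < (y - c) * (a * z powr (a - 1))"
      using 2 a by simp
    then show ?thesis
      using z(3) by (simp add: algebra_simps)
  qed
qed

section \<open>Uniform convexity of powers of a Euclidean norm\<close>

text \<open>The defect in midpoint convexity of the \<open>r\<close>-th power of the norm: zero for
  equal arguments and positively homogeneous of degree \<open>r\<close>.\<close>

definition gap :: "real \<Rightarrow> 'b::real_normed_vector \<Rightarrow> 'b \<Rightarrow> real" where
  "gap r a b = (norm a powr r + norm b powr r) / 2 - norm ((1/2) *\<^sub>R (a + b)) powr r"

lemma midpoint_powr_le: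
  assumes "1 \<le> r" "0 \<le> s" "0 \<le> (t::real)"
  shows "((s + t) / 2) powr r \<le> (s powr r + t powr r) / 2"
proof -
  define c where "c = (s + t) / 2"
  define X Y where "X = r * c powr (r - 1) * (s - c)" and "Y = r * c powr (r - 1) * (t - c)"
  have "c powr r + X \<le> s powr r" "c powr r + Y \<le> t powr r"
    unfolding X_def Y_def
    using assms by (intro powr_tangent_le; simp add: c_def)+
  moreover have "X + Y = 0"
    by (simp add: X_def Y_def c_def field_simps)
  ultimately have "c powr r * 2 \<le> s powr r + t powr r"
    by (simp add: add_eq_0_iff)
  then show ?thesis
    unfolding c_def[symmetric] by simp
qed

lemma midpoint_powr_less:
  assumes "1 < r" "0 \<le> s" "0 \<le> (t::real)" "s \<noteq> t"
  shows "((s + t) / 2) powr r < (s powr r + t powr r) / 2"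
proof -
  define c where "c = (s + t) / 2"
  define X Y where "X = r * c powr (r - 1) * (s - c)" and "Y = r * c powr (r - 1) * (t - c)"
  have "c powr r + X < s powr r" "c powr r + Y < t powr r"
    unfolding X_def Y_def
    using assms by (intro powr_tangent_less; simp add: c_def)+
  moreover have "X + Y = 0"
    by (simp add: X_def Y_def c_def field_simps)
  ultimately have "c powr r * 2 < s powr r + t powr r"
    by (simp add: add_eq_0_iff)
  then show ?thesis
    unfolding c_def[symmetric] by simp
qed

lemma norm_midpoint_le: "norm ((1/2) *\<^sub>R (a + b)) \<le> (norm a + norm b) / 2"
  using norm_triangle_ineq[of a b] by simp

lemma gap_nonneg:
  assumes "1 \<le> r"
  shows "0 \<le> gap r a b"
proof -
  have "norm ((1/2) *\<^sub>R (a + b)) powr r \<le> ((norm a + norm b) / 2) powr r"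
    using assms by (intro powr_mono2 norm_midpoint_le) auto
  also have "\<dots> \<le> (norm a powr r + norm b powr r) / 2"
    using assms by (intro midpoint_powr_le) auto
  finally show ?thesis by (simp add: gap_def)
qed

text \<open>Vectors of different norms are separated by strict convexity of the power. For equal
  norms the parallelogram law makes the midpoint strictly shorter; this is where the inner product
  enters.\<close>

lemma gap_pos:
  fixes a b :: "'b::real_inner"
  assumes "1 < r" "a \<noteq> b"
  shows "0 < gap r a b"
proof (cases "norm a = norm b")
  case False
  have "norm ((1/2) *\<^sub>R (a + b)) powr r \<le> ((norm a + norm b) / 2) powr r"
    using assms by (intro powr_mono2 norm_midpoint_le) auto
  also have "\<dots> < (norm a powr r + norm b powr r) / 2"
    using assms False by (intro midpoint_powr_less) auto
  finally show ?thesis by (simp add: gap_def)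
next
  case True
  have "(norm (a + b))\<^sup>2 + (norm (a - b))\<^sup>2 = 2 * (norm a)\<^sup>2 + 2 * (norm b)\<^sup>2"
    by (simp add: power2_norm_eq_inner inner_add inner_diff inner_commute)
  moreover have "(norm (a - b))\<^sup>2 > 0"
    using assms by simp
  moreover have "(2 * norm a)\<^sup>2 = 2 * (norm a)\<^sup>2 + 2 * (norm b)\<^sup>2"
    using True by (simp add: power_mult_distrib)
  ultimately have "(norm (a + b))\<^sup>2 < (2 * norm a)\<^sup>2"
    by linarith
  then have "norm (a + b) < 2 * norm a"
    by (rule power_less_imp_less_base) simp
  then have "norm ((1/2) *\<^sub>R (a + b)) powr r < norm a powr r"
    using assms by (intro powr_less_mono2) auto
  then show ?thesis
    using True by (simp add: gap_def)
qed

lemma gap_scale: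
  assumes "t \<ge> 0"
  shows "gap r (t *\<^sub>R a) (t *\<^sub>R b) = t powr r * gap r a b"
proof -
  define X where "X = norm ((1/2) *\<^sub>R (a + b))"
  have "(1/2) *\<^sub>R (t *\<^sub>R a + t *\<^sub>R b) = t *\<^sub>R ((1/2) *\<^sub>R (a + b))"
    by (simp add: algebra_simps)
  then have "norm ((1/2) *\<^sub>R (t *\<^sub>R a + t *\<^sub>R b)) = t * X"
    using assms by (simp only: norm_scaleR X_def abs_of_nonneg)
  moreover have "X \<ge> 0"
    by (simp add: X_def)
  ultimately show ?thesis
    using assms unfolding gap_def X_def[symmetric] by (simp add: powr_mult algebra_simps)
qed

text \<open>By homogeneity one may normalise the larger of
  the two norms, and on the resulting compact set the gap is bounded below.\<close>

lemma uniform_convexity: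
  assumes pm: "1 < pm" and \<eta>: "\<eta> > 0"
  obtains \<kappa> where "\<kappa> > 0"
    "\<And>r (a::'b::euclidean_space) b. \<lbrakk>pm \<le> r; r \<le> pp\<rbrakk> \<Longrightarrow>
       norm (a - b) powr r \<le> \<kappa> * gap r a b + \<eta> * (norm a powr r + norm b powr r)"
proof -
  \<comment> \<open>The exponent is a coordinate of the compact set, so the lower bound on the gap
    is uniform in \<open>r\<close> between \<open>pm\<close> and \<open>pp\<close>. The preimage
    condition keeps the set away from pairs of equal vectors.\<close>
  define S :: "(real \<times> 'b \<times> 'b) set" where
    "S = ({pm..pp} \<times> cball 0 1 \<times> cball 0 1) \<inter> (\<lambda>z. norm (fst (snd z) - snd (snd z)) powr fst z) -` {\<eta>..}"
  have c1: "continuous_on ({pm..pp} \<times> cball (0::'b) 1 \<times> cball (0::'b) 1) (\<lambda>z. norm (f (snd z)) powr fst z)"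
    if "continuous_on UNIV f" for f :: "'b \<times> 'b \<Rightarrow> 'b"
    using pm by (intro continuous_on_powr' continuous_intros continuous_on_compose2[OF that]) auto
  have "closed S"
    unfolding S_def
    by (rule continuous_closed_preimage[OF c1]) (auto intro!: continuous_intros closed_Times)
  then have "compact (({pm..pp} \<times> cball 0 1 \<times> cball 0 1) \<inter> S)"
    by (intro compact_Int_closed compact_Times) auto
  moreover have "({pm..pp} \<times> cball 0 1 \<times> cball 0 1) \<inter> S = S"
    by (auto simp: S_def)
  ultimately have "compact S"
    by simp
  have gc: "continuous_on S (\<lambda>z. gap (fst z) (fst (snd z)) (snd (snd z)))"
    unfolding gap_def
    by (intro continuous_intros continuous_on_subset[OF c1[of fst]] continuous_on_subset[OF c1[of snd]]
        continuous_on_subset[OF c1[of "\<lambda>z. (1/2) *\<^sub>R (fst z + snd z)"]]) (auto simp: S_def)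
  obtain \<gamma> where \<gamma>: "\<gamma> > 0" "\<And>z. z \<in> S \<Longrightarrow> \<gamma> \<le> gap (fst z) (fst (snd z)) (snd (snd z))"
  proof (cases "S = {}")
    case False
    then obtain z0 where z0: "z0 \<in> S" "\<And>z. z \<in> S \<Longrightarrow> gap (fst z0) (fst (snd z0)) (snd (snd z0)) \<le> gap (fst z) (fst (snd z)) (snd (snd z))"
      using continuous_attains_inf[OF \<open>compact S\<close> _ gc] by blast
    have "fst (snd z0) \<noteq> snd (snd z0)"
      using z0(1) \<eta> by (auto simp: S_def)
    then have "gap (fst z0) (fst (snd z0)) (snd (snd z0)) > 0"
      using z0(1) pm by (intro gap_pos) (auto simp: S_def)
    then show ?thesis
      using that z0(2) by blast
  qed (use that[of 1] in auto)
  \<comment> \<open>On \<open>S\<close> the left side is at most \<open>2 powr pp\<close>, which is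
    \<open>\<kappa> * \<gamma>\<close>. Off \<open>S\<close> it is below \<open>\<eta>\<close>, and
    the second summand suffices because one of the normalised vectors has norm one.\<close>
  define \<kappa> where "\<kappa> = 2 powr pp / \<gamma>"
  have \<kappa>: "\<kappa> > 0"
    using \<gamma> by (simp add: \<kappa>_def)
  have norm1: "norm (a - b) powr r \<le> \<kappa> * gap r a b + \<eta> * (norm a powr r + norm b powr r)"
    if r: "pm \<le> r" "r \<le> pp" and ab: "norm a \<le> 1" "norm b \<le> 1" "norm a = 1 \<or> norm b = 1" for r and a b :: 'b
  proof (cases "norm (a - b) powr r \<ge> \<eta>")
    case True
    have "norm (a - b) powr r \<le> 2 powr r"
      using norm_triangle_ineq4[of a b] ab r pm by (intro powr_mono2) auto
    also have "\<dots> \<le> 2 powr pp"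
      using r by simp
    also have "\<dots> = \<kappa> * \<gamma>"
      using \<gamma> by (simp add: \<kappa>_def)
    also have "\<dots> \<le> \<kappa> * gap r a b"
      using \<gamma>(2)[of "(r, a, b)"] True ab r \<kappa> by (intro mult_left_mono) (auto simp: S_def)
    also have "\<dots> \<le> \<kappa> * gap r a b + \<eta> * (norm a powr r + norm b powr r)"
      using \<eta> by simp
    finally show ?thesis .
  next
    case False
    have "1 \<le> norm a powr r + norm b powr r"
      using ab(3) by auto
    then have "\<eta> * 1 \<le> \<eta> * (norm a powr r + norm b powr r)"
      using \<eta> by (intro mult_left_mono) auto
    moreover have "0 \<le> \<kappa> * gap r a b"
      using \<kappa> gap_nonneg[of r a b] r pm by simp
    ultimately show ?thesis
      using False by linarith
  qed
  have "norm (a - b) powr r \<le> \<kappa> * gap r a b + \<eta> * (norm a powr r + norm b powr r)"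
    if r: "pm \<le> r" "r \<le> pp" for r and a b :: 'b
  proof (cases "a = 0 \<and> b = 0")
    case True
    then show ?thesis by (simp add: gap_def)
  next
    case False
    define t where "t = max (norm a) (norm b)"
    have t: "t > 0"
      using False by (auto simp: t_def less_max_iff_disj)
    define a' b' where "a' = (1 / t) *\<^sub>R a" and "b' = (1 / t) *\<^sub>R b"
    have ab: "a = t *\<^sub>R a'" "b = t *\<^sub>R b'"
      using t by (auto simp: a'_def b'_def)
    have n: "norm (t *\<^sub>R c) powr r = t powr r * norm c powr r" for c :: 'b
      using t by (simp add: powr_mult)
    have "norm (a' - b') powr r \<le> \<kappa> * gap r a' b' + \<eta> * (norm a' powr r + norm b' powr r)"
      using t by (intro norm1 r) (auto simp: a'_def b'_def t_def max_def field_simps)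
    then have "t powr r * norm (a' - b') powr r \<le> t powr r * (\<kappa> * gap r a' b' + \<eta> * (norm a' powr r + norm b' powr r))"
      by (intro mult_left_mono) auto
    moreover have "a - b = t *\<^sub>R (a' - b')"
      by (simp add: ab scaleR_diff_right)
    ultimately show ?thesis
      unfolding \<open>a - b = _\<close> n ab(1,2)[THEN arg_cong[of _ _ norm]] using t
      by (simp only: ab gap_scale n less_imp_le) (simp add: algebra_simps)
  qed
  then show thesis
    using that \<kappa> by blast
qed

section \<open>Modulars on a finite measure space\<close>

text \<open>An arbitrary finite measure is allowed because the theory is used twice: for Lebesgue
  measure on \<Omega> with the exponent \<open>p\<close>, and for a weighted measure with the
  constant exponent 2.\<close>

locale exponent = finite_measure M for M :: "'a measure" +
  fixes p :: "'a \<Rightarrow> real" and pm pp :: real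
  assumes p_measurable[measurable]: "p \<in> borel_measurable M"
    and pm_gt_1: "1 < pm"
    and p_bounds: "\<And>x. x \<in> space M \<Longrightarrow> pm \<le> p x \<and> p x \<le> pp"
    and pm_le_pp: "pm \<le> pp"
begin

text \<open>With values in \<open>ennreal\<close> the modular makes sense before integrability is
  known; vector values let functions and gradients share all lemmas.\<close>

definition nmod :: "('a \<Rightarrow> 'b::euclidean_space) \<Rightarrow> ennreal" where
  "nmod f = (\<integral>\<^sup>+x. ennreal (norm (f x) powr p x) \<partial>M)"

lemma p_pos: "x \<in> space M \<Longrightarrow> 1 < p x"
  using p_bounds pm_gt_1 by fastforce

lemma nmod_zero[simp]: "nmod (\<lambda>x. 0) = 0"
  by (simp add: nmod_def)

lemma nmod_cong_AE: "AE x in M. f x = g x \<Longrightarrow> nmod f = nmod g"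
  unfolding nmod_def by (rule nn_integral_cong_AE) auto

lemma nmod_add_le:
  assumes [measurable]: "f \<in> borel_measurable M" "g \<in> borel_measurable M"
  shows "nmod (\<lambda>x. f x + g x) \<le> ennreal (2 powr pp) * (nmod f + nmod g)"
proof -
  have "nmod (\<lambda>x. f x + g x) \<le> (\<integral>\<^sup>+x. ennreal (2 powr pp) * (ennreal (norm (f x) powr p x) + ennreal (norm (g x) powr p x)) \<partial>M)"
    unfolding nmod_def
  proof (rule nn_integral_mono)
    fix x assume x: "x \<in> space M"
    have "norm (f x + g x) powr p x \<le> (norm (f x) + norm (g x)) powr p x"
      using p_pos[OF x] by (intro powr_mono2 norm_triangle_ineq) auto
    also have "\<dots> \<le> 2 powr pp * (norm (f x) powr p x + norm (g x) powr p x)"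
      using p_pos[OF x] p_bounds[OF x] by (intro powr_add_le) auto
    finally show "ennreal (norm (f x + g x) powr p x) \<le> ennreal (2 powr pp) * (ennreal (norm (f x) powr p x) + ennreal (norm (g x) powr p x))"
      by (simp add: ennreal_leI flip: ennreal_mult ennreal_plus)
  qed
  also have "\<dots> = ennreal (2 powr pp) * (nmod f + nmod g)"
    by (simp add: nmod_def nn_integral_cmult nn_integral_add)
  finally show ?thesis .
qed

lemma nmod_scale_le:
  assumes [measurable]: "f \<in> borel_measurable M"
  shows "nmod (\<lambda>x. c *\<^sub>R f x) \<le> ennreal (max 1 \<bar>c\<bar> powr pp) * nmod f"
proof -
  have "nmod (\<lambda>x. c *\<^sub>R f x) \<le> (\<integral>\<^sup>+x. ennreal (max 1 \<bar>c\<bar> powr pp) * ennreal (norm (f x) powr p x) \<partial>M)"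
    unfolding nmod_def
  proof (rule nn_integral_mono)
    fix x assume x: "x \<in> space M"
    have "\<bar>c\<bar> powr p x \<le> max 1 \<bar>c\<bar> powr p x"
      using p_pos[OF x] by (intro powr_mono2) auto
    also have "\<dots> \<le> max 1 \<bar>c\<bar> powr pp"
      using p_bounds[OF x] by (intro powr_mono) auto
    finally have "norm (c *\<^sub>R f x) powr p x \<le> max 1 \<bar>c\<bar> powr pp * norm (f x) powr p x"
      by (simp add: powr_mult mult_right_mono)
    then show "ennreal (norm (c *\<^sub>R f x) powr p x) \<le> ennreal (max 1 \<bar>c\<bar> powr pp) * ennreal (norm (f x) powr p x)"
      by (simp add: ennreal_leI flip: ennreal_mult)
  qed
  also have "\<dots> = ennreal (max 1 \<bar>c\<bar> powr pp) * nmod f"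
    by (simp add: nmod_def nn_integral_cmult)
  finally show ?thesis .
qed

lemma nmod_minus_commute: "nmod (\<lambda>x. f x - g x) = nmod (\<lambda>x. g x - f x)"
  by (simp add: nmod_def norm_minus_commute)

lemma nmod_triangle:
  assumes "f \<in> borel_measurable M" "g \<in> borel_measurable M" "h \<in> borel_measurable M"
  shows "nmod (\<lambda>x. f x - h x) \<le> ennreal (2 powr pp) * (nmod (\<lambda>x. f x - g x) + nmod (\<lambda>x. g x - h x))"
  using nmod_add_le[of "\<lambda>x. f x - g x" "\<lambda>x. g x - h x"] assms by simp

lemma nmod_le_if_close:
  assumes "f \<in> borel_measurable M" "g \<in> borel_measurable M"
  shows "nmod f \<le> ennreal (2 powr pp) * (nmod (\<lambda>x. f x - g x) + nmod g)"
  using nmod_add_le[of "\<lambda>x. f x - g x" g] assms by simp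

lemma nmod_finite_iff:
  assumes [measurable]: "f \<in> borel_measurable M"
  shows "nmod f < top \<longleftrightarrow> integrable M (\<lambda>x. norm (f x) powr p x)"
  unfolding nmod_def integrable_iff_bounded by simp

lemmas nmod_finiteD = nmod_finite_iff[THEN iffD1]

lemma nmod_eq_integral:
  assumes "integrable M (\<lambda>x. norm (f x) powr p x)"
  shows "nmod f = ennreal (\<integral>x. norm (f x) powr p x \<partial>M)"
  unfolding nmod_def by (rule nn_integral_eq_integral[OF assms]) simp

text \<open>Interpolation bounds the lower power by \<open>\<eta>\<close> plus a constant times the
  higher power; since the measure is finite, the first part contributes only
  \<open>\<eta> * V\<close>.\<close>

lemma nn_powr_tendsto_0_lower:
  fixes f :: "nat \<Rightarrow> 'a \<Rightarrow> 'b::euclidean_space"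
  assumes [measurable]: "\<And>n. f n \<in> borel_measurable M" "r \<in> borel_measurable M"
    and sr: "\<And>x. x \<in> space M \<Longrightarrow> 1 \<le> s x \<and> s x \<le> r x \<and> r x \<le> R"
    and lim: "(\<lambda>n. \<integral>\<^sup>+x. ennreal (norm (f n x) powr r x) \<partial>M) \<longlonglongrightarrow> 0"
  shows "(\<lambda>n. \<integral>\<^sup>+x. ennreal (norm (f n x) powr s x) \<partial>M) \<longlonglongrightarrow> 0"
  unfolding ennreal_tendsto_0_iff
proof (intro allI impI)
  fix e :: real assume "e > 0"
  define V where "V = measure M (space M)"
  have V: "V \<ge> 0" "emeasure M (space M) = ennreal V"
    by (simp_all add: V_def emeasure_eq_measure)
  define \<eta> where "\<eta> = min 1 (e / (2 * (V + 1)))"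
  have \<eta>: "0 < \<eta>" "\<eta> \<le> 1" "\<eta> * V \<le> e / 2"
  proof -
    show "0 < \<eta>" "\<eta> \<le> 1" using \<open>e > 0\<close> V by (auto simp: \<eta>_def)
    have "\<eta> * V \<le> e / (2 * (V + 1)) * (V + 1)"
      using V \<open>e > 0\<close> by (intro mult_mono) (auto simp: \<eta>_def)
    also have "\<dots> = e / 2" using V by (simp add: field_simps)
    finally show "\<eta> * V \<le> e / 2" .
  qed
  define c where "c = \<eta> powr (- R)"
  have c: "c > 0" using \<eta> by (simp add: c_def)
  have "\<forall>\<^sub>F n in sequentially. (\<integral>\<^sup>+x. ennreal (norm (f n x) powr r x) \<partial>M) \<le> ennreal (e / (2 * c))"
    using lim \<open>e > 0\<close> c unfolding ennreal_tendsto_0_iff by simp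
  then show "\<forall>\<^sub>F n in sequentially. (\<integral>\<^sup>+x. ennreal (norm (f n x) powr s x) \<partial>M) \<le> ennreal e"
  proof eventually_elim
    case (elim n)
    have "(\<integral>\<^sup>+x. ennreal (norm (f n x) powr s x) \<partial>M) \<le> (\<integral>\<^sup>+x. ennreal \<eta> + ennreal c * ennreal (norm (f n x) powr r x) \<partial>M)"
    proof (rule nn_integral_mono)
      fix x assume "x \<in> space M"
      then have "norm (f n x) powr s x \<le> \<eta> + c * norm (f n x) powr r x"
        unfolding c_def using sr \<eta> by (intro powr_le_interpolate) auto
      then show "ennreal (norm (f n x) powr s x) \<le> ennreal \<eta> + ennreal c * ennreal (norm (f n x) powr r x)"
        using \<eta> c by (simp add: ennreal_leI flip: ennreal_mult ennreal_plus)
    qed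
    also have "\<dots> = ennreal (\<eta> * V) + ennreal c * (\<integral>\<^sup>+x. ennreal (norm (f n x) powr r x) \<partial>M)"
      using \<eta> V by (simp add: nn_integral_add nn_integral_cmult ennreal_mult)
    also have "\<dots> \<le> ennreal (e / 2) + ennreal c * ennreal (e / (2 * c))"
      using \<eta> elim by (intro add_mono mult_left_mono ennreal_leI) auto
    also have "\<dots> = ennreal e"
      using c \<open>e > 0\<close> by (simp flip: ennreal_mult ennreal_plus)
    finally show ?case .
  qed
qed

lemma nmod_tendsto_0_imp_L1:
  fixes f :: "nat \<Rightarrow> 'a \<Rightarrow> 'b::euclidean_space"
  assumes "\<And>n. f n \<in> borel_measurable M" "(\<lambda>n. nmod (f n)) \<longlonglongrightarrow> 0"
  shows "(\<lambda>n. \<integral>\<^sup>+x. ennreal (norm (f n x)) \<partial>M) \<longlonglongrightarrow> 0"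
  using nn_powr_tendsto_0_lower[of f p "\<lambda>_. 1" pp] assms p_pos p_bounds
  by (force simp: nmod_def less_imp_le)

lemma nmod_finite_imp_integrable:
  fixes f :: "'a \<Rightarrow> 'b::euclidean_space"
  assumes [measurable]: "f \<in> borel_measurable M" and "nmod f < top"
  shows "integrable M f"
proof (rule Bochner_Integration.integrable_bound)
  show "integrable M (\<lambda>x. 1 + norm (f x) powr p x)"
    by (intro Bochner_Integration.integrable_add integrable_const nmod_finiteD assms)
  show "AE x in M. norm (f x) \<le> norm (1 + norm (f x) powr p x)"
  proof (rule AE_I2)
    fix x assume x: "x \<in> space M"
    show "norm (f x) \<le> norm (1 + norm (f x) powr p x)"
      using powr_le_interpolate[of "norm (f x)" 1 1 "p x" pp] p_pos[OF x] p_bounds[OF x] by simp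
  qed
qed simp

lemma L1_tendsto_imp_AE_subseq:
  fixes f :: "nat \<Rightarrow> 'a \<Rightarrow> 'b::euclidean_space"
  assumes "\<And>n. integrable M (f n)" "integrable M g"
    and "(\<lambda>n. \<integral>\<^sup>+x. ennreal (norm (f n x - g x)) \<partial>M) \<longlonglongrightarrow> 0"
  obtains r where "strict_mono (r :: nat \<Rightarrow> nat)" "AE x in M. (\<lambda>n. f (r n) x) \<longlonglongrightarrow> g x"
proof -
  have i: "integrable M (\<lambda>x. f n x - g x)" for n
    using assms by auto
  have "(\<lambda>n. ennreal (\<integral>x. norm (f n x - g x) \<partial>M)) \<longlonglongrightarrow> ennreal 0"
    using assms(3) i by (simp add: nn_integral_eq_integral integrable_norm)
  then have "(\<lambda>n. \<integral>x. norm (f n x - g x) \<partial>M) \<longlonglongrightarrow> 0"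
    by (subst (asm) tendsto_ennreal_iff) auto
  then obtain r where r: "strict_mono (r :: nat \<Rightarrow> nat)" "AE x in M. (\<lambda>n. f (r n) x - g x) \<longlonglongrightarrow> 0"
    using tendsto_L1_AE_subseq[of M "\<lambda>n x. f n x - g x"] i by auto
  have "AE x in M. (\<lambda>n. f (r n) x) \<longlonglongrightarrow> g x"
    using r(2) by eventually_elim (simp add: LIM_zero_iff)
  then show thesis
    using that r(1) by blast
qed

text \<open>Riesz-Fischer for modulars: a modular Cauchy sequence is Cauchy in L^1 and so converges
  almost everywhere along a subsequence; Fatou's lemma turns the Cauchy condition into modular
  convergence to that limit.\<close>

lemma nmod_complete:
  fixes f :: "nat \<Rightarrow> 'a \<Rightarrow> 'b::euclidean_space"
  assumes [measurable]: "\<And>n. f n \<in> borel_measurable M" and fin: "\<And>n. nmod (f n) < top"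
    and cauchy: "\<And>e. e > 0 \<Longrightarrow> \<exists>N. \<forall>i\<ge>N. \<forall>j\<ge>N. nmod (\<lambda>x. f i x - f j x) \<le> ennreal e"
  obtains g where "g \<in> borel_measurable M" "(\<lambda>n. nmod (\<lambda>x. f n x - g x)) \<longlonglongrightarrow> 0" "nmod g < top"
proof -
  have int: "integrable M (f n)" for n
    by (intro nmod_finite_imp_integrable fin assms(1))
  have "\<exists>N. \<forall>i\<ge>N. \<forall>j\<ge>N. (\<integral>x. norm (f i x - f j x) \<partial>M) < e" if "e > 0" for e
  proof (rule ccontr)
    assume "\<not> ?thesis"
    \<comment> \<open>Modular and L^1 convergence have been compared for sequences tending to zero,
      so a failure of the Cauchy condition in L^1 is packed into a sequence of index pairs.\<close>
    then have "\<exists>i j. i \<ge> N \<and> j \<ge> N \<and> e \<le> (\<integral>x. norm (f i x - f j x) \<partial>M)" for N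
      by (meson not_less)
    then obtain I J where IJ: "\<And>N. I N \<ge> N" "\<And>N. J N \<ge> N" "\<And>N. e \<le> (\<integral>x. norm (f (I N) x - f (J N) x) \<partial>M)"
      by metis
    have "(\<lambda>N. nmod (\<lambda>x. f (I N) x - f (J N) x)) \<longlonglongrightarrow> 0"
      unfolding ennreal_tendsto_0_iff
    proof (intro allI impI)
      fix d :: real assume "d > 0"
      then obtain N where N: "\<And>i j. i \<ge> N \<Longrightarrow> j \<ge> N \<Longrightarrow> nmod (\<lambda>x. f i x - f j x) \<le> ennreal d"
        using cauchy by blast
      show "\<forall>\<^sub>F N in sequentially. nmod (\<lambda>x. f (I N) x - f (J N) x) \<le> ennreal d"
      proof (rule eventually_sequentiallyI[of N])
        fix n assume "N \<le> n"
        then show "nmod (\<lambda>x. f (I n) x - f (J n) x) \<le> ennreal d"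
          using IJ(1)[of n] IJ(2)[of n] by (intro N) auto
      qed
    qed
    then have "(\<lambda>N. \<integral>\<^sup>+x. ennreal (norm (f (I N) x - f (J N) x)) \<partial>M) \<longlonglongrightarrow> 0"
      by (intro nmod_tendsto_0_imp_L1) auto
    then have "\<forall>\<^sub>F N in sequentially. (\<integral>\<^sup>+x. ennreal (norm (f (I N) x - f (J N) x)) \<partial>M) \<le> ennreal (e / 2)"
      using \<open>e > 0\<close> unfolding ennreal_tendsto_0_iff by simp
    then obtain N where "(\<integral>\<^sup>+x. ennreal (norm (f (I N) x - f (J N) x)) \<partial>M) \<le> ennreal (e / 2)"
      by (auto simp: eventually_sequentially)
    then have "(\<integral>x. norm (f (I N) x - f (J N) x) \<partial>M) \<le> e / 2"
      using \<open>e > 0\<close> int by (subst (asm) nn_integral_eq_integral) (auto intro!: integrable_norm)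
    then show False
      using IJ(3)[of N] \<open>e > 0\<close> by simp
  qed
  then obtain r where r: "strict_mono r" "AE x in M. Cauchy (\<lambda>i. f (r i) x)"
    using cauchy_L1_AE_cauchy_subseq[of M f] int by blast
  define g where "g x = lim (\<lambda>i. f (r i) x)" for x
  have gm[measurable]: "g \<in> borel_measurable M"
    unfolding g_def by measurable
  have lim: "AE x in M. (\<lambda>i. f (r i) x) \<longlonglongrightarrow> g x"
    using r(2) by eventually_elim (simp add: g_def Cauchy_convergent_iff convergent_LIMSEQ_iff)
  have limp: "(\<lambda>n. ennreal (norm (f i x - f (r n) x) powr p x)) \<longlonglongrightarrow> ennreal (norm (f i x - g x) powr p x)"
    if "(\<lambda>i. f (r i) x) \<longlonglongrightarrow> g x" "x \<in> space M" for i x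
    using that p_pos[OF that(2)] by (intro tendsto_ennrealI tendsto_powr' tendsto_intros) auto
  have conv: "(\<lambda>n. nmod (\<lambda>x. f n x - g x)) \<longlonglongrightarrow> 0"
    unfolding ennreal_tendsto_0_iff
  proof (intro allI impI)
    fix e :: real assume "e > 0"
    then obtain N where N: "\<And>i j. i \<ge> N \<Longrightarrow> j \<ge> N \<Longrightarrow> nmod (\<lambda>x. f i x - f j x) \<le> ennreal e"
      using cauchy by blast
    have "nmod (\<lambda>x. f i x - g x) \<le> ennreal e" if i: "i \<ge> N" for i
      unfolding nmod_def
    proof (rule nn_integral_fatou_AE)
      show "AE x in M. (\<lambda>n. ennreal (norm (f i x - f (r n) x) powr p x)) \<longlonglongrightarrow> ennreal (norm (f i x - g x) powr p x)"
        using lim AE_space by eventually_elim (rule limp)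
      show "\<forall>\<^sub>F n in sequentially. (\<integral>\<^sup>+x. ennreal (norm (f i x - f (r n) x) powr p x) \<partial>M) \<le> ennreal e"
        using eventually_ge_at_top[of N]
      proof eventually_elim
        case (elim n)
        then show ?case
          using N[OF i, of "r n"] seq_suble[OF r(1), of n] by (simp add: nmod_def)
      qed
    qed measurable
    then show "\<forall>\<^sub>F n in sequentially. nmod (\<lambda>x. f n x - g x) \<le> ennreal e"
      by (rule eventually_sequentiallyI)
  qed
  then have "\<forall>\<^sub>F n in sequentially. nmod (\<lambda>x. f n x - g x) \<le> ennreal 1"
    unfolding ennreal_tendsto_0_iff by (metis zero_less_one)
  then obtain n where n: "nmod (\<lambda>x. f n x - g x) \<le> ennreal 1"
    by (auto simp: eventually_sequentially)
  have "nmod g \<le> ennreal (2 powr pp) * (nmod (\<lambda>x. g x - f n x) + nmod (f n))"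
    by (rule nmod_le_if_close) measurable
  also have "\<dots> < top"
    using n fin[of n] by (simp add: nmod_minus_commute[of g] ennreal_mult_less_top le_less_trans)
  finally show thesis
    using that gm conv by blast
qed

section \<open>The energy: uniform convexity and directional derivatives\<close>

text \<open>The weight \<open>1 / p x\<close> cancels the factor produced by differentiation, so
  that the derivative is the weak form of the p(x)-Laplacian.\<close>

definition energy :: "('a \<Rightarrow> 'b::euclidean_space) \<Rightarrow> real" where
  "energy f = (\<integral>x. norm (f x) powr p x / p x \<partial>M)"

lemma integrable_energy:
  fixes f :: "'a \<Rightarrow> 'b::euclidean_space"
  assumes [measurable]: "f \<in> borel_measurable M" and "nmod f < top"
  shows "integrable M (\<lambda>x. norm (f x) powr p x / p x)"
proof (rule Bochner_Integration.integrable_bound)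
  show "integrable M (\<lambda>x. norm (f x) powr p x)"
    by (intro nmod_finiteD assms)
  show "AE x in M. norm (norm (f x) powr p x / p x) \<le> norm (norm (f x) powr p x)"
  proof (rule AE_I2)
    fix x assume "x \<in> space M"
    then have "1 < p x" by (rule p_pos)
    then have "norm (f x) powr p x * 1 \<le> norm (f x) powr p x * p x"
      by (intro mult_left_mono) auto
    then show "norm (norm (f x) powr p x / p x) \<le> norm (norm (f x) powr p x)"
      using \<open>1 < p x\<close> by (simp add: divide_le_eq)
  qed
qed simp

text \<open>The weight lies between \<open>1 / pp\<close> and \<open>1 / pm\<close>. The quotient of
  these two constants reappears in the admissible range of \<lambda>.\<close>

lemma energy_bounds:
  fixes f :: "'a \<Rightarrow> 'b::euclidean_space"
  assumes m: "f \<in> borel_measurable M" and fin: "nmod f < top"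
  shows "(\<integral>x. norm (f x) powr p x \<partial>M) / pp \<le> energy f" "energy f \<le> (\<integral>x. norm (f x) powr p x \<partial>M) / pm"
    "0 \<le> energy f"
proof -
  have i: "integrable M (\<lambda>x. norm (f x) powr p x)"
    by (intro nmod_finiteD assms)
  have "(\<integral>x. norm (f x) powr p x / pp \<partial>M) \<le> energy f"
    unfolding energy_def using i integrable_energy[OF m fin] p_pos p_bounds pm_gt_1
    by (intro integral_mono divide_left_mono) (auto intro!: mult_pos_pos, force+)
  then show "(\<integral>x. norm (f x) powr p x \<partial>M) / pp \<le> energy f"
    by simp
  have "energy f \<le> (\<integral>x. norm (f x) powr p x / pm \<partial>M)"
    unfolding energy_def using i integrable_energy[OF m fin] p_pos p_bounds pm_gt_1
    by (intro integral_mono divide_left_mono) (auto intro!: mult_pos_pos, force+)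
  then show "energy f \<le> (\<integral>x. norm (f x) powr p x \<partial>M) / pm"
    by simp
  show "0 \<le> energy f"
    unfolding energy_def using p_pos by (intro integral_nonneg_AE AE_I2) (simp add: less_imp_le order.strict_trans[OF zero_less_one])
qed

text \<open>Pointwise uniform convexity, integrated. The pointwise gap is \<open>p x\<close> times
  the defect of the energy density, which accounts for the additional factor
  \<open>pp\<close>.\<close>

lemma energy_midpoint_controls_nmod:
  assumes "\<eta> > 0"
  obtains \<kappa> where "\<kappa> > 0"
    "\<And>f (g :: 'a \<Rightarrow> 'b::euclidean_space). \<lbrakk>f \<in> borel_measurable M; g \<in> borel_measurable M; nmod f < top; nmod g < top\<rbrakk> \<Longrightarrow>
      nmod (\<lambda>x. f x - g x) \<le> ennreal (\<kappa> * ((energy f + energy g) / 2 - energy (\<lambda>x. (1/2) *\<^sub>R (f x + g x)))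
        + \<eta> * ((\<integral>x. norm (f x) powr p x \<partial>M) + (\<integral>x. norm (g x) powr p x \<partial>M)))"
proof -
  obtain \<kappa> where \<kappa>: "\<kappa> > 0"
    "\<And>r (a::'b) b. \<lbrakk>pm \<le> r; r \<le> pp\<rbrakk> \<Longrightarrow> norm (a - b) powr r \<le> \<kappa> * gap r a b + \<eta> * (norm a powr r + norm b powr r)"
    using uniform_convexity[OF pm_gt_1 assms, where pp = pp] by metis
  have "pp > 0" using pm_gt_1 pm_le_pp by simp
  show thesis
  proof
    show "\<kappa> * pp > 0" using \<kappa> \<open>pp > 0\<close> by simp
    fix f g :: "'a \<Rightarrow> 'b"
    assume m[measurable]: "f \<in> borel_measurable M" "g \<in> borel_measurable M" and fin: "nmod f < top" "nmod g < top"
    let ?h = "\<lambda>x. (1/2) *\<^sub>R (f x + g x)"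
    have finh: "nmod ?h < top"
    proof -
      have "nmod (\<lambda>x. f x + g x) < top"
        using nmod_add_le[OF m] fin by (auto simp: ennreal_mult_less_top intro: le_less_trans)
      then show ?thesis
        using nmod_scale_le[of "\<lambda>x. f x + g x" "1/2"] by (auto simp: ennreal_mult_less_top intro: le_less_trans)
    qed
    define E where "E x = (norm (f x) powr p x / p x + norm (g x) powr p x / p x) / 2 - norm (?h x) powr p x / p x" for x
    have iE: "integrable M E"
      unfolding E_def using integrable_energy[of f] integrable_energy[of g] integrable_energy[of ?h] fin finh by auto
    have E: "(\<integral>x. E x \<partial>M) = (energy f + energy g) / 2 - energy ?h"
      unfolding E_def energy_def using integrable_energy[of f] integrable_energy[of g] integrable_energy[of ?h] fin finh by simp
    have i: "integrable M (\<lambda>x. norm (f x) powr p x)" "integrable M (\<lambda>x. norm (g x) powr p x)"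
      by (intro nmod_finiteD m fin)+
    have bound: "norm (f x - g x) powr p x \<le> \<kappa> * pp * E x + \<eta> * (norm (f x) powr p x + norm (g x) powr p x)" if x: "x \<in> space M" for x
    proof -
      have "gap (p x) (f x) (g x) = p x * E x"
        using p_pos[OF x] by (simp add: gap_def E_def field_simps)
      moreover have "E x \<ge> 0"
        using calculation gap_nonneg[of "p x" "f x" "g x"] p_pos[OF x] by (simp add: zero_le_mult_iff)
      ultimately have "\<kappa> * gap (p x) (f x) (g x) \<le> \<kappa> * pp * E x"
        using p_bounds[OF x] \<kappa>(1) by (simp add: mult_right_mono)
      then show ?thesis
        using \<kappa>(2)[of "p x" "f x" "g x"] p_bounds[OF x] by linarith
    qed
    have "nmod (\<lambda>x. f x - g x) \<le> (\<integral>\<^sup>+x. ennreal (\<kappa> * pp * E x + \<eta> * (norm (f x) powr p x + norm (g x) powr p x)) \<partial>M)"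
      unfolding nmod_def by (intro nn_integral_mono ennreal_leI bound)
    also have "\<dots> = ennreal (\<integral>x. \<kappa> * pp * E x + \<eta> * (norm (f x) powr p x + norm (g x) powr p x) \<partial>M)"
    proof (rule nn_integral_eq_integral)
      show "integrable M (\<lambda>x. \<kappa> * pp * E x + \<eta> * (norm (f x) powr p x + norm (g x) powr p x))"
        using i iE by auto
      show "AE x in M. 0 \<le> \<kappa> * pp * E x + \<eta> * (norm (f x) powr p x + norm (g x) powr p x)"
        using bound by (intro AE_I2) (meson order_trans powr_ge_zero)
    qed
    also have "(\<integral>x. \<kappa> * pp * E x + \<eta> * (norm (f x) powr p x + norm (g x) powr p x) \<partial>M)
        = \<kappa> * pp * ((energy f + energy g) / 2 - energy ?h) + \<eta> * ((\<integral>x. norm (f x) powr p x \<partial>M) + (\<integral>x. norm (g x) powr p x \<partial>M))"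
      using i iE E by simp
    finally show "nmod (\<lambda>x. f x - g x) \<le> ennreal (\<kappa> * pp * ((energy f + energy g) / 2 - energy ?h) + \<eta> * ((\<integral>x. norm (f x) powr p x \<partial>M) + (\<integral>x. norm (g x) powr p x \<partial>M)))" .
  qed
qed

text \<open>Here \<open>\<eta>\<close> is fixed against the energy bound, so that the error term is
  at most \<open>e / 2\<close>. This fixes \<open>\<kappa>\<close>, and the vanishing midpoint
  defect takes care of the other half.\<close>

lemma nmod_Cauchy_if_energy_gap_vanishes:
  fixes h :: "nat \<Rightarrow> 'a \<Rightarrow> 'b::euclidean_space"
  assumes m: "\<And>n. h n \<in> borel_measurable M" and fin: "\<And>n. nmod (h n) < top"
    and bound: "\<And>n. energy (h n) \<le> B"
    and gap: "\<And>e. e > 0 \<Longrightarrow> \<exists>N. \<forall>i\<ge>N. \<forall>j\<ge>N. (energy (h i) + energy (h j)) / 2 - energy (\<lambda>x. (1/2) *\<^sub>R (h i x + h j x)) \<le> e"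
    and "e > 0"
  shows "\<exists>N. \<forall>i\<ge>N. \<forall>j\<ge>N. nmod (\<lambda>x. h i x - h j x) \<le> ennreal e"
proof -
  have "pp > 0" using pm_gt_1 pm_le_pp by simp
  have "B \<ge> 0" using energy_bounds(3)[OF m fin] bound order_trans by blast
  have int: "(\<integral>x. norm (h n x) powr p x \<partial>M) \<le> pp * B" for n
  proof -
    have "(\<integral>x. norm (h n x) powr p x \<partial>M) / pp \<le> B"
      using energy_bounds(1)[OF m fin, of n] bound[of n] by simp
    then show ?thesis
      using \<open>pp > 0\<close> by (simp add: divide_le_eq mult.commute)
  qed
  define \<eta> where "\<eta> = e / (4 * (pp * B + 1))"
  have pB: "0 \<le> pp * B" using \<open>pp > 0\<close> \<open>B \<ge> 0\<close> by simp
  have \<eta>: "\<eta> > 0" "\<eta> * (pp * B + pp * B) \<le> e / 2"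
  proof -
    show "\<eta> > 0" using \<open>e > 0\<close> pB by (simp add: \<eta>_def)
    have "\<eta> * (pp * B + pp * B) \<le> \<eta> * (2 * (pp * B + 1))"
      using \<open>\<eta> > 0\<close> by (intro mult_left_mono) auto
    also have "\<dots> = e / 2"
      using pB by (simp add: \<eta>_def field_simps)
    finally show "\<eta> * (pp * B + pp * B) \<le> e / 2" .
  qed
  obtain \<kappa> where \<kappa>: "\<kappa> > 0"
    "\<And>f (g :: 'a \<Rightarrow> 'b). \<lbrakk>f \<in> borel_measurable M; g \<in> borel_measurable M; nmod f < top; nmod g < top\<rbrakk> \<Longrightarrow>
      nmod (\<lambda>x. f x - g x) \<le> ennreal (\<kappa> * ((energy f + energy g) / 2 - energy (\<lambda>x. (1/2) *\<^sub>R (f x + g x)))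
        + \<eta> * ((\<integral>x. norm (f x) powr p x \<partial>M) + (\<integral>x. norm (g x) powr p x \<partial>M)))"
    by (rule energy_midpoint_controls_nmod[OF \<eta>(1)], rule that)
  obtain N where N: "\<And>i j. i \<ge> N \<Longrightarrow> j \<ge> N \<Longrightarrow> (energy (h i) + energy (h j)) / 2 - energy (\<lambda>x. (1/2) *\<^sub>R (h i x + h j x)) \<le> e / (2 * \<kappa>)"
    using gap[of "e / (2 * \<kappa>)"] \<open>e > 0\<close> \<kappa>(1) by auto
  have "nmod (\<lambda>x. h i x - h j x) \<le> ennreal e" if "i \<ge> N" "j \<ge> N" for i j
  proof -
    have "\<kappa> * ((energy (h i) + energy (h j)) / 2 - energy (\<lambda>x. (1/2) *\<^sub>R (h i x + h j x))) \<le> \<kappa> * (e / (2 * \<kappa>))"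
      using N[OF that] \<kappa>(1) by (intro mult_left_mono) auto
    moreover have "\<eta> * ((\<integral>x. norm (h i x) powr p x \<partial>M) + (\<integral>x. norm (h j x) powr p x \<partial>M)) \<le> \<eta> * (pp * B + pp * B)"
      using int \<eta>(1) by (intro mult_left_mono add_mono) auto
    moreover have "\<kappa> * (e / (2 * \<kappa>)) = e / 2"
      using \<kappa>(1) by simp
    ultimately have le: "\<kappa> * ((energy (h i) + energy (h j)) / 2 - energy (\<lambda>x. (1/2) *\<^sub>R (h i x + h j x)))
        + \<eta> * ((\<integral>x. norm (h i x) powr p x \<partial>M) + (\<integral>x. norm (h j x) powr p x \<partial>M)) \<le> e"
      using \<eta>(2) by linarith
    show ?thesis
      by (rule order_trans[OF \<kappa>(2)[OF m m fin fin] ennreal_leI[OF le]])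
  qed
  then show ?thesis by blast
qed


text \<open>The tangent inequality bounds the change of the power by its slope at
  \<open>norm a + norm b\<close>, which dominates both norms because
  \<open>\<bar>t\<bar> \<le> 1\<close>. Division by \<open>t\<close> leaves a majorant independent
  of \<open>t\<close>.\<close>

lemma norm_powr_quotient_bound:
  fixes a b :: "'b::euclidean_space"
  assumes r: "1 < r" "r \<le> R" and t: "\<bar>t\<bar> \<le> 1"
  shows "\<bar>norm (a + t *\<^sub>R b) powr r / r - norm a powr r / r\<bar> \<le> \<bar>t\<bar> * (2 powr R * (norm a powr r + norm b powr r))"
proof -
  have tangent: "x powr r - y powr r \<le> r * (norm a + norm b) powr (r - 1) * (\<bar>t\<bar> * norm b)"
    if "0 \<le> x" "0 \<le> y" "x \<le> norm a + norm b" "\<bar>x - y\<bar> \<le> \<bar>t\<bar> * norm b" for x y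
  proof (cases "x \<le> y")
    case True
    then have "x powr r \<le> y powr r"
      using that r by (intro powr_mono2) auto
    moreover have "0 \<le> r * (norm a + norm b) powr (r - 1) * (\<bar>t\<bar> * norm b)"
      using r by simp
    ultimately show ?thesis by linarith
  next
    case False
    have "x powr r - y powr r \<le> r * x powr (r - 1) * (x - y)"
      using powr_tangent_le[of r y x] r that by (simp add: algebra_simps)
    also have "\<dots> \<le> r * (norm a + norm b) powr (r - 1) * (\<bar>t\<bar> * norm b)"
      using that r False by (intro mult_mono powr_mono2) auto
    finally show ?thesis .
  qed
  have tb: "\<bar>t\<bar> * norm b \<le> norm b"
    using t by (simp add: mult_left_le_one_le)
  have d: "\<bar>norm (a + t *\<^sub>R b) - norm a\<bar> \<le> \<bar>t\<bar> * norm b"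
    using norm_triangle_ineq3[of "a + t *\<^sub>R b" a] by simp
  then have "norm (a + t *\<^sub>R b) \<le> norm a + norm b"
    using tb by linarith
  then have "\<bar>norm (a + t *\<^sub>R b) powr r - norm a powr r\<bar> \<le> r * (norm a + norm b) powr (r - 1) * (\<bar>t\<bar> * norm b)"
    using tangent[of "norm (a + t *\<^sub>R b)" "norm a"] tangent[of "norm a" "norm (a + t *\<^sub>R b)"] d
    by (simp add: abs_le_iff abs_minus_commute)
  note diff = this
  have "\<bar>norm (a + t *\<^sub>R b) powr r / r - norm a powr r / r\<bar> \<le> (r * (norm a + norm b) powr (r - 1) * (\<bar>t\<bar> * norm b)) / r"
  proof -
    have e: "\<bar>u / r - v / r\<bar> = \<bar>u - v\<bar> / r" for u v
      using r by (simp flip: diff_divide_distrib)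
    show ?thesis
      unfolding e using r diff by (intro divide_right_mono) auto
  qed
  also have "\<dots> = \<bar>t\<bar> * ((norm a + norm b) powr (r - 1) * norm b)"
    using r by simp
  also have "\<dots> \<le> \<bar>t\<bar> * ((norm a + norm b) powr (r - 1) * (norm a + norm b))"
    by (intro mult_left_mono) auto
  also have "(norm a + norm b) powr (r - 1) * (norm a + norm b) = (norm a + norm b) powr r"
    by (cases "norm a + norm b = 0") (auto simp: powr_diff)
  also have "\<bar>t\<bar> * (norm a + norm b) powr r \<le> \<bar>t\<bar> * (2 powr R * (norm a powr r + norm b powr r))"
    using r by (intro mult_left_mono powr_add_le) auto
  finally show ?thesis .
qed

text \<open>Away from zero the power is written as \<open>(v \<bullet> v) powr (r / 2)\<close>, a
  power of a quadratic polynomial in \<open>t\<close>. At \<open>a = 0\<close> the quotient is of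
  order \<open>\<bar>h\<bar> powr (r - 1)\<close>, and the formula gives zero whatever the sign of
  \<open>r - 2\<close>, because \<open>a \<bullet> b\<close> vanishes.\<close>

lemma norm_powr_has_derivative:
  fixes a b :: "'b::euclidean_space"
  assumes r: "1 < r"
  shows "((\<lambda>t. norm (a + t *\<^sub>R b) powr r / r) has_real_derivative norm a powr (r - 2) * (a \<bullet> b)) (at 0)"
proof (cases "a = 0")
  case True
  have "((\<lambda>h::real. \<bar>h\<bar> powr (r - 1)) \<longlongrightarrow> 0 powr (r - 1)) (at 0)"
    using r by (intro tendsto_powr' tendsto_intros tendsto_rabs_zero) (auto simp: tendsto_ident_at)
  then have "((\<lambda>h::real. \<bar>h\<bar> powr (r - 1)) \<longlongrightarrow> 0) (at 0)"
    by simp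
  then have "((\<lambda>h::real. \<bar>h\<bar> powr (r - 1) * (norm b powr r / r)) \<longlongrightarrow> 0) (at 0)"
    by (rule tendsto_mult_left_zero)
  then have "((\<lambda>h. (norm (a + (0 + h) *\<^sub>R b) powr r / r - norm (a + 0 *\<^sub>R b) powr r / r) / h) \<longlongrightarrow> 0) (at 0)"
  proof (rule Lim_null_comparison[rotated])
    show "\<forall>\<^sub>F h in at 0. norm ((norm (a + (0 + h) *\<^sub>R b) powr r / r - norm (a + 0 *\<^sub>R b) powr r / r) / h) \<le> \<bar>h\<bar> powr (r - 1) * (norm b powr r / r)"
      using True r by (auto intro!: always_eventually simp: eventually_at_filter powr_mult powr_diff abs_mult mult.commute[of r])
  qed
  then show ?thesis
    using True by (simp add: DERIV_def)
next
  case False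
  have sq: "norm v powr r / r = (v \<bullet> v) powr (r / 2) / r" for v :: 'b
    by (simp add: norm_eq_sqrt_inner powr_half_sqrt[symmetric] powr_powr)
  have "((\<lambda>t. (a + t *\<^sub>R b) \<bullet> (a + t *\<^sub>R b)) has_real_derivative 2 * (a \<bullet> b)) (at 0)"
  proof -
    have e: "(\<lambda>t. (a + t *\<^sub>R b) \<bullet> (a + t *\<^sub>R b)) = (\<lambda>t. a \<bullet> a + 2 * t * (a \<bullet> b) + t * t * (b \<bullet> b))"
      by (auto simp: inner_add inner_commute algebra_simps)
    show ?thesis
      unfolding e by (auto intro!: derivative_eq_intros)
  qed
  moreover have "((\<lambda>z. z powr (r / 2)) has_real_derivative r / 2 * (a \<bullet> a) powr (r / 2 - 1)) (at ((a + 0 *\<^sub>R b) \<bullet> (a + 0 *\<^sub>R b)))"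
    using has_real_derivative_powr[of "a \<bullet> a" "r / 2"] False by simp
  ultimately have "((\<lambda>t. ((a + t *\<^sub>R b) \<bullet> (a + t *\<^sub>R b)) powr (r / 2)) has_real_derivative (r / 2 * (a \<bullet> a) powr (r / 2 - 1)) * (2 * (a \<bullet> b))) (at 0)"
    by (rule DERIV_chain2[rotated])
  from DERIV_cdivide[OF this, of r]
  have "((\<lambda>t. norm (a + t *\<^sub>R b) powr r / r) has_real_derivative (a \<bullet> a) powr (r / 2 - 1) * (a \<bullet> b)) (at 0)"
    unfolding sq using r by simp
  moreover have "(a \<bullet> a) powr (r / 2 - 1) = norm a powr (r - 2)"
  proof -
    have "a \<bullet> a = norm a powr 2"
      using False by (simp add: dot_square_norm)
    then have "(a \<bullet> a) powr (r / 2 - 1) = norm a powr (2 * (r / 2 - 1))"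
      by (simp only: powr_powr)
    also have "2 * (r / 2 - 1) = r - 2"
      by simp
    finally show ?thesis .
  qed
  ultimately show ?thesis by simp
qed

text \<open>Dominated convergence with the pointwise derivative and the majorant for the quotients.
  The limit runs along a sequence because dominated convergence does.\<close>

lemma energy_directional_derivative:
  fixes f g :: "'a \<Rightarrow> 'b::euclidean_space"
  assumes m[measurable]: "f \<in> borel_measurable M" "g \<in> borel_measurable M" and fin: "nmod f < top" "nmod g < top"
    and t: "t \<longlonglongrightarrow> 0" "\<And>n. t n \<noteq> 0" "\<And>n. \<bar>t n\<bar> \<le> 1"
  shows "integrable M (\<lambda>x. norm (f x) powr (p x - 2) * (f x \<bullet> g x))"
    and "(\<lambda>n. (energy (\<lambda>x. f x + t n *\<^sub>R g x) - energy f) / t n) \<longlonglongrightarrow> (\<integral>x. norm (f x) powr (p x - 2) * (f x \<bullet> g x) \<partial>M)"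
proof -
  have fint: "nmod (\<lambda>x. f x + t n *\<^sub>R g x) < top" for n
  proof -
    have "nmod (\<lambda>x. t n *\<^sub>R g x) < top"
      using nmod_scale_le[OF m(2), of "t n"] fin by (auto simp: ennreal_mult_less_top intro: le_less_trans)
    then show ?thesis
      using nmod_add_le[OF m(1), of "\<lambda>x. t n *\<^sub>R g x"] fin by (auto simp: ennreal_mult_less_top intro: le_less_trans)
  qed
  define q where "q n x = (norm (f x + t n *\<^sub>R g x) powr p x / p x - norm (f x) powr p x / p x) / t n" for n x
  have q: "(energy (\<lambda>x. f x + t n *\<^sub>R g x) - energy f) / t n = (\<integral>x. q n x \<partial>M)" for n
    unfolding q_def energy_def
    using integrable_energy[of "\<lambda>x. f x + t n *\<^sub>R g x"] integrable_energy[OF m(1) fin(1)] fint by simp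
  let ?w = "\<lambda>x. 2 powr pp * (norm (f x) powr p x + norm (g x) powr p x)"
  have w: "integrable M ?w"
    by (intro integrable_mult_right Bochner_Integration.integrable_add nmod_finiteD m fin)
  have bound: "norm (q n x) \<le> ?w x" if x: "x \<in> space M" for n x
  proof -
    have "\<bar>norm (f x + t n *\<^sub>R g x) powr p x / p x - norm (f x) powr p x / p x\<bar> \<le> \<bar>t n\<bar> * ?w x"
      using p_pos[OF x] p_bounds[OF x] t by (intro norm_powr_quotient_bound) auto
    then show ?thesis
      using t(2)[of n] by (simp add: q_def field_simps)
  qed
  have lim: "(\<lambda>n. q n x) \<longlonglongrightarrow> norm (f x) powr (p x - 2) * (f x \<bullet> g x)" if x: "x \<in> space M" for x
  proof -
    have "filterlim t (at 0) sequentially"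
      using t(1,2) by (simp add: filterlim_at)
    from filterlim_compose[OF norm_powr_has_derivative[OF p_pos[OF x], of "f x" "g x", unfolded DERIV_def] this]
    show ?thesis
      by (simp add: q_def)
  qed
  have mq: "(\<lambda>x. norm (f x) powr (p x - 2) * (f x \<bullet> g x)) \<in> borel_measurable M" "\<And>n. q n \<in> borel_measurable M"
    unfolding q_def by measurable
  note dc = mq w AE_I2[OF lim] AE_I2[OF bound]
  show "integrable M (\<lambda>x. norm (f x) powr (p x - 2) * (f x \<bullet> g x))"
    by (rule integrable_dominated_convergence[OF dc])
  show "(\<lambda>n. (energy (\<lambda>x. f x + t n *\<^sub>R g x) - energy f) / t n) \<longlonglongrightarrow> (\<integral>x. norm (f x) powr (p x - 2) * (f x \<bullet> g x) \<partial>M)"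
    unfolding q by (rule integral_dominated_convergence[OF dc])
qed

end

section \<open>The Sobolev space\<close>

lemma L1_tendsto_integral_mult:
  fixes u :: "nat \<Rightarrow> 'a \<Rightarrow> real"
  assumes u: "\<And>n. integrable M (u n)" "integrable M v"
    and lim: "(\<lambda>n. \<integral>\<^sup>+x. ennreal \<bar>u n x - v x\<bar> \<partial>M) \<longlonglongrightarrow> 0"
    and m[measurable]: "m \<in> borel_measurable M" and B: "\<And>x. \<bar>m x\<bar> \<le> B"
  shows "(\<lambda>n. \<integral>x. u n x * m x \<partial>M) \<longlonglongrightarrow> (\<integral>x. v x * m x \<partial>M)"
proof -
  have B0: "B \<ge> 0"
    using B[of undefined] by linarith
  have im: "integrable M (\<lambda>x. f x * m x)" if f: "integrable M f" for f :: "'a \<Rightarrow> real"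
  proof (rule Bochner_Integration.integrable_bound[OF integrable_mult_right[OF f, of B]])
    show "AE x in M. norm (f x * m x) \<le> norm (B * f x)"
      using B B0 by (auto simp: abs_mult mult.commute[of B] mult_left_mono)
  qed (use f in measurable)
  have d: "integrable M (\<lambda>x. \<bar>u n x - v x\<bar>)" for n
    using u by (intro integrable_abs Bochner_Integration.integrable_diff)
  have "(\<lambda>n. ennreal (\<integral>x. \<bar>u n x - v x\<bar> \<partial>M)) \<longlonglongrightarrow> ennreal 0"
    using lim by (simp add: nn_integral_eq_integral[OF d])
  then have "(\<lambda>n. \<integral>x. \<bar>u n x - v x\<bar> \<partial>M) \<longlonglongrightarrow> 0"
    by (subst (asm) tendsto_ennreal_iff) auto
  then have "(\<lambda>n. B * (\<integral>x. \<bar>u n x - v x\<bar> \<partial>M)) \<longlonglongrightarrow> 0"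
    by (rule tendsto_mult_right_zero)
  then have "(\<lambda>n. (\<integral>x. u n x * m x \<partial>M) - (\<integral>x. v x * m x \<partial>M)) \<longlonglongrightarrow> 0"
  proof (rule Lim_null_comparison[rotated], intro always_eventually allI)
    fix n
    have "norm ((\<integral>x. u n x * m x \<partial>M) - (\<integral>x. v x * m x \<partial>M)) = \<bar>\<integral>x. (u n x - v x) * m x \<partial>M\<bar>"
      using im u by (simp add: left_diff_distrib)
    also have "\<dots> \<le> (\<integral>x. \<bar>(u n x - v x) * m x\<bar> \<partial>M)"
      by (rule integral_abs_bound)
    also have "\<dots> \<le> (\<integral>x. B * \<bar>u n x - v x\<bar> \<partial>M)"
    proof (rule integral_mono)
      show "integrable M (\<lambda>x. \<bar>(u n x - v x) * m x\<bar>)"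
        using u by (intro integrable_abs im Bochner_Integration.integrable_diff)
      show "integrable M (\<lambda>x. B * \<bar>u n x - v x\<bar>)"
        using d by (rule integrable_mult_right)
      show "\<bar>(u n x - v x) * m x\<bar> \<le> B * \<bar>u n x - v x\<bar>" for x
        using B by (simp add: abs_mult mult.commute[of B] mult_left_mono)
    qed
    finally show "norm ((\<integral>x. u n x * m x \<partial>M) - (\<integral>x. v x * m x \<partial>M)) \<le> B * (\<integral>x. \<bar>u n x - v x\<bar> \<partial>M)"
      by simp
  qed
  then show ?thesis
    by (simp add: LIM_zero_iff)
qed

lemma integrable_imp_locally_integrable:
  fixes f :: "'a::euclidean_space \<Rightarrow> 'b::{banach, second_countable_topology}"
  assumes \<Omega>: "\<Omega> \<in> sets lebesgue" and f: "integrable (lebesgue_on \<Omega>) f"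
  shows "locally_integrable_on f \<Omega>"
  unfolding locally_integrable_on_def
proof (intro allI impI)
  fix K assume K: "compact K \<and> K \<subseteq> \<Omega>"
  have "set_integrable lebesgue \<Omega> f"
    using \<Omega> f by (simp add: integrable_restrict_space set_integrable_def)
  then show "set_integrable lebesgue K f"
    by (rule set_integrable_subset) (use K in \<open>auto simp: borel_compact\<close>)
qed

lemma is_weak_gradient_diff:
  fixes u v :: "'a::euclidean_space \<Rightarrow> real"
  assumes \<Omega>: "open \<Omega>" and u: "is_weak_gradient \<Omega> u g" and v: "is_weak_gradient \<Omega> v h"
  shows "is_weak_gradient \<Omega> (\<lambda>x. u x - v x) (\<lambda>x. g x - h x)"
  unfolding is_weak_gradient_def
proof (intro conjI ballI)
  have \<Omega>m: "\<Omega> \<in> sets lebesgue"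
    using \<Omega> by (simp add: borel_open)
  have L: "locally_integrable_on u \<Omega>" "locally_integrable_on v \<Omega>" "locally_integrable_on g \<Omega>" "locally_integrable_on h \<Omega>"
    using u v by (auto simp: is_weak_gradient_def)
  show "locally_integrable_on (\<lambda>x. u x - v x) \<Omega>" "locally_integrable_on (\<lambda>x. g x - h x) \<Omega>"
    using L by (auto simp: locally_integrable_on_def intro: set_integral_diff)
  fix \<phi> :: "'a \<Rightarrow> real" and b :: 'a assume \<phi>: "\<phi> \<in> test_functions \<Omega>" and b: "b \<in> Basis"
  note [measurable] = test_function_measurable[OF \<phi>]
  obtain K where K: "compact K" "K \<subseteq> \<Omega>" "\<And>x. x \<notin> K \<Longrightarrow> \<phi> x = 0" "\<And>x. x \<notin> K \<Longrightarrow> grad \<phi> x = 0"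
    using test_function_support[OF \<phi>] by metis
  obtain B where B: "B > 0" "\<And>x. \<bar>\<phi> x\<bar> \<le> B" "\<And>x. norm (grad \<phi> x) \<le> B"
    using test_function_bounded[OF \<phi>] by metis
  have gb: "\<bar>grad \<phi> x \<bullet> b\<bar> \<le> B" for x
    using B(3)[of x] Basis_le_norm[OF b] order_trans by blast
  have i1: "integrable (lebesgue_on \<Omega>) (\<lambda>x. f x * (grad \<phi> x \<bullet> b))" if "locally_integrable_on f \<Omega>" for f
    by (rule integrable_test_mult[OF \<Omega>m that K(1,2)]) (use K gb in auto)
  have zero: "locally_integrable_on (\<lambda>x. 0::'a) \<Omega>"
    by (rule continuous_imp_locally_integrable) simp
  have i2: "integrable (lebesgue_on \<Omega>) (\<lambda>x. (f x \<bullet> b) * \<phi> x)" if f: "locally_integrable_on f \<Omega>" for f :: "'a \<Rightarrow> 'a"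
    using integrable_test_function_mult[OF \<Omega>m locally_integrable_inner_diff[OF f zero, of b] \<phi>] by simp
  have "(LINT x|lebesgue_on \<Omega>. u x * (grad \<phi> x \<bullet> b)) = - (LINT x|lebesgue_on \<Omega>. (g x \<bullet> b) * \<phi> x)"
    "(LINT x|lebesgue_on \<Omega>. v x * (grad \<phi> x \<bullet> b)) = - (LINT x|lebesgue_on \<Omega>. (h x \<bullet> b) * \<phi> x)"
    using u v \<phi> b by (simp_all add: is_weak_gradient_def test_function_derivative_eq)
  then show "(LINT x|lebesgue_on \<Omega>. (u x - v x) * frechet_derivative \<phi> (at x) b) = - (LINT x|lebesgue_on \<Omega>. ((g x - h x) \<bullet> b) * \<phi> x)"
    using i1[OF L(1)] i1[OF L(2)] i2[OF L(3)] i2[OF L(4)]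
    by (simp add: test_function_derivative_eq[OF \<phi>] left_diff_distrib inner_diff_left)
qed

section \<open>The closure of the test functions\<close>

locale variable_sobolev =
  fixes \<Omega> :: "'a::euclidean_space set" and p :: "'a \<Rightarrow> real"
  assumes \<Omega>_open: "open \<Omega>" and \<Omega>_bounded: "bounded \<Omega>" and \<Omega>_ne: "\<Omega> \<noteq> {}"
    and p_cont: "continuous_on (closure \<Omega>) p" and pminus_gt_1: "1 < pminus \<Omega> p"
begin

lemma \<Omega>_sets: "\<Omega> \<in> sets lebesgue"
  using \<Omega>_open by (simp add: borel_open)

lemma p_bdd: "bdd_below (p ` \<Omega>)" "bdd_above (p ` \<Omega>)"
proof -
  have "bounded (p ` closure \<Omega>)"
    using \<Omega>_bounded p_cont by (intro compact_imp_bounded compact_continuous_image) (auto simp: compact_closure)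
  then have "bounded (p ` \<Omega>)"
    by (rule bounded_subset) (use closure_subset in auto)
  then show "bdd_below (p ` \<Omega>)" "bdd_above (p ` \<Omega>)"
    by (auto intro: bounded_imp_bdd_below bounded_imp_bdd_above)
qed

lemma pminus_le: "x \<in> \<Omega> \<Longrightarrow> pminus \<Omega> p \<le> p x" and pplus_ge: "x \<in> \<Omega> \<Longrightarrow> p x \<le> pplus \<Omega> p"
  unfolding pminus_def pplus_def using p_bdd by (auto intro: cINF_lower cSUP_upper)

lemma pminus_le_pplus: "pminus \<Omega> p \<le> pplus \<Omega> p"
  using \<Omega>_ne pminus_le pplus_ge by (meson all_not_in_conv order_trans)

lemma finite_measure_M: "finite_measure (lebesgue_on \<Omega>)"
proof (rule finite_measureI)
  have "emeasure lebesgue \<Omega> < \<infinity>"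
    using \<Omega>_open \<Omega>_bounded emeasure_bounded_finite[OF \<Omega>_bounded] by (simp add: borel_open)
  then show "emeasure (lebesgue_on \<Omega>) (space (lebesgue_on \<Omega>)) \<noteq> \<infinity>"
    using \<Omega>_sets by (simp add: emeasure_restrict_space)
qed

sublocale exponent "lebesgue_on \<Omega>" p "pminus \<Omega> p" "pplus \<Omega> p"
proof -
  interpret finite_measure "lebesgue_on \<Omega>" by (rule finite_measure_M)
  show "exponent (lebesgue_on \<Omega>) p (pminus \<Omega> p) (pplus \<Omega> p)"
  proof
    show "p \<in> borel_measurable (lebesgue_on \<Omega>)"
      using continuous_on_subset[OF p_cont closure_subset] \<Omega>_sets
      by (rule continuous_imp_measurable_on_sets_lebesgue)
  qed (use pminus_gt_1 pminus_le pplus_ge pminus_le_pplus in auto)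
qed

abbreviation "M \<equiv> lebesgue_on \<Omega>"
abbreviation "pm \<equiv> pminus \<Omega> p"
abbreviation "pp \<equiv> pplus \<Omega> p"

lemma test_measurable[measurable_dest]:
  assumes "\<phi> \<in> test_functions \<Omega>"
  shows "\<phi> \<in> borel_measurable M" "grad \<phi> \<in> borel_measurable M"
  using test_function_measurable[OF assms] by (auto intro: borel_measurable_lebesgue_on)

lemma nmod_test_finite:
  assumes \<phi>: "\<phi> \<in> test_functions \<Omega>"
  shows "nmod \<phi> < top" "nmod (grad \<phi>) < top"
proof -
  obtain B where B: "B > 0" "\<And>x. \<bar>\<phi> x\<bar> \<le> B" "\<And>x. norm (grad \<phi> x) \<le> B"
    using test_function_bounded[OF \<phi>] by metis
  have *: "nmod f < top" if f: "f \<in> borel_measurable M" "\<And>x. norm (f x) \<le> B" for f :: "'a \<Rightarrow> 'b::euclidean_space"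
  proof -
    have "nmod f \<le> (\<integral>\<^sup>+x. ennreal (max 1 B powr pp) \<partial>M)"
      unfolding nmod_def
    proof (intro nn_integral_mono ennreal_leI)
      fix x assume x: "x \<in> space M"
      have "norm (f x) powr p x \<le> max 1 B powr p x"
        using f(2)[of x] p_pos[OF x] by (intro powr_mono2) auto
      also have "\<dots> \<le> max 1 B powr pp"
        using p_bounds[OF x] by (intro powr_mono) auto
      finally show "norm (f x) powr p x \<le> max 1 B powr pp" .
    qed
    also have "\<dots> < top"
      by (simp add: ennreal_mult_less_top emeasure_eq_measure)
    finally show ?thesis .
  qed
  show "nmod \<phi> < top" "nmod (grad \<phi>) < top"
    using B test_measurable[OF \<phi>] by (auto intro!: *)
qed

text \<open>\<open>W u g\<close> says that \<open>u\<close> belongs to \<open>W\<^sub>0\<^bsup>1,p(x)\<^esup>(\<Omega>)\<close> with weak gradient \<open>g\<close>: modular convergence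
  is equivalent to norm convergence because the exponent is bounded.\<close>

definition W :: "('a \<Rightarrow> real) \<Rightarrow> ('a \<Rightarrow> 'a) \<Rightarrow> bool" where
  "W u g \<longleftrightarrow> u \<in> borel_measurable M \<and> g \<in> borel_measurable M \<and>
     (\<forall>e>0. \<exists>\<phi>\<in>test_functions \<Omega>. nmod (\<lambda>x. u x - \<phi> x) \<le> ennreal e \<and> nmod (\<lambda>x. g x - grad \<phi> x) \<le> ennreal e)"

lemma W_measurable[measurable_dest]:
  "W u g \<Longrightarrow> u \<in> borel_measurable M" "W u g \<Longrightarrow> g \<in> borel_measurable M"
  by (simp_all add: W_def)

lemma W_sequence:
  assumes "W u g"
  obtains \<phi> where "\<And>n. \<phi> n \<in> test_functions \<Omega>" "(\<lambda>n. nmod (\<lambda>x. u x - \<phi> n x)) \<longlonglongrightarrow> 0"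
    "(\<lambda>n. nmod (\<lambda>x. g x - grad (\<phi> n) x)) \<longlonglongrightarrow> 0"
proof -
  have "\<forall>n. \<exists>\<phi>\<in>test_functions \<Omega>. nmod (\<lambda>x. u x - \<phi> x) \<le> ennreal (1 / real (Suc n)) \<and> nmod (\<lambda>x. g x - grad \<phi> x) \<le> ennreal (1 / real (Suc n))"
    using assms by (simp add: W_def)
  then obtain \<phi> where \<phi>: "\<And>n. \<phi> n \<in> test_functions \<Omega>"
    "\<And>n. nmod (\<lambda>x. u x - \<phi> n x) \<le> ennreal (1 / real (Suc n))" "\<And>n. nmod (\<lambda>x. g x - grad (\<phi> n) x) \<le> ennreal (1 / real (Suc n))"
    by metis
  have lim: "a \<longlonglongrightarrow> 0" if "\<And>n. a n \<le> ennreal (1 / real (Suc n))" for a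
    unfolding ennreal_tendsto_0_iff
  proof (intro allI impI)
    fix e :: real assume "e > 0"
    then have "\<forall>\<^sub>F n in sequentially. 1 / real (Suc n) < e"
      using LIMSEQ_Suc[OF lim_1_over_n] by (rule order_tendstoD(2)[rotated])
    then show "\<forall>\<^sub>F n in sequentially. a n \<le> ennreal e"
      by eventually_elim (meson that order_trans ennreal_leI less_imp_le)
  qed
  show thesis
    by (rule that[OF \<phi>(1) lim[OF \<phi>(2)] lim[OF \<phi>(3)]])
qed

lemma W_I_sequence:
  assumes "u \<in> borel_measurable M" "g \<in> borel_measurable M" "\<And>n. \<phi> n \<in> test_functions \<Omega>"
    "(\<lambda>n. nmod (\<lambda>x. u x - \<phi> n x)) \<longlonglongrightarrow> 0" "(\<lambda>n. nmod (\<lambda>x. g x - grad (\<phi> n) x)) \<longlonglongrightarrow> 0"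
  shows "W u g"
  unfolding W_def
proof (intro conjI allI impI assms(1,2))
  fix e :: real assume "e > 0"
  then have "\<forall>\<^sub>F n in sequentially. nmod (\<lambda>x. u x - \<phi> n x) \<le> ennreal e" "\<forall>\<^sub>F n in sequentially. nmod (\<lambda>x. g x - grad (\<phi> n) x) \<le> ennreal e"
    using assms(4,5) by (auto simp: ennreal_tendsto_0_iff)
  then have "\<forall>\<^sub>F n in sequentially. nmod (\<lambda>x. u x - \<phi> n x) \<le> ennreal e \<and> nmod (\<lambda>x. g x - grad (\<phi> n) x) \<le> ennreal e"
    by (rule eventually_conj)
  then obtain n where "nmod (\<lambda>x. u x - \<phi> n x) \<le> ennreal e \<and> nmod (\<lambda>x. g x - grad (\<phi> n) x) \<le> ennreal e"
    by (auto dest: eventually_happens)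
  then show "\<exists>\<phi>\<in>test_functions \<Omega>. nmod (\<lambda>x. u x - \<phi> x) \<le> ennreal e \<and> nmod (\<lambda>x. g x - grad \<phi> x) \<le> ennreal e"
    using assms(3) by blast
qed

lemma W_test: "\<phi> \<in> test_functions \<Omega> \<Longrightarrow> W \<phi> (grad \<phi>)"
  by (auto simp: W_def test_measurable intro!: bexI[of _ \<phi>])

lemma W_finite:
  assumes "W u g"
  shows "nmod u < top" "nmod g < top"
proof -
  note [measurable] = W_measurable[OF assms]
  have "\<exists>\<phi>\<in>test_functions \<Omega>. nmod (\<lambda>x. u x - \<phi> x) \<le> ennreal 1 \<and> nmod (\<lambda>x. g x - grad \<phi> x) \<le> ennreal 1"
    using assms unfolding W_def by (metis zero_less_one)
  then obtain \<phi> where \<phi>: "\<phi> \<in> test_functions \<Omega>" "nmod (\<lambda>x. u x - \<phi> x) \<le> ennreal 1" "nmod (\<lambda>x. g x - grad \<phi> x) \<le> ennreal 1"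
    by blast
  note [measurable] = test_measurable[OF \<phi>(1)]
  have "nmod u \<le> ennreal (2 powr pp) * (nmod (\<lambda>x. u x - \<phi> x) + nmod \<phi>)"
    by (rule nmod_le_if_close) measurable
  also have "\<dots> < top"
    using \<phi> nmod_test_finite[OF \<phi>(1)] by (auto simp: ennreal_mult_less_top intro: le_less_trans)
  finally show "nmod u < top" .
  have "nmod g \<le> ennreal (2 powr pp) * (nmod (\<lambda>x. g x - grad \<phi> x) + nmod (grad \<phi>))"
    by (rule nmod_le_if_close) measurable
  also have "\<dots> < top"
    using \<phi> nmod_test_finite[OF \<phi>(1)] by (auto simp: ennreal_mult_less_top intro: le_less_trans)
  finally show "nmod g < top" .
qed

lemma W_integrable:
  assumes "W u g"
  shows "integrable M u" "integrable M g"
  using nmod_finite_imp_integrable[OF W_measurable(1)[OF assms] W_finite(1)[OF assms]]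
    nmod_finite_imp_integrable[OF W_measurable(2)[OF assms] W_finite(2)[OF assms]] by simp_all

lemma ennreal_cmult_tendsto_0:
  fixes a b :: "nat \<Rightarrow> ennreal"
  assumes "a \<longlonglongrightarrow> 0" "b \<longlonglongrightarrow> 0"
  shows "(\<lambda>n. ennreal c * (a n + b n)) \<longlonglongrightarrow> 0"
proof -
  have "(\<lambda>n. ennreal c * (a n + b n)) \<longlonglongrightarrow> ennreal c * (0 + 0)"
    using assms by (intro ennreal_tendsto_cmult tendsto_add) auto
  then show ?thesis by simp
qed

lemma W_add:
  assumes u: "W u g" and v: "W v h"
  shows "W (\<lambda>x. u x + c * v x) (\<lambda>x. g x + c *\<^sub>R h x)"
proof -
  note [measurable] = W_measurable[OF u] W_measurable[OF v]
  obtain \<phi> where \<phi>: "\<And>n. \<phi> n \<in> test_functions \<Omega>" "(\<lambda>n. nmod (\<lambda>x. u x - \<phi> n x)) \<longlonglongrightarrow> 0"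
    "(\<lambda>n. nmod (\<lambda>x. g x - grad (\<phi> n) x)) \<longlonglongrightarrow> 0"
    by (rule W_sequence[OF u], rule that)
  obtain \<psi> where \<psi>: "\<And>n. \<psi> n \<in> test_functions \<Omega>" "(\<lambda>n. nmod (\<lambda>x. v x - \<psi> n x)) \<longlonglongrightarrow> 0"
    "(\<lambda>n. nmod (\<lambda>x. h x - grad (\<psi> n) x)) \<longlonglongrightarrow> 0"
    by (rule W_sequence[OF v], rule that)
  note [measurable] = test_measurable[OF \<phi>(1)] test_measurable[OF \<psi>(1)]
  have lim: "(\<lambda>n. nmod (\<lambda>x. (a x + c *\<^sub>R b x) - (a' n x + c *\<^sub>R b' n x))) \<longlonglongrightarrow> 0"
    if m[measurable]: "a \<in> borel_measurable M" "b \<in> borel_measurable M" "\<And>n. a' n \<in> borel_measurable M" "\<And>n. b' n \<in> borel_measurable M"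
      and l: "(\<lambda>n. nmod (\<lambda>x. a x - a' n x)) \<longlonglongrightarrow> 0" "(\<lambda>n. nmod (\<lambda>x. b x - b' n x)) \<longlonglongrightarrow> 0"
    for a b :: "'a \<Rightarrow> 'b::euclidean_space" and a' b'
  proof (rule tendsto_sandwich[OF _ _ tendsto_const])
    have "(\<lambda>n. ennreal (max 1 \<bar>c\<bar> powr pp) * (nmod (\<lambda>x. b x - b' n x) + 0)) \<longlonglongrightarrow> 0"
      by (rule ennreal_cmult_tendsto_0[OF l(2) tendsto_const])
    then have "(\<lambda>n. ennreal (max 1 \<bar>c\<bar> powr pp) * nmod (\<lambda>x. b x - b' n x)) \<longlonglongrightarrow> 0"
      by simp
    from ennreal_cmult_tendsto_0[OF l(1) this]
    show "(\<lambda>n. ennreal (2 powr pp) * (nmod (\<lambda>x. a x - a' n x) + ennreal (max 1 \<bar>c\<bar> powr pp) * nmod (\<lambda>x. b x - b' n x))) \<longlonglongrightarrow> 0" .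
    show "\<forall>\<^sub>F n in sequentially. nmod (\<lambda>x. (a x + c *\<^sub>R b x) - (a' n x + c *\<^sub>R b' n x)) \<le>
        ennreal (2 powr pp) * (nmod (\<lambda>x. a x - a' n x) + ennreal (max 1 \<bar>c\<bar> powr pp) * nmod (\<lambda>x. b x - b' n x))"
    proof (intro always_eventually allI)
      fix n
      have "nmod (\<lambda>x. (a x + c *\<^sub>R b x) - (a' n x + c *\<^sub>R b' n x)) = nmod (\<lambda>x. (a x - a' n x) + c *\<^sub>R (b x - b' n x))"
        by (simp add: algebra_simps)
      also have "\<dots> \<le> ennreal (2 powr pp) * (nmod (\<lambda>x. a x - a' n x) + nmod (\<lambda>x. c *\<^sub>R (b x - b' n x)))"
        by (rule nmod_add_le) measurable
      also have "\<dots> \<le> ennreal (2 powr pp) * (nmod (\<lambda>x. a x - a' n x) + ennreal (max 1 \<bar>c\<bar> powr pp) * nmod (\<lambda>x. b x - b' n x))"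
        by (intro mult_left_mono add_mono order_refl nmod_scale_le) measurable
      finally show "nmod (\<lambda>x. (a x + c *\<^sub>R b x) - (a' n x + c *\<^sub>R b' n x)) \<le> \<dots>" .
    qed
  qed simp
  show ?thesis
  proof (rule W_I_sequence[where \<phi> = "\<lambda>n x. \<phi> n x + c * \<psi> n x"])
    show "(\<lambda>x. \<phi> n x + c * \<psi> n x) \<in> test_functions \<Omega>" for n
      by (rule test_function_add[OF \<phi>(1) \<psi>(1)])
    show "(\<lambda>n. nmod (\<lambda>x. u x + c * v x - (\<phi> n x + c * \<psi> n x))) \<longlonglongrightarrow> 0"
      using lim[of u v \<phi> \<psi>] \<phi>(2) \<psi>(2) by simp
    show "(\<lambda>n. nmod (\<lambda>x. g x + c *\<^sub>R h x - grad (\<lambda>x. \<phi> n x + c * \<psi> n x) x)) \<longlonglongrightarrow> 0"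
      unfolding test_function_add(2)[OF \<phi>(1) \<psi>(1)] by (rule lim) (use \<phi>(3) \<psi>(3) in measurable)
  qed measurable
qed

text \<open>Each \<open>u n\<close> is replaced by a test function within \<open>1 / (n + 1)\<close>
  in both modulars; the triangle inequality with constant \<open>2 powr pp\<close> carries the
  convergence over.\<close>

lemma W_closed:
  assumes W: "\<And>n. W (u n) (g n)" and m[measurable]: "v \<in> borel_measurable M" "h \<in> borel_measurable M"
    and lim: "(\<lambda>n. nmod (\<lambda>x. u n x - v x)) \<longlonglongrightarrow> 0" "(\<lambda>n. nmod (\<lambda>x. g n x - h x)) \<longlonglongrightarrow> 0"
  shows "W v h"
proof -
  note [measurable] = W_measurable[OF W]
  have "\<forall>n. \<exists>\<phi>\<in>test_functions \<Omega>. nmod (\<lambda>x. u n x - \<phi> x) \<le> ennreal (1 / real (Suc n)) \<and> nmod (\<lambda>x. g n x - grad \<phi> x) \<le> ennreal (1 / real (Suc n))"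
    using W by (simp add: W_def)
  then obtain \<phi> where \<phi>: "\<And>n. \<phi> n \<in> test_functions \<Omega>"
    "\<And>n. nmod (\<lambda>x. u n x - \<phi> n x) \<le> ennreal (1 / real (Suc n))" "\<And>n. nmod (\<lambda>x. g n x - grad (\<phi> n) x) \<le> ennreal (1 / real (Suc n))"
    by metis
  note [measurable] = test_measurable[OF \<phi>(1)]
  have "(\<lambda>n. ennreal (1 / real (Suc n))) \<longlonglongrightarrow> ennreal 0"
    by (intro tendsto_ennrealI LIMSEQ_Suc[OF lim_1_over_n])
  then have inv: "(\<lambda>n. ennreal (1 / real (Suc n))) \<longlonglongrightarrow> 0"
    by simp
  have lim': "(\<lambda>n. nmod (\<lambda>x. b x - c n x)) \<longlonglongrightarrow> 0"
    if mm[measurable]: "\<And>n. a n \<in> borel_measurable M" "b \<in> borel_measurable M" "\<And>n. c n \<in> borel_measurable M"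
      and l: "(\<lambda>n. nmod (\<lambda>x. a n x - b x)) \<longlonglongrightarrow> 0" "\<And>n. nmod (\<lambda>x. a n x - c n x) \<le> ennreal (1 / real (Suc n))"
    for a c :: "nat \<Rightarrow> 'a \<Rightarrow> 'b::euclidean_space" and b
  proof (rule tendsto_sandwich[OF _ _ tendsto_const ennreal_cmult_tendsto_0[OF l(1) inv, of "2 powr pp"]])
    show "\<forall>\<^sub>F n in sequentially. nmod (\<lambda>x. b x - c n x) \<le> ennreal (2 powr pp) * (nmod (\<lambda>x. a n x - b x) + ennreal (1 / real (Suc n)))"
    proof (intro always_eventually allI)
      fix n
      have "nmod (\<lambda>x. b x - c n x) \<le> ennreal (2 powr pp) * (nmod (\<lambda>x. b x - a n x) + nmod (\<lambda>x. a n x - c n x))"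
        by (rule nmod_triangle) measurable
      also have "\<dots> \<le> ennreal (2 powr pp) * (nmod (\<lambda>x. a n x - b x) + ennreal (1 / real (Suc n)))"
        using l(2)[of n] by (intro mult_left_mono add_mono) (auto simp: nmod_minus_commute)
      finally show "nmod (\<lambda>x. b x - c n x) \<le> \<dots>" .
    qed
  qed simp
  show ?thesis
    by (rule W_I_sequence[OF m \<phi>(1)]; rule lim'; (rule lim | rule \<phi> | measurable))
qed

text \<open>Integration by parts holds for the approximating test functions. Modular convergence
  implies convergence in L^1, which suffices for the limit because the other factor is
  bounded.\<close>

lemma W_is_weak_gradient:
  assumes W: "W u g"
  shows "is_weak_gradient \<Omega> u g"
  unfolding is_weak_gradient_def
proof (intro conjI ballI)
  note [measurable] = W_measurable[OF W]
  note int = W_integrable[OF W]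
  show "locally_integrable_on u \<Omega>" "locally_integrable_on g \<Omega>"
    using int \<Omega>_sets by (auto intro: integrable_imp_locally_integrable)
  fix \<psi> :: "'a \<Rightarrow> real" and b :: 'a assume \<psi>: "\<psi> \<in> test_functions \<Omega>" and b: "b \<in> Basis"
  note [measurable] = test_measurable[OF \<psi>]
  obtain B where B: "B > 0" "\<And>x. \<bar>\<psi> x\<bar> \<le> B" "\<And>x. norm (grad \<psi> x) \<le> B"
    using test_function_bounded[OF \<psi>] by metis
  have gb: "\<bar>grad \<psi> x \<bullet> b\<bar> \<le> B" for x
    using B(3)[of x] Basis_le_norm[OF b] order_trans by blast
  obtain \<phi> where \<phi>: "\<And>n. \<phi> n \<in> test_functions \<Omega>" "(\<lambda>n. nmod (\<lambda>x. u x - \<phi> n x)) \<longlonglongrightarrow> 0"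
    "(\<lambda>n. nmod (\<lambda>x. g x - grad (\<phi> n) x)) \<longlonglongrightarrow> 0"
    by (rule W_sequence[OF W], rule that)
  note [measurable] = test_measurable[OF \<phi>(1)]
  note int\<phi> = W_integrable[OF W_test[OF \<phi>(1)]]
  have L1: "(\<lambda>n. \<integral>\<^sup>+x. ennreal \<bar>\<phi> n x - u x\<bar> \<partial>M) \<longlonglongrightarrow> 0"
    using nmod_tendsto_0_imp_L1[of "\<lambda>n x. u x - \<phi> n x"] \<phi>(2) by (simp add: abs_minus_commute)
  have L2: "(\<lambda>n. \<integral>\<^sup>+x. ennreal (norm (grad (\<phi> n) x - g x)) \<partial>M) \<longlonglongrightarrow> 0"
    using nmod_tendsto_0_imp_L1[of "\<lambda>n x. g x - grad (\<phi> n) x"] \<phi>(3) by (simp add: norm_minus_commute)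
  have L2b: "(\<lambda>n. \<integral>\<^sup>+x. ennreal \<bar>grad (\<phi> n) x \<bullet> b - g x \<bullet> b\<bar> \<partial>M) \<longlonglongrightarrow> 0"
  proof (rule tendsto_sandwich[OF _ _ tendsto_const L2])
    show "\<forall>\<^sub>F n in sequentially. (\<integral>\<^sup>+x. ennreal \<bar>grad (\<phi> n) x \<bullet> b - g x \<bullet> b\<bar> \<partial>M) \<le> (\<integral>\<^sup>+x. ennreal (norm (grad (\<phi> n) x - g x)) \<partial>M)"
      using Basis_le_norm[OF b] by (intro always_eventually allI nn_integral_mono ennreal_leI) (simp flip: inner_diff_left)
  qed simp
  have "(\<lambda>n. LINT x|M. \<phi> n x * (grad \<psi> x \<bullet> b)) \<longlonglongrightarrow> (LINT x|M. u x * (grad \<psi> x \<bullet> b))"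
    by (rule L1_tendsto_integral_mult[OF _ _ L1 _ gb]) (use int int\<phi> in measurable)
  moreover have "(\<lambda>n. LINT x|M. (grad (\<phi> n) x \<bullet> b) * \<psi> x) \<longlonglongrightarrow> (LINT x|M. (g x \<bullet> b) * \<psi> x)"
    by (rule L1_tendsto_integral_mult[OF _ _ L2b _ B(2)]) (use int int\<phi> in \<open>auto intro: integrable_inner_left\<close>)
  then have "(\<lambda>n. - (LINT x|M. (grad (\<phi> n) x \<bullet> b) * \<psi> x)) \<longlonglongrightarrow> - (LINT x|M. (g x \<bullet> b) * \<psi> x)"
    by (rule tendsto_minus)
  moreover have "(LINT x|M. \<phi> n x * (grad \<psi> x \<bullet> b)) = - (LINT x|M. (grad (\<phi> n) x \<bullet> b) * \<psi> x)" for n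
    using grad_is_weak_gradient[OF \<Omega>_open \<phi>(1), of n] \<psi> b
    by (simp add: is_weak_gradient_def test_function_derivative_eq)
  ultimately show "(LINT x|M. u x * frechet_derivative \<psi> (at x) b) = - (LINT x|M. (g x \<bullet> b) * \<psi> x)"
    by (simp add: test_function_derivative_eq[OF \<psi>] LIMSEQ_unique)
qed

lemma weak_grad_AE_eq:
  assumes "is_weak_gradient \<Omega> u g"
  shows "is_weak_gradient \<Omega> u (weak_grad \<Omega> u)" "AE x in M. weak_grad \<Omega> u x = g x"
    "weak_grad \<Omega> u \<in> borel_measurable M"
proof -
  show w: "is_weak_gradient \<Omega> u (weak_grad \<Omega> u)"
    unfolding weak_grad_def by (rule someI[of "is_weak_gradient \<Omega> u", OF assms])
  show "AE x in M. weak_grad \<Omega> u x = g x"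
    by (rule weak_gradient_unique[OF \<Omega>_open w assms])
  show "weak_grad \<Omega> u \<in> borel_measurable M"
    using w \<Omega>_open by (auto simp: is_weak_gradient_def intro: locally_integrable_imp_measurable)
qed


section \<open>Luxemburg norms and modulars\<close>

lemma Lpx_iff: "f \<in> Lpx \<Omega> p \<longleftrightarrow> f \<in> borel_measurable M \<and> nmod f < top"
  unfolding Lpx_def using nmod_finite_iff[of f] by auto

lemma modular_eq:
  assumes "f \<in> borel_measurable M" "nmod f < top"
  shows "ennreal (modular \<Omega> p f) = nmod f"
  unfolding modular_def using nmod_eq_integral[of f] nmod_finiteD[OF assms] by simp

lemma nmod_divide_finite:
  fixes f :: "'a \<Rightarrow> real"
  assumes "f \<in> borel_measurable M" "nmod f < top"
  shows "nmod (\<lambda>x. f x / c) < top"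
  using nmod_scale_le[OF assms(1), of "1 / c"] assms(2) by (auto simp: ennreal_mult_less_top intro: le_less_trans)

text \<open>Division by \<open>\<eta> \<le> 1\<close> multiplies the modular by at most
  \<open>(1 / \<eta>) powr pp\<close>, so a modular below \<open>\<eta> powr pp\<close> puts
  \<open>\<eta>\<close> into the set whose infimum is the norm.\<close>

lemma Lpx_norm_le:
  assumes m: "f \<in> borel_measurable M" and \<eta>: "0 < \<eta>" "\<eta> \<le> 1" and le: "nmod f \<le> ennreal (\<eta> powr pp)"
  shows "Lpx_norm \<Omega> p f \<le> \<eta>"
  unfolding Lpx_norm_def
proof (rule cInf_lower)
  have fin: "nmod f < top"
    using le by (simp add: le_less_trans)
  have "max 1 \<bar>1 / \<eta>\<bar> = 1 / \<eta>"
    using \<eta> by simp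
  then have "nmod (\<lambda>x. f x / \<eta>) \<le> ennreal ((1 / \<eta>) powr pp) * nmod f"
    using nmod_scale_le[OF m, of "1 / \<eta>"] by simp
  also have "\<dots> \<le> ennreal ((1 / \<eta>) powr pp) * ennreal (\<eta> powr pp)"
    by (intro mult_left_mono le) simp
  also have "\<dots> = 1"
    using \<eta> by (simp flip: ennreal_mult powr_mult)
  finally have "ennreal (modular \<Omega> p (\<lambda>x. f x / \<eta>)) \<le> ennreal 1"
    using modular_eq[of "\<lambda>x. f x / \<eta>"] nmod_divide_finite[OF m fin, of \<eta>] m by simp
  then show "\<eta> \<in> {\<kappa>. 0 < \<kappa> \<and> modular \<Omega> p (\<lambda>x. f x / \<kappa>) \<le> 1}"
    using \<eta> by (simp add: ennreal_le_iff)
  show "bdd_below {\<kappa>. 0 < \<kappa> \<and> modular \<Omega> p (\<lambda>x. f x / \<kappa>) \<le> 1}"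
    by (rule bdd_belowI[of _ 0]) auto
qed

text \<open>The infimum of an empty set of reals carries no information, so a member is exhibited:
  since \<open>k \<le> k powr p x\<close> for \<open>k \<ge> 1\<close>, the maximum of 1 and the
  modular works.\<close>

lemma Lpx_norm_set_nonempty:
  assumes m[measurable]: "f \<in> borel_measurable M" and fin: "nmod f < top"
  shows "{\<kappa>. 0 < \<kappa> \<and> modular \<Omega> p (\<lambda>x. f x / \<kappa>) \<le> 1} \<noteq> {}"
proof -
  define k where "k = max 1 (modular \<Omega> p f)"
  have k: "k \<ge> 1" "modular \<Omega> p f \<le> k"
    by (auto simp: k_def)
  have i: "integrable M (\<lambda>x. \<bar>f x\<bar> powr p x)"
    using nmod_finiteD[OF m fin] by simp
  have "modular \<Omega> p (\<lambda>x. f x / k) \<le> (LINT x|M. \<bar>f x\<bar> powr p x / k)"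
    unfolding modular_def
  proof (rule integral_mono)
    show "integrable M (\<lambda>x. \<bar>f x / k\<bar> powr p x)"
      using nmod_finiteD[of "\<lambda>x. f x / k"] nmod_divide_finite[OF m fin] by simp
    show "integrable M (\<lambda>x. \<bar>f x\<bar> powr p x / k)"
      using i by simp
    fix x assume x: "x \<in> space M"
    have "k powr 1 \<le> k powr p x"
      using k p_pos[OF x] by (intro powr_mono) auto
    then show "\<bar>f x / k\<bar> powr p x \<le> \<bar>f x\<bar> powr p x / k"
      using k by (simp add: powr_divide frac_le)
  qed
  also have "\<dots> = modular \<Omega> p f / k"
    by (simp add: modular_def)
  also have "\<dots> \<le> 1"
    using k by simp
  finally show ?thesis
    using k by (auto intro!: exI[of _ k])
qed

lemma Lpx_norm_nonneg:
  assumes "f \<in> borel_measurable M" "nmod f < top"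
  shows "0 \<le> Lpx_norm \<Omega> p f"
  unfolding Lpx_norm_def
  by (rule cInf_greatest[OF Lpx_norm_set_nonempty[OF assms]]) simp

text \<open>For \<open>k < 1\<close> one has \<open>k powr p x \<le> k\<close>, so the modular of
  \<open>f\<close> is at most \<open>k\<close> times the modular of \<open>f / k\<close>. The bound
  \<open>e \<le> 1\<close> secures this.\<close>

lemma nmod_le_if_Lpx_norm_less:
  assumes m[measurable]: "f \<in> borel_measurable M" and fin: "nmod f < top"
    and less: "Lpx_norm \<Omega> p f < e" and e: "e \<le> 1"
  shows "nmod f \<le> ennreal e"
proof -
  obtain k where k: "0 < k" "modular \<Omega> p (\<lambda>x. f x / k) \<le> 1" "k < e"
    using cInf_lessD[OF Lpx_norm_set_nonempty[OF m fin] less[unfolded Lpx_norm_def]] by auto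
  have "nmod f \<le> (\<integral>\<^sup>+x. ennreal k * ennreal (norm (f x / k) powr p x) \<partial>M)"
    unfolding nmod_def
  proof (rule nn_integral_mono)
    fix x assume x: "x \<in> space M"
    have "norm (f x) powr p x = k powr p x * norm (f x / k) powr p x"
      using k by (simp flip: powr_mult)
    also have "\<dots> \<le> k powr 1 * norm (f x / k) powr p x"
      using k e p_pos[OF x] by (intro mult_right_mono powr_mono') auto
    finally show "ennreal (norm (f x) powr p x) \<le> ennreal k * ennreal (norm (f x / k) powr p x)"
      using k by (simp add: ennreal_leI flip: ennreal_mult)
  qed
  also have "\<dots> = ennreal k * nmod (\<lambda>x. f x / k)"
    by (simp add: nmod_def nn_integral_cmult)
  also have "nmod (\<lambda>x. f x / k) = ennreal (modular \<Omega> p (\<lambda>x. f x / k))"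
    using modular_eq[of "\<lambda>x. f x / k"] nmod_divide_finite[OF m fin] by simp
  also have "ennreal k * \<dots> \<le> ennreal k * ennreal 1"
    using k by (intro mult_left_mono ennreal_leI) auto
  also have "\<dots> \<le> ennreal e"
    using k by (simp add: ennreal_leI)
  finally show ?thesis .
qed

lemma nmod_norm: "nmod (\<lambda>x. norm (f x)) = nmod f"
  by (simp add: nmod_def)

text \<open>The norm of \<open>u - \<phi>\<close> is computed with the chosen weak gradient of the
  difference, which uniqueness identifies almost everywhere with
  \<open>g - grad \<phi>\<close>.\<close>

lemma W_imp_W01px:
  assumes W: "W u g"
  shows "u \<in> W01px \<Omega> p" "AE x in M. weak_grad \<Omega> u x = g x"
proof -
  note [measurable] = W_measurable[OF W]
  have wg: "is_weak_gradient \<Omega> u g" by (rule W_is_weak_gradient[OF W])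
  show ae: "AE x in M. weak_grad \<Omega> u x = g x" by (rule weak_grad_AE_eq[OF wg])
  note [measurable] = weak_grad_AE_eq(3)[OF wg]
  have W1: "u \<in> W1px \<Omega> p"
    unfolding W1px_def using W_finite[OF W] wg nmod_cong_AE[OF ae] by (auto simp: Lpx_iff nmod_norm)
  have "\<exists>\<phi>\<in>test_functions \<Omega>. W1px_norm \<Omega> p (\<lambda>x. u x - \<phi> x) < e" if "e > 0" for e
  proof -
    \<comment> \<open>Each of the two norms will be at most \<open>\<eta>\<close>, and their sum has
      to be strictly less than \<open>e\<close>.\<close>
    define \<eta> where "\<eta> = min 1 (e / 3)"
    have \<eta>: "0 < \<eta>" "\<eta> \<le> 1" "\<eta> + \<eta> < e"
      using \<open>e > 0\<close> by (auto simp: \<eta>_def min_def)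
    have "\<eta> powr pp > 0" using \<eta> by simp
    then obtain \<phi> where \<phi>: "\<phi> \<in> test_functions \<Omega>" "nmod (\<lambda>x. u x - \<phi> x) \<le> ennreal (\<eta> powr pp)"
      "nmod (\<lambda>x. g x - grad \<phi> x) \<le> ennreal (\<eta> powr pp)"
      using W unfolding W_def by blast
    note [measurable] = test_measurable[OF \<phi>(1)]
    have wd: "is_weak_gradient \<Omega> (\<lambda>x. u x - \<phi> x) (\<lambda>x. g x - grad \<phi> x)"
      by (rule is_weak_gradient_diff[OF \<Omega>_open wg grad_is_weak_gradient[OF \<Omega>_open \<phi>(1)]])
    note [measurable] = weak_grad_AE_eq(3)[OF wd]
    have "Lpx_norm \<Omega> p (\<lambda>x. u x - \<phi> x) \<le> \<eta>"
      by (rule Lpx_norm_le[OF _ \<eta>(1,2) \<phi>(2)]) measurable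
    moreover have "Lpx_norm \<Omega> p (\<lambda>x. norm (weak_grad \<Omega> (\<lambda>x. u x - \<phi> x) x)) \<le> \<eta>"
    proof (rule Lpx_norm_le[OF _ \<eta>(1,2)])
      show "nmod (\<lambda>x. norm (weak_grad \<Omega> (\<lambda>x. u x - \<phi> x) x)) \<le> ennreal (\<eta> powr pp)"
        unfolding nmod_norm nmod_cong_AE[OF weak_grad_AE_eq(2)[OF wd]] by (rule \<phi>(3))
    qed measurable
    ultimately show ?thesis
      using \<phi>(1) \<eta>(3) by (intro bexI[of _ \<phi>]) (auto simp: W1px_norm_def)
  qed
  with W1 show "u \<in> W01px \<Omega> p"
    by (simp add: W01px_def)
qed

lemma nmod_diff_finite:
  assumes "f \<in> borel_measurable M" "g \<in> borel_measurable M" "nmod f < top" "nmod g < top"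
  shows "nmod (\<lambda>x. f x - g x) < top"
proof -
  have "nmod (\<lambda>x. f x - g x) \<le> ennreal (2 powr pp) * (nmod f + nmod g)"
    using nmod_triangle[of f "\<lambda>x. 0" g] assms nmod_minus_commute[of "\<lambda>x. 0" g] by simp
  also have "\<dots> < top"
    using assms by (auto simp: ennreal_mult_less_top)
  finally show ?thesis .
qed

lemma W01px_imp_W:
  assumes u: "u \<in> W01px \<Omega> p"
  shows "W u (weak_grad \<Omega> u)"
proof -
  obtain g where "is_weak_gradient \<Omega> u g"
    using u by (auto simp: W01px_def W1px_def)
  note wg = weak_grad_AE_eq[OF this]
  note [measurable] = wg(3)
  have um[measurable]: "u \<in> borel_measurable M" and uf: "nmod u < top" and gf: "nmod (weak_grad \<Omega> u) < top"
    using u by (auto simp: W01px_def W1px_def Lpx_iff nmod_norm)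
  show ?thesis
    unfolding W_def
  proof (intro conjI um wg(3) allI impI)
    fix e :: real assume "e > 0"
    \<comment> \<open>Closeness in norm is converted into closeness in modular only for radii up to
      one, hence the minimum.\<close>
    then have "min 1 e > 0" by simp
    then obtain \<phi> where \<phi>: "\<phi> \<in> test_functions \<Omega>" "W1px_norm \<Omega> p (\<lambda>x. u x - \<phi> x) < min 1 e"
      using u unfolding W01px_def by blast
    note [measurable] = test_measurable[OF \<phi>(1)]
    have wd: "is_weak_gradient \<Omega> (\<lambda>x. u x - \<phi> x) (\<lambda>x. weak_grad \<Omega> u x - grad \<phi> x)"
      by (rule is_weak_gradient_diff[OF \<Omega>_open wg(1) grad_is_weak_gradient[OF \<Omega>_open \<phi>(1)]])
    note [measurable] = weak_grad_AE_eq(3)[OF wd]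
    have f1: "nmod (\<lambda>x. u x - \<phi> x) < top"
      by (rule nmod_diff_finite[OF um _ uf nmod_test_finite(1)[OF \<phi>(1)]]) measurable
    have "nmod (\<lambda>x. weak_grad \<Omega> u x - grad \<phi> x) < top"
      by (rule nmod_diff_finite[OF wg(3) _ gf nmod_test_finite(2)[OF \<phi>(1)]]) measurable
    then have f2: "nmod (\<lambda>x. norm (weak_grad \<Omega> (\<lambda>x. u x - \<phi> x) x)) < top"
      unfolding nmod_norm nmod_cong_AE[OF weak_grad_AE_eq(2)[OF wd]] .
    have m2: "(\<lambda>x. norm (weak_grad \<Omega> (\<lambda>x. u x - \<phi> x) x)) \<in> borel_measurable M" "(\<lambda>x. u x - \<phi> x) \<in> borel_measurable M"
      by measurable
    have "nmod (\<lambda>x. u x - \<phi> x) \<le> ennreal (min 1 e)"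
      using \<phi>(2) Lpx_norm_nonneg[OF m2(1) f2] by (intro nmod_le_if_Lpx_norm_less[OF m2(2) f1]) (auto simp: W1px_norm_def)
    moreover have "nmod (\<lambda>x. norm (weak_grad \<Omega> (\<lambda>x. u x - \<phi> x) x)) \<le> ennreal (min 1 e)"
      using \<phi>(2) Lpx_norm_nonneg[OF m2(2) f1] by (intro nmod_le_if_Lpx_norm_less[OF m2(1) f2]) (auto simp: W1px_norm_def)
    then have "nmod (\<lambda>x. weak_grad \<Omega> u x - grad \<phi> x) \<le> ennreal (min 1 e)"
      unfolding nmod_norm nmod_cong_AE[OF weak_grad_AE_eq(2)[OF wd]] .
    moreover have "ennreal (min 1 e) \<le> ennreal e"
      by (intro ennreal_leI) simp
    ultimately show "\<exists>\<phi>\<in>test_functions \<Omega>. nmod (\<lambda>x. u x - \<phi> x) \<le> ennreal e \<and> nmod (\<lambda>x. weak_grad \<Omega> u x - grad \<phi> x) \<le> ennreal e"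
      using \<phi>(1) order_trans by blast
  qed
qed

section \<open>Sobolev embedding and compactness for the closure\<close>

lemma integrable_powr_pminus:
  fixes f :: "'a \<Rightarrow> 'b::euclidean_space"
  assumes m[measurable]: "f \<in> borel_measurable M" and fin: "nmod f < top"
  shows "integrable M (\<lambda>x. norm (f x) powr pm)"
proof (rule Bochner_Integration.integrable_bound)
  show "integrable M (\<lambda>x. 1 + norm (f x) powr p x)"
    by (intro Bochner_Integration.integrable_add integrable_const nmod_finiteD m fin)
  show "AE x in M. norm (norm (f x) powr pm) \<le> norm (1 + norm (f x) powr p x)"
  proof (rule AE_I2)
    fix x assume x: "x \<in> space M"
    show "norm (norm (f x) powr pm) \<le> norm (1 + norm (f x) powr p x)"
      using powr_le_interpolate[of "norm (f x)" 1 pm "p x" pp] p_bounds[OF x] pm_gt_1 by simp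
  qed
qed simp

lemma integral_powr_pminus_triangle:
  fixes f g :: "'a \<Rightarrow> 'b::euclidean_space"
  assumes "f \<in> borel_measurable M" "g \<in> borel_measurable M" "nmod f < top" "nmod g < top"
  shows "(LINT x|M. norm (f x + g x) powr pm) \<le> 2 powr pm * ((LINT x|M. norm (f x) powr pm) + (LINT x|M. norm (g x) powr pm))"
proof -
  have "nmod (\<lambda>x. f x + g x) < top"
    using nmod_add_le[OF assms(1,2)] assms(3,4) by (auto simp: ennreal_mult_less_top intro: le_less_trans)
  then have i: "integrable M (\<lambda>x. norm (f x + g x) powr pm)" "integrable M (\<lambda>x. norm (f x) powr pm)" "integrable M (\<lambda>x. norm (g x) powr pm)"
    using assms by (auto intro!: integrable_powr_pminus)
  have "(LINT x|M. norm (f x + g x) powr pm) \<le> (LINT x|M. 2 powr pm * (norm (f x) powr pm + norm (g x) powr pm))"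
  proof (rule integral_mono)
    fix x
    have "norm (f x + g x) powr pm \<le> (norm (f x) + norm (g x)) powr pm"
      using pm_gt_1 by (intro powr_mono2 norm_triangle_ineq) auto
    also have "\<dots> \<le> 2 powr pm * (norm (f x) powr pm + norm (g x) powr pm)"
      using pm_gt_1 by (intro powr_add_le) auto
    finally show "norm (f x + g x) powr pm \<le> 2 powr pm * (norm (f x) powr pm + norm (g x) powr pm)" .
  qed (use i in auto)
  also have "\<dots> = 2 powr pm * ((LINT x|M. norm (f x) powr pm) + (LINT x|M. norm (g x) powr pm))"
    using i by simp
  finally show ?thesis .
qed

lemma nmod_tendsto_0_imp_pminus:
  fixes f :: "nat \<Rightarrow> 'a \<Rightarrow> 'b::euclidean_space"
  assumes m[measurable]: "\<And>n. f n \<in> borel_measurable M" and lim: "(\<lambda>n. nmod (f n)) \<longlonglongrightarrow> 0" and e: "e > 0"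
    and fin: "\<And>n. nmod (f n) < top"
  shows "\<forall>\<^sub>F n in sequentially. (LINT x|M. norm (f n x) powr pm) \<le> e"
proof -
  have "(\<lambda>n. \<integral>\<^sup>+x. ennreal (norm (f n x) powr pm) \<partial>M) \<longlonglongrightarrow> 0"
  proof (rule nn_powr_tendsto_0_lower[where r = p and R = pp])
    show "(\<lambda>n. \<integral>\<^sup>+x. ennreal (norm (f n x) powr p x) \<partial>M) \<longlonglongrightarrow> 0"
      using lim by (simp add: nmod_def)
    show "1 \<le> pm \<and> pm \<le> p x \<and> p x \<le> pp" if "x \<in> space M" for x
      using p_bounds[OF that] pm_gt_1 by auto
  qed measurable
  then have "\<forall>\<^sub>F n in sequentially. (\<integral>\<^sup>+x. ennreal (norm (f n x) powr pm) \<partial>M) \<le> ennreal e"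
    using e by (simp add: ennreal_tendsto_0_iff)
  then show ?thesis
    by (rule eventually_mono) (use e in \<open>simp add: nn_integral_eq_integral[OF integrable_powr_pminus[OF m fin]]\<close>)
qed

lemma W_diff:
  assumes "W u g" "W v h"
  shows "W (\<lambda>x. u x - v x) (\<lambda>x. g x - h x)"
  using W_add[OF assms, of "-1"] by simp

text \<open>The summand \<open>d\<close> only spares the passage to the limit on the right-hand side.\<close>

lemma W_sobolev:
  assumes q: "pm \<le> q" "q * (real DIM('a) - pm) < real DIM('a) * pm"
  obtains C where "C > 0"
    "\<And>u g d. \<lbrakk>W u g; d > 0\<rbrakk> \<Longrightarrow> (\<integral>\<^sup>+x. ennreal (\<bar>u x\<bar> powr q) \<partial>M) \<le> ennreal (C * ((LINT x|M. norm (g x) powr pm) + d) powr (q / pm))"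
proof -
  have "1 \<le> pm" using pm_gt_1 by simp
  obtain C where C: "C > 0"
    "\<And>\<phi>. \<phi> \<in> test_functions \<Omega> \<Longrightarrow> (\<integral>\<^sup>+x. ennreal (\<bar>\<phi> x\<bar> powr q) \<partial>lborel)
       \<le> ennreal (C * (LINT x|lborel. norm (grad \<phi> x) powr pm) powr (q / pm))"
    by (rule sobolev_test_functions[OF \<Omega>_bounded \<open>1 \<le> pm\<close> q], rule that)
  show thesis
  proof
    \<comment> \<open>The factor comes from the triangle inequality between \<open>g\<close> and the
      gradients of the approximating test functions, raised to the power
      \<open>q / pm\<close>.\<close>
    let ?K = "(2 powr pm) powr (q / pm)"
    show "C * ?K > 0" using C by simp
    fix u g and d :: real assume W: "W u g" and d: "d > 0"
    note [measurable] = W_measurable[OF W]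
    obtain \<phi> where \<phi>: "\<And>n. \<phi> n \<in> test_functions \<Omega>" "(\<lambda>n. nmod (\<lambda>x. u x - \<phi> n x)) \<longlonglongrightarrow> 0"
      "(\<lambda>n. nmod (\<lambda>x. g x - grad (\<phi> n) x)) \<longlonglongrightarrow> 0"
      by (rule W_sequence[OF W], rule that)
    note [measurable] = test_measurable[OF \<phi>(1)]
    note Wd = W_diff[OF W W_test[OF \<phi>(1)]]
    have "(\<lambda>n. \<integral>\<^sup>+x. ennreal (norm (\<phi> n x - u x)) \<partial>M) \<longlonglongrightarrow> 0"
      using nmod_tendsto_0_imp_L1[of "\<lambda>n x. u x - \<phi> n x"] \<phi>(2) by (simp add: abs_minus_commute)
    then obtain r where r: "strict_mono (r :: nat \<Rightarrow> nat)" "AE x in M. (\<lambda>n. \<phi> (r n) x) \<longlonglongrightarrow> u x"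
      by (rule L1_tendsto_imp_AE_subseq[rotated 2, OF _ that]) (use W_integrable[OF W] W_integrable[OF W_test[OF \<phi>(1)]] in auto)
    let ?I = "LINT x|M. norm (g x) powr pm"
    have "\<forall>\<^sub>F n in sequentially. (LINT x|M. norm (g x - grad (\<phi> n) x) powr pm) \<le> d"
      by (rule nmod_tendsto_0_imp_pminus[OF _ \<phi>(3) d W_finite(2)[OF Wd]]) measurable
    then have "\<forall>\<^sub>F n in sequentially. (LINT x|M. norm (g x - grad (\<phi> (r n)) x) powr pm) \<le> d"
      by (rule eventually_subseq[OF r(1)])
    then have bound: "\<forall>\<^sub>F n in sequentially. (\<integral>\<^sup>+x. ennreal (\<bar>\<phi> (r n) x\<bar> powr q) \<partial>M) \<le> ennreal (C * ?K * (?I + d) powr (q / pm))"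
    proof eventually_elim
      case (elim n)
      have "(LINT x|M. norm (g x + (grad (\<phi> (r n)) x - g x)) powr pm) \<le> 2 powr pm * (?I + (LINT x|M. norm (grad (\<phi> (r n)) x - g x) powr pm))"
        using W_finite(2)[OF W] W_finite(2)[OF Wd] nmod_minus_commute[of g] by (intro integral_powr_pminus_triangle) auto
      also have "\<dots> \<le> 2 powr pm * (?I + d)"
        using elim by (intro mult_left_mono add_left_mono) (auto simp: norm_minus_commute)
      finally have le: "(LINT x|lborel. norm (grad (\<phi> (r n)) x) powr pm) \<le> 2 powr pm * (?I + d)"
        using test_function_zero_outside[OF \<phi>(1)] test_function_measurable[OF \<phi>(1)]
        by (simp add: integral_lebesgue_on_eq_lborel(1)[OF \<Omega>_sets, symmetric])
      have "(\<integral>\<^sup>+x. ennreal (\<bar>\<phi> (r n) x\<bar> powr q) \<partial>M) = (\<integral>\<^sup>+x. ennreal (\<bar>\<phi> (r n) x\<bar> powr q) \<partial>lborel)"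
        using test_function_zero_outside[OF \<phi>(1)] by (intro nn_integral_lebesgue_on_eq_lborel[OF \<Omega>_sets]) simp
      also have "\<dots> \<le> ennreal (C * (LINT x|lborel. norm (grad (\<phi> (r n)) x) powr pm) powr (q / pm))"
        by (rule C(2)[OF \<phi>(1)])
      also have "\<dots> \<le> ennreal (C * (2 powr pm * (?I + d)) powr (q / pm))"
        using le C(1) q pm_gt_1 by (intro ennreal_leI mult_left_mono powr_mono2) auto
      also have "\<dots> = ennreal (C * ?K * (?I + d) powr (q / pm))"
        using d by (simp add: powr_mult mult.assoc)
      finally show ?case .
    qed
    show "(\<integral>\<^sup>+x. ennreal (\<bar>u x\<bar> powr q) \<partial>M) \<le> ennreal (C * ?K * (?I + d) powr (q / pm))"
    proof (rule nn_integral_fatou_AE[OF _ _ bound])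
      show "AE x in M. (\<lambda>n. ennreal (\<bar>\<phi> (r n) x\<bar> powr q)) \<longlonglongrightarrow> ennreal (\<bar>u x\<bar> powr q)"
        using r(2)
      proof eventually_elim
        case (elim x)
        then show ?case
          using q pm_gt_1 by (intro tendsto_ennrealI tendsto_powr' tendsto_intros) auto
      qed
    qed measurable
  qed
qed

end

lemma ennreal_tendsto_0D:
  fixes f :: "'a \<Rightarrow> ennreal"
  shows "\<lbrakk>(f \<longlongrightarrow> 0) F; 0 < e\<rbrakk> \<Longrightarrow> \<forall>\<^sub>F x in F. f x \<le> ennreal e"
  by (simp add: ennreal_tendsto_0_iff)

lemma L1_Cauchy_limit:
  fixes f :: "nat \<Rightarrow> 'a \<Rightarrow> real"
  assumes int: "\<And>n. integrable M (f n)"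
    and cauchy: "\<And>e. e > 0 \<Longrightarrow> \<exists>N. \<forall>i\<ge>N. \<forall>j\<ge>N. (\<integral>x. \<bar>f i x - f j x\<bar> \<partial>M) < e"
  obtains g where "integrable M g" "(\<lambda>n. \<integral>\<^sup>+x. ennreal \<bar>f n x - g x\<bar> \<partial>M) \<longlonglongrightarrow> 0"
proof -
  note [measurable] = borel_measurable_integrable[OF int]
  obtain r where r: "strict_mono r" "AE x in M. Cauchy (\<lambda>i. f (r i) x)"
    by (rule cauchy_L1_AE_cauchy_subseq[OF int, rotated], rule that) (use cauchy in auto)
  define g where "g x = lim (\<lambda>i. f (r i) x)" for x
  have [measurable]: "g \<in> borel_measurable M"
    unfolding g_def by measurable
  have lim: "AE x in M. (\<lambda>i. f (r i) x) \<longlonglongrightarrow> g x"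
    using r(2) by eventually_elim (simp add: g_def Cauchy_convergent_iff convergent_LIMSEQ_iff)
  have conv: "(\<lambda>n. \<integral>\<^sup>+x. ennreal \<bar>f n x - g x\<bar> \<partial>M) \<longlonglongrightarrow> 0"
    unfolding ennreal_tendsto_0_iff
  proof (intro allI impI)
    fix e :: real assume "e > 0"
    then obtain N where N: "\<And>i j. i \<ge> N \<Longrightarrow> j \<ge> N \<Longrightarrow> (\<integral>x. \<bar>f i x - f j x\<bar> \<partial>M) < e"
      using cauchy by blast
    have "(\<integral>\<^sup>+x. ennreal \<bar>f n x - g x\<bar> \<partial>M) \<le> ennreal e" if "N \<le> n" for n
    proof (rule nn_integral_fatou_AE)
      show "AE x in M. (\<lambda>k. ennreal \<bar>f n x - f (r k) x\<bar>) \<longlonglongrightarrow> ennreal \<bar>f n x - g x\<bar>"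
        using lim by eventually_elim (intro tendsto_ennrealI tendsto_intros)
      show "\<forall>\<^sub>F k in sequentially. (\<integral>\<^sup>+x. ennreal \<bar>f n x - f (r k) x\<bar> \<partial>M) \<le> ennreal e"
        using eventually_ge_at_top[of N]
      proof eventually_elim
        case (elim k)
        then have "(\<integral>x. \<bar>f n x - f (r k) x\<bar> \<partial>M) < e"
          using N[OF that, of "r k"] seq_suble[OF r(1), of k] by simp
        then show ?case
          using int by (subst nn_integral_eq_integral) (auto intro!: ennreal_leI integrable_abs)
      qed
    qed measurable
    then show "\<forall>\<^sub>F n in sequentially. (\<integral>\<^sup>+x. ennreal \<bar>f n x - g x\<bar> \<partial>M) \<le> ennreal e"
      by (rule eventually_sequentiallyI)
  qed
  then have "\<forall>\<^sub>F n in sequentially. (\<integral>\<^sup>+x. ennreal \<bar>f n x - g x\<bar> \<partial>M) \<le> ennreal 1"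
    by (rule ennreal_tendsto_0D) simp
  then obtain n where n: "(\<integral>\<^sup>+x. ennreal \<bar>f n x - g x\<bar> \<partial>M) \<le> ennreal 1"
    by (auto simp: eventually_sequentially)
  have "integrable M (\<lambda>x. f n x - g x)"
    unfolding integrable_iff_bounded using n by (auto intro: le_less_trans)
  from Bochner_Integration.integrable_diff[OF int this, of n]
  have "integrable M g"
    by simp
  then show thesis
    using conv by (rule that)
qed

context variable_sobolev
begin

text \<open>Test functions within \<open>1 / (n + 1)\<close> of \<open>u n\<close> inherit the L^1
  bound on the gradients, up to one, from some index \<open>N\<close> on, and an L^1 limit of them
  is a limit of \<open>u\<close> along the same subsequence. Nothing is claimed yet about the weak
  gradient of the limit.\<close>

lemma W_rellich:
  assumes W: "\<And>n. W (u n) (g n)" and K: "\<And>n. (LINT x|M. norm (g n x)) \<le> K"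
  obtains r v where "strict_mono (r :: nat \<Rightarrow> nat)" "integrable M v"
    "(\<lambda>n. \<integral>\<^sup>+x. ennreal \<bar>u (r n) x - v x\<bar> \<partial>M) \<longlonglongrightarrow> 0"
proof -
  note [measurable] = W_measurable[OF W]
  have "\<forall>n. \<exists>\<phi>\<in>test_functions \<Omega>. nmod (\<lambda>x. u n x - \<phi> x) \<le> ennreal (1 / real (Suc n)) \<and> nmod (\<lambda>x. g n x - grad \<phi> x) \<le> ennreal (1 / real (Suc n))"
    using W by (simp add: W_def)
  then obtain \<phi> where \<phi>: "\<And>n. \<phi> n \<in> test_functions \<Omega>"
    "\<And>n. nmod (\<lambda>x. u n x - \<phi> n x) \<le> ennreal (1 / real (Suc n))" "\<And>n. nmod (\<lambda>x. g n x - grad (\<phi> n) x) \<le> ennreal (1 / real (Suc n))"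
    by metis
  note [measurable] = test_measurable[OF \<phi>(1)]
  have "(\<lambda>n. ennreal (1 / real (Suc n))) \<longlonglongrightarrow> ennreal 0"
    by (intro tendsto_ennrealI LIMSEQ_Suc[OF lim_1_over_n])
  then have inv: "(\<lambda>n. ennreal (1 / real (Suc n))) \<longlonglongrightarrow> 0"
    by simp
  have nm: "(\<lambda>n. nmod (\<lambda>x. u n x - \<phi> n x)) \<longlonglongrightarrow> 0" "(\<lambda>n. nmod (\<lambda>x. g n x - grad (\<phi> n) x)) \<longlonglongrightarrow> 0"
    by (rule tendsto_sandwich[OF _ _ tendsto_const inv]; use \<phi> in simp)+
  have L1: "(\<lambda>n. \<integral>\<^sup>+x. ennreal (norm (u n x - \<phi> n x)) \<partial>M) \<longlonglongrightarrow> 0" "(\<lambda>n. \<integral>\<^sup>+x. ennreal (norm (g n x - grad (\<phi> n) x)) \<partial>M) \<longlonglongrightarrow> 0"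
    by (rule nmod_tendsto_0_imp_L1[OF _ nm(1)], measurable, rule nmod_tendsto_0_imp_L1[OF _ nm(2)], measurable)
  have "\<forall>\<^sub>F n in sequentially. (\<integral>\<^sup>+x. ennreal (norm (g n x - grad (\<phi> n) x)) \<partial>M) \<le> ennreal 1"
    by (rule ennreal_tendsto_0D[OF L1(2)]) simp
  then obtain N where N: "\<And>n. n \<ge> N \<Longrightarrow> (\<integral>\<^sup>+x. ennreal (norm (g n x - grad (\<phi> n) x)) \<partial>M) \<le> ennreal 1"
    by (auto simp: eventually_sequentially)
  note iW = W_integrable[OF W] and i\<phi> = W_integrable[OF W_test[OF \<phi>(1)]]
  have gb: "(LINT x|lborel. norm (grad (\<phi> (n + N)) x)) \<le> K + 1" for n
  proof -
    let ?n = "n + N"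
    have "(LINT x|M. norm (g ?n x - grad (\<phi> ?n) x)) \<le> 1"
    proof -
      have "integrable M (\<lambda>x. norm (g ?n x - grad (\<phi> ?n) x))"
        by (intro integrable_norm Bochner_Integration.integrable_diff iW i\<phi>)
      then show ?thesis
        using N[of ?n] by (simp add: nn_integral_eq_integral)
    qed
    moreover have "(LINT x|M. norm (grad (\<phi> ?n) x)) \<le> (LINT x|M. norm (g ?n x) + norm (g ?n x - grad (\<phi> ?n) x))"
    proof (rule integral_mono)
      show "norm (grad (\<phi> ?n) x) \<le> norm (g ?n x) + norm (g ?n x - grad (\<phi> ?n) x)" for x
        using norm_triangle_ineq4[of "g ?n x" "g ?n x - grad (\<phi> ?n) x"] by simp
    qed (intro Bochner_Integration.integrable_add integrable_norm Bochner_Integration.integrable_diff iW i\<phi>)+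
    moreover have "\<dots> = (LINT x|M. norm (g ?n x)) + (LINT x|M. norm (g ?n x - grad (\<phi> ?n) x))"
      by (intro Bochner_Integration.integral_add integrable_norm Bochner_Integration.integrable_diff iW i\<phi>)
    moreover have "(LINT x|M. norm (grad (\<phi> ?n) x)) = (LINT x|lborel. norm (grad (\<phi> ?n) x))"
      using test_function_zero_outside[OF \<phi>(1)] test_function_measurable[OF \<phi>(1)]
      by (intro integral_lebesgue_on_eq_lborel(1)[OF \<Omega>_sets]) auto
    ultimately show ?thesis
      using K[of ?n] by linarith
  qed
  obtain r where r: "strict_mono (r :: nat \<Rightarrow> nat)"
    and rc: "\<And>e. e > 0 \<Longrightarrow> \<exists>M. \<forall>i\<ge>M. \<forall>j\<ge>M. (LINT x|lborel. \<bar>\<phi> (r i + N) x - \<phi> (r j + N) x\<bar>) < e"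
    by (rule rellich_test_functions[where \<phi> = "\<lambda>n. \<phi> (n + N)", OF \<Omega>_bounded \<phi>(1) gb], rule that)
  define s where "s n = r n + N" for n
  have s: "strict_mono s"
    using r by (simp add: s_def strict_mono_def)
  have c: "\<exists>N. \<forall>i\<ge>N. \<forall>j\<ge>N. (\<integral>x. \<bar>\<phi> (s i) x - \<phi> (s j) x\<bar> \<partial>M) < e" if "e > 0" for e
  proof -
    have "(LINT x|M. \<bar>\<phi> (s i) x - \<phi> (s j) x\<bar>) = (LINT x|lborel. \<bar>\<phi> (s i) x - \<phi> (s j) x\<bar>)" for i j
      using test_function_zero_outside[OF \<phi>(1)] test_function_measurable[OF \<phi>(1)]
      by (intro integral_lebesgue_on_eq_lborel(1)[OF \<Omega>_sets]) auto
    then show ?thesis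
      using rc[OF that] by (simp add: s_def)
  qed
  obtain v where v: "integrable M v" "(\<lambda>n. \<integral>\<^sup>+x. ennreal \<bar>\<phi> (s n) x - v x\<bar> \<partial>M) \<longlonglongrightarrow> 0"
    by (rule L1_Cauchy_limit[OF i\<phi>(1) c], assumption, rule that)
  note [measurable] = borel_measurable_integrable[OF v(1)]
  have "(\<lambda>n. \<integral>\<^sup>+x. ennreal \<bar>u (s n) x - v x\<bar> \<partial>M) \<longlonglongrightarrow> 0"
  proof (rule tendsto_sandwich[OF _ _ tendsto_const])
    have "(\<lambda>n. \<integral>\<^sup>+x. ennreal (norm (u (s n) x - \<phi> (s n) x)) \<partial>M) \<longlonglongrightarrow> 0"
      using LIMSEQ_subseq_LIMSEQ[OF L1(1) s] by (simp add: o_def)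
    from tendsto_add[OF this v(2)]
    show "(\<lambda>n. (\<integral>\<^sup>+x. ennreal (norm (u (s n) x - \<phi> (s n) x)) \<partial>M) + (\<integral>\<^sup>+x. ennreal \<bar>\<phi> (s n) x - v x\<bar> \<partial>M)) \<longlonglongrightarrow> 0"
      by simp
    show "\<forall>\<^sub>F n in sequentially. (\<integral>\<^sup>+x. ennreal \<bar>u (s n) x - v x\<bar> \<partial>M) \<le>
        (\<integral>\<^sup>+x. ennreal (norm (u (s n) x - \<phi> (s n) x)) \<partial>M) + (\<integral>\<^sup>+x. ennreal \<bar>\<phi> (s n) x - v x\<bar> \<partial>M)"
    proof (intro always_eventually allI)
      fix n
      have "(\<integral>\<^sup>+x. ennreal \<bar>u (s n) x - v x\<bar> \<partial>M) \<le> (\<integral>\<^sup>+x. ennreal (norm (u (s n) x - \<phi> (s n) x)) + ennreal \<bar>\<phi> (s n) x - v x\<bar> \<partial>M)"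
        by (intro nn_integral_mono) (simp flip: ennreal_plus add: ennreal_leI)
      also have "\<dots> = (\<integral>\<^sup>+x. ennreal (norm (u (s n) x - \<phi> (s n) x)) \<partial>M) + (\<integral>\<^sup>+x. ennreal \<bar>\<phi> (s n) x - v x\<bar> \<partial>M)"
        by (rule nn_integral_add) measurable
      finally show "(\<integral>\<^sup>+x. ennreal \<bar>u (s n) x - v x\<bar> \<partial>M) \<le> \<dots>" .
    qed
  qed simp
  then show thesis
    using that[OF s v(1)] by simp
qed

lemma nmod_tendsto_0_if_powr:
  fixes f :: "nat \<Rightarrow> 'a \<Rightarrow> real"
  assumes [measurable]: "\<And>n. f n \<in> borel_measurable M" and q: "pp \<le> q"
    and lim: "(\<lambda>n. \<integral>\<^sup>+x. ennreal (\<bar>f n x\<bar> powr q) \<partial>M) \<longlonglongrightarrow> 0"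
  shows "(\<lambda>n. nmod (f n)) \<longlonglongrightarrow> 0"
  unfolding nmod_def
proof (rule nn_powr_tendsto_0_lower[where r = "\<lambda>_. q" and R = q])
  show "1 \<le> p x \<and> p x \<le> q \<and> q \<le> q" if "x \<in> space M" for x
    using p_pos[OF that] p_bounds[OF that] q by simp
qed (use lim in simp_all)

text \<open>Weak lower semicontinuity without weak convergence: nearly minimising the energy among the
  functions in small \<open>L\<^sup>1\<close>-neighbourhoods of the limit yields a sequence that converges strongly,
  by uniform convexity.\<close>

lemma W_energy_lsc:
  assumes q: "pp \<le> q" "q * (real DIM('a) - pm) < real DIM('a) * pm"
    and W: "\<And>n. W (u n) (g n)" and v: "integrable M v"
    and L1: "(\<lambda>n. \<integral>\<^sup>+x. ennreal \<bar>u n x - v x\<bar> \<partial>M) \<longlonglongrightarrow> 0"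
    and D: "(\<lambda>n. energy (g n)) \<longlonglongrightarrow> D"
  obtains h where "W v h" "energy h \<le> D"
proof -
  note [measurable] = W_measurable[OF W] borel_measurable_integrable[OF v]
  define \<epsilon> where "\<epsilon> m = 1 / real (Suc m)" for m
  have \<epsilon>: "\<epsilon> m > 0" for m by (simp add: \<epsilon>_def)
  have \<epsilon>mono: "\<epsilon> m \<le> \<epsilon> n" if "n \<le> m" for m n
    using that by (simp add: \<epsilon>_def frac_le)
  have \<epsilon>0: "\<epsilon> \<longlonglongrightarrow> 0"
    unfolding \<epsilon>_def by (rule LIMSEQ_Suc[OF lim_1_over_n])
  \<comment> \<open>Competitors at L^1 distance at most \<open>\<epsilon> m\<close> from
    \<open>v\<close>. These sets are convex and decrease with \<open>m\<close>, and the given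
    sequence eventually enters each of them.\<close>
  define C where "C m = {(w, h). W w h \<and> (\<integral>\<^sup>+x. ennreal \<bar>w x - v x\<bar> \<partial>M) \<le> ennreal (\<epsilon> m)}" for m
  define E where "E m = (\<lambda>(w, h). energy h) ` C m" for m
  have Enn: "0 \<le> e" if "e \<in> E m" for e m
    using that by (auto simp: E_def C_def intro!: energy_bounds(3)[OF W_measurable(2) W_finite(2)])
  then have Ebdd: "bdd_below (E m)" for m
    by (rule bdd_belowI)
  have evC: "\<forall>\<^sub>F n in sequentially. (u n, g n) \<in> C m" for m
  proof -
    have "\<forall>\<^sub>F n in sequentially. (\<integral>\<^sup>+x. ennreal \<bar>u n x - v x\<bar> \<partial>M) \<le> ennreal (\<epsilon> m)"
      using L1 \<epsilon>[of m] by (simp add: ennreal_tendsto_0_iff)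
    then show ?thesis
      by (rule eventually_mono) (use W in \<open>simp add: C_def\<close>)
  qed
  then have Ene: "E m \<noteq> {}" for m
    unfolding E_def using eventually_happens[OF evC[of m]] by auto
  \<comment> \<open>The infima increase with \<open>m\<close> because the sets shrink, and they are
    at most \<open>D\<close>. Their convergence is what makes the midpoint defects vanish.\<close>
  define d where "d m = Inf (E m)" for m
  have dle: "d m \<le> energy h" if "(w, h) \<in> C m" for m w h
    unfolding d_def using that by (intro cInf_lower Ebdd) (force simp: E_def)
  have dD: "d m \<le> D" for m
  proof (rule tendsto_lowerbound[OF D])
    show "\<forall>\<^sub>F n in sequentially. d m \<le> energy (g n)"
      using evC[of m] by (rule eventually_mono) (rule dle)
  qed simp
  have Cmono: "C m \<subseteq> C n" if "n \<le> m" for m n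
    using \<epsilon>mono[OF that] by (auto simp: C_def intro: order_trans ennreal_leI)
  have dmono: "d n \<le> d m" if "n \<le> m" for m n
    unfolding d_def using Cmono[OF that] by (intro cInf_superset_mono Ene Ebdd) (auto simp: E_def)
  have "incseq d"
    by (simp add: incseq_def dmono)
  then obtain L where L: "d \<longlonglongrightarrow> L" "\<And>i. d i \<le> L"
    using incseq_convergent[of d D] dD by blast
  have "\<exists>w h. (w, h) \<in> C m \<and> energy h < d m + \<epsilon> m" for m
  proof -
    have "Inf (E m) < d m + \<epsilon> m"
      using \<epsilon>[of m] by (simp add: d_def)
    then obtain e where "e \<in> E m" "e < d m + \<epsilon> m"
      using cInf_lessD[OF Ene] by blast
    then show ?thesis
      by (auto simp: E_def)
  qed
  then obtain w h where wh: "\<And>m. (w m, h m) \<in> C m" "\<And>m. energy (h m) < d m + \<epsilon> m"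
    by metis
  have Wwh: "W (w m) (h m)" and wL1: "(\<integral>\<^sup>+x. ennreal \<bar>w m x - v x\<bar> \<partial>M) \<le> ennreal (\<epsilon> m)" for m
    using wh(1)[of m] by (auto simp: C_def)
  note [measurable] = W_measurable[OF Wwh]
  have wlim: "(\<lambda>m. \<integral>\<^sup>+x. ennreal \<bar>w m x - v x\<bar> \<partial>M) \<longlonglongrightarrow> 0"
  proof (rule tendsto_sandwich[OF _ _ tendsto_const])
    have "(\<lambda>m. ennreal (\<epsilon> m)) \<longlonglongrightarrow> ennreal 0"
      by (intro tendsto_ennrealI \<epsilon>0)
    then show "(\<lambda>m. ennreal (\<epsilon> m)) \<longlonglongrightarrow> 0" by simp
  qed (use wL1 in auto)
  \<comment> \<open>Convexity of the L^1 ball: the midpoint is again a competitor, so its energy is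
    at least \<open>d N\<close>.\<close>
  have mid: "(\<lambda>x. (1/2) *\<^sub>R (w i x + w j x), \<lambda>x. (1/2) *\<^sub>R (h i x + h j x)) \<in> C N" if ij: "N \<le> i" "N \<le> j" for i j N
  proof -
    have "W (\<lambda>x. 0 + (1/2) * (w i x + 1 * w j x)) (\<lambda>x. 0 + (1/2) *\<^sub>R (h i x + 1 *\<^sub>R h j x))"
      by (intro W_add Wwh) (use W_add[OF Wwh[of 0] Wwh[of 0], of "-1"] in simp)
    then have "W (\<lambda>x. (1/2) *\<^sub>R (w i x + w j x)) (\<lambda>x. (1/2) *\<^sub>R (h i x + h j x))"
      by simp
    moreover have "(\<integral>\<^sup>+x. ennreal \<bar>(1/2) *\<^sub>R (w i x + w j x) - v x\<bar> \<partial>M) \<le>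
        (\<integral>\<^sup>+x. ennreal (1/2) * (ennreal \<bar>w i x - v x\<bar> + ennreal \<bar>w j x - v x\<bar>) \<partial>M)"
    proof (rule nn_integral_mono)
      fix x
      have "\<bar>(1/2) *\<^sub>R (w i x + w j x) - v x\<bar> \<le> (1/2) * (\<bar>w i x - v x\<bar> + \<bar>w j x - v x\<bar>)"
      proof -
        have "(1/2) *\<^sub>R (w i x + w j x) - v x = (1/2) * ((w i x - v x) + (w j x - v x))"
          by (simp add: field_simps)
        then show ?thesis
          using abs_triangle_ineq[of "w i x - v x" "w j x - v x"] by (simp only: abs_mult) simp
      qed
      then show "ennreal \<bar>(1/2) *\<^sub>R (w i x + w j x) - v x\<bar> \<le> ennreal (1/2) * (ennreal \<bar>w i x - v x\<bar> + ennreal \<bar>w j x - v x\<bar>)"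
        by (subst ennreal_plus[symmetric], simp, simp, subst ennreal_mult[symmetric]) (auto intro: ennreal_leI)
    qed
    moreover have "\<dots> = ennreal (1/2) * ((\<integral>\<^sup>+x. ennreal \<bar>w i x - v x\<bar> \<partial>M) + (\<integral>\<^sup>+x. ennreal \<bar>w j x - v x\<bar> \<partial>M))"
      by (simp add: nn_integral_cmult nn_integral_add)
    moreover have "\<dots> \<le> ennreal (1/2) * (ennreal (\<epsilon> N) + ennreal (\<epsilon> N))"
      by (intro mult_left_mono add_mono order_trans[OF wL1] ennreal_leI \<epsilon>mono ij) simp
    moreover have "\<dots> = ennreal (\<epsilon> N)"
    proof -
      have "ennreal (\<epsilon> N) + ennreal (\<epsilon> N) = ennreal (2 * \<epsilon> N)"
        using \<epsilon>[of N] by (simp flip: ennreal_plus)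
      moreover have "ennreal (1/2) * ennreal (2 * \<epsilon> N) = ennreal ((1/2) * (2 * \<epsilon> N))"
        by (rule ennreal_mult[symmetric]) (use \<epsilon>[of N] in \<open>simp_all add: less_imp_le\<close>)
      ultimately show ?thesis
        by (metis mult.assoc mult_1 field_sum_of_halves nonzero_mult_div_cancel_left times_divide_eq_left zero_neq_numeral)
    qed
    ultimately show ?thesis
      by (simp add: C_def)
  qed
  have cauchy: "\<exists>N. \<forall>i\<ge>N. \<forall>j\<ge>N. nmod (\<lambda>x. h i x - h j x) \<le> ennreal e" if "e > 0" for e
  proof (rule nmod_Cauchy_if_energy_gap_vanishes[OF _ _ _ _ that])
    show "h n \<in> borel_measurable M" "nmod (h n) < top" for n
      using W_finite[OF Wwh] by auto
    show "energy (h n) \<le> D + 1" for n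
    proof -
      have "\<epsilon> n \<le> 1" by (simp add: \<epsilon>_def)
      then show ?thesis using wh(2)[of n] dD[of n] by linarith
    qed
    fix e :: real assume e: "e > 0"
    \<comment> \<open>The midpoint defect of two near-minimisers with indices beyond
      \<open>N\<close> is at most \<open>L + \<epsilon> N - d N\<close>.\<close>
    have "\<forall>\<^sub>F N in sequentially. L + \<epsilon> N - d N < e"
    proof (rule order_tendstoD(2))
      show "(\<lambda>N. L + \<epsilon> N - d N) \<longlonglongrightarrow> L + 0 - L"
        by (intro tendsto_intros \<epsilon>0 L)
    qed (use e in simp)
    then obtain N where N: "L + \<epsilon> N - d N < e"
      by (auto dest: eventually_happens)
    have "(energy (h i) + energy (h j)) / 2 - energy (\<lambda>x. (1/2) *\<^sub>R (h i x + h j x)) \<le> e" if ij: "N \<le> i" "N \<le> j" for i j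
      using dle[OF mid[OF ij]] wh(2)[of i] wh(2)[of j] \<epsilon>mono[OF ij(1)] \<epsilon>mono[OF ij(2)] L(2)[of i] L(2)[of j] N
      by (simp add: field_simps)
    then show "\<exists>N. \<forall>i\<ge>N. \<forall>j\<ge>N. (energy (h i) + energy (h j)) / 2 - energy (\<lambda>x. (1/2) *\<^sub>R (h i x + h j x)) \<le> e"
      by blast
  qed
  obtain k where k: "k \<in> borel_measurable M" "(\<lambda>n. nmod (\<lambda>x. h n x - k x)) \<longlonglongrightarrow> 0" "nmod k < top"
    by (rule nmod_complete[OF W_measurable(2)[OF Wwh] W_finite(2)[OF Wwh] cauchy], assumption, rule that)
  note [measurable] = k(1)
  have fink: "nmod (\<lambda>x. h n x - k x) < top" for n
    by (rule nmod_diff_finite[OF _ k(1) W_finite(2)[OF Wwh] k(3)]) measurable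
  have qm: "pm \<le> q" using q(1) pm_le_pp by simp
  obtain S where S: "S > 0"
    "\<And>u g d. \<lbrakk>W u g; d > 0\<rbrakk> \<Longrightarrow> (\<integral>\<^sup>+x. ennreal (\<bar>u x\<bar> powr q) \<partial>M) \<le> ennreal (S * ((LINT x|M. norm (g x) powr pm) + d) powr (q / pm))"
    by (rule W_sobolev[OF qm q(2)], rule that)
  obtain r where r: "strict_mono (r :: nat \<Rightarrow> nat)" "AE x in M. (\<lambda>n. w (r n) x) \<longlonglongrightarrow> v x"
    by (rule L1_tendsto_imp_AE_subseq[OF W_integrable(1)[OF Wwh] v], use wlim in simp, rule that)
  \<comment> \<open>So far the functions converge only in L^1. The Sobolev inequality for
    \<open>w n - w (r i)\<close>, whose gradients are Cauchy, and Fatou's lemma in \<open>i\<close>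
    improve this to L^q; \<open>pp \<le> q\<close> then gives modular convergence.\<close>
  have wq: "(\<lambda>n. \<integral>\<^sup>+x. ennreal (\<bar>w n x - v x\<bar> powr q) \<partial>M) \<longlonglongrightarrow> 0"
    unfolding ennreal_tendsto_0_iff
  proof (intro allI impI)
    fix e :: real assume e: "e > 0"
    have qp: "q / pm > 0" using qm pm_gt_1 by simp
    have "((\<lambda>d::real. S * (2 powr pm * (d + d) + d) powr (q / pm)) \<longlongrightarrow> S * (2 powr pm * (0 + 0) + 0) powr (q / pm)) (at_right 0)"
      using qp by (intro tendsto_intros tendsto_powr') (auto simp: eventually_at_right_less elim!: eventually_mono intro!: eventually_at_rightI[of 0 1])
    then have "\<forall>\<^sub>F d in at_right 0. S * (2 powr pm * (d + d) + d) powr (q / pm) < e"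
      using e by (intro order_tendstoD(2)) auto
    then have "\<forall>\<^sub>F d in at_right 0. 0 < d \<and> S * (2 powr pm * (d + d) + d) powr (q / pm) < e"
      by (intro eventually_conj eventually_at_right_less)
    then obtain d :: real where d: "d > 0" "S * (2 powr pm * (d + d) + d) powr (q / pm) < e"
      by (metis (no_types, lifting) eventually_happens trivial_limit_at_right_real)
    have "\<forall>\<^sub>F n in sequentially. (LINT x|M. norm (h n x - k x) powr pm) \<le> d"
      by (rule nmod_tendsto_0_imp_pminus[OF _ k(2) d(1) fink]) measurable
    then obtain N where N: "\<And>n. n \<ge> N \<Longrightarrow> (LINT x|M. norm (h n x - k x) powr pm) \<le> d"
      by (auto simp: eventually_sequentially)
    have "(\<integral>\<^sup>+x. ennreal (\<bar>w n x - v x\<bar> powr q) \<partial>M) \<le> ennreal e" if n: "N \<le> n" for n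
    proof (rule nn_integral_fatou_AE)
      show "AE x in M. (\<lambda>i. ennreal (\<bar>w n x - w (r i) x\<bar> powr q)) \<longlonglongrightarrow> ennreal (\<bar>w n x - v x\<bar> powr q)"
        using r(2)
      proof eventually_elim
        case (elim x)
        then show ?case
          using qm pm_gt_1 by (intro tendsto_ennrealI tendsto_powr' tendsto_intros) auto
      qed
      show "\<forall>\<^sub>F i in sequentially. (\<integral>\<^sup>+x. ennreal (\<bar>w n x - w (r i) x\<bar> powr q) \<partial>M) \<le> ennreal e"
        using eventually_ge_at_top[of N]
      proof eventually_elim
        case (elim i)
        then have ri: "N \<le> r i"
          using seq_suble[OF r(1), of i] by simp
        have "(LINT x|M. norm ((h n x - k x) + (k x - h (r i) x)) powr pm) \<le>
            2 powr pm * ((LINT x|M. norm (h n x - k x) powr pm) + (LINT x|M. norm (k x - h (r i) x) powr pm))"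
          using fink nmod_minus_commute[of k] by (intro integral_powr_pminus_triangle) auto
        also have "\<dots> \<le> 2 powr pm * (d + d)"
          using N[OF n] N[OF ri] by (intro mult_left_mono add_mono) (auto simp: norm_minus_commute)
        finally have "(LINT x|M. norm (h n x - h (r i) x) powr pm) \<le> 2 powr pm * (d + d)"
          by simp
        then have "S * ((LINT x|M. norm (h n x - h (r i) x) powr pm) + d) powr (q / pm) \<le> S * (2 powr pm * (d + d) + d) powr (q / pm)"
          using S(1) qp d(1) by (intro mult_left_mono powr_mono2) auto
        then show ?case
          using d(2) by (intro order_trans[OF S(2)[OF W_diff[OF Wwh Wwh] d(1)]] ennreal_leI) auto
      qed
    qed measurable
    then show "\<forall>\<^sub>F n in sequentially. (\<integral>\<^sup>+x. ennreal (\<bar>w n x - v x\<bar> powr q) \<partial>M) \<le> ennreal e"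
      by (rule eventually_sequentiallyI)
  qed
  have "W v k"
    by (rule W_closed[OF Wwh _ k(1) nmod_tendsto_0_if_powr[OF _ q(1) wq] k(2)]) measurable
  moreover have "energy k \<le> D"
  proof (rule field_le_epsilon)
    fix e :: real assume e: "e > 0"
    have hL1: "(\<lambda>n. \<integral>\<^sup>+x. ennreal (norm (h n x - k x)) \<partial>M) \<longlonglongrightarrow> 0"
      by (rule nmod_tendsto_0_imp_L1[OF _ k(2)]) measurable
    obtain r where r: "strict_mono (r :: nat \<Rightarrow> nat)" "AE x in M. (\<lambda>n. h (r n) x) \<longlonglongrightarrow> k x"
      by (rule L1_tendsto_imp_AE_subseq[OF W_integrable(2)[OF Wwh] nmod_finite_imp_integrable[OF k(1,3)] hL1], rule that)
    have "\<forall>\<^sub>F n in sequentially. \<epsilon> n < e"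
      using \<epsilon>0 e by (rule order_tendstoD)
    then have ev: "\<forall>\<^sub>F n in sequentially. \<epsilon> (r n) < e"
      by (rule eventually_subseq[OF r(1)])
    have D0: "0 \<le> D"
      using energy_bounds(3)[OF W_measurable(2)[OF W] W_finite(2)[OF W]] D by (intro LIMSEQ_le_const) auto
    have nne: "(\<integral>\<^sup>+x. ennreal (norm (f x) powr p x / p x) \<partial>M) = ennreal (energy f)"
      if "f \<in> borel_measurable M" "nmod f < top" for f :: "'a \<Rightarrow> 'a"
      unfolding energy_def using p_pos
      by (intro nn_integral_eq_integral integrable_energy that AE_I2) (simp add: less_imp_le order.strict_trans[OF zero_less_one])
    \<comment> \<open>Fatou along an almost everywhere convergent subsequence of the gradients,
      whose energies stay below \<open>D\<close> plus a vanishing error.\<close>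
    have "(\<integral>\<^sup>+x. ennreal (norm (k x) powr p x / p x) \<partial>M) \<le> ennreal (D + e)"
    proof (rule nn_integral_fatou_AE)
      show "AE x in M. (\<lambda>i. ennreal (norm (h (r i) x) powr p x / p x)) \<longlonglongrightarrow> ennreal (norm (k x) powr p x / p x)"
        using r(2) AE_space
      proof eventually_elim
        case (elim x)
        then show ?case
          using p_pos[of x] by (intro tendsto_ennrealI tendsto_divide tendsto_powr' tendsto_intros) auto
      qed
      show "\<forall>\<^sub>F i in sequentially. (\<integral>\<^sup>+x. ennreal (norm (h (r i) x) powr p x / p x) \<partial>M) \<le> ennreal (D + e)"
        using ev
      proof eventually_elim
        case (elim i)
        show ?case
          unfolding nne[OF W_measurable(2)[OF Wwh] W_finite(2)[OF Wwh]]
          using wh(2)[of "r i"] dD[of "r i"] elim by (intro ennreal_leI) linarith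
      qed
    qed measurable
    then show "energy k \<le> D + e"
      unfolding nne[OF k(1,3)] using D0 e by (subst (asm) ennreal_le_iff) auto
  qed
  ultimately show thesis
    by (rule that)
qed

end

section \<open>The energy functional and its minimiser\<close>

text \<open>Rounding \<open>u\<close> down to multiples of \<open>1 / (n + 1)\<close> leaves
  countably many values, for which measurability at each fixed value suffices; continuity in the
  second variable carries it to the limit.\<close>

lemma caratheodory_measurable:
  fixes f :: "'a \<Rightarrow> real \<Rightarrow> real"
  assumes f: "\<And>t. (\<lambda>x. f x t) \<in> borel_measurable M" and cont: "\<And>x. x \<in> space M \<Longrightarrow> continuous_on UNIV (f x)"
    and u[measurable]: "u \<in> borel_measurable M"
  shows "(\<lambda>x. f x (u x)) \<in> borel_measurable M"
proof (rule borel_measurable_LIMSEQ_real)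
  define v where "v n x = real_of_int \<lfloor>real (Suc n) * u x\<rfloor> / real (Suc n)" for n x
  show "(\<lambda>x. f x (v n x)) \<in> borel_measurable M" for n
  proof -
    have "(\<lambda>x. \<lfloor>real (Suc n) * u x\<rfloor>) \<in> measurable M (count_space UNIV)"
      by measurable
    from measurable_compose_countable[where f = "\<lambda>i x. f x (real_of_int i / real (Suc n))", OF f this]
    show ?thesis
      by (simp only: v_def)
  qed
  show "(\<lambda>n. f x (v n x)) \<longlonglongrightarrow> f x (u x)" if x: "x \<in> space M" for x
  proof -
    have "(\<lambda>n. v n x) \<longlonglongrightarrow> u x"
    proof (rule LIM_zero_cancel, rule Lim_null_comparison[OF _ LIMSEQ_Suc[OF lim_1_over_n]], intro always_eventually allI)
      fix n
      have "\<bar>real_of_int \<lfloor>real (Suc n) * u x\<rfloor> - real (Suc n) * u x\<bar> \<le> 1"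
        by linarith
      moreover have "v n x - u x = (real_of_int \<lfloor>real (Suc n) * u x\<rfloor> - real (Suc n) * u x) / real (Suc n)"
        unfolding v_def by (simp add: diff_divide_distrib del: of_nat_Suc)
      ultimately show "norm (v n x - u x) \<le> 1 / real (Suc n)"
        by (simp add: divide_right_mono del: of_nat_Suc)
    qed
    then show ?thesis
      using cont[OF x] by (metis UNIV_I continuous_on_eq_continuous_within isCont_tendsto_compose)
  qed
qed

text \<open>Splitting at \<open>T\<close>: below it the power is at most \<open>T powr R\<close>,
  above it the exponent may be raised at the price \<open>T powr (R - q)\<close>. Since
  \<open>R < q\<close>, this coefficient is small for large \<open>T\<close>.\<close>

lemma powr_le_absorb:
  fixes t :: real
  assumes "0 \<le> t" "1 \<le> T" "0 \<le> r" "r \<le> R" "R < q"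
  shows "t powr r \<le> T powr R + T powr (R - q) * t powr q"
proof (cases "t \<le> T")
  case True
  have "t powr r \<le> T powr r"
    using assms True by (intro powr_mono2) auto
  also have "\<dots> \<le> T powr R"
    using assms by (intro powr_mono) auto
  finally show ?thesis by (simp add: add_increasing2)
next
  case False
  have "t powr r \<le> t powr R"
    using assms False by (intro powr_mono) auto
  also have "\<dots> = t powr (R - q) * t powr q"
    by (simp flip: powr_add)
  also have "\<dots> \<le> T powr (R - q) * t powr q"
    using assms False by (intro mult_right_mono powr_mono2') auto
  finally show ?thesis by (simp add: add_increasing)
qed

text \<open>What the variational argument uses, stated at every point of \<Omega>: a Lipschitz
  estimate with growth exponent \<open>R\<close> from the subgradient bound, an upper bound
  \<open>B\<close> from the decay condition, a subcritical \<open>q\<close> strictly above the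
  largest exponent, and coercivity with constant \<open>\<gamma>\<close> from the bound on
  \<open>lam\<close>.\<close>

locale potential = variable_sobolev \<Omega> p for \<Omega> :: "'a::euclidean_space set" and p +
  fixes lam :: real and j :: "'a \<Rightarrow> real \<Rightarrow> real" and A R q B \<gamma> :: real
  assumes j_zero: "x \<in> \<Omega> \<Longrightarrow> j x 0 = 0"
    and j_measurable: "\<And>t. (\<lambda>x. j x t) \<in> borel_measurable (lebesgue_on \<Omega>)"
    and A_nonneg: "0 \<le> A" and R_nonneg: "0 \<le> R"
    and j_lipschitz: "\<And>x s t c. \<lbrakk>x \<in> \<Omega>; \<bar>s\<bar> \<le> c; \<bar>t\<bar> \<le> c\<rbrakk> \<Longrightarrow> \<bar>j x t - j x s\<bar> \<le> A * (1 + c) powr R * \<bar>t - s\<bar>"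
    and j_upper: "\<And>x t. x \<in> \<Omega> \<Longrightarrow> j x t \<le> B"
    and q_R: "R + 1 \<le> q" and q_pplus: "pplus \<Omega> p < q"
    and q_subcritical: "q * (real DIM('a) - pminus \<Omega> p) < real DIM('a) * pminus \<Omega> p"
    and \<gamma>_pos: "0 < \<gamma>"
    and coercive: "\<And>u g. W u g \<Longrightarrow> lam * energy u + \<gamma> * (LINT x|lebesgue_on \<Omega>. norm (g x) powr p x) \<le> energy g"
begin

lemma B_nonneg: "0 \<le> B"
  using \<Omega>_ne j_upper[of _ 0] j_zero by force

lemma q_gt_1: "1 < q"
  using q_pplus pm_le_pp pm_gt_1 by simp

lemma j_continuous: "x \<in> \<Omega> \<Longrightarrow> continuous_on UNIV (j x)"
proof (rule continuous_at_imp_continuous_on, intro ballI)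
  fix t assume x: "x \<in> \<Omega>"
  have "((\<lambda>s. j x s - j x t) \<longlongrightarrow> 0) (at t)"
  proof (rule Lim_null_comparison)
    show "\<forall>\<^sub>F s in at t. norm (j x s - j x t) \<le> A * (1 + (\<bar>t\<bar> + 1)) powr R * \<bar>s - t\<bar>"
      unfolding eventually_at
    proof (intro exI[of _ 1] conjI ballI impI)
      fix s assume "s \<noteq> t \<and> dist s t < 1"
      then have "\<bar>s\<bar> \<le> \<bar>t\<bar> + 1" by (simp add: dist_real_def) linarith
      then show "norm (j x s - j x t) \<le> A * (1 + (\<bar>t\<bar> + 1)) powr R * \<bar>s - t\<bar>"
        using j_lipschitz[OF x, of t "\<bar>t\<bar> + 1" s] by simp
    qed simp
    show "((\<lambda>s. A * (1 + (\<bar>t\<bar> + 1)) powr R * \<bar>s - t\<bar>) \<longlongrightarrow> 0) (at t)"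
      by (auto intro!: tendsto_mult_right_zero tendsto_rabs_zero LIM_zero tendsto_ident_at)
  qed
  then show "isCont (j x) t"
    by (simp add: isCont_def LIM_zero_iff)
qed

lemma j_comp_measurable[measurable]:
  "u \<in> borel_measurable M \<Longrightarrow> (\<lambda>x. j x (u x)) \<in> borel_measurable M"
  by (rule caratheodory_measurable) (auto intro: j_measurable j_continuous)

lemma W_integrable_powr_q:
  assumes W: "W u g"
  shows "integrable M (\<lambda>x. \<bar>u x\<bar> powr q)"
proof -
  note [measurable] = W_measurable[OF W]
  have qm: "pm \<le> q" using q_pplus pm_le_pp by simp
  obtain S where S: "S > 0"
    "\<And>u g d. \<lbrakk>W u g; d > 0\<rbrakk> \<Longrightarrow> (\<integral>\<^sup>+x. ennreal (\<bar>u x\<bar> powr q) \<partial>M) \<le> ennreal (S * ((LINT x|M. norm (g x) powr pm) + d) powr (q / pm))"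
    by (rule W_sobolev[OF qm q_subcritical], rule that)
  show ?thesis
    unfolding integrable_iff_bounded using S(2)[OF W, of 1] by (auto intro: le_less_trans)
qed

lemma W_integrable_weight:
  assumes W: "W u g" and "0 \<le> r" "r \<le> q" "0 \<le> c"
  shows "integrable M (\<lambda>x. (c + \<bar>u x\<bar>) powr r)"
proof (rule Bochner_Integration.integrable_bound)
  note [measurable] = W_measurable[OF W]
  show "integrable M (\<lambda>x. 2 powr q * ((c + 1) powr q + (1 + \<bar>u x\<bar> powr q)))"
    by (intro integrable_mult_right Bochner_Integration.integrable_add integrable_const W_integrable_powr_q[OF W])
  show "(\<lambda>x. (c + \<bar>u x\<bar>) powr r) \<in> borel_measurable M"
    by measurable
  show "AE x in M. norm ((c + \<bar>u x\<bar>) powr r) \<le> norm (2 powr q * ((c + 1) powr q + (1 + \<bar>u x\<bar> powr q)))"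
  proof (rule AE_I2)
    fix x
    have "(c + \<bar>u x\<bar>) powr r \<le> (c + 1 + \<bar>u x\<bar>) powr r"
      using assms by (intro powr_mono2) auto
    also have "\<dots> \<le> (c + 1 + \<bar>u x\<bar>) powr q"
      using assms by (intro powr_mono) auto
    also have "\<dots> \<le> 2 powr q * ((c + 1) powr q + \<bar>u x\<bar> powr q)"
      using assms q_gt_1 by (intro powr_add_le) auto
    also have "\<dots> \<le> 2 powr q * ((c + 1) powr q + (1 + \<bar>u x\<bar> powr q))"
      by (intro mult_left_mono) auto
    finally show "norm ((c + \<bar>u x\<bar>) powr r) \<le> norm (2 powr q * ((c + 1) powr q + (1 + \<bar>u x\<bar> powr q)))"
      by simp
  qed
qed

text \<open>The Lipschitz estimate, started at zero, gives growth of order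
  \<open>R + 1 \<le> q\<close>, which the Sobolev embedding makes integrable.\<close>

lemma W_integrable_j:
  assumes W: "W u g"
  shows "integrable M (\<lambda>x. j x (u x))"
proof (rule Bochner_Integration.integrable_bound)
  note [measurable] = W_measurable[OF W]
  show "integrable M (\<lambda>x. A * (1 + \<bar>u x\<bar>) powr (R + 1))"
    using W_integrable_weight[OF W, of "R + 1" 1] q_R R_nonneg by simp
  show "(\<lambda>x. j x (u x)) \<in> borel_measurable M" by measurable
  show "AE x in M. norm (j x (u x)) \<le> norm (A * (1 + \<bar>u x\<bar>) powr (R + 1))"
  proof (rule AE_I2)
    fix x assume "x \<in> space M"
    then have x: "x \<in> \<Omega>" by simp
    have "\<bar>j x (u x)\<bar> \<le> A * (1 + \<bar>u x\<bar>) powr R * \<bar>u x\<bar>"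
      using j_lipschitz[OF x, of 0 "\<bar>u x\<bar>" "u x"] j_zero[OF x] by simp
    also have "\<dots> \<le> A * (1 + \<bar>u x\<bar>) powr R * (1 + \<bar>u x\<bar>)"
      using A_nonneg by (intro mult_left_mono) auto
    also have "\<dots> = A * (1 + \<bar>u x\<bar>) powr (R + 1)"
      by (simp add: powr_add)
    finally show "norm (j x (u x)) \<le> norm (A * (1 + \<bar>u x\<bar>) powr (R + 1))"
      using A_nonneg by simp
  qed
qed

definition E :: "('a \<Rightarrow> real) \<Rightarrow> ('a \<Rightarrow> 'a) \<Rightarrow> real" where
  "E u g = energy g - lam * energy u - (LINT x|M. j x (u x))"

abbreviation "V \<equiv> measure M \<Omega>"

lemma E_lower:
  assumes W: "W u g"
  shows "\<gamma> * (LINT x|M. norm (g x) powr p x) - B * V \<le> E u g"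
proof -
  have "(LINT x|M. j x (u x)) \<le> (LINT x|M. B)"
    using j_upper by (intro integral_mono W_integrable_j[OF W]) auto
  then show ?thesis
    using coercive[OF W] by (simp add: E_def mult.commute)
qed

text \<open>Fatou's lemma needs nonnegative integrands. The potential is bounded by
  \<open>B\<close>, and the term with \<open>lam\<close> grows with an exponent below
  \<open>q\<close>, so a constant \<open>c\<close> and a multiple \<open>\<delta>\<close> of the
  \<open>q\<close>-th power compensate both. The latter costs at most \<open>\<delta> * K\<close>,
  and \<open>\<delta>\<close> tends to zero as the threshold \<open>T\<close> grows.\<close>

lemma lower_order_lsc:
  assumes W: "\<And>n. W (u n) (g n)" and K: "\<And>n. (LINT x|M. \<bar>u n x\<bar> powr q) \<le> K"
    and Wv: "W v h" and lim: "AE x in M. (\<lambda>n. u n x) \<longlonglongrightarrow> v x"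
    and L: "(\<lambda>n. - lam * energy (u n) - (LINT x|M. j x (u n x))) \<longlonglongrightarrow> L"
  shows "- lam * energy v - (LINT x|M. j x (v x)) \<le> L"
proof -
  note [measurable] = W_measurable[OF W] W_measurable[OF Wv]
  define F where "F x t = - lam * (\<bar>t\<bar> powr p x / p x) - j x t" for x t
  have iF: "integrable M (\<lambda>x. F x (w x))" and intF: "(LINT x|M. F x (w x)) = - lam * energy w - (LINT x|M. j x (w x))"
    if "W w k" for w k
  proof -
    have a: "integrable M (\<lambda>x. \<bar>w x\<bar> powr p x / p x)"
      using integrable_energy[OF W_measurable(1)[OF that] W_finite(1)[OF that]] by simp
    note b = W_integrable_j[OF that]
    show "integrable M (\<lambda>x. F x (w x))"
      unfolding F_def by (intro Bochner_Integration.integrable_diff integrable_mult_right a b)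
    show "(LINT x|M. F x (w x)) = - lam * energy w - (LINT x|M. j x (w x))"
      unfolding F_def energy_def
      by (simp only: Bochner_Integration.integral_diff[OF integrable_mult_right[OF a] b] integral_mult_right_zero real_norm_def)
  qed
  have K0: "0 \<le> K"
    using K[of 0] by (rule order_trans[rotated]) simp
  have step: "(LINT x|M. F x (v x)) \<le> L + e + \<bar>lam\<bar> * T powr (pp - q) * K" if e: "e > 0" and T: "T \<ge> 1" for e T :: real
  proof -
    define c \<delta> where "c = \<bar>lam\<bar> * T powr pp + B" and "\<delta> = \<bar>lam\<bar> * T powr (pp - q)"
    have c: "c \<ge> 0" "\<delta> \<ge> 0"
      using B_nonneg by (auto simp: c_def \<delta>_def)
    have pos: "0 \<le> F x t + c + \<delta> * \<bar>t\<bar> powr q" if x: "x \<in> \<Omega>" for x t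
    proof -
      have px: "1 < p x" "p x \<le> pp"
        using p_pos[of x] p_bounds[of x] x by auto
      have "lam * (\<bar>t\<bar> powr p x / p x) \<le> \<bar>lam\<bar> * (\<bar>t\<bar> powr p x / 1)"
        using px by (intro mult_mono divide_left_mono) auto
      also have "\<dots> \<le> \<bar>lam\<bar> * (T powr pp + T powr (pp - q) * \<bar>t\<bar> powr q)"
        using px T q_pplus by (simp, intro mult_left_mono powr_le_absorb) auto
      also have "\<dots> = \<bar>lam\<bar> * T powr pp + \<delta> * \<bar>t\<bar> powr q"
        by (simp add: \<delta>_def algebra_simps)
      finally show ?thesis
        using j_upper[OF x, of t] by (simp add: F_def c_def)
    qed
    have i: "integrable M (\<lambda>x. F x (w x) + c + \<delta> * \<bar>w x\<bar> powr q)" if "W w k" for w k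
      using iF[OF that] W_integrable_powr_q[OF that] by simp
    have int: "(\<integral>\<^sup>+x. ennreal (F x (w x) + c + \<delta> * \<bar>w x\<bar> powr q) \<partial>M) = ennreal ((LINT x|M. F x (w x)) + c * V + \<delta> * (LINT x|M. \<bar>w x\<bar> powr q))"
      if "W w k" for w k
      using iF[OF that] W_integrable_powr_q[OF that] pos
      by (subst nn_integral_eq_integral[OF i[OF that]]) (auto simp: mult.commute)
    have "\<forall>\<^sub>F n in sequentially. (LINT x|M. F x (u n x)) < L + e"
      unfolding intF[OF W] using L e by (intro order_tendstoD(2)) auto
    then have bound: "\<forall>\<^sub>F n in sequentially. (\<integral>\<^sup>+x. ennreal (F x (u n x) + c + \<delta> * \<bar>u n x\<bar> powr q) \<partial>M) \<le> ennreal (L + e + c * V + \<delta> * K)"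
    proof eventually_elim
      case (elim n)
      then show ?case
        unfolding int[OF W] using mult_left_mono[OF K[of n] c(2)] by (intro ennreal_leI) linarith
    qed
    have "(\<integral>\<^sup>+x. ennreal (F x (v x) + c + \<delta> * \<bar>v x\<bar> powr q) \<partial>M) \<le> ennreal (L + e + c * V + \<delta> * K)"
    proof (rule nn_integral_fatou_AE[OF _ _ bound])
      show "(\<lambda>x. ennreal (F x (u n x) + c + \<delta> * \<bar>u n x\<bar> powr q)) \<in> borel_measurable M" for n
        unfolding F_def by measurable
      show "AE x in M. (\<lambda>n. ennreal (F x (u n x) + c + \<delta> * \<bar>u n x\<bar> powr q)) \<longlonglongrightarrow> ennreal (F x (v x) + c + \<delta> * \<bar>v x\<bar> powr q)"
        using lim AE_space
      proof eventually_elim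
        case (elim x)
        then have x: "x \<in> \<Omega>" and px: "1 < p x"
          using p_pos by auto
        have "(\<lambda>n. j x (u n x)) \<longlonglongrightarrow> j x (v x)"
          using j_continuous[OF x] elim(1) by (metis UNIV_I continuous_on_eq_continuous_within isCont_tendsto_compose)
        then show ?case
          unfolding F_def using px q_gt_1 elim(1)
          by (intro tendsto_ennrealI tendsto_add tendsto_diff tendsto_mult tendsto_divide tendsto_powr' tendsto_rabs tendsto_const) auto
      qed
    qed
    moreover have nonneg: "0 \<le> L + e + c * V + \<delta> * K"
    proof -
      obtain n where "(LINT x|M. F x (u n x)) < L + e"
        using \<open>\<forall>\<^sub>F n in sequentially. (LINT x|M. F x (u n x)) < L + e\<close> by (auto simp: eventually_sequentially)
      moreover have "0 \<le> (LINT x|M. F x (u n x) + c + \<delta> * \<bar>u n x\<bar> powr q)"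
        using pos by (intro integral_nonneg_AE AE_I2) auto
      moreover have "(LINT x|M. F x (u n x) + c + \<delta> * \<bar>u n x\<bar> powr q) = (LINT x|M. F x (u n x)) + c * V + \<delta> * (LINT x|M. \<bar>u n x\<bar> powr q)"
        using iF[OF W] W_integrable_powr_q[OF W] by (simp add: mult.commute)
      ultimately show ?thesis
        using mult_left_mono[OF K[of n] c(2)] by linarith
    qed
    ultimately have "(LINT x|M. F x (v x)) + c * V + \<delta> * (LINT x|M. \<bar>v x\<bar> powr q) \<le> L + e + c * V + \<delta> * K"
      unfolding int[OF Wv] using ennreal_le_iff by blast
    \<comment> \<open>The compensating term of the limit function has the right sign and is
      dropped.\<close>
    moreover have "0 \<le> \<delta> * (LINT x|M. \<bar>v x\<bar> powr q)"
      using c by simp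
    ultimately show ?thesis
      unfolding \<delta>_def by linarith
  qed
  have le_e: "(LINT x|M. F x (v x)) \<le> L + e" if e: "e > 0" for e
  proof (rule tendsto_lowerbound)
    have "((\<lambda>T. L + e + \<bar>lam\<bar> * T powr (pp - q) * K) \<longlongrightarrow> L + e + \<bar>lam\<bar> * 0 * K) at_top"
      using q_pplus by (intro tendsto_intros tendsto_neg_powr filterlim_ident) auto
    then show "((\<lambda>T. L + e + \<bar>lam\<bar> * T powr (pp - q) * K) \<longlongrightarrow> L + e) at_top"
      by simp
    show "\<forall>\<^sub>F T in at_top. (LINT x|M. F x (v x)) \<le> L + e + \<bar>lam\<bar> * T powr (pp - q) * K"
      using eventually_ge_at_top[of 1] by eventually_elim (rule step[OF e])
  qed simp
  have "(LINT x|M. F x (v x)) \<le> L"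
    by (rule field_le_epsilon[OF le_e])
  then show ?thesis
    using intF[OF Wv] by simp
qed

lemma minimiser_exists:
  obtains u g where "W u g" "\<And>v h. W v h \<Longrightarrow> E u g \<le> E v h"
proof -
  define S where "S = {E u g |u g. W u g}"
  have Wz: "W (\<lambda>x. 0) (grad (\<lambda>x. 0))"
    by (rule W_test[OF test_function_zero])
  have ne: "S \<noteq> {}"
    using Wz by (auto simp: S_def)
  have low: "- (B * V) \<le> E u g" if "W u g" for u g
    using E_lower[OF that] \<gamma>_pos by (smt (verit) integral_nonneg_AE AE_I2 powr_ge_zero mult_nonneg_nonneg)
  then have bdd: "bdd_below S"
    unfolding S_def by (auto intro!: bdd_belowI)
  define m where "m = Inf S"
  have mle: "m \<le> E u g" if "W u g" for u g
    unfolding m_def using that by (intro cInf_lower bdd) (auto simp: S_def)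
  have "\<exists>u g. W u g \<and> E u g < m + 1 / real (Suc n)" for n
  proof -
    have "Inf S < m + 1 / real (Suc n)" by (simp add: m_def)
    then show ?thesis
      using cInf_lessD[OF ne] by (fastforce simp: S_def)
  qed
  then obtain u g where W: "\<And>n. W (u n) (g n)" and Eu: "\<And>n. E (u n) (g n) < m + 1 / real (Suc n)"
    by metis
  have Em: "(\<lambda>n. E (u n) (g n)) \<longlonglongrightarrow> m"
  proof (rule tendsto_sandwich[OF _ _ tendsto_const])
    show "(\<lambda>n. m + 1 / real (Suc n)) \<longlonglongrightarrow> m"
      using tendsto_add[OF tendsto_const LIMSEQ_Suc[OF lim_1_over_n], of m] by simp
  qed (use mle[OF W] Eu in \<open>auto intro!: always_eventually less_imp_le\<close>)
  \<comment> \<open>Coercivity turns the bound \<open>m + 1\<close> on the functional into a bound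
    on the modulars of the gradients.\<close>
  define K where "K = (m + 1 + B * V) / \<gamma>"
  have gK: "(LINT x|M. norm (g n x) powr p x) \<le> K" for n
  proof -
    have "1 / real (Suc n) \<le> 1" by simp
    then have "\<gamma> * (LINT x|M. norm (g n x) powr p x) \<le> m + 1 + B * V"
      using E_lower[OF W, of n] Eu[of n] by linarith
    then show ?thesis
      using \<gamma>_pos by (simp add: K_def field_simps)
  qed
  \<comment> \<open>The exponent 1 is used for compactness in L^1, the exponent \<open>pm\<close>
    for the Sobolev bound.\<close>
  have lower_exp: "(LINT x|M. norm (g n x) powr s) \<le> V + K" if s: "1 \<le> s" "s \<le> pm" for n s
  proof -
    have ip: "integrable M (\<lambda>x. norm (g n x) powr p x)"
      by (rule nmod_finiteD[OF W_measurable(2)[OF W] W_finite(2)[OF W]])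
    have le: "norm (g n x) powr s \<le> 1 + norm (g n x) powr p x" if "x \<in> space M" for x
      using powr_le_interpolate[of "norm (g n x)" 1 s "p x" pp] p_bounds[OF that] s by simp
    have i: "integrable M (\<lambda>x. norm (g n x) powr s)"
    proof (rule Bochner_Integration.integrable_bound)
      show "integrable M (\<lambda>x. 1 + norm (g n x) powr p x)"
        by (intro Bochner_Integration.integrable_add integrable_const ip)
    qed (use le W_measurable(2)[OF W] in auto)
    have "(LINT x|M. norm (g n x) powr s) \<le> (LINT x|M. 1 + norm (g n x) powr p x)"
      using ip by (intro integral_mono i le) auto
    also have "\<dots> = V + (LINT x|M. norm (g n x) powr p x)"
      using ip by simp
    finally show ?thesis
      using gK[of n] by linarith
  qed
  have g1: "(LINT x|M. norm (g n x)) \<le> V + K" for n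
    using lower_exp[of 1 n] pm_gt_1 by simp
  obtain r v where r: "strict_mono (r :: nat \<Rightarrow> nat)" and v: "integrable M v"
    and rv: "(\<lambda>n. \<integral>\<^sup>+x. ennreal \<bar>u (r n) x - v x\<bar> \<partial>M) \<longlonglongrightarrow> 0"
    by (rule W_rellich[OF W g1], rule that)
  obtain r' where r': "strict_mono (r' :: nat \<Rightarrow> nat)" "AE x in M. (\<lambda>n. u (r (r' n)) x) \<longlonglongrightarrow> v x"
    by (rule L1_tendsto_imp_AE_subseq[OF W_integrable(1)[OF W] v], use rv in simp, rule that)
  have en: "0 \<le> energy (g n)" "energy (g n) \<le> K / pm" for n
  proof -
    show "0 \<le> energy (g n)" by (rule energy_bounds(3)[OF W_measurable(2)[OF W] W_finite(2)[OF W]])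
    have "energy (g n) \<le> (LINT x|M. norm (g n x) powr p x) / pm"
      by (rule energy_bounds(2)[OF W_measurable(2)[OF W] W_finite(2)[OF W]])
    also have "\<dots> \<le> K / pm"
      using gK[of n] pm_gt_1 by (intro divide_right_mono) auto
    finally show "energy (g n) \<le> K / pm" .
  qed
  \<comment> \<open>A further extraction makes the gradient energies converge, since semicontinuity
    compares with their limit \<open>D\<close>. Convergence of the functional to \<open>m\<close>
    then forces the lower-order part to converge to \<open>m - D\<close>.\<close>
  have "compact {0..K / pm}" by simp
  then have "seq_compact {0..K / pm}"
    by (rule compact_imp_seq_compact)
  then obtain D s where s: "strict_mono (s :: nat \<Rightarrow> nat)" and D: "(\<lambda>n. energy (g (r (r' (s n))))) \<longlonglongrightarrow> D"
    using en by (auto simp: o_def elim!: seq_compactE[where f = "\<lambda>n. energy (g (r (r' n)))"])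
  define t where "t n = r (r' (s n))" for n
  have t: "strict_mono t"
    using r r'(1) s unfolding t_def by (simp add: strict_mono_def)
  have D: "(\<lambda>n. energy (g (t n))) \<longlonglongrightarrow> D"
    using D by (simp add: t_def)
  have L1: "(\<lambda>n. \<integral>\<^sup>+x. ennreal \<bar>u (t n) x - v x\<bar> \<partial>M) \<longlonglongrightarrow> 0"
    using LIMSEQ_subseq_LIMSEQ[OF LIMSEQ_subseq_LIMSEQ[OF rv r'(1)] s] by (simp add: o_def t_def)
  have lim: "AE x in M. (\<lambda>n. u (t n) x) \<longlonglongrightarrow> v x"
    using r'(2)
  proof eventually_elim
    case (elim x)
    then show ?case
      using LIMSEQ_subseq_LIMSEQ[OF elim s] by (simp add: o_def t_def)
  qed
  obtain h where h: "W v h" "energy h \<le> D"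
    by (rule W_energy_lsc[OF less_imp_le[OF q_pplus] q_subcritical W v L1 D], rule that)
  have qm: "pm \<le> q" using q_pplus pm_le_pp by simp
  obtain S where S: "S > 0"
    "\<And>u g d. \<lbrakk>W u g; d > 0\<rbrakk> \<Longrightarrow> (\<integral>\<^sup>+x. ennreal (\<bar>u x\<bar> powr q) \<partial>M) \<le> ennreal (S * ((LINT x|M. norm (g x) powr pm) + d) powr (q / pm))"
    by (rule W_sobolev[OF qm q_subcritical], rule that)
  have uq: "(LINT x|M. \<bar>u n x\<bar> powr q) \<le> S * ((V + K) + 1) powr (q / pm)" for n
  proof -
    have "ennreal (LINT x|M. \<bar>u n x\<bar> powr q) = (\<integral>\<^sup>+x. ennreal (\<bar>u n x\<bar> powr q) \<partial>M)"
      by (rule nn_integral_eq_integral[symmetric, OF W_integrable_powr_q[OF W]]) simp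
    also have "\<dots> \<le> ennreal (S * ((LINT x|M. norm (g n x) powr pm) + 1) powr (q / pm))"
      by (rule S(2)[OF W]) simp
    also have "\<dots> \<le> ennreal (S * ((V + K) + 1) powr (q / pm))"
      using S(1) lower_exp[of pm n] pm_gt_1 qm by (intro ennreal_leI mult_left_mono powr_mono2) auto
    finally show ?thesis
      using S(1) by (subst (asm) ennreal_le_iff) auto
  qed
  have "(\<lambda>n. E (u (t n)) (g (t n)) - energy (g (t n))) \<longlonglongrightarrow> m - D"
    using tendsto_diff[OF LIMSEQ_subseq_LIMSEQ[OF Em t] D] by (simp add: o_def)
  then have "(\<lambda>n. - lam * energy (u (t n)) - (LINT x|M. j x (u (t n) x))) \<longlonglongrightarrow> m - D"
    by (simp add: E_def)
  from lower_order_lsc[OF W uq h(1) lim this]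
  have "E v h \<le> m"
    using h(2) by (simp add: E_def)
  then have "E v h \<le> E w k" if "W w k" for w k
    using mle[OF that] by simp
  then show thesis
    using that h(1) by blast
qed

end

section \<open>The Euler-Lagrange inclusion\<close>

context potential
begin

context
  fixes u :: "'a \<Rightarrow> real" and g :: "'a \<Rightarrow> 'a"
  assumes Wu: "W u g" and minimal: "\<And>v h. W v h \<Longrightarrow> E u g \<le> E v h"
begin

lemmas ug_measurable[measurable] = W_measurable[OF Wu]

text \<open>The scalar term is spelled with \<open>norm\<close> and \<open>\<bullet>\<close> so that
  one differentiation lemma for Euclidean-valued functions covers both terms.\<close>

definition ell :: "('a \<Rightarrow> real) \<Rightarrow> real" where
  "ell \<phi> = (LINT x|M. norm (g x) powr (p x - 2) * (g x \<bullet> grad \<phi> x)) - lam * (LINT x|M. norm (u x) powr (p x - 2) * (u x \<bullet> \<phi> x))"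

lemma ell_integrable:
  assumes \<phi>: "\<phi> \<in> test_functions \<Omega>"
  shows "integrable M (\<lambda>x. norm (g x) powr (p x - 2) * (g x \<bullet> grad \<phi> x))"
    "integrable M (\<lambda>x. norm (u x) powr (p x - 2) * (u x \<bullet> \<phi> x))"
proof -
  have t: "(\<lambda>n. 1 / real (Suc n)) \<longlonglongrightarrow> 0"
    by (rule LIMSEQ_Suc[OF lim_1_over_n])
  note * = energy_directional_derivative(1)[OF _ _ _ _ t]
  show "integrable M (\<lambda>x. norm (g x) powr (p x - 2) * (g x \<bullet> grad \<phi> x))"
    using *[OF ug_measurable(2) test_measurable(2)[OF \<phi>] W_finite(2)[OF Wu] nmod_test_finite(2)[OF \<phi>]] by simp
  show "integrable M (\<lambda>x. norm (u x) powr (p x - 2) * (u x \<bullet> \<phi> x))"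
    using *[OF ug_measurable(1) test_measurable(1)[OF \<phi>] W_finite(1)[OF Wu] nmod_test_finite(1)[OF \<phi>]] by simp
qed

lemma ell_add:
  assumes \<phi>: "\<phi> \<in> test_functions \<Omega>" and \<psi>: "\<psi> \<in> test_functions \<Omega>"
  shows "ell (\<lambda>x. \<phi> x + c * \<psi> x) = ell \<phi> + c * ell \<psi>"
proof -
  have "(LINT x|M. norm (g x) powr (p x - 2) * (g x \<bullet> (grad \<phi> x + c *\<^sub>R grad \<psi> x))) =
      (LINT x|M. norm (g x) powr (p x - 2) * (g x \<bullet> grad \<phi> x) + c * (norm (g x) powr (p x - 2) * (g x \<bullet> grad \<psi> x)))"
    by (simp add: inner_add_right algebra_simps)
  also have "\<dots> = (LINT x|M. norm (g x) powr (p x - 2) * (g x \<bullet> grad \<phi> x)) + c * (LINT x|M. norm (g x) powr (p x - 2) * (g x \<bullet> grad \<psi> x))"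
    using ell_integrable(1)[OF \<phi>] ell_integrable(1)[OF \<psi>] by simp
  finally have 1: "(LINT x|M. norm (g x) powr (p x - 2) * (g x \<bullet> (grad \<phi> x + c *\<^sub>R grad \<psi> x))) = \<dots>" .
  have "(LINT x|M. norm (u x) powr (p x - 2) * (u x \<bullet> (\<phi> x + c * \<psi> x))) =
      (LINT x|M. norm (u x) powr (p x - 2) * (u x \<bullet> \<phi> x) + c * (norm (u x) powr (p x - 2) * (u x \<bullet> \<psi> x)))"
    by (simp add: algebra_simps)
  also have "\<dots> = (LINT x|M. norm (u x) powr (p x - 2) * (u x \<bullet> \<phi> x)) + c * (LINT x|M. norm (u x) powr (p x - 2) * (u x \<bullet> \<psi> x))"
    using ell_integrable(2)[OF \<phi>] ell_integrable(2)[OF \<psi>] by (simp only: Bochner_Integration.integral_add integrable_mult_right integral_mult_right_zero)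
  finally show ?thesis
    unfolding ell_def test_function_add(2)[OF \<phi> \<psi>] 1 by (simp add: algebra_simps)
qed

lemma ell_minus: "\<phi> \<in> test_functions \<Omega> \<Longrightarrow> ell (\<lambda>x. - \<phi> x) = - ell \<phi>"
  using ell_add[OF test_function_zero, of \<phi> "-1"] ell_add[OF test_function_zero test_function_zero, of "-1"] by simp

text \<open>Minimality along \<open>u + t * \<phi>\<close> bounds the difference quotients of the
  smooth part from below by integrals of difference quotients of j. A minorant \<open>H\<close>
  valid for all small \<open>t\<close> survives the limit, and no derivative of j is formed.\<close>

lemma ell_lower_bound:
  assumes \<phi>: "\<phi> \<in> test_functions \<Omega>" and d: "0 < d" and H: "integrable M H"
    and le: "\<And>x t. \<lbrakk>x \<in> \<Omega>; 0 < t; t * \<bar>\<phi> x\<bar> < d\<rbrakk> \<Longrightarrow> H x \<le> (j x (u x + t * \<phi> x) - j x (u x)) / t"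
  shows "(LINT x|M. H x) \<le> ell \<phi>"
proof -
  obtain b where b: "b > 0" "\<And>x. \<bar>\<phi> x\<bar> \<le> b"
    using test_function_bounded[OF \<phi>] by metis
  \<comment> \<open>The bound \<open>c \<le> 1\<close> is required by the directional derivative,
    and \<open>c * b < d\<close> puts all steps into the range where \<open>H\<close> is a
    minorant.\<close>
  define c where "c = min 1 (d / (2 * b))"
  have c: "0 < c" "c \<le> 1" "c * b < d"
  proof -
    show "0 < c" "c \<le> 1" using b d by (auto simp: c_def)
    have "c * b \<le> d / (2 * b) * b" using b by (intro mult_right_mono) (auto simp: c_def)
    then show "c * b < d" using b d by simp
  qed
  define t where "t n = c / real (Suc n)" for n
  have t: "0 < t n" "t n \<le> c" for n
  proof -
    show "0 < t n" using c by (simp add: t_def)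
    have "c / real (Suc n) \<le> c / 1" using c by (intro divide_left_mono) auto
    then show "t n \<le> c" by (simp add: t_def)
  qed
  have "(\<lambda>n. c * (1 / real (Suc n))) \<longlonglongrightarrow> c * 0"
    by (intro tendsto_mult tendsto_const LIMSEQ_Suc[OF lim_1_over_n])
  then have t0: "t \<longlonglongrightarrow> 0" by (simp add: t_def[abs_def])
  have t1: "t n \<noteq> 0" "\<bar>t n\<bar> \<le> 1" for n
    using t[of n] c by auto
  have lim1: "(\<lambda>n. (energy (\<lambda>x. g x + t n *\<^sub>R grad \<phi> x) - energy g) / t n) \<longlonglongrightarrow> (LINT x|M. norm (g x) powr (p x - 2) * (g x \<bullet> grad \<phi> x))"
    by (rule energy_directional_derivative(2)[OF ug_measurable(2) test_measurable(2)[OF \<phi>] W_finite(2)[OF Wu] nmod_test_finite(2)[OF \<phi>] t0 t1])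
  have lim2: "(\<lambda>n. (energy (\<lambda>x. u x + t n *\<^sub>R \<phi> x) - energy u) / t n) \<longlonglongrightarrow> (LINT x|M. norm (u x) powr (p x - 2) * (u x \<bullet> \<phi> x))"
    by (rule energy_directional_derivative(2)[OF ug_measurable(1) test_measurable(1)[OF \<phi>] W_finite(1)[OF Wu] nmod_test_finite(1)[OF \<phi>] t0 t1])
  have "(\<lambda>n. (energy (\<lambda>x. g x + t n *\<^sub>R grad \<phi> x) - energy g) / t n - lam * ((energy (\<lambda>x. u x + t n *\<^sub>R \<phi> x) - energy u) / t n)) \<longlonglongrightarrow> ell \<phi>"
    unfolding ell_def by (intro tendsto_diff tendsto_mult tendsto_const lim1 lim2)
  then show ?thesis
  proof (rule tendsto_lowerbound, intro always_eventually allI)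
    fix n
    have Wn: "W (\<lambda>x. u x + t n * \<phi> x) (\<lambda>x. g x + t n *\<^sub>R grad \<phi> x)"
      by (rule W_add[OF Wu W_test[OF \<phi>]])
    have i: "integrable M (\<lambda>x. (j x (u x + t n * \<phi> x) - j x (u x)) / t n)"
      using W_integrable_j[OF Wn] W_integrable_j[OF Wu] by simp
    have "(LINT x|M. H x) \<le> (LINT x|M. (j x (u x + t n * \<phi> x) - j x (u x)) / t n)"
    proof (rule integral_mono[OF H i])
      fix x assume "x \<in> space M"
      moreover have "t n * \<bar>\<phi> x\<bar> \<le> c * b"
        using t[of n] b c by (intro mult_mono) auto
      ultimately show "H x \<le> (j x (u x + t n * \<phi> x) - j x (u x)) / t n"
        using c t(1)[of n] by (intro le) auto
    qed
    also have "\<dots> = ((LINT x|M. j x (u x + t n * \<phi> x)) - (LINT x|M. j x (u x))) / t n"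
      using W_integrable_j[OF Wn] W_integrable_j[OF Wu] by simp
    also have "\<dots> \<le> ((energy (\<lambda>x. g x + t n *\<^sub>R grad \<phi> x) - energy g) - lam * (energy (\<lambda>x. u x + t n *\<^sub>R \<phi> x) - energy u)) / t n"
      using minimal[OF Wn] t(1)[of n] by (intro divide_right_mono) (auto simp: E_def algebra_simps)
    also have "\<dots> = (energy (\<lambda>x. g x + t n *\<^sub>R grad \<phi> x) - energy g) / t n - lam * ((energy (\<lambda>x. u x + t n *\<^sub>R \<phi> x) - energy u) / t n)"
    proof -
      have "(a - lam * b) / t n = a / t n - lam * (b / t n)" for a b
        by (simp add: diff_divide_distrib)
      then show ?thesis by blast
    qed
    finally show "(LINT x|M. H x) \<le> (energy (\<lambda>x. g x + t n *\<^sub>R grad \<phi> x) - energy g) / t n - lam * ((energy (\<lambda>x. u x + t n *\<^sub>R \<phi> x) - energy u) / t n)" .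
  qed simp
qed

section \<open>Envelopes of difference quotients at the minimiser\<close>

text \<open>\<open>A * (3 + \<bar>u x\<bar>) powr R\<close> is a Lipschitz constant of
  \<open>j x\<close> on the interval of radius \<open>\<bar>u x\<bar> + 2\<close>, which contains
  base point and end point of all increments of size at most one. The summand 1 keeps the weight
  positive.\<close>

definition wt :: "'a \<Rightarrow> real" where
  "wt x = A * (3 + \<bar>u x\<bar>) powr R + 1"

lemma wt_pos: "0 < wt x" "1 \<le> wt x"
proof -
  have "0 \<le> A * (3 + \<bar>u x\<bar>) powr R" using A_nonneg by simp
  then show "0 < wt x" "1 \<le> wt x" by (auto simp: wt_def)
qed

lemma wt_measurable[measurable]: "wt \<in> borel_measurable M"
  unfolding wt_def by measurable

lemma wt_integrable: "integrable M wt"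
  unfolding wt_def
  by (intro Bochner_Integration.integrable_add integrable_mult_right integrable_const W_integrable_weight[OF Wu])
    (use R_nonneg q_R in auto)

lemma j_quotient_bound:
  assumes x: "x \<in> \<Omega>" and "\<bar>\<rho>\<bar> \<le> 1" "0 < s" "s \<le> 1"
  shows "\<bar>(j x (u x + \<rho> + s) - j x (u x + \<rho>)) / s\<bar> \<le> wt x"
proof -
  have "\<bar>j x (u x + \<rho> + s) - j x (u x + \<rho>)\<bar> \<le> A * (1 + (\<bar>u x\<bar> + 2)) powr R * \<bar>(u x + \<rho> + s) - (u x + \<rho>)\<bar>"
    using assms by (intro j_lipschitz[OF x]) auto
  also have "\<dots> \<le> wt x * s"
    using assms by (auto simp: wt_def add.commute intro!: mult_right_mono)
  finally show ?thesis
    using assms by (simp add: abs_divide divide_le_eq)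
qed

definition quot :: "'a \<Rightarrow> real \<times> real \<Rightarrow> real" where
  "quot x z = (j x (u x + fst z + snd z) - j x (u x + fst z)) / snd z"

text \<open>Pairs of a displacement of the base point and a step. They are rational so that the
  envelopes are suprema and infima of countably many measurable functions.\<close>

definition increments :: "nat \<Rightarrow> (real \<times> real) set" where
  "increments k = {z \<in> \<rat> \<times> \<rat>. \<bar>fst z\<bar> < 1 / real (Suc k) \<and> 0 < snd z \<and> snd z < 1 / real (Suc k)}"

lemma increments_props: "countable (increments k)" "increments k \<noteq> {}"
proof -
  have "countable (\<rat> \<times> \<rat> :: (real \<times> real) set)"
    by (intro countable_SIGMA countable_rat)
  then show "countable (increments k)"
    by (rule countable_subset[rotated]) (auto simp: increments_def)
  have "(0, 1 / real (Suc (Suc k))) \<in> increments k"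
    by (auto simp: increments_def field_simps simp del: of_nat_Suc)
  then show "increments k \<noteq> {}" by blast
qed

lemma quot_bound:
  assumes "x \<in> \<Omega>" "\<bar>fst z\<bar> < 1 / real (Suc k)" "0 < snd z" "snd z < 1 / real (Suc k)"
  shows "\<bar>quot x z\<bar> \<le> wt x"
proof -
  have "1 / real (Suc k) \<le> 1" by simp
  then show ?thesis
    using assms unfolding quot_def by (intro j_quotient_bound) (assumption | linarith)+
qed

lemma quot_bdd: "x \<in> \<Omega> \<Longrightarrow> bdd_above (quot x ` increments k)" "x \<in> \<Omega> \<Longrightarrow> bdd_below (quot x ` increments k)"
  using quot_bound[of x _ k]
  by (auto intro!: bdd_aboveI[of _ "wt x"] bdd_belowI[of _ "- wt x"] simp: increments_def abs_le_iff) (smt (verit))+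

text \<open>As \<open>k\<close> grows, \<open>bl k x\<close> and \<open>bu k x\<close> close in on
  the two end points of the Clarke subdifferential of \<open>j x\<close> at
  \<open>u x\<close>.\<close>

definition bu :: "nat \<Rightarrow> 'a \<Rightarrow> real" where
  "bu k x = (SUP z\<in>increments k. quot x z)"

definition bl :: "nat \<Rightarrow> 'a \<Rightarrow> real" where
  "bl k x = (INF z\<in>increments k. quot x z)"

text \<open>Rational increments approximate real ones and the quotient is continuous in both
  entries, so the bounds by the envelopes extend to all increments of the same size.\<close>

lemma quot_between:
  assumes x: "x \<in> \<Omega>" and z: "\<bar>\<rho>\<bar> < 1 / real (Suc k)" "0 < s" "s < 1 / real (Suc k)"
  shows "bl k x \<le> quot x (\<rho>, s)" "quot x (\<rho>, s) \<le> bu k x"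
proof -
  have rat: "\<exists>r\<in>\<rat>. \<bar>r - y\<bar> < 1 / real (Suc n)" for y :: real and n
    using Rats_dense_in_real[of "y - 1 / real (Suc n)" "y + 1 / real (Suc n)"] by (auto simp: abs_less_iff) (smt (verit))
  obtain \<rho>' where \<rho>': "\<And>n. \<rho>' n \<in> \<rat>" "\<And>n. \<bar>\<rho>' n - \<rho>\<bar> < 1 / real (Suc n)"
    using rat[of \<rho>] by metis
  obtain s' where s': "\<And>n. s' n \<in> \<rat>" "\<And>n. \<bar>s' n - s\<bar> < 1 / real (Suc n)"
    using rat[of s] by metis
  have lim: "a \<longlonglongrightarrow> l" if "\<And>n. \<bar>a n - l\<bar> < 1 / real (Suc n)" for a and l :: real
    by (rule LIM_zero_cancel, rule Lim_null_comparison[OF _ LIMSEQ_Suc[OF lim_1_over_n]])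
      (use that in \<open>auto intro!: always_eventually less_imp_le simp del: of_nat_Suc\<close>)
  have \<rho>l: "\<rho>' \<longlonglongrightarrow> \<rho>" and sl: "s' \<longlonglongrightarrow> s"
    using lim \<rho>'(2) s'(2) by blast+
  have cont: "isCont (j x) y" for y
    using j_continuous[OF x] by (simp add: continuous_on_eq_continuous_at)
  have ql: "(\<lambda>n. quot x (\<rho>' n, s' n)) \<longlonglongrightarrow> quot x (\<rho>, s)"
    unfolding quot_def using z
    by (auto intro!: tendsto_divide tendsto_diff isCont_tendsto_compose[OF cont] tendsto_add tendsto_const \<rho>l sl)
  have "\<forall>\<^sub>F n in sequentially. \<bar>\<rho>' n\<bar> < 1 / real (Suc k)" "\<forall>\<^sub>F n in sequentially. 0 < s' n" "\<forall>\<^sub>F n in sequentially. s' n < 1 / real (Suc k)"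
    using z by (auto intro!: order_tendstoD[OF tendsto_rabs[OF \<rho>l]] order_tendstoD[OF sl])
  then have ev: "\<forall>\<^sub>F n in sequentially. (\<rho>' n, s' n) \<in> increments k"
    by eventually_elim (use \<rho>'(1) s'(1) in \<open>simp add: increments_def\<close>)
  show "quot x (\<rho>, s) \<le> bu k x"
    by (rule tendsto_upperbound[OF ql eventually_mono[OF ev]])
      (auto simp: bu_def intro: cSUP_upper quot_bdd[OF x])
  show "bl k x \<le> quot x (\<rho>, s)"
    by (rule tendsto_lowerbound[OF ql eventually_mono[OF ev]])
      (auto simp: bl_def intro: cINF_lower quot_bdd[OF x])
qed

lemma bu_bl_bound:
  assumes x: "x \<in> \<Omega>"
  shows "\<bar>bu k x\<bar> \<le> wt x" "\<bar>bl k x\<bar> \<le> wt x"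
proof -
  have q: "\<bar>quot x z\<bar> \<le> wt x" if "z \<in> increments k" for z
    using that by (intro quot_bound[OF x, of _ k]) (auto simp: increments_def)
  obtain z where z: "z \<in> increments k" using increments_props(2) by blast
  have "quot x z \<le> bu k x" "bl k x \<le> quot x z"
    unfolding bu_def bl_def by (intro cSUP_upper cINF_lower z quot_bdd[OF x])+
  moreover have "bu k x \<le> wt x" "- wt x \<le> bl k x"
    unfolding bu_def bl_def using q increments_props(2) by (auto intro!: cSUP_least cINF_greatest simp: abs_le_iff) (smt (verit))+
  ultimately show "\<bar>bu k x\<bar> \<le> wt x" "\<bar>bl k x\<bar> \<le> wt x"
    using q[OF z] by linarith+
qed

lemma bu_bl_measurable[measurable]: "bu k \<in> borel_measurable M" "bl k \<in> borel_measurable M"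
proof -
  have [measurable]: "(\<lambda>x. quot x z) \<in> borel_measurable M" for z
    unfolding quot_def by measurable
  show "bu k \<in> borel_measurable M" "bl k \<in> borel_measurable M"
    unfolding bu_def bl_def
    by (intro borel_measurable_cSUP borel_measurable_cINF increments_props(1); use quot_bdd in simp)+
qed

lemma bu_bl_integrable: "integrable M (bu k)" "integrable M (bl k)"
  by (rule Bochner_Integration.integrable_bound[OF wt_integrable]; use bu_bl_bound wt_pos in \<open>auto intro!: AE_I2 simp: less_imp_le\<close>)+

lemma integrable_mult_test:
  assumes f: "integrable M f" and \<phi>: "\<phi> \<in> test_functions \<Omega>"
  shows "integrable M (\<lambda>x. f x * \<phi> x)"
  by (rule integrable_test_function_mult[OF \<Omega>_sets integrable_imp_locally_integrable[OF \<Omega>_sets f] \<phi>])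

text \<open>The Lipschitz weight supplies the minorant, and \<open>\<phi>\<close> and its negative
  give the two signs. Continuity of \<open>ell\<close> for the weighted L^1 norm is what the
  representation by a function rests on.\<close>

lemma abs_ell_le:
  assumes \<phi>: "\<phi> \<in> test_functions \<Omega>"
  shows "\<bar>ell \<phi>\<bar> \<le> (LINT x|M. wt x * \<bar>\<phi> x\<bar>)"
proof -
  have i: "integrable M (\<lambda>x. wt x * \<bar>\<phi> x\<bar>)"
    using integrable_abs[OF integrable_mult_test[OF wt_integrable \<phi>]] wt_pos by (simp add: abs_mult less_imp_le)
  have lower: "- (LINT x|M. wt x * \<bar>\<psi> x\<bar>) \<le> ell \<psi>" if \<psi>: "\<psi> \<in> test_functions \<Omega>" and iw: "integrable M (\<lambda>x. wt x * \<bar>\<psi> x\<bar>)" for \<psi>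
  proof -
    have "(LINT x|M. - (wt x * \<bar>\<psi> x\<bar>)) \<le> ell \<psi>"
    proof (rule ell_lower_bound[OF \<psi>, of 1])
      show "integrable M (\<lambda>x. - (wt x * \<bar>\<psi> x\<bar>))" using iw by simp
      fix x t assume x: "x \<in> \<Omega>" and t: "0 < (t::real)" "t * \<bar>\<psi> x\<bar> < 1"
      have "\<bar>t * \<psi> x\<bar> < 1" using t by (simp add: abs_mult)
      then have "\<bar>j x (u x + t * \<psi> x) - j x (u x)\<bar> \<le> A * (1 + (\<bar>u x\<bar> + 2)) powr R * \<bar>(u x + t * \<psi> x) - u x\<bar>"
        by (intro j_lipschitz[OF x]) auto
      also have "\<dots> \<le> wt x * \<bar>t * \<psi> x\<bar>"
        by (simp add: wt_def add.commute mult_right_mono)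
      finally have "- (wt x * \<bar>\<psi> x\<bar>) * t \<le> j x (u x + t * \<psi> x) - j x (u x)"
        using t by (simp add: abs_mult mult_ac abs_le_iff)
      then show "- (wt x * \<bar>\<psi> x\<bar>) \<le> (j x (u x + t * \<psi> x) - j x (u x)) / t"
        using t by (simp add: le_divide_eq)
    qed simp
    then show ?thesis by simp
  qed
  have "(\<lambda>x. - \<phi> x) \<in> test_functions \<Omega>"
    using test_function_scale(1)[OF \<phi>, of "-1"] by simp
  from lower[OF this] lower[OF \<phi> i] i show ?thesis
    by (simp add: ell_minus[OF \<phi>] abs_le_iff)
qed

text \<open>The lower bound uses quotients with base \<open>u x\<close> and step
  \<open>t * \<phi> x\<close>. For the upper bound the negative of \<open>\<phi>\<close> is tested,
  and the increment starts at \<open>u x - t * \<phi> x\<close>; therefore the envelopes admit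
  displaced base points.\<close>

lemma ell_between:
  assumes \<phi>: "\<phi> \<in> test_functions \<Omega>" and pos: "\<And>x. 0 \<le> \<phi> x"
  shows "(LINT x|M. bl k x * \<phi> x) \<le> ell \<phi>" "ell \<phi> \<le> (LINT x|M. bu k x * \<phi> x)"
proof -
  have d: "0 < 1 / real (Suc k)" by simp
  show "(LINT x|M. bl k x * \<phi> x) \<le> ell \<phi>"
  proof (rule ell_lower_bound[OF \<phi> d integrable_mult_test[OF bu_bl_integrable(2) \<phi>]])
    fix x and t :: real assume x: "x \<in> \<Omega>" and t: "0 < t" "t * \<bar>\<phi> x\<bar> < 1 / real (Suc k)"
    show "bl k x * \<phi> x \<le> (j x (u x + t * \<phi> x) - j x (u x)) / t"
    proof (cases "\<phi> x = 0")
      case False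
      then have "\<phi> x > 0" using pos[of x] by simp
      then have "bl k x \<le> quot x (0, t * \<phi> x)"
        using t by (intro quot_between[OF x]) auto
      then have "bl k x * \<phi> x \<le> quot x (0, t * \<phi> x) * \<phi> x"
        using \<open>\<phi> x > 0\<close> by (intro mult_right_mono) auto
      then show ?thesis
        using \<open>\<phi> x > 0\<close> t by (simp add: quot_def)
    qed simp
  qed
  have m: "(\<lambda>x. - \<phi> x) \<in> test_functions \<Omega>"
    using test_function_scale(1)[OF \<phi>, of "-1"] by simp
  have "(LINT x|M. - (bu k x * \<phi> x)) \<le> ell (\<lambda>x. - \<phi> x)"
  proof (rule ell_lower_bound[OF m d])
    show "integrable M (\<lambda>x. - (bu k x * \<phi> x))"
      using integrable_mult_test[OF bu_bl_integrable(1) \<phi>] by simp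
    fix x and t :: real assume x: "x \<in> \<Omega>" and t: "0 < t" "t * \<bar>- \<phi> x\<bar> < 1 / real (Suc k)"
    show "- (bu k x * \<phi> x) \<le> (j x (u x + t * - \<phi> x) - j x (u x)) / t"
    proof (cases "\<phi> x = 0")
      case False
      then have "\<phi> x > 0" using pos[of x] by simp
      then have "quot x (- (t * \<phi> x), t * \<phi> x) \<le> bu k x"
        using t by (intro quot_between[OF x]) (auto simp: abs_mult)
      then have "quot x (- (t * \<phi> x), t * \<phi> x) * \<phi> x \<le> bu k x * \<phi> x"
        using \<open>\<phi> x > 0\<close> by (intro mult_right_mono) auto
      moreover have "quot x (- (t * \<phi> x), t * \<phi> x) * \<phi> x = (j x (u x) - j x (u x + t * - \<phi> x)) / t"
        using \<open>\<phi> x > 0\<close> t by (simp add: quot_def)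
      moreover have "\<dots> = - ((j x (u x + t * - \<phi> x) - j x (u x)) / t)"
        by (simp only: minus_divide_left minus_diff_eq)
      ultimately show ?thesis
        by linarith
    qed simp
  qed
  then show "ell \<phi> \<le> (LINT x|M. bu k x * \<phi> x)"
    by (simp add: ell_minus[OF \<phi>])
qed


section \<open>Representation of the derivative by a function\<close>

text \<open>Integrability of the weight makes this measure finite, so that bounded test functions
  are square integrable and square integrable functions are integrable.\<close>

definition Mw :: "'a measure" where
  "Mw = density M (\<lambda>x. ennreal (wt x))"

lemma measurable_Mw[simp, measurable_cong]: "sets Mw = sets M" "space Mw = \<Omega>"
  by (simp_all add: Mw_def)

lemma borel_Mw: "borel_measurable Mw = borel_measurable M"
  by (rule measurable_cong_sets) simp_all

lemma exponent_Mw: "exponent Mw (\<lambda>_. 2) 2 2"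
proof -
  have "emeasure Mw \<Omega> = (\<integral>\<^sup>+x. ennreal (wt x) \<partial>M)"
    using nn_integral_density[of "\<lambda>x. ennreal (wt x)" M "\<lambda>_. 1"] emeasure_eq_measure
    by (simp add: Mw_def emeasure_density \<Omega>_sets sets_restrict_space_iff)
  also have "\<dots> < \<infinity>"
    using wt_integrable wt_pos by (subst nn_integral_eq_integral) (auto simp: less_imp_le)
  finally have "emeasure Mw (space Mw) \<noteq> \<infinity>"
    by simp
  then interpret finite_measure Mw
    by (rule finite_measureI)
  show ?thesis
    by standard auto
qed

lemma integral_Mw:
  assumes "f \<in> borel_measurable M"
  shows "(LINT x|Mw. f x) = (LINT x|M. wt x * f x)"
  unfolding Mw_def using integral_density[OF assms wt_measurable] wt_pos by (simp add: less_imp_le)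

lemma integrable_Mw:
  fixes f :: "'a \<Rightarrow> real"
  assumes "f \<in> borel_measurable M"
  shows "integrable Mw f \<longleftrightarrow> integrable M (\<lambda>x. wt x * f x)"
  unfolding Mw_def using integrable_density[OF assms wt_measurable] wt_pos by (simp add: less_imp_le)

text \<open>The linear form \<open>ell\<close> is bounded on \<open>L\<^sup>2(wt dx)\<close>; its representing element is the limit of a
  minimising sequence of test functions for \<open>\<phi> \<mapsto> \<integral>\<phi>\<^sup>2 wt / 2 - ell \<phi>\<close>.\<close>

lemma ell_representation:
  obtains h where "h \<in> borel_measurable M" "integrable Mw h"
    "\<And>\<psi>. \<psi> \<in> test_functions \<Omega> \<Longrightarrow> ell \<psi> = (LINT x|Mw. h x * \<psi> x)"
proof -
  interpret L2: exponent Mw "\<lambda>_. 2" 2 2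
    by (rule exponent_Mw)
  have ib: "integrable Mw f" if "f \<in> borel_measurable M" "\<And>x. \<bar>f x\<bar> \<le> c" for f :: "'a \<Rightarrow> real" and c
    using that by (intro L2.integrable_const_bound[where B = c]) (auto simp: borel_Mw)
  have ip: "integrable Mw (\<lambda>x. \<phi> x * \<psi> x)" "integrable Mw (\<lambda>x. \<bar>\<phi> x\<bar>)"
    if \<phi>: "\<phi> \<in> test_functions \<Omega>" and \<psi>: "\<psi> \<in> test_functions \<Omega>" for \<phi> \<psi>
  proof -
    note [measurable] = test_measurable[OF \<phi>] test_measurable[OF \<psi>]
    obtain b where b: "\<And>x. \<bar>\<phi> x\<bar> \<le> b" using test_function_bounded[OF \<phi>] by metis
    obtain c where c: "\<And>x. \<bar>\<psi> x\<bar> \<le> c" using test_function_bounded[OF \<psi>] by metis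
    have "\<bar>\<phi> x * \<psi> x\<bar> \<le> b * c" for x
      unfolding abs_mult using b[of x] c[of x] by (intro mult_mono) auto
    then show "integrable Mw (\<lambda>x. \<phi> x * \<psi> x)"
      by (intro ib[of _ "b * c"]) auto
    show "integrable Mw (\<lambda>x. \<bar>\<phi> x\<bar>)"
      using b by (intro ib[of _ b]) auto
  qed
  define \<Psi> where "\<Psi> \<phi> = (LINT x|Mw. \<phi> x * \<phi> x) / 2 - ell \<phi>" for \<phi>
  \<comment> \<open>The exact quadratic expansion yields both the Cauchy property of a minimising
    sequence and the first variation at its limit.\<close>
  have expand: "\<Psi> (\<lambda>x. \<phi> x + c * \<psi> x) = \<Psi> \<phi> + c * ((LINT x|Mw. \<phi> x * \<psi> x) - ell \<psi>) + c * c / 2 * (LINT x|Mw. \<psi> x * \<psi> x)"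
    if \<phi>: "\<phi> \<in> test_functions \<Omega>" and \<psi>: "\<psi> \<in> test_functions \<Omega>" for \<phi> \<psi> c
  proof -
    have "(LINT x|Mw. (\<phi> x + c * \<psi> x) * (\<phi> x + c * \<psi> x)) = (LINT x|Mw. \<phi> x * \<phi> x + (2 * c) * (\<phi> x * \<psi> x) + (c * c) * (\<psi> x * \<psi> x))"
      by (simp add: algebra_simps)
    also have "\<dots> = (LINT x|Mw. \<phi> x * \<phi> x) + (2 * c) * (LINT x|Mw. \<phi> x * \<psi> x) + (c * c) * (LINT x|Mw. \<psi> x * \<psi> x)"
      using ip(1)[OF \<phi> \<phi>] ip(1)[OF \<phi> \<psi>] ip(1)[OF \<psi> \<psi>]
      by (simp only: Bochner_Integration.integral_add Bochner_Integration.integrable_add integrable_mult_right integral_mult_right_zero)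
    finally show ?thesis
      unfolding \<Psi>_def ell_add[OF \<phi> \<psi>] by (simp add: field_simps)
  qed
  \<comment> \<open>The elementary inequality
    \<open>\<bar>\<phi>\<bar> \<le> \<phi>\<^sup>2 / 2 + 1 / 2\<close> bounds the linear form by the
    quadratic term plus half of the total mass.\<close>
  have low: "- (measure Mw \<Omega> / 2) \<le> \<Psi> \<phi>" if \<phi>: "\<phi> \<in> test_functions \<Omega>" for \<phi>
  proof -
    note [measurable] = test_measurable[OF \<phi>]
    have "ell \<phi> \<le> (LINT x|Mw. \<bar>\<phi> x\<bar>)"
      using abs_ell_le[OF \<phi>] by (subst integral_Mw) auto
    moreover have "(LINT x|Mw. \<bar>\<phi> x\<bar>) \<le> (LINT x|Mw. \<phi> x * \<phi> x / 2 + 1 / 2)"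
    proof (rule integral_mono)
      show "\<bar>\<phi> x\<bar> \<le> \<phi> x * \<phi> x / 2 + 1 / 2" for x
        using zero_le_square[of "\<bar>\<phi> x\<bar> - 1"] by (simp add: algebra_simps)
    qed (use ip[OF \<phi> \<phi>] in auto)
    moreover have "\<dots> = (LINT x|Mw. \<phi> x * \<phi> x) / 2 + measure Mw \<Omega> / 2"
      using ip(1)[OF \<phi> \<phi>] by simp
    ultimately show ?thesis
      by (simp add: \<Psi>_def)
  qed
  define d where "d = Inf (\<Psi> ` test_functions \<Omega>)"
  have bdd: "bdd_below (\<Psi> ` test_functions \<Omega>)"
    using low by (auto intro!: bdd_belowI)
  have dle: "d \<le> \<Psi> \<phi>" if "\<phi> \<in> test_functions \<Omega>" for \<phi>
    unfolding d_def using that by (intro cInf_lower bdd) auto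
  have "\<exists>\<phi>\<in>test_functions \<Omega>. \<Psi> \<phi> < d + 1 / real (Suc n)" for n
  proof -
    have "Inf (\<Psi> ` test_functions \<Omega>) < d + 1 / real (Suc n)" by (simp add: d_def)
    from cInf_lessD[OF _ this] show ?thesis
      using test_function_zero by blast
  qed
  then obtain \<phi> where \<phi>: "\<And>n. \<phi> n \<in> test_functions \<Omega>" and \<Psi>\<phi>: "\<And>n. \<Psi> (\<phi> n) < d + 1 / real (Suc n)"
    by metis
  note [measurable] = test_measurable[OF \<phi>]
  have nmod: "L2.nmod f = ennreal (LINT x|Mw. f x * f x)" if "integrable Mw (\<lambda>x. f x * f x)" for f :: "'a \<Rightarrow> real"
    unfolding L2.nmod_def using that by (subst nn_integral_eq_integral[symmetric]) (auto simp: power2_eq_square)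
  have diff: "(\<lambda>x. \<phi> i x - \<phi> k x) \<in> test_functions \<Omega>" for i k
    using test_function_add(1)[OF \<phi>[of i] \<phi>[of k], of "-1"] by simp
  \<comment> \<open>Expanding around \<open>\<phi> k\<close> both at the midpoint and at
    \<open>\<phi> i\<close>, and eliminating the linear term, bounds the squared distance by the
    errors of the two near-minimisers.\<close>
  have gap: "(LINT x|Mw. (\<phi> i x - \<phi> k x) * (\<phi> i x - \<phi> k x)) \<le> 4 * (1 / real (Suc i) + 1 / real (Suc k))" for i k
  proof -
    let ?\<delta> = "\<lambda>x. \<phi> i x - \<phi> k x"
    have "d \<le> \<Psi> (\<lambda>x. \<phi> k x + (1/2) * ?\<delta> x)"
      by (intro dle test_function_add(1) \<phi> diff)
    then have "d \<le> \<Psi> (\<phi> k) + 1/2 * ((LINT x|Mw. \<phi> k x * ?\<delta> x) - ell ?\<delta>) + 1/8 * (LINT x|Mw. ?\<delta> x * ?\<delta> x)"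
      unfolding expand[OF \<phi> diff] by simp
    moreover have "\<Psi> (\<phi> i) = \<Psi> (\<lambda>x. \<phi> k x + 1 * ?\<delta> x)"
      by simp
    then have "\<Psi> (\<phi> i) = \<Psi> (\<phi> k) + ((LINT x|Mw. \<phi> k x * ?\<delta> x) - ell ?\<delta>) + 1/2 * (LINT x|Mw. ?\<delta> x * ?\<delta> x)"
      unfolding expand[OF \<phi> diff] by simp
    moreover have "Q \<le> 4 * (a + b)" if "d \<le> K + 1/2 * P + 1/8 * Q" "J = K + P + 1/2 * Q" "J < d + a" "K < d + b"
      for Q P J K a b :: real
      using that by (simp add: field_simps)
    ultimately show ?thesis
      using \<Psi>\<phi>[of i] \<Psi>\<phi>[of k] by blast
  qed
  have cauchy: "\<exists>N. \<forall>i\<ge>N. \<forall>k\<ge>N. L2.nmod (\<lambda>x. \<phi> i x - \<phi> k x) \<le> ennreal e" if "e > 0" for e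
  proof -
    have "\<forall>\<^sub>F n in sequentially. 1 / real (Suc n) < e / 8"
      using LIMSEQ_Suc[OF lim_1_over_n] that by (intro order_tendstoD(2)) auto
    then obtain N where N: "\<And>n. n \<ge> N \<Longrightarrow> 1 / real (Suc n) < e / 8"
      by (auto simp: eventually_sequentially)
    have "L2.nmod (\<lambda>x. \<phi> i x - \<phi> k x) \<le> ennreal e" if "i \<ge> N" "k \<ge> N" for i k
    proof -
      have "4 * (1 / real (Suc i) + 1 / real (Suc k)) \<le> 4 * (e / 8 + e / 8)"
        using N[OF that(1)] N[OF that(2)] by (intro mult_left_mono add_mono) auto
      then show ?thesis
        unfolding nmod[OF ip(1)[OF diff diff]] using gap[of i k] by (intro ennreal_leI) simp
    qed
    then show ?thesis by blast
  qed
  have fin: "L2.nmod (\<phi> n) < top" for n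
    unfolding nmod[OF ip(1)[OF \<phi> \<phi>]] by simp
  have mMw: "\<phi> n \<in> borel_measurable Mw" for n
    unfolding borel_Mw by measurable
  obtain h where h: "h \<in> borel_measurable Mw" "(\<lambda>n. L2.nmod (\<lambda>x. \<phi> n x - h x)) \<longlonglongrightarrow> 0" "L2.nmod h < top"
    by (rule L2.nmod_complete[OF mMw fin cauchy], assumption, rule that)
  have hi: "integrable Mw h"
    by (rule L2.nmod_finite_imp_integrable[OF h(1,3)])
  have "(\<lambda>n. \<integral>\<^sup>+x. ennreal (norm (\<phi> n x - h x)) \<partial>Mw) \<longlonglongrightarrow> 0"
    by (rule L2.nmod_tendsto_0_imp_L1[OF _ h(2)]) (use mMw h(1) in measurable)
  then have L1: "(\<lambda>n. \<integral>\<^sup>+x. ennreal \<bar>\<phi> n x - h x\<bar> \<partial>Mw) \<longlonglongrightarrow> 0"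
    by simp
  have "ell \<psi> = (LINT x|Mw. h x * \<psi> x)" if \<psi>: "\<psi> \<in> test_functions \<Omega>" for \<psi>
  proof -
    note [measurable] = test_measurable[OF \<psi>]
    obtain b where b: "\<And>x. \<bar>\<psi> x\<bar> \<le> b" using test_function_bounded[OF \<psi>] by metis
    have i\<phi>: "integrable Mw (\<phi> n)" for n
      by (rule L2.nmod_finite_imp_integrable[OF mMw fin])
    have lim: "(\<lambda>n. LINT x|Mw. \<phi> n x * \<psi> x) \<longlonglongrightarrow> (LINT x|Mw. h x * \<psi> x)"
      by (rule L1_tendsto_integral_mult[OF i\<phi> hi L1 _ b]) (simp add: borel_Mw)
    \<comment> \<open>\<open>X\<close> is the defect of the representation at \<open>\<psi>\<close>.
      Near-minimality of \<open>\<phi> n\<close>, compared with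
      \<open>\<phi> n + t * \<psi>\<close>, makes \<open>t * X + t * t * Y\<close> nonnegative for
      every \<open>t\<close>.\<close>
    define X Y where "X = (LINT x|Mw. h x * \<psi> x) - ell \<psi>" and "Y = (LINT x|Mw. \<psi> x * \<psi> x) / 2"
    have "Y \<ge> 0" by (simp add: Y_def)
    have pos: "0 \<le> t * X + t * t * Y" for t
    proof (rule tendsto_lowerbound)
      have "(\<lambda>n. 1 / real (Suc n) + t * ((LINT x|Mw. \<phi> n x * \<psi> x) - ell \<psi>) + t * t * Y) \<longlonglongrightarrow> 0 + t * X + t * t * Y"
        unfolding X_def by (intro tendsto_intros lim LIMSEQ_Suc[OF lim_1_over_n])
      then show "(\<lambda>n. 1 / real (Suc n) + t * ((LINT x|Mw. \<phi> n x * \<psi> x) - ell \<psi>) + t * t * Y) \<longlonglongrightarrow> t * X + t * t * Y"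
        by simp
      show "\<forall>\<^sub>F n in sequentially. 0 \<le> 1 / real (Suc n) + t * ((LINT x|Mw. \<phi> n x * \<psi> x) - ell \<psi>) + t * t * Y"
      proof (intro always_eventually allI)
        fix n
        have "d \<le> \<Psi> (\<lambda>x. \<phi> n x + t * \<psi> x)"
          by (intro dle test_function_add(1) \<phi> \<psi>)
        then show "0 \<le> 1 / real (Suc n) + t * ((LINT x|Mw. \<phi> n x * \<psi> x) - ell \<psi>) + t * t * Y"
          using \<Psi>\<phi>[of n] unfolding expand[OF \<phi> \<psi>] Y_def by simp
      qed
    qed simp
    have "X = 0"
    proof (rule ccontr)
      assume "X \<noteq> 0"
      \<comment> \<open>Since \<open>c * Y = 1 - c\<close>, the quadratic at
        \<open>t = - X * c\<close> equals \<open>- ((X * X) * (c * c))\<close>, which is negative;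
        adding 1 in the denominator covers \<open>Y = 0\<close>.\<close>
      define c where "c = 1 / (Y + 1)"
      have c: "c > 0" "c * Y = 1 - c"
        using \<open>Y \<ge> 0\<close> by (auto simp: c_def field_simps)
      have "(- X * c) * X + (- X * c) * (- X * c) * Y = - (X * X) * c + (X * X) * c * (c * Y)"
        by (simp add: algebra_simps)
      also have "\<dots> = - ((X * X) * (c * c))"
        unfolding c(2) by (simp add: algebra_simps)
      also have "\<dots> < 0"
        using \<open>X \<noteq> 0\<close> c(1) by (auto simp: zero_less_mult_iff linorder_neq_iff)
      finally show False
        using pos[of "- X * c"] by simp
    qed
    then show ?thesis by (simp add: X_def)
  qed
  then show thesis
    using that[of h] h(1) hi by (simp add: borel_Mw)
qed

text \<open>With respect to Lebesgue measure the representing density is \<open>wt * h\<close>. Off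
  one null set it lies between the envelopes for all \<open>k\<close> at once, and increments below
  \<open>1 / (k + 1)\<close> supply the quotients that a Clarke subgradient requires.\<close>

lemma euler_lagrange:
  obtains vs where "vs \<in> borel_measurable M" "integrable M vs" "AE x in M. vs x \<in> clarke_subdiff (j x) (u x)"
    "\<And>\<psi>. \<psi> \<in> test_functions \<Omega> \<Longrightarrow> ell \<psi> = (LINT x|M. vs x * \<psi> x)"
proof -
  obtain h where h[measurable]: "h \<in> borel_measurable M" and hi: "integrable Mw h"
    and rep: "\<And>\<psi>. \<psi> \<in> test_functions \<Omega> \<Longrightarrow> ell \<psi> = (LINT x|Mw. h x * \<psi> x)"
    by (rule ell_representation, rule that)
  define vs where "vs x = wt x * h x" for x
  have vm: "vs \<in> borel_measurable M"
    unfolding vs_def by measurable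
  have vi: "integrable M vs"
    using hi integrable_Mw[OF h] by (simp add: vs_def[abs_def])
  have eq: "ell \<psi> = (LINT x|M. vs x * \<psi> x)" if \<psi>: "\<psi> \<in> test_functions \<Omega>" for \<psi>
  proof -
    note [measurable] = test_measurable[OF \<psi>]
    show ?thesis
      unfolding rep[OF \<psi>] vs_def by (subst integral_Mw) (simp_all add: mult.assoc)
  qed
  have "AE x in M. 0 \<le> bu k x - vs x" for k
  proof (rule AE_nonneg_if_test_integrals_nonneg[OF \<Omega>_open])
    have i: "integrable M (\<lambda>x. bu k x - vs x)"
      using bu_bl_integrable vi by simp
    then show "locally_integrable_on (\<lambda>x. bu k x - vs x) \<Omega>"
      by (rule integrable_imp_locally_integrable[OF \<Omega>_sets])
    fix \<psi> :: "'a \<Rightarrow> real" assume \<psi>: "\<psi> \<in> test_functions \<Omega>" "\<And>x. 0 \<le> \<psi> x"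
    show "0 \<le> (LINT x|M. (bu k x - vs x) * \<psi> x)"
      using ell_between(2)[OF \<psi>, of k] eq[OF \<psi>(1)] integrable_mult_test[OF bu_bl_integrable(1) \<psi>(1)] integrable_mult_test[OF vi \<psi>(1)]
      by (simp add: left_diff_distrib)
  qed
  moreover have "AE x in M. 0 \<le> vs x - bl k x" for k
  proof (rule AE_nonneg_if_test_integrals_nonneg[OF \<Omega>_open])
    have i: "integrable M (\<lambda>x. vs x - bl k x)"
      using bu_bl_integrable vi by simp
    then show "locally_integrable_on (\<lambda>x. vs x - bl k x) \<Omega>"
      by (rule integrable_imp_locally_integrable[OF \<Omega>_sets])
    fix \<psi> :: "'a \<Rightarrow> real" assume \<psi>: "\<psi> \<in> test_functions \<Omega>" "\<And>x. 0 \<le> \<psi> x"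
    show "0 \<le> (LINT x|M. (vs x - bl k x) * \<psi> x)"
      using ell_between(1)[OF \<psi>, of k] eq[OF \<psi>(1)] integrable_mult_test[OF bu_bl_integrable(2) \<psi>(1)] integrable_mult_test[OF vi \<psi>(1)]
      by (simp add: left_diff_distrib)
  qed
  ultimately have "AE x in M. \<forall>k. 0 \<le> bu k x - vs x \<and> 0 \<le> vs x - bl k x"
    by (simp add: AE_all_countable)
  then have "AE x in M. vs x \<in> clarke_subdiff (j x) (u x)"
    using AE_space
  proof eventually_elim
    case (elim x)
    then have x: "x \<in> \<Omega>" by simp
    show ?case
    proof (rule clarke_subdiff_between)
      fix \<delta> :: real assume "\<delta> > 0"
      then obtain k where k: "1 / real (Suc k) < \<delta>"
        using nat_approx_posE by blast
      have "vs x - \<delta> < (SUP z\<in>increments k. quot x z)"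
        using elim(1) \<open>\<delta> > 0\<close> unfolding bu_def[symmetric] by (smt (verit))
      then obtain z where z: "z \<in> increments k" "vs x - \<delta> < quot x z"
        using less_cSUP_iff[OF increments_props(2) quot_bdd(1)[OF x]] by blast
      then show "\<exists>y s. \<bar>y - u x\<bar> < \<delta> \<and> 0 < s \<and> s < \<delta> \<and> vs x - \<delta> \<le> (j x (y + s) - j x y) / s"
        using k by (intro exI[of _ "u x + fst z"] exI[of _ "snd z"]) (auto simp: increments_def quot_def)
    next
      fix \<delta> :: real assume "\<delta> > 0"
      then obtain k where k: "1 / real (Suc k) < \<delta>"
        using nat_approx_posE by blast
      have "(INF z\<in>increments k. quot x z) < vs x + \<delta>"
        using elim(1) \<open>\<delta> > 0\<close> unfolding bl_def[symmetric] by (smt (verit))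
      then obtain z where z: "z \<in> increments k" "quot x z < vs x + \<delta>"
        using cINF_less_iff[OF increments_props(2) quot_bdd(2)[OF x]] by blast
      then show "\<exists>y s. \<bar>y - u x\<bar> < \<delta> \<and> 0 < s \<and> s < \<delta> \<and> (j x (y + s) - j x y) / s \<le> vs x + \<delta>"
        using k by (intro exI[of _ "u x + fst z"] exI[of _ "snd z"]) (auto simp: increments_def quot_def)
    qed
  qed
  then show thesis
    using that vm vi eq by blast
qed

end

end

section \<open>Existence of a nontrivial solution\<close>

text \<open>The decay estimate started at \<open>L\<close> keeps \<open>f t / \<bar>t\<bar>\<close>
  plus a positive power below a constant \<open>\<alpha>\<close>. The bound \<open>B\<close> is
  fixed before \<open>f\<close> and \<open>r\<close>, so that one constant serves all points
  x.\<close>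

lemma clarke_decay_imp_bounded_above:
  assumes pm: "1 < pm" "pm \<le> pp" and c: "0 < c" and L: "0 < L" and A: "0 \<le> A"
  obtains B where "\<And>f r t. \<lbrakk>pm \<le> r; r \<le> pp; continuous_on UNIV f; \<And>t. \<bar>f t\<bar> \<le> A * (1 + \<bar>t\<bar>) powr R * \<bar>t\<bar>;
      \<And>t v. \<lbrakk>L \<le> \<bar>t\<bar>; v \<in> clarke_subdiff f t\<rbrakk> \<Longrightarrow> v * t - f t \<le> - c * \<bar>t\<bar> powr r\<rbrakk> \<Longrightarrow> f t \<le> B"
proof -
  \<comment> \<open>With this value \<open>\<kappa> * (r - 1) \<le> c\<close> holds for every
    \<open>r \<le> pp\<close> at once.\<close>
  define \<kappa> where "\<kappa> = c / (pp - 1)"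
  have \<kappa>: "\<kappa> > 0" using pm c by (simp add: \<kappa>_def)
  define \<alpha> where "\<alpha> = A * (1 + L) powr R + \<kappa> * (1 + L) powr pp"
  have \<alpha>: "\<alpha> > 0"
    unfolding \<alpha>_def using A \<kappa> L by (intro add_nonneg_pos) auto
  \<comment> \<open>\<open>T powr (pm - 1)\<close> is \<open>max 1 (\<alpha> / \<kappa>)\<close>, so
    beyond \<open>T\<close> the term \<open>\<kappa> * s powr (r - 1)\<close> is at least
    \<open>\<alpha>\<close> and \<open>f\<close> is nonpositive.\<close>
  define T where "T = max 1 (\<alpha> / \<kappa>) powr (1 / (pm - 1))"
  have T: "1 \<le> T"
    using pm by (simp add: T_def ge_one_powr_ge_zero)
  \<comment> \<open>The two summands cover \<open>\<bar>t\<bar> < L\<close> and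
    \<open>L \<le> \<bar>t\<bar> \<le> T\<close>.\<close>
  define B where "B = A * (max 1 ((1 + L) powr R)) * L + \<alpha> * T"
  have "f t \<le> B"
    if r: "pm \<le> r" "r \<le> pp" and cont: "continuous_on UNIV f" and bound: "\<And>t. \<bar>f t\<bar> \<le> A * (1 + \<bar>t\<bar>) powr R * \<bar>t\<bar>"
      and dec: "\<And>t v. \<lbrakk>L \<le> \<bar>t\<bar>; v \<in> clarke_subdiff f t\<rbrakk> \<Longrightarrow> v * t - f t \<le> - c * \<bar>t\<bar> powr r" for f r t
  proof (cases "\<bar>t\<bar> < L")
    case True
    have "(1 + \<bar>t\<bar>) powr R \<le> max 1 ((1 + L) powr R)"
    proof (cases "R \<ge> 0")
      case True
      then have "(1 + \<bar>t\<bar>) powr R \<le> (1 + L) powr R"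
        using \<open>\<bar>t\<bar> < L\<close> by (intro powr_mono2) auto
      then show ?thesis by simp
    next
      case False
      then have "(1 + \<bar>t\<bar>) powr R \<le> (1 + \<bar>t\<bar>) powr 0"
        by (intro powr_mono) simp_all
      moreover have "1 + \<bar>t\<bar> \<noteq> 0" by linarith
      ultimately show ?thesis by simp
    qed
    then have "A * (1 + \<bar>t\<bar>) powr R * \<bar>t\<bar> \<le> A * max 1 ((1 + L) powr R) * L"
      using True A by (intro mult_mono mult_left_mono) auto
    moreover have "0 \<le> \<alpha> * T" using \<alpha> T by simp
    ultimately show ?thesis
      using bound[of t] unfolding B_def by linarith
  next
    case False
    define \<sigma> where "\<sigma> = (if t \<ge> 0 then 1 else -1 :: real)"
    define s where "s = \<bar>t\<bar>"
    have \<sigma>: "\<sigma> = 1 \<or> \<sigma> = -1" "t = \<sigma> * s" "\<bar>\<sigma>\<bar> = 1"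
      by (auto simp: \<sigma>_def s_def)
    have s: "L \<le> s" "0 < s" using False L by (auto simp: s_def)
    have "f (\<sigma> * s) / s + \<kappa> * s powr (r - 1) \<le> f (\<sigma> * L) / L + \<kappa> * L powr (r - 1)"
    proof (rule clarke_superlinear_decay[OF \<sigma>(1) cont L s(1) _ \<kappa>, where c = c])
      show "1 < r" using r pm by simp
      have "\<kappa> * (r - 1) \<le> \<kappa> * (pp - 1)"
        using \<kappa> r by (intro mult_left_mono) auto
      then show "\<kappa> * (r - 1) \<le> c"
        using pm by (simp add: \<kappa>_def)
      fix x v assume "L \<le> x" "v \<in> clarke_subdiff f (\<sigma> * x)"
      then show "v * (\<sigma> * x) - f (\<sigma> * x) \<le> - c * x powr r"
        using dec[of "\<sigma> * x" v] L \<sigma>(3) by (simp add: abs_mult)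
    qed
    also have "\<dots> \<le> \<alpha>"
    proof -
      have "f (\<sigma> * L) \<le> A * (1 + L) powr R * L"
        using bound[of "\<sigma> * L"] L \<sigma>(3) by (simp add: abs_mult)
      then have "f (\<sigma> * L) / L \<le> A * (1 + L) powr R"
        using L by (simp add: divide_le_eq)
      moreover have "L powr (r - 1) \<le> (1 + L) powr (r - 1)"
        using L r pm by (intro powr_mono2) auto
      moreover have "(1 + L) powr (r - 1) \<le> (1 + L) powr pp"
        using L r by (intro powr_mono) auto
      ultimately show ?thesis
        using \<kappa> unfolding \<alpha>_def by (intro add_mono mult_left_mono) auto
    qed
    finally have main: "f t / s + \<kappa> * s powr (r - 1) \<le> \<alpha>"
      by (simp add: \<sigma>(2))
    have nonneg: "0 \<le> A * (max 1 ((1 + L) powr R)) * L" using A L by simp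
    show ?thesis
    proof (cases "s \<le> T")
      case True
      have "0 \<le> \<kappa> * s powr (r - 1)" using \<kappa> by simp
      then have "f t / s \<le> \<alpha>" using main by linarith
      then have "f t \<le> \<alpha> * s" using s by (simp add: divide_le_eq)
      also have "\<dots> \<le> \<alpha> * T" using True \<alpha> by (intro mult_left_mono) auto
      finally show ?thesis using nonneg unfolding B_def by linarith
    next
      case False
      then have "1 < s" using T by simp
      have "\<alpha> / \<kappa> \<le> max 1 (\<alpha> / \<kappa>)" by simp
      also have "\<dots> = T powr (pm - 1)"
        using pm by (simp add: T_def powr_powr)
      also have "\<dots> \<le> s powr (pm - 1)"
        using False T pm by (intro powr_mono2) auto
      also have "\<dots> \<le> s powr (r - 1)"
        using \<open>1 < s\<close> r by (intro powr_mono) auto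
      finally have "\<alpha> \<le> \<kappa> * s powr (r - 1)"
        using \<kappa> by (simp add: divide_le_eq mult.commute)
      then have "f t / s \<le> 0" using main by linarith
      then have "f t \<le> 0" using s by (simp add: divide_le_0_iff)
      moreover have "0 \<le> \<alpha> * T" using \<alpha> T by simp
      ultimately show ?thesis using nonneg unfolding B_def by linarith
    qed
  qed
  then show thesis by (rule that)
qed

section \<open>Coercivity from the spectral bound\<close>

context variable_sobolev
begin

lemma W_modular:
  assumes W: "W u g"
  shows "modular \<Omega> p (\<lambda>x. norm (weak_grad \<Omega> u x)) = (LINT x|M. norm (g x) powr p x)"
    "modular \<Omega> p u = (LINT x|M. norm (u x) powr p x)"
proof -
  note [measurable] = W_measurable[OF W] weak_grad_AE_eq(3)[OF W_is_weak_gradient[OF W]]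
  have "AE x in M. \<bar>norm (weak_grad \<Omega> u x)\<bar> powr p x = norm (g x) powr p x"
    using W_imp_W01px(2)[OF W] by eventually_elim simp
  then show "modular \<Omega> p (\<lambda>x. norm (weak_grad \<Omega> u x)) = (LINT x|M. norm (g x) powr p x)"
    unfolding modular_def by (intro integral_cong_AE) measurable
  show "modular \<Omega> p u = (LINT x|M. norm (u x) powr p x)"
    by (simp add: modular_def)
qed

lemma modular_pos:
  assumes W: "W u g" and nt: "nontrivial_on \<Omega> u"
  shows "0 < modular \<Omega> p u"
proof (rule ccontr)
  assume "\<not> 0 < modular \<Omega> p u"
  moreover have "0 \<le> (LINT x|M. \<bar>u x\<bar> powr p x)"
    by (intro integral_nonneg_AE) auto
  ultimately have z: "(LINT x|M. \<bar>u x\<bar> powr p x) = 0"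
    unfolding modular_def by linarith
  have "integrable M (\<lambda>x. \<bar>u x\<bar> powr p x)"
    using nmod_finiteD[OF W_measurable(1)[OF W] W_finite(1)[OF W]] by simp
  then have "AE x in M. \<bar>u x\<bar> powr p x = 0"
    using integral_nonneg_eq_0_iff_AE[of M "\<lambda>x. \<bar>u x\<bar> powr p x"] z by simp
  then have "AE x in M. u x = 0"
    by eventually_elim simp
  then show False
    using nt by (simp add: nontrivial_on_def)
qed

text \<open>Functions that vanish almost everywhere are excluded from the infimum; for them the left
  side is zero and the right side nonnegative.\<close>

lemma lambda_star_le:
  assumes W: "W u g"
  shows "lambda_star \<Omega> p * (LINT x|M. norm (u x) powr p x) \<le> (LINT x|M. norm (g x) powr p x)"
proof (cases "nontrivial_on \<Omega> u")
  case True
  have "lambda_star \<Omega> p \<le> modular \<Omega> p (\<lambda>x. norm (weak_grad \<Omega> u x)) / modular \<Omega> p u"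
    unfolding lambda_star_def
  proof (rule cINF_lower)
    show "bdd_below ((\<lambda>u. modular \<Omega> p (\<lambda>x. norm (weak_grad \<Omega> u x)) / modular \<Omega> p u) ` {u \<in> W01px \<Omega> p. nontrivial_on \<Omega> u})"
    proof (rule bdd_belowI2[of _ 0])
      fix v
      show "0 \<le> modular \<Omega> p (\<lambda>x. norm (weak_grad \<Omega> v x)) / modular \<Omega> p v"
        unfolding modular_def by (intro divide_nonneg_nonneg integral_nonneg_AE) auto
    qed
  qed (use True W_imp_W01px(1)[OF W] in simp)
  then show ?thesis
    using modular_pos[OF W True] by (simp add: le_divide_eq W_modular[OF W])
next
  case False
  then have "AE x in M. norm (u x) powr p x = 0"
    by (auto simp: nontrivial_on_def)
  then have "(LINT x|M. norm (u x) powr p x) = 0"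
    by (rule integral_eq_zero_AE)
  moreover have "0 \<le> (LINT x|M. norm (g x) powr p x)"
    by (intro integral_nonneg_AE) auto
  ultimately show ?thesis by simp
qed

text \<open>For \<open>lam \<le> 0\<close> the gradient energy alone suffices. For
  \<open>lam > 0\<close> the assumption forces \<open>lambda_star\<close> to be positive; then
  \<open>energy u\<close> is at most the gradient modular divided by \<open>pm\<close> times
  \<open>lambda_star\<close>, while \<open>energy g\<close> is at least that modular divided by
  \<open>pp\<close>.\<close>

lemma lambda_coercive:
  assumes lambda: "lam < ptilde \<Omega> p * lambda_star \<Omega> p"
  obtains \<gamma> where "0 < \<gamma>" "\<And>u g. W u g \<Longrightarrow> lam * energy u + \<gamma> * (LINT x|M. norm (g x) powr p x) \<le> energy g"
proof (cases "lam \<le> 0")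
  case True
  have "pp > 0" using pm_gt_1 pm_le_pp by simp
  show thesis
  proof (rule that[of "1 / pp"])
    fix u g assume W: "W u g"
    have "lam * energy u \<le> 0"
      using True energy_bounds(3)[OF W_measurable(1)[OF W] W_finite(1)[OF W]] by (simp add: mult_nonpos_nonneg)
    then show "lam * energy u + 1 / pp * (LINT x|M. norm (g x) powr p x) \<le> energy g"
      using energy_bounds(1)[OF W_measurable(2)[OF W] W_finite(2)[OF W]] by simp
  qed (use \<open>pp > 0\<close> in simp)
next
  case False
  let ?l = "lambda_star \<Omega> p"
  have pos: "pp > 0" "pm > 0" using pm_gt_1 pm_le_pp by auto
  have "0 < ((pm - 1) * pp) / ((pp - 1) * pm)"
    using pm_gt_1 pm_le_pp by simp
  then have pt: "0 < ptilde \<Omega> p" "ptilde \<Omega> p \<le> pm / pp"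
    using pos by (auto simp: ptilde_def)
  have l: "?l > 0"
    using False lambda pt(1) by (smt (verit) mult_nonneg_nonpos)
  have "lam < pm / pp * ?l"
    using lambda mult_right_mono[OF pt(2), of ?l] l by simp
  then have lt: "lam * pp < pm * ?l"
    using pos by (simp add: field_simps)
  \<comment> \<open>What remains of \<open>1 / pp\<close> after the term with \<open>lam\<close> has
    been absorbed; \<open>lam * pp < pm * ?l\<close> is its positivity.\<close>
  define \<gamma> where "\<gamma> = 1 / pp - lam / (pm * ?l)"
  show thesis
  proof (rule that[of \<gamma>])
    show "0 < \<gamma>"
      using lt pos l by (simp add: \<gamma>_def field_simps)
    fix u g assume W: "W u g"
    let ?I = "LINT x|M. norm (g x) powr p x"
    have "energy u \<le> (LINT x|M. norm (u x) powr p x) / pm"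
      by (rule energy_bounds(2)[OF W_measurable(1)[OF W] W_finite(1)[OF W]])
    also have "\<dots> \<le> (?I / ?l) / pm"
      using lambda_star_le[OF W] l pos by (intro divide_right_mono) (auto simp: le_divide_eq mult.commute)
    finally have "lam * energy u \<le> lam * ((?I / ?l) / pm)"
      using False by (intro mult_left_mono) auto
    moreover have "lam * ((?I / ?l) / pm) + \<gamma> * ?I = ?I / pp"
      using pos l by (simp add: \<gamma>_def field_simps)
    moreover have "?I / pp \<le> energy g"
      by (rule energy_bounds(1)[OF W_measurable(2)[OF W] W_finite(2)[OF W]])
    ultimately show "lam * energy u + \<gamma> * ?I \<le> energy g"
      by linarith
  qed
qed

end

context potential
begin

lemma nontrivial_minimiser:
  assumes w: "w \<in> W01px \<Omega> p" "nontrivial_on \<Omega> w"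
    and le: "1 / pm * modular \<Omega> p (\<lambda>x. norm (weak_grad \<Omega> w x)) + max 0 (- lam) / pm * modular \<Omega> p w
        \<le> (LINT x|M. j x (w x))"
  obtains u g where "W u g" "\<And>v h. W v h \<Longrightarrow> E u g \<le> E v h" "nontrivial_on \<Omega> u"
proof -
  obtain u g where u: "W u g" "\<And>v h. W v h \<Longrightarrow> E u g \<le> E v h"
    by (rule minimiser_exists, rule that)
  show thesis
  proof (cases "nontrivial_on \<Omega> u")
    case True
    then show ?thesis using that u by blast
  next
    case False
    then have z: "AE x in M. u x = 0" by (simp add: nontrivial_on_def)
    let ?h = "weak_grad \<Omega> w"
    have W: "W w ?h" by (rule W01px_imp_W[OF w(1)])
    have "(LINT x|M. j x (u x)) = 0"
      by (rule integral_eq_zero_AE) (use z AE_space in \<open>eventually_elim, simp add: j_zero\<close>)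
    moreover have "energy u = 0"
      unfolding energy_def by (rule integral_eq_zero_AE) (use z in \<open>eventually_elim, simp\<close>)
    moreover have "0 \<le> energy g"
      by (rule energy_bounds(3)[OF W_measurable(2)[OF u(1)] W_finite(2)[OF u(1)]])
    ultimately have "0 \<le> E u g" by (simp add: E_def)
    moreover have "E w ?h \<le> 0"
    proof -
      \<comment> \<open>The factor \<open>1 / pm\<close> in the hypothesis on \<open>w\<close> is
        the one lost in passing from energies to modulars, so the functional at \<open>w\<close> is
        at most zero for either sign of \<open>lam\<close>.\<close>
      have "energy ?h \<le> 1 / pm * modular \<Omega> p (\<lambda>x. norm (weak_grad \<Omega> w x))"
        using energy_bounds(2)[OF W_measurable(2)[OF W] W_finite(2)[OF W]] by (simp add: W_modular(1)[OF W])
      moreover have "- lam * energy w \<le> max 0 (- lam) * energy w"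
        using energy_bounds(3)[OF W_measurable(1)[OF W] W_finite(1)[OF W]] by (intro mult_right_mono) auto
      moreover have "max 0 (- lam) * energy w \<le> max 0 (- lam) * (modular \<Omega> p w / pm)"
        using energy_bounds(2)[OF W_measurable(1)[OF W] W_finite(1)[OF W]] by (intro mult_left_mono) (auto simp: W_modular(2)[OF W])
      ultimately show ?thesis
        using le by (simp add: E_def)
    qed
    ultimately have "E w ?h \<le> E v k" if "W v k" for v k
      using u(2)[OF that] by simp
    then show ?thesis using that W w(2) by blast
  qed
qed

text \<open>The notion of solution refers to the chosen weak gradients of \<open>u\<close> and of
  every test function. They agree almost everywhere with \<open>g\<close> and
  \<open>grad \<psi>\<close>, in terms of which \<open>ell\<close> is written.\<close>

lemma nontrivial_solution:
  assumes w: "w \<in> W01px \<Omega> p" "nontrivial_on \<Omega> w"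
    and le: "1 / pm * modular \<Omega> p (\<lambda>x. norm (weak_grad \<Omega> w x)) + max 0 (- lam) / pm * modular \<Omega> p w
        \<le> (LINT x|M. j x (w x))"
  shows "\<exists>u. is_solution \<Omega> p lam j u \<and> nontrivial_on \<Omega> u"
proof -
  obtain u g where u: "W u g" "\<And>v h. W v h \<Longrightarrow> E u g \<le> E v h" "nontrivial_on \<Omega> u"
    by (rule nontrivial_minimiser[OF w le], rule that)
  obtain vs where vs: "vs \<in> borel_measurable M" "integrable M vs" "AE x in M. vs x \<in> clarke_subdiff (j x) (u x)"
    and eq: "\<And>\<psi>. \<psi> \<in> test_functions \<Omega> \<Longrightarrow> ell u g \<psi> = (LINT x|M. vs x * \<psi> x)"
    by (rule euler_lagrange[OF u(1,2)], assumption, rule that)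
  note [measurable] = W_measurable[OF u(1)] weak_grad_AE_eq(3)[OF W_is_weak_gradient[OF u(1)]]
  have "is_solution \<Omega> p lam j u"
    unfolding is_solution_def
  proof (intro conjI bexI[of _ vs] ballI W_imp_W01px(1)[OF u(1)] vs(1,3))
    fix \<psi> assume \<psi>: "\<psi> \<in> test_functions \<Omega>"
    show "integrable M (\<lambda>x. vs x * \<psi> x)"
      by (rule integrable_test_function_mult[OF \<Omega>_sets integrable_imp_locally_integrable[OF \<Omega>_sets vs(2)] \<psi>])
    note [measurable] = test_measurable[OF \<psi>] weak_grad_AE_eq(3)[OF grad_is_weak_gradient[OF \<Omega>_open \<psi>]]
    have "(LINT x|M. norm (weak_grad \<Omega> u x) powr (p x - 2) * (weak_grad \<Omega> u x \<bullet> weak_grad \<Omega> \<psi> x))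
        = (LINT x|M. norm (g x) powr (p x - 2) * (g x \<bullet> grad \<psi> x))"
    proof (rule integral_cong_AE)
      show "AE x in M. norm (weak_grad \<Omega> u x) powr (p x - 2) * (weak_grad \<Omega> u x \<bullet> weak_grad \<Omega> \<psi> x)
          = norm (g x) powr (p x - 2) * (g x \<bullet> grad \<psi> x)"
        using W_imp_W01px(2)[OF u(1)] weak_grad_AE_eq(2)[OF grad_is_weak_gradient[OF \<Omega>_open \<psi>]] by eventually_elim simp
    qed measurable
    also have "\<dots> = lam * (LINT x|M. norm (u x) powr (p x - 2) * (u x \<bullet> \<psi> x)) + (LINT x|M. vs x * \<psi> x)"
      using eq[OF \<psi>] by (simp add: ell_def[OF u(1,2)])
    also have "lam * (LINT x|M. norm (u x) powr (p x - 2) * (u x \<bullet> \<psi> x)) = (LINT x|M. lam * \<bar>u x\<bar> powr (p x - 2) * u x * \<psi> x)"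
      by (simp add: mult.assoc)
    finally show "(LINT x|M. norm (weak_grad \<Omega> u x) powr (p x - 2) * (weak_grad \<Omega> u x \<bullet> weak_grad \<Omega> \<psi> x))
        = (LINT x|M. lam * \<bar>u x\<bar> powr (p x - 2) * u x * \<psi> x) + (LINT x|M. vs x * \<psi> x)" .
  qed
  then show ?thesis using u(3) by blast
qed

end

theorem theorem3p8:
  fixes \<Omega> :: "(real ^ 'n) set"
    and p :: "real ^ 'n \<Rightarrow> real"
    and lam :: real
    and j :: "real ^ 'n \<Rightarrow> real \<Rightarrow> real"
  assumes dim: "CARD('n) > 2"
    and domain: "bounded_Ck_domain 2 \<Omega>"
    and p_cont: "continuous_on (closure \<Omega>) p"
    and p_minus: "1 < pminus \<Omega> p"
    and p_plus: "pplus \<Omega> p < real CARD('n)"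
    and p_crit: "pplus \<Omega> p \<le> crit_exponent \<Omega> p"
    and H: "hyp_H \<Omega> p j"
    and H1: "hyp_H1 \<Omega> p lam j"
    and lambda: "lam < ptilde \<Omega> p * lambda_star \<Omega> p"
  shows "\<exists>u. is_solution \<Omega> p lam j u \<and> nontrivial_on \<Omega> u"
proof -
  interpret variable_sobolev \<Omega> p
    by standard (use domain p_cont p_minus in \<open>auto simp: bounded_Ck_domain_def\<close>)
  define N where "N = real CARD('n)"
  have Npm: "0 < N - pm" using p_plus pm_le_pp by (simp add: N_def)
  obtain a c\<^sub>1 r Ma where "AE x in M. a x \<le> Ma" and c\<^sub>1: "c\<^sub>1 > 0"
    and r: "continuous_on (closure \<Omega>) r" "\<And>x. x \<in> closure \<Omega> \<Longrightarrow> 1 \<le> r x"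
    and rp: "pp \<le> (SUP x\<in>closure \<Omega>. r x)" "(SUP x\<in>closure \<Omega>. r x) < crit_exponent \<Omega> p"
    and growth: "AE x in M. \<forall>t. \<forall>v\<in>clarke_subdiff (j x) t. \<bar>v\<bar> \<le> a x + c\<^sub>1 * abs_pow t (r x - 1)"
    using H unfolding hyp_H_def growth_condition_def by blast
  define rmax where "rmax = (SUP x\<in>closure \<Omega>. r x)"
  have "bounded (r ` closure \<Omega>)"
    using \<Omega>_bounded r(1) by (intro compact_imp_bounded compact_continuous_image) (auto simp: compact_closure)
  then have r_le: "r x \<le> rmax" if "x \<in> closure \<Omega>" for x
    unfolding rmax_def using that by (intro cSUP_upper bounded_imp_bdd_above) auto
  \<comment> \<open>Subgradients grow with exponent at most \<open>rmax - 1\<close>, so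
    \<open>A * (1 + \<bar>t\<bar>) powr R\<close> will bound them uniformly in x.\<close>
  define R where "R = rmax - 1"
  have R: "0 \<le> R"
    using rp(1) pm_gt_1 pm_le_pp by (simp add: R_def rmax_def)
  define A where "A = max 0 Ma + c\<^sub>1"
  have A: "0 \<le> A" using c\<^sub>1 by (simp add: A_def)
  \<comment> \<open>The midpoint lies strictly between the growth exponent and the critical one,
    hence also strictly above \<open>pp\<close>.\<close>
  define q where "q = (rmax + crit_exponent \<Omega> p) / 2"
  have q: "R + 1 \<le> q" "pp < q" "q < crit_exponent \<Omega> p"
    using rp by (auto simp: q_def R_def rmax_def)
  have q_sub: "q * (real DIM(real ^ 'n) - pm) < real DIM(real ^ 'n) * pm"
    using q(3) Npm by (simp add: crit_exponent_def N_def less_divide_eq)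
  obtain c where c: "c > 0" and dec0: "\<And>\<epsilon>. \<epsilon> > 0 \<Longrightarrow> \<exists>L>0. AE x in M. \<forall>t. \<forall>v\<in>clarke_subdiff (j x) t.
        L \<le> \<bar>t\<bar> \<longrightarrow> (v * t - j x t) / \<bar>t\<bar> powr p x \<le> - c + \<epsilon>"
    using H1 unfolding hyp_H1_def by blast
  \<comment> \<open>Half of \<open>c\<close> is spent on the error in the uniform upper limit, which
    leaves the decay rate \<open>c / 2\<close>.\<close>
  obtain L where L: "L > 0" and dec: "AE x in M. \<forall>t. \<forall>v\<in>clarke_subdiff (j x) t.
        L \<le> \<bar>t\<bar> \<longrightarrow> (v * t - j x t) / \<bar>t\<bar> powr p x \<le> - c + c / 2"
    using dec0[of "c / 2"] c by auto
  obtain w where w: "w \<in> W01px \<Omega> p" "nontrivial_on \<Omega> w"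
    and wle: "1 / pm * modular \<Omega> p (\<lambda>x. norm (weak_grad \<Omega> w x)) + max 0 (- lam) / pm * modular \<Omega> p w
        \<le> (LINT x|M. j x (w x))"
    using H1 unfolding hyp_H1_def by blast
  obtain B where B: "\<And>f r t. \<lbrakk>pm \<le> r; r \<le> pp; continuous_on UNIV f; \<And>t. \<bar>f t\<bar> \<le> A * (1 + \<bar>t\<bar>) powr R * \<bar>t\<bar>;
      \<And>t v. \<lbrakk>L \<le> \<bar>t\<bar>; v \<in> clarke_subdiff f t\<rbrakk> \<Longrightarrow> v * t - f t \<le> - (c / 2) * \<bar>t\<bar> powr r\<rbrakk> \<Longrightarrow> f t \<le> B"
    by (rule clarke_decay_imp_bounded_above[OF pm_gt_1 pm_le_pp _ L A, where c = "c / 2"]) (use c in auto)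
  obtain \<gamma> where \<gamma>: "0 < \<gamma>" "\<And>u g. W u g \<Longrightarrow> lam * energy u + \<gamma> * (LINT x|M. norm (g x) powr p x) \<le> energy g"
    by (rule lambda_coercive[OF lambda], rule that)
  define good where "good x \<longleftrightarrow> j x 0 = 0 \<and> locally_lipschitz (j x) \<and> a x \<le> Ma \<and>
      (\<forall>t. \<forall>v\<in>clarke_subdiff (j x) t. \<bar>v\<bar> \<le> a x + c\<^sub>1 * abs_pow t (r x - 1)) \<and>
      (\<forall>t. \<forall>v\<in>clarke_subdiff (j x) t. L \<le> \<bar>t\<bar> \<longrightarrow> (v * t - j x t) / \<bar>t\<bar> powr p x \<le> - c + c / 2)" for x
  have "AE x in M. j x 0 = 0" "AE x in M. locally_lipschitz (j x)"
    using H by (auto simp: hyp_H_def)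
  then have "AE x in M. good x"
    using \<open>AE x in M. a x \<le> Ma\<close> growth dec unfolding good_def by eventually_elim blast
  then obtain Z where Z: "{x \<in> space M. \<not> good x} \<subseteq> Z" "emeasure M Z = 0" "Z \<in> sets M"
    by (rule AE_E)
  have Z_null: "Z \<in> null_sets M" using Z(2,3) by blast
  have goodx: "good x" if "x \<in> \<Omega>" "x \<notin> Z" for x
    using that Z(1) by auto
  text \<open>The hypotheses hold everywhere after redefining the potential on a null set.\<close>
  define j' where "j' x = (if x \<in> Z then (\<lambda>t. 0) else j x)" for x
  have j'_eq: "AE x in M. j' x = j x"
    using AE_not_in[OF Z_null] by eventually_elim (simp add: j'_def)
  have sub_bound: "\<bar>v\<bar> \<le> A * (1 + \<bar>t\<bar>) powr R" if x: "x \<in> \<Omega>" "x \<notin> Z" and v: "v \<in> clarke_subdiff (j x) t" for x t v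
  proof -
    have xc: "x \<in> closure \<Omega>" using x closure_subset by blast
    have e: "0 \<le> r x - 1" "r x - 1 \<le> R" using r(2)[OF xc] r_le[OF xc] by (auto simp: R_def)
    \<comment> \<open>The base \<open>1 + \<bar>t\<bar>\<close> is at least one, so exponents may be
      raised to \<open>R\<close> and the bounded part of the growth condition is absorbed as
      well.\<close>
    have "abs_pow t (r x - 1) \<le> (1 + \<bar>t\<bar>) powr (r x - 1)"
      using e by (auto simp: abs_pow_def intro!: powr_mono2)
    also have "\<dots> \<le> (1 + \<bar>t\<bar>) powr R"
      using e by (intro powr_mono) auto
    finally have ap: "abs_pow t (r x - 1) \<le> (1 + \<bar>t\<bar>) powr R" .
    have one: "1 \<le> (1 + \<bar>t\<bar>) powr R"
      using R by (intro ge_one_powr_ge_zero) auto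
    have "\<bar>v\<bar> \<le> a x + c\<^sub>1 * abs_pow t (r x - 1)" "a x \<le> Ma"
      using goodx[OF x] v by (auto simp: good_def)
    then have "\<bar>v\<bar> \<le> max 0 Ma * 1 + c\<^sub>1 * abs_pow t (r x - 1)"
      by simp
    also have "\<dots> \<le> max 0 Ma * (1 + \<bar>t\<bar>) powr R + c\<^sub>1 * (1 + \<bar>t\<bar>) powr R"
      using one ap c\<^sub>1 by (intro add_mono mult_left_mono) auto
    finally show ?thesis by (simp add: A_def distrib_right)
  qed
  have lip: "\<bar>j' x t - j' x s\<bar> \<le> A * (1 + k) powr R * \<bar>t - s\<bar>" if x: "x \<in> \<Omega>" and st: "\<bar>s\<bar> \<le> k" "\<bar>t\<bar> \<le> k" for x s t k
  proof (cases "x \<in> Z")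
    case True
    then show ?thesis using A by (simp add: j'_def)
  next
    case False
    have "\<bar>j x t - j x s\<bar> \<le> A * (1 + k) powr R * \<bar>t - s\<bar>"
    proof (rule clarke_bound_imp_lipschitz)
      show "continuous_on UNIV (j x)"
        using goodx[OF x False] by (intro locally_lipschitz_imp_continuous_on) (simp add: good_def)
      fix y v assume y: "min s t \<le> y" "y \<le> max s t" "v \<in> clarke_subdiff (j x) y"
      have "\<bar>y\<bar> \<le> k" using y(1,2) st by (auto simp: min_def max_def split: if_splits)
      then have "A * (1 + \<bar>y\<bar>) powr R \<le> A * (1 + k) powr R"
        using A R by (intro mult_left_mono powr_mono2) auto
      then show "\<bar>v\<bar> \<le> A * (1 + k) powr R"
        using sub_bound[OF x False y(3)] by simp
    qed
    then show ?thesis using False by (simp add: j'_def)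
  qed
  have zero: "j' x 0 = 0" if "x \<in> \<Omega>" for x
    using goodx[OF that] by (auto simp: j'_def good_def)
  have upper: "j' x t \<le> max 0 B" if x: "x \<in> \<Omega>" for x t
  proof (cases "x \<in> Z")
    case True
    then show ?thesis by (simp add: j'_def)
  next
    case False
    have "j x t \<le> B"
    proof (rule B[of "p x" "j x" t])
      show "pm \<le> p x" "p x \<le> pp" using p_bounds[of x] x by auto
      show "continuous_on UNIV (j x)"
        using goodx[OF x False] by (intro locally_lipschitz_imp_continuous_on) (simp add: good_def)
      show "\<bar>j x t\<bar> \<le> A * (1 + \<bar>t\<bar>) powr R * \<bar>t\<bar>" for t
        using lip[OF x, of 0 "\<bar>t\<bar>" t] False zero[OF x] by (simp add: j'_def)
      fix t v assume t: "L \<le> \<bar>t\<bar>" and v: "v \<in> clarke_subdiff (j x) t"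
      have "(v * t - j x t) / \<bar>t\<bar> powr p x \<le> - (c / 2)"
        using goodx[OF x False] t v by (auto simp: good_def)
      moreover have "\<bar>t\<bar> powr p x > 0" using t L by simp
      ultimately show "v * t - j x t \<le> - (c / 2) * \<bar>t\<bar> powr p x"
        by (simp add: divide_le_eq)
    qed
    then show ?thesis using False by (simp add: j'_def)
  qed
  have meas: "(\<lambda>x. j' x t) \<in> borel_measurable M" for t
  proof -
    have "(\<lambda>x. j x t) \<in> borel_measurable M"
      using H by (simp add: hyp_H_def)
    then have "(\<lambda>x. if x \<in> Z then 0 else j x t) \<in> borel_measurable M"
      using Z(3) by measurable
    moreover have "(\<lambda>x. j' x t) = (\<lambda>x. if x \<in> Z then 0 else j x t)"
      by (auto simp: j'_def)
    ultimately show ?thesis by simp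
  qed
  interpret potential \<Omega> p lam j' A R q "max 0 B" \<gamma>
    by standard (fact zero meas A R lip upper q q_sub \<gamma>)+
  have "(LINT x|M. j' x (w x)) = (LINT x|M. j x (w x))"
  proof (rule integral_cong_AE)
    note [measurable] = W_measurable[OF W01px_imp_W[OF w(1)]]
    show 1: "(\<lambda>x. j' x (w x)) \<in> borel_measurable M" by measurable
    show 2: "AE x in M. j' x (w x) = j x (w x)"
      using j'_eq by eventually_elim simp
    \<comment> \<open>For x in \<open>Z\<close> the function \<open>j x\<close> may be
      discontinuous, so measurability of \<open>j x (w x)\<close> is inherited from
      \<open>j'\<close> off \<open>Z\<close>; a null set does not affect measurability for a
      complete measure.\<close>
    have "(\<lambda>x. j' x (w x)) \<in> borel_measurable (lebesgue_on (\<Omega> - Z))"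
      using 1 borel_measurable_diff_null[OF Z_null \<Omega>_sets] by blast
    then have "(\<lambda>x. j x (w x)) \<in> borel_measurable (lebesgue_on (\<Omega> - Z))"
      by (subst measurable_cong[where g = "\<lambda>x. j' x (w x)"]) (auto simp: j'_def)
    then show "(\<lambda>x. j x (w x)) \<in> borel_measurable M"
      using borel_measurable_diff_null[OF Z_null \<Omega>_sets] by blast
  qed
  then obtain u where u: "is_solution \<Omega> p lam j' u" "nontrivial_on \<Omega> u"
    using nontrivial_solution[OF w] wle by metis
  obtain vs where vs: "vs \<in> borel_measurable M" "AE x in M. vs x \<in> clarke_subdiff (j' x) (u x)"
    "\<And>v. v \<in> test_functions \<Omega> \<Longrightarrow> integrable M (\<lambda>x. vs x * v x) \<and>
       (LINT x|M. norm (weak_grad \<Omega> u x) powr (p x - 2) * (weak_grad \<Omega> u x \<bullet> weak_grad \<Omega> v x)) =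
       (LINT x|M. lam * \<bar>u x\<bar> powr (p x - 2) * u x * v x) + (LINT x|M. vs x * v x)"
    using u(1) unfolding is_solution_def by blast
  have "AE x in M. vs x \<in> clarke_subdiff (j x) (u x)"
    using vs(2) j'_eq by eventually_elim simp
  then have "is_solution \<Omega> p lam j u"
    using u(1) vs(1,3) unfolding is_solution_def by blast
  then show ?thesis
    using u(2) by blast
qed

end
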